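(* Let $G=(V,E)$ be a connected, locally finite, quasi-transitive graph such that $p_c(G)<p_{2\to 2}(G)$, and write $p_c=p_c(G)$. Then there exist positive constants $\delta=\delta(G)$, $c=c(G)$, and $C=C(G)$ such that $$c^k|p-p_c|^{-2k+1}k!\leq \mathbf{E}_p\left[|K_v|^k\,\mathbf{1}(|K_v|<\infty)\right]\leq C^k|p-p_c|^{-2k+1}k!$$ for every integer $k\geq 1$, every $p\in(p_c-\delta,p_c)\cup(p_c,p_c+\delta)$, and every $v\in V$. In particular, the critical exponents $\gamma,\gamma',\Delta,\Delta'$ are well-defined and satisfy $\gamma=\gamma'=1$ and $\Delta=\Delta'=2$.
   Context: A graph is quasi-transitive if the action of its automorphism group on its vertex set has at most finitely many orbits. In Bernoulli-$p$ bond percolation on $G$, with law $\mathbf{P}_p$ and expectation $\mathbf{E}_p$, each edge is independently open with probability $p$ and closed otherwise; clusters are the connected components of the random subgraph of open edges. $K_v$ is the cluster of $v$ and $|K_v|$ its number of vertices. The critical probability is $p_c(G)=\sup\{p\in[0,1]:\text{every cluster is finite } \mathbf{P}_p\text{-a.s.}\}$. The two-point matrix is $T_p(u,v)=\mathbf{P}_p(u\leftrightarrow v)$ (the probability that $u,v$ lie in the same cluster), $\|T_p\|_{2\to2}\in[0,\infty]$ is its $L^2(V)\to L^2(V)$ operator norm, and $p_{2\to2}(G)=\sup\{p\in[0,1]:\|T_p\|_{2\to2}<\infty\}$. The exponents $\gamma,\Delta$ (resp. $\gamma',\Delta'$), when they exist, are the numbers such that for each positive integer $k$, $\mathbf{E}_p[|K_v|^k]\asymp_k|p-p_c|^{-\gamma-(k-1)\Delta\pm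 o_k(1)}$ as $p\uparrow p_c$ (resp. $\mathbf{E}_p[|K_v|^k\mathbf{1}(|K_v|<\infty)]\asymp_k|p-p_c|^{-\gamma'-(k-1)\Delta'\pm o_k(1)}$ as $p\downarrow p_c$), where the subscript $k$ means that implicit constants may depend on $k$. *)

theory Defs
  imports "HOL-Probability.Probability"
begin

definition simple_graph :: "'a set \<Rightarrow> 'a set set \<Rightarrow> bool" where
  "simple_graph V E \<longleftrightarrow> (\<forall>e\<in>E. \<exists>u\<in>V. \<exists>v\<in>V. u \<noteq> v \<and> e = {u, v})"

definition component :: "'a set set \<Rightarrow> 'a \<Rightarrow> 'a set" where
  "component F v = {u. (v, u) \<in> {(x, y). {x, y} \<in> F}\<^sup>*}"

definition connected_graph :: "'a set \<Rightarrow> 'a set set \<Rightarrow> bool" where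
  "connected_graph V E \<longleftrightarrow> V \<noteq> {} \<and> (\<forall>u\<in>V. \<forall>v\<in>V. v \<in> component E u)"

definition locally_finite :: "'a set \<Rightarrow> 'a set set \<Rightarrow> bool" where
  "locally_finite V E \<longleftrightarrow> (\<forall>v\<in>V. finite {e \<in> E. v \<in> e})"

definition automorphisms :: "'a set \<Rightarrow> 'a set set \<Rightarrow> ('a \<Rightarrow> 'a) set" where
  "automorphisms V E =
     {\<phi>. bij_betw \<phi> V V \<and> (\<forall>u\<in>V. \<forall>v\<in>V. {\<phi> u, \<phi> v} \<in> E \<longleftrightarrow> {u, v} \<in> E)}"

definition quasi_transitive :: "'a set \<Rightarrow> 'a set set \<Rightarrow> bool" where
  "quasi_transitive V E \<longleftrightarrow> finite ((\<lambda>v. {\<phi> v | \<phi>. \<phi> \<in> automorphisms V E}) ` V)"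

text \<open>A configuration maps each edge to \<^term>\<open>True\<close> (open) or \<^term>\<open>False\<close> (closed).
  For a parameter outside the unit interval, \<^const>\<open>bernoulli_pmf\<close> truncates it to
  that interval.\<close>

definition percolation :: "'a set set \<Rightarrow> real \<Rightarrow> ('a set \<Rightarrow> bool) measure" where
  "percolation E p = (\<Pi>\<^sub>M e\<in>E. measure_pmf (bernoulli_pmf p))"

definition cluster :: "'a set set \<Rightarrow> ('a set \<Rightarrow> bool) \<Rightarrow> 'a \<Rightarrow> 'a set" where
  "cluster E \<omega> v = component {e \<in> E. \<omega> e} v"

definition cluster_size :: "'a set set \<Rightarrow> ('a set \<Rightarrow> bool) \<Rightarrow> 'a \<Rightarrow> ennreal" where
  "cluster_size E \<omega> v = emeasure (count_space UNIV) (cluster E \<omega> v)"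

definition critical_prob :: "'a set \<Rightarrow> 'a set set \<Rightarrow> real" where
  "critical_prob V E =
     Sup {p \<in> {0..1}. AE \<omega> in percolation E p. \<forall>v\<in>V. finite (cluster E \<omega> v)}"

definition moment :: "'a set set \<Rightarrow> real \<Rightarrow> nat \<Rightarrow> 'a \<Rightarrow> ennreal" where
  "moment E p k v = (\<integral>\<^sup>+\<omega>. cluster_size E \<omega> v ^ k \<partial>percolation E p)"

text \<open>On infinite clusters the integrand below is \<open>\<infinity> * 0 = 0\<close>.\<close>

definition truncated_moment :: "'a set set \<Rightarrow> real \<Rightarrow> nat \<Rightarrow> 'a \<Rightarrow> ennreal" where
  "truncated_moment E p k v =
     (\<integral>\<^sup>+\<omega>. cluster_size E \<omega> v ^ k * indicator {\<omega>. cluster_size E \<omega> v < \<infinity>} \<omega> \<partial>percolation E p)"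

definition two_point :: "'a set set \<Rightarrow> real \<Rightarrow> 'a \<Rightarrow> 'a \<Rightarrow> real" where
  "two_point E p u v = \<P>(\<omega> in percolation E p. v \<in> cluster E \<omega> u)"

definition l2 :: "'a set \<Rightarrow> ('a \<Rightarrow> real) set" where
  "l2 V = {f. (\<lambda>v. (f v)\<^sup>2) summable_on V}"

definition l2_norm :: "'a set \<Rightarrow> ('a \<Rightarrow> real) \<Rightarrow> ennreal" where
  "l2_norm V f = (if f \<in> l2 V then ennreal (sqrt (\<Sum>\<^sub>\<infinity>v\<in>V. (f v)\<^sup>2)) else \<infinity>)"

text \<open>The norm is infinite if some sum defining the action of the matrix \<open>T\<close> on an
  \<open>L\<^sup>2\<close> function does not converge (\<^const>\<open>infsum\<close> would silently return 0), or if
  some image is not in \<open>L\<^sup>2\<close>. For a real matrix the real and the complex operator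
  norms agree.\<close>

definition l2_op_norm :: "'a set \<Rightarrow> ('a \<Rightarrow> 'a \<Rightarrow> real) \<Rightarrow> ennreal" where
  "l2_op_norm V T =
     (if \<forall>f\<in>l2 V. \<forall>u\<in>V. (\<lambda>v. T u v * f v) summable_on V
      then SUP f\<in>{f. l2_norm V f \<le> 1}. l2_norm V (\<lambda>u. \<Sum>\<^sub>\<infinity>v\<in>V. T u v * f v)
      else \<infinity>)"

definition p_2_to_2 :: "'a set \<Rightarrow> 'a set set \<Rightarrow> real" where
  "p_2_to_2 V E = Sup {p \<in> {0..1}. l2_op_norm V (two_point E p) < \<infinity>}"

text \<open>\<open>f p \<asymp> \<bar>p - p0\<bar>\<^bsup>a \<plusminus> o(1)\<^esup>\<close> along the filter \<open>F\<close>; the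
  function \<open>\<epsilon>\<close> is the \<open>o(1)\<close> term.\<close>

definition has_power_law :: "real filter \<Rightarrow> real \<Rightarrow> (real \<Rightarrow> ennreal) \<Rightarrow> real \<Rightarrow> bool" where
  "has_power_law F p0 f a \<longleftrightarrow>
     (\<exists>\<epsilon> c C. (\<epsilon> \<longlongrightarrow> 0) F \<and> c > 0 \<and> C > 0 \<and>
        (\<forall>\<^sub>F p in F. ennreal (c * \<bar>p - p0\<bar> powr (a + \<epsilon> p)) \<le> f p \<and>
                    f p \<le> ennreal (C * \<bar>p - p0\<bar> powr (a - \<epsilon> p))))"

definition subcritical_exponents :: "'a set \<Rightarrow> 'a set set \<Rightarrow> real \<Rightarrow> real \<Rightarrow> bool" where
  "subcritical_exponents V E \<gamma> \<Delta> \<longleftrightarrow>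
     (\<forall>v\<in>V. \<forall>k\<ge>1. has_power_law (at_left (critical_prob V E)) (critical_prob V E)
        (\<lambda>p. moment E p k v) (- \<gamma> - (real k - 1) * \<Delta>))"

definition supercritical_exponents :: "'a set \<Rightarrow> 'a set set \<Rightarrow> real \<Rightarrow> real \<Rightarrow> bool" where
  "supercritical_exponents V E \<gamma> \<Delta> \<longleftrightarrow>
     (\<forall>v\<in>V. \<forall>k\<ge>1. has_power_law (at_right (critical_prob V E)) (critical_prob V E)
        (\<lambda>p. truncated_moment E p k v) (- \<gamma> - (real k - 1) * \<Delta>))"

end

theory Submission
 imports Defs
begin

text \<open>All densities are coupled by independent uniform edge labels. Let \<open>M(p, x) = E (1 - x^|K|)\<close> with
 \<open>x = exp (- h)\<close>; at \<open>x = 1\<close> this is the probability \<open>\<theta>(p)\<close> of an infinite cluster. Since the two-point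
 matrix is bounded on \<open>L\<^sup>2\<close> slightly above \<open>p\<^sub>c\<close>, a positive proportion of the boundary of every finite set
 \<open>S\<close> is connected off \<open>S\<close> about as well as a vertex of the whole graph, whence \<open>\<partial>\<^sub>p M \<ge> c M \<partial>\<^sub>h M\<close>. Following characteristics gives
 \<open>E |K| \<le> C / (p\<^sub>c - p)\<close> below and \<open>\<theta> \<ge> c (p - p\<^sub>c)\<close> above \<open>p\<^sub>c\<close>. Comparing the laws of the cluster at nearby densities
 in Hellinger distance yields \<open>\<partial>\<^sub>p M \<le> C sqrt (E |K| M)\<close>; with the first inequality this shows \<open>M \<le> C \<epsilon>\<close> for
 \<open>|p - p\<^sub>c| \<le> \<epsilon>\<close>, \<open>h = \<epsilon>\<^sup>2\<close>.

 The BK inequality and tree graphs turn the bound on \<open>E |K|\<close> into the subcritical upper bounds. For the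
 lower bounds on both sides, \<open>|K|\<close> is of order \<open>n\<close> with probability \<open>\<ge> c / sqrt n\<close> at \<open>p\<^sub>c - 1 / sqrt n\<close>, and
 with \<open>n = k / \<epsilon>\<^sup>2\<close> the Hellinger affinity moves this event to \<open>p\<^sub>c \<plusminus> \<epsilon>\<close> at a cost \<open>exp (- C k)\<close>. Above \<open>p\<^sub>c\<close>, a second
 moment argument shows that of order \<open>\<epsilon> |S|\<close> boundary edges of a finite cluster \<open>S\<close> lead to infinite clusters
 at level \<open>p\<^sub>c + \<epsilon> / 2\<close>. Closing them all costs \<open>exp (- c \<epsilon>\<^sup>2 |S|)\<close>, while the events where they are
 unconstrained are disjoint for different \<open>S\<close> and force an infinite cluster, so their total probability is \<open>O(\<epsilon>)\<close>.\<close>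

section \<open>Components\<close>

text \<open>No derivative in \<open>p\<close> is taken. Passing from level \<open>p\<close> to
  \<open>q\<close> opens each closed boundary edge of a revealed cluster independently with
  probability \<open>(q - p) / (1 - p)\<close>, so each differential inequality is replaced by an
  inequality for one finite step with an explicit error; steps are then iterated or sent to zero.
  The operator norm enters only after testing the operator on indicators of finite sets, as
  \<open>(\<Sum>w\<in>B. (\<Sum>u\<in>A. tau p3 w u)\<^sup>2) \<le> Lam * card A\<close> at one
  level \<open>p3\<close> strictly above the critical one. It serves three purposes: neighbourhoods
  of finite sets grow by any prescribed factor, a finite set disturbs only few vertices near it, and
  the number of boundary edges leading to infinite clusters has a second moment of the order of its
  squared mean. The scale \<open>h = \<epsilon>\<^sup>2\<close> is that of the characteristics:
  their slope in \<open>h\<close> is of order \<open>M\<close>, hence of order \<epsilon>, and they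
  run for a time of order \<epsilon>.\<close>

definition del :: "'a set set \<Rightarrow> 'a set \<Rightarrow> 'a set set" where
 "del F S = {e \<in> F. e \<inter> S = {}}"

text \<open>Boundary edges are ordered pairs, inner endpoint first, so that \<open>snd\<close> names
  the vertex from which an exploration off \<open>S\<close> continues. The first argument may be the
  whole edge set or only the open edges.\<close>

definition bd :: "'a set set \<Rightarrow> 'a set \<Rightarrow> ('a \<times> 'a) set" where
 "bd E S = {(a, y). a \<in> S \<and> y \<notin> S \<and> {a, y} \<in> E}"

lemma del_empty [simp]: "del F {} = F"
 by (auto simp: del_def)

lemma del_subset: "del F S \<subseteq> F"
 by (auto simp: del_def)

lemma del_mono: "F \<subseteq> F' \<Longrightarrow> del F S \<subseteq> del F' S"
 by (auto simp: del_def)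

lemma component_self [simp, intro]: "v \<in> component F v"
 by (auto simp: component_def)

lemma component_step: "u \<in> component F v \<Longrightarrow> {u, w} \<in> F \<Longrightarrow> w \<in> component F v"
 by (auto simp: component_def intro: rtrancl_into_rtrancl)

lemma component_induct [consumes 1, case_names base step]:
 assumes "w \<in> component F v" "P v"
  and "\<And>x y. x \<in> component F v \<Longrightarrow> {x, y} \<in> F \<Longrightarrow> P x \<Longrightarrow> P y"
 shows "P w"
proof -
 have "(v, w) \<in> {(x, y). {x, y} \<in> F}\<^sup>*"
  using assms(1) by (simp add: component_def)
 then show ?thesis
  by (induction rule: rtrancl_induct) (use assms(2,3) in \<open>auto simp: component_def\<close>)
qed

lemma component_sym: "u \<in> component F v \<Longrightarrow> v \<in> component F u"
proof -
 have "sym ({(x, y). {x, y} \<in> F}\<^sup>*)"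
  by (rule sym_rtrancl) (auto simp: sym_def insert_commute)
 then show "u \<in> component F v \<Longrightarrow> v \<in> component F u"
  by (auto simp: component_def sym_def)
qed

lemma component_trans: "u \<in> component F v \<Longrightarrow> w \<in> component F u \<Longrightarrow> w \<in> component F v"
 by (auto simp: component_def)

lemma component_eq: "u \<in> component F v \<Longrightarrow> component F u = component F v"
 by (auto intro: component_trans component_sym)

lemma component_mono:
 assumes "F \<subseteq> F'" shows "component F v \<subseteq> component F' v"
proof
 fix w assume "w \<in> component F v"
 then show "w \<in> component F' v"
  by (induction rule: component_induct) (use assms in \<open>auto intro: component_step\<close>)
qed

lemma component_closed:
 assumes "v \<in> S" "\<And>x y. {x, y} \<in> F \<Longrightarrow> x \<in> S \<Longrightarrow> y \<in> S"
 shows "component F v \<subseteq> S"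
proof
 fix w assume "w \<in> component F v"
 then show "w \<in> S"
  by (induction rule: component_induct) (use assms in auto)
qed

lemma component_empty [simp]: "component {} v = {v}"
 using component_closed[of v "{v}" "{}"] by auto

lemma component_finite_witness1:
 assumes "w \<in> component F v"
 shows "\<exists>D. finite D \<and> D \<subseteq> F \<and> w \<in> component D v"
 using assms
proof (induction rule: component_induct)
 case base
 then show ?case by (intro exI[of _ "{}"]) auto
next
 case (step x y)
 then obtain D where D: "finite D" "D \<subseteq> F" "x \<in> component D v" by auto
 have "x \<in> component (insert {x, y} D) v"
  using D(3) component_mono[of D "insert {x, y} D" v] by auto
 then have "y \<in> component (insert {x, y} D) v"
  by (rule component_step) auto
 then show ?case using D step by (intro exI[of _ "insert {x, y} D"]) auto
qed

lemma component_finite_witness: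
 assumes "finite I" "I \<subseteq> component F v"
 shows "\<exists>D. finite D \<and> D \<subseteq> F \<and> I \<subseteq> component D v"
 using assms
proof (induction I)
 case empty
 then show ?case by (intro exI[of _ "{}"]) auto
next
 case (insert x I)
 then obtain D where D: "finite D" "D \<subseteq> F" "I \<subseteq> component D v" by auto
 from insert obtain D' where D': "finite D'" "D' \<subseteq> F" "x \<in> component D' v"
  using component_finite_witness1[of x F v] by auto
 have "component D v \<subseteq> component (D \<union> D') v" "component D' v \<subseteq> component (D \<union> D') v"
  by (auto intro!: component_mono)
 then show ?case
  using D D' by (intro exI[of _ "D \<union> D'"]) auto
qed

lemma component_del_disjoint:
 assumes "y \<notin> S" shows "component (del F S) y \<inter> S = {}"
proof -
 have "component (del F S) y \<subseteq> - S"
  by (rule component_closed) (use assms in \<open>auto simp: del_def\<close>)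
 then show ?thesis by auto
qed

text \<open>Cut a path from \<open>v\<close> to \<open>w\<close> after its last visit to
  \<open>S\<close>: the rest starts with a boundary edge and never touches \<open>S\<close>. In the
  induction, a new vertex outside \<open>S\<close> either begins such a final segment or prolongs
  one.\<close>

lemma component_exit:
 assumes "w \<in> component F v" "v \<in> S"
 shows "w \<in> S \<or> (\<exists>(a, y) \<in> bd F S. w \<in> component (del F S) y)"
 using assms(1)
proof (induction rule: component_induct)
 case base
 then show ?case using assms by auto
next
 case (step x y)
 show ?case
 proof (cases "y \<in> S")
  case False
  show ?thesis
  proof (cases "x \<in> S")
   case True
   then have "(x, y) \<in> bd F S" using False step by (auto simp: bd_def)
   then show ?thesis by auto
  next
   case x: False
   then obtain a b where ab: "(a, b) \<in> bd F S" "x \<in> component (del F S) b"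
    using step by auto
   have "{x, y} \<in> del F S" using x False step by (auto simp: del_def)
   then have "y \<in> component (del F S) b" using ab(2) by (auto intro: component_step)
   then show ?thesis using ab by auto
  qed
 qed auto
qed

lemma component_enter:
 assumes "(a, y) \<in> bd F S" "a \<in> component F v"
 shows "component (del F S) y \<subseteq> component F v"
proof -
 have "y \<in> component F v"
  using assms by (auto simp: bd_def intro: component_step)
 then have "component F y = component F v" by (rule component_eq)
 then show ?thesis using component_mono[OF del_subset, of F S y] by simp
qed

text \<open>The event splits into a condition on the edges inside \<open>S\<close> and one on the
  boundary edges. These edge sets are disjoint, which is the source of all independence statements
  about clusters.\<close>

lemma component_eq_iff:
 assumes "v \<in> S" and F: "\<And>e. e \<in> F \<Longrightarrow> \<exists>x y. e = {x, y}"
 shows "component F v = S \<longleftrightarrow> component {e \<in> F. e \<subseteq> S} v = S \<and> bd F S = {}"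
proof (intro iffI conjI)
 assume K: "component F v = S"
 show "bd F S = {}" using K by (auto simp: bd_def intro: component_step)
 show "component {e \<in> F. e \<subseteq> S} v = S"
 proof
  show "component {e \<in> F. e \<subseteq> S} v \<subseteq> S"
   using component_mono[of "{e \<in> F. e \<subseteq> S}" F v] K by auto
  show "S \<subseteq> component {e \<in> F. e \<subseteq> S} v"
  proof
   fix w assume "w \<in> S"
   then have "w \<in> component F v" using K by auto
   then show "w \<in> component {e \<in> F. e \<subseteq> S} v"
   proof (induction rule: component_induct)
    case (step x y)
    then have "y \<in> component F v" by (auto intro: component_step)
    then have "{x, y} \<in> {e \<in> F. e \<subseteq> S}" using step K by auto
    then show ?case using step by (auto intro: component_step)
   qed auto
  qed
 qed
next
 assume A: "component {e \<in> F. e \<subseteq> S} v = S \<and> bd F S = {}"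
 show "component F v = S"
 proof
  show "component F v \<subseteq> S"
   by (rule component_closed) (use A assms in \<open>auto simp: bd_def\<close>)
  show "S \<subseteq> component F v"
   using A component_mono[of "{e \<in> F. e \<subseteq> S}" F v] by auto
 qed
qed

text \<open>Explore the component \<open>B\<close> of \<open>z\<close> off \<open>S\<close> first. A
  path from \<open>z\<close> leaves \<open>B\<close> for the last time through an edge into
  \<open>S\<close>, because \<open>B\<close> is saturated off \<open>S\<close>. The remainder avoids
  \<open>B\<close> and so uses only edges that the exploration has not seen.\<close>

lemma component_reattach:
 assumes "w \<in> component F z" "z \<notin> S"
 shows "w \<in> component (del F S) z \<or>
  (\<exists>u\<in>S. \<exists>b\<in>component (del F S) z. {b, u} \<in> F \<and> w \<in> component (del F (component (del F S) z)) u)"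
proof -
 let ?B = "component (del F S) z"
 from component_exit[OF assms(1), of ?B]
 consider "w \<in> ?B" | a y where "(a, y) \<in> bd F ?B" "w \<in> component (del F ?B) y" by auto
 then show ?thesis
 proof cases
  case 2
  then have a: "a \<in> ?B" "y \<notin> ?B" "{a, y} \<in> F" by (auto simp: bd_def)
  have "y \<in> S"
  proof (rule ccontr)
   assume "y \<notin> S"
   moreover have "a \<notin> S" using component_del_disjoint[OF assms(2), of F] a by auto
   ultimately have "{a, y} \<in> del F S" using a by (auto simp: del_def)
   then show False using a by (auto intro: component_step)
  qed
  then show ?thesis using 2 a by auto
 qed auto
qed

section \<open>Percolation with uniform edge labels\<close>

definition unif :: "real measure" where
 "unif = uniform_measure lborel {0..1}"

definition opn :: "'a set set \<Rightarrow> real \<Rightarrow> ('a set \<Rightarrow> real) \<Rightarrow> 'a set set" where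
 "opn E p U = {e \<in> E. U e \<le> p}"

lemma space_unif [simp]: "space unif = UNIV"
 by (simp add: unif_def)

lemma sets_unif [simp, measurable_cong]: "sets unif = sets borel"
 by (simp add: unif_def)

interpretation unif: prob_space unif
 unfolding unif_def by (rule prob_space_uniform_measure) auto

lemma measure_unif:
 assumes "A \<in> sets borel"
 shows "measure unif A = measure lborel ({0..1} \<inter> A)"
proof -
 have "emeasure unif A = emeasure lborel ({0..1} \<inter> A) / 1"
  using assms by (simp add: unif_def)
 then show ?thesis by (simp add: measure_def divide_ennreal_def)
qed

lemma measure_unif_le: "0 \<le> p \<Longrightarrow> p \<le> 1 \<Longrightarrow> measure unif {..p} = p"
proof -
 assume "0 \<le> p" "p \<le> 1"
 then have "{0..1} \<inter> {..p} = {0..p}" by auto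
 then show ?thesis using \<open>0 \<le> p\<close> by (simp add: measure_unif)
qed

lemma measure_unif_gt: "0 \<le> p \<Longrightarrow> p \<le> 1 \<Longrightarrow> measure unif {p<..} = 1 - p"
proof -
 assume "0 \<le> p" "p \<le> 1"
 then have "{0..1} \<inter> {p<..} = {p<..1}" by auto
 then show ?thesis using \<open>p \<le> 1\<close> by (simp add: measure_unif)
qed

lemma measure_unif_ioc: "0 \<le> p \<Longrightarrow> p \<le> q \<Longrightarrow> q \<le> 1 \<Longrightarrow> measure unif {p<..q} = q - p"
proof -
 assume "0 \<le> p" "p \<le> q" "q \<le> 1"
 then have "{0..1} \<inter> {p<..q} = {p<..q}" by auto
 then show ?thesis using \<open>p \<le> q\<close> by (simp add: measure_unif)
qed

locale perc =
 fixes V :: "'a set" and E :: "'a set set"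
 assumes simple: "simple_graph V E"
  and conn: "connected_graph V E"
  and locfin: "locally_finite V E"
begin

lemma edgeE:
 assumes "e \<in> E"
 obtains u v where "e = {u, v}" "u \<noteq> v" "u \<in> V" "v \<in> V"
 using assms simple by (auto simp: simple_graph_def)

lemma edge_vertices: "{u, v} \<in> E \<Longrightarrow> u \<in> V \<and> v \<in> V \<and> u \<noteq> v"
 by (erule edgeE) (auto simp: doubleton_eq_iff)

lemma edge_subset: "e \<in> E \<Longrightarrow> e \<subseteq> V"
 by (erule edgeE) auto

lemma component_subset_V:
 assumes "F \<subseteq> E" "v \<in> V" shows "component F v \<subseteq> V"
 by (rule component_closed) (use assms edge_vertices in blast)+

definition nbh :: "'a set \<Rightarrow> 'a set" where
 "nbh S = S \<union> {y. \<exists>a\<in>S. {a, y} \<in> E}"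

definition gball :: "nat \<Rightarrow> 'a set \<Rightarrow> 'a set" where
 "gball r S = (nbh ^^ r) S"

definition tch :: "'a set \<Rightarrow> 'a set set" where
 "tch S = {e \<in> E. e \<inter> S \<noteq> {}}"

lemma finite_tch: "finite S \<Longrightarrow> S \<subseteq> V \<Longrightarrow> finite (tch S)"
proof -
 assume S: "finite S" "S \<subseteq> V"
 have "tch S = (\<Union>v\<in>S. {e \<in> E. v \<in> e})" by (auto simp: tch_def)
 then show ?thesis using S locfin by (auto simp: locally_finite_def)
qed

lemma inj_bd: "inj_on (\<lambda>(a, y). {a, y}) (bd E S)"
 by (auto simp: inj_on_def bd_def doubleton_eq_iff)

lemma bd_tch: "(\<lambda>(a, y). {a, y}) ` bd E S \<subseteq> tch S"
 by (auto simp: bd_def tch_def)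

lemma finite_bd: "finite S \<Longrightarrow> S \<subseteq> V \<Longrightarrow> finite (bd E S)"
 using inj_bd bd_tch finite_tch by (metis finite_imageD finite_subset)

lemma bd_V: "(a, y) \<in> bd E S \<Longrightarrow> a \<in> S \<and> y \<notin> S \<and> a \<in> V \<and> y \<in> V \<and> {a, y} \<in> E"
 using edge_vertices by (auto simp: bd_def)

lemma nbh_eq: "nbh S = S \<union> snd ` bd E S"
 by (force simp: nbh_def bd_def image_iff)

lemma ball_0 [simp]: "gball 0 S = S"
 by (simp add: gball_def)

lemma ball_Suc: "gball (Suc r) S = nbh (gball r S)"
 by (simp add: gball_def)

lemma ball_V: "S \<subseteq> V \<Longrightarrow> gball r S \<subseteq> V"
 by (induction r) (auto simp: ball_Suc nbh_def dest: edge_vertices)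

lemma finite_ball: "finite S \<Longrightarrow> S \<subseteq> V \<Longrightarrow> finite (gball r S)"
proof (induction r)
 case (Suc r)
 then have "finite (bd E (gball r S))" using ball_V by (intro finite_bd) auto
 then show ?case using Suc by (simp add: ball_Suc nbh_eq)
qed simp

lemma ball_mono: "S \<subseteq> S' \<Longrightarrow> gball r S \<subseteq> gball r S'"
proof (induction r)
 case (Suc r)
 then have "gball r S \<subseteq> gball r S'" by blast
 then show ?case unfolding ball_Suc nbh_def by blast
qed simp

lemma ball_incr: "r \<le> r' \<Longrightarrow> gball r S \<subseteq> gball r' S"
 by (rule lift_Suc_mono_le[of "\<lambda>r. gball r S"]) (auto simp: ball_Suc nbh_def)

lemma subset_ball: "S \<subseteq> gball r S"
 using ball_incr[of 0 r S] by simp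

lemma V_eq_UN_ball: "v \<in> V \<Longrightarrow> V = (\<Union>r. gball r {v})"
proof (intro equalityI subsetI)
 fix w assume v: "v \<in> V" "w \<in> V"
 then have "w \<in> component E v" using conn by (auto simp: connected_graph_def)
 then show "w \<in> (\<Union>r. gball r {v})"
 proof (induction rule: component_induct)
  case base
  show ?case using ball_0[of "{v}"] by blast
 next
  case (step x y)
  then obtain r where "x \<in> gball r {v}" by auto
  then have "y \<in> gball (Suc r) {v}" using step by (auto simp: ball_Suc nbh_def)
  then show ?case by auto
 qed
next
 fix w assume "v \<in> V" "w \<in> (\<Union>r. gball r {v})"
 then show "w \<in> V" using ball_V[of "{v}"] by auto
qed

lemma V_nonempty: "V \<noteq> {}"
 using conn by (simp add: connected_graph_def)

lemma countable_V: "countable V"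
proof -
 obtain v where v: "v \<in> V" using V_nonempty by auto
 show ?thesis
  unfolding V_eq_UN_ball[OF v]
  by (rule countable_UN) (use v finite_ball[of "{v}"] in \<open>auto intro!: countable_finite\<close>)
qed

lemma countable_E: "countable E"
proof -
 have "E \<subseteq> (\<lambda>(u, v). {u, v}) ` (V \<times> V)" by (auto elim!: edgeE)
 then show ?thesis using countable_V by (meson countable_SIGMA countable_image countable_subset)
qed

lemma pred_countable_ex:
 assumes "countable I" "\<And>i. i \<in> I \<Longrightarrow> Measurable.pred M (P i)"
 shows "Measurable.pred M (\<lambda>x. \<exists>i\<in>I. P i x)"
 using assms sets.sets_Collect_countable_Ex'[of I M P] by (simp add: pred_def)

lemma pred_countable_all:
 assumes "countable I" "\<And>i. i \<in> I \<Longrightarrow> Measurable.pred M (P i)"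
 shows "Measurable.pred M (\<lambda>x. \<forall>i\<in>I. P i x)"
 using assms sets.sets_Collect_countable_All'[of I M P] by (simp add: pred_def)

definition FS :: "'a set set" where
 "FS = {S. finite S \<and> S \<subseteq> V}"

lemma countable_FS: "countable FS"
 unfolding FS_def using countable_Collect_finite_subset[OF countable_V] by simp

abbreviation clu :: "real \<Rightarrow> ('a set \<Rightarrow> real) \<Rightarrow> 'a \<Rightarrow> 'a set" where
 "clu p U v \<equiv> component (opn E p U) v"

definition PU :: "('a set \<Rightarrow> real) measure" where
 "PU = PiM E (\<lambda>_. unif)"

abbreviation nn_expectation :: "(('a set \<Rightarrow> real) \<Rightarrow> ennreal) \<Rightarrow> ennreal" (binder "\<E> " 10) where
 "nn_expectation f \<equiv> integral\<^sup>N PU f"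

sublocale P: product_prob_space "\<lambda>_. unif" E
 by unfold_locales

sublocale PU: prob_space PU
 unfolding PU_def by (rule P.P.prob_space_axioms)

lemma space_PU: "space PU = E \<rightarrow>\<^sub>E UNIV"
 by (simp add: PU_def space_PiM)

lemma measurable_coord [measurable]: "e \<in> E \<Longrightarrow> (\<lambda>U. U e) \<in> borel_measurable PU"
 unfolding PU_def by measurable

definition meas_eset :: "(('a set \<Rightarrow> real) \<Rightarrow> 'a set set) \<Rightarrow> bool" where
 "meas_eset F \<longleftrightarrow> (\<forall>e\<in>E. Measurable.pred PU (\<lambda>U. e \<in> F U)) \<and> (\<forall>U. F U \<subseteq> E)"

lemma meas_eset_subset: "meas_eset F \<Longrightarrow> F U \<subseteq> E"
 by (simp add: meas_eset_def)

lemma meas_eset_pred: "meas_eset F \<Longrightarrow> e \<in> E \<Longrightarrow> Measurable.pred PU (\<lambda>U. e \<in> F U)"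
 by (simp add: meas_eset_def)

lemma meas_eset_opn: "meas_eset (opn E p)"
 unfolding meas_eset_def opn_def by auto

lemma meas_eset_filter: "meas_eset F \<Longrightarrow> meas_eset (\<lambda>U. {e \<in> F U. Q e})"
 unfolding meas_eset_def
proof safe
 fix e assume a: "\<forall>e\<in>E. Measurable.pred PU (\<lambda>U. e \<in> F U)" "e \<in> E"
 then have [measurable]: "Measurable.pred PU (\<lambda>U. e \<in> F U)" by auto
 have "Measurable.pred PU (\<lambda>U. e \<in> F U \<and> Q e)" by measurable
 then show "Measurable.pred PU (\<lambda>U. e \<in> {e \<in> F U. Q e})" by simp
qed auto

lemma meas_eset_del: "meas_eset F \<Longrightarrow> meas_eset (\<lambda>U. del (F U) S)"
 unfolding del_def by (rule meas_eset_filter)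

text \<open>A connection is witnessed by a finite edge set, and there are only countably many of
  those.\<close>

lemma pred_component:
 assumes F: "meas_eset F"
 shows "Measurable.pred PU (\<lambda>U. u \<in> component (F U) v)"
proof -
 let ?I = "{D. finite D \<and> D \<subseteq> E} \<inter> {D. u \<in> component D v}"
 have eq: "u \<in> component (F U) v \<longleftrightarrow> (\<exists>D\<in>?I. \<forall>e\<in>D. e \<in> F U)" for U
 proof
  assume "u \<in> component (F U) v"
  from component_finite_witness1[OF this]
  obtain D where "finite D" "D \<subseteq> F U" "u \<in> component D v" by blast
  then show "\<exists>D\<in>?I. \<forall>e\<in>D. e \<in> F U"
   using meas_eset_subset[OF F, of U] by (intro bexI[of _ D]) auto
 next
  assume "\<exists>D\<in>?I. \<forall>e\<in>D. e \<in> F U"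
  then obtain D where "D \<subseteq> F U" "u \<in> component D v" by auto
  then show "u \<in> component (F U) v" using component_mono[of D "F U" v] by blast
 qed
 have c: "countable ?I" using countable_Collect_finite_subset[OF countable_E] by (rule countable_Int1)
 have "Measurable.pred PU (\<lambda>U. \<exists>D\<in>?I. \<forall>e\<in>D. e \<in> F U)"
 proof (rule pred_countable_ex[OF c])
  fix D assume "D \<in> ?I"
  then show "Measurable.pred PU (\<lambda>U. \<forall>e\<in>D. e \<in> F U)"
   by (intro pred_countable_all meas_eset_pred[OF F] countable_finite) auto
 qed
 then show ?thesis unfolding eq .
qed

lemma pred_component_eq:
 assumes F: "meas_eset F" and v: "v \<in> V"
 shows "Measurable.pred PU (\<lambda>U. component (F U) v = S)"
proof -
 have sub: "component (F U) v \<subseteq> V" for U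
  using component_subset_V[OF meas_eset_subset[OF F] v] .
 show ?thesis
 proof (cases "S \<subseteq> V")
  case True
  have eq: "component (F U) v = S \<longleftrightarrow> (\<forall>w\<in>V. w \<in> component (F U) v \<longleftrightarrow> w \<in> S)" for U
   using sub[of U] True by auto
  have [measurable]: "Measurable.pred PU (\<lambda>U. w \<in> component (F U) v)" for w
   by (rule pred_component[OF F])
  show ?thesis unfolding eq
   by (rule pred_countable_all[OF countable_V]) measurable
 next
  case False
  then have "(component (F U) v = S) = False" for U using sub[of U] by auto
  then show ?thesis by simp
 qed
qed

lemma component_FS:
 assumes F: "F \<subseteq> E" and v: "v \<in> V"
 shows "finite (component F v) \<longleftrightarrow> (\<exists>S\<in>FS. component F v = S)"
 using component_subset_V[OF F v] by (auto simp: FS_def)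

lemma pred_component_finite:
 assumes F: "meas_eset F" and v: "v \<in> V"
 shows "Measurable.pred PU (\<lambda>U. finite (component (F U) v))"
proof -
 have eq: "finite (component (F U) v) \<longleftrightarrow> (\<exists>S\<in>FS. component (F U) v = S)" for U
  using component_FS[OF meas_eset_subset[OF F] v] .
 show ?thesis unfolding eq
  by (rule pred_countable_ex[OF countable_FS]) (rule pred_component_eq[OF F v])
qed

text \<open>The selector sends a finite cluster to \<open>Some\<close> of it and an infinite one to
  \<open>None\<close>. It takes countably many values, so each branch may depend on \<open>U\<close>
  in its own measurable way.\<close>

lemma measurable_component_dep:
 assumes F: "meas_eset F" and v: "v \<in> V"
  and h: "\<And>S. S \<in> FS \<Longrightarrow> h S \<in> measurable PU N" and c: "c \<in> space N"
 shows "(\<lambda>U. if finite (component (F U) v) then h (component (F U) v) U else c) \<in> measurable PU N"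
proof -
 let ?k = "\<lambda>U. if finite (component (F U) v) then Some (component (F U) v) else None"
 let ?A = "insert None (Some ` FS)"
 have cA: "countable ?A" using countable_FS by auto
 have k: "?k \<in> measurable PU (count_space ?A)"
  unfolding measurable_count_space_eq_countable[OF cA]
 proof (intro conjI ballI)
  show "?k \<in> space PU \<rightarrow> ?A"
   using component_FS[OF meas_eset_subset[OF F] v] by auto
  fix a assume a: "a \<in> ?A"
  show "?k -` {a} \<inter> space PU \<in> sets PU"
  proof (cases a)
   case None
   then have "?k -` {a} \<inter> space PU = {U \<in> space PU. \<not> finite (component (F U) v)}" by auto
   then show ?thesis using pred_component_finite[OF F v] by simp
  next
   case (Some S)
   then have "S \<in> FS" using a by auto
   then have "?k -` {a} \<inter> space PU = {U \<in> space PU. component (F U) v = S}"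
    using Some by (auto simp: FS_def split: if_splits)
   then show ?thesis using pred_component_eq[OF F v] by simp
  qed
 qed
 have "(\<lambda>U. (\<lambda>a. case a of None \<Rightarrow> (\<lambda>_. c) | Some S \<Rightarrow> h S) (?k U) U) \<in> measurable PU N"
  by (rule measurable_compose_countable'[OF _ k cA]) (use h c in \<open>auto split: option.splits\<close>)
 then show ?thesis by (simp add: if_distrib if_distribR cong: if_cong)
qed

lemma measurable_component_fun:
 assumes "meas_eset F" "v \<in> V" "\<And>S. g S \<in> space N" "c \<in> space N"
 shows "(\<lambda>U. if finite (component (F U) v) then g (component (F U) v) else c) \<in> measurable PU N"
 by (rule measurable_component_dep[where h="\<lambda>S _. g S"]) (use assms in auto)

subsection \<open>Independence of disjoint edge sets\<close>

definition depends_on :: "'a set set \<Rightarrow> (('a set \<Rightarrow> real) \<Rightarrow> 'b) \<Rightarrow> bool" where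
 "depends_on A f \<longleftrightarrow> (\<forall>U\<in>space PU. \<forall>U'\<in>space PU. (\<forall>e\<in>A. U e = U' e) \<longrightarrow> f U = f U')"

lemma depends_onD:
 "depends_on A f \<Longrightarrow> U \<in> space PU \<Longrightarrow> U' \<in> space PU \<Longrightarrow> (\<And>e. e \<in> A \<Longrightarrow> U e = U' e) \<Longrightarrow> f U = f U'"
 unfolding depends_on_def by blast

lemma depends_onI:
 "(\<And>U U'. U \<in> space PU \<Longrightarrow> U' \<in> space PU \<Longrightarrow> (\<And>e. e \<in> A \<Longrightarrow> U e = U' e) \<Longrightarrow> f U = f U') \<Longrightarrow> depends_on A f"
 unfolding depends_on_def by blast

lemma depends_on_comp: "depends_on A f \<Longrightarrow> depends_on A (\<lambda>U. h (f U))"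
 by (rule depends_onI) (metis depends_onD)

lemma depends_on_comp2: "depends_on A f \<Longrightarrow> depends_on A g \<Longrightarrow> depends_on A (\<lambda>U. h (f U) (g U))"
 by (rule depends_onI) (metis depends_onD)

lemma depends_on_mono: "depends_on A f \<Longrightarrow> A \<subseteq> B \<Longrightarrow> depends_on B f"
 unfolding depends_on_def by blast

lemma indep_coords:
 assumes "A \<inter> B = {}" "A \<subseteq> E" "B \<subseteq> E"
 shows "PU.indep_var (PiM A (\<lambda>_. unif)) (\<lambda>U. restrict U A) (PiM B (\<lambda>_. unif)) (\<lambda>U. restrict U B)"
proof -
 have "PU.indep_vars (\<lambda>_. unif) (\<lambda>e U. U e) E"
 proof (cases "E = {}")
  case True
  then show ?thesis
   unfolding PU.indep_vars_def PU.indep_sets_def by auto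
 next
  case False
  have m: "e \<in> E \<Longrightarrow> (\<lambda>U. U e) \<in> measurable PU unif" for e
   unfolding PU_def by measurable
  have "distr PU (PiM E (\<lambda>_. unif)) (\<lambda>U. \<lambda>e\<in>E. U e) = distr PU PU (\<lambda>U. U)"
   by (rule distr_cong) (auto simp: PU_def space_PiM)
  also have "... = PU" by (simp add: distr_id)
  also have "... = (\<Pi>\<^sub>M e\<in>E. distr PU unif (\<lambda>U. U e))"
   unfolding PU_def by (rule PiM_cong) (auto simp: P.PiM_component)
  finally show ?thesis
   using PU.indep_vars_iff_distr_eq_PiM'[OF False, of "\<lambda>e U. U e" "\<lambda>_. unif"] m by auto
 qed
 from PU.indep_var_restrict[OF this assms] show ?thesis by simp
qed

lemma depends_on_extend:
 assumes "f \<in> measurable PU N" "depends_on A f" "A \<subseteq> E"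
 shows "\<exists>g\<in>measurable (PiM A (\<lambda>_. unif)) N. \<forall>U\<in>space PU. f U = g (restrict U A)"
proof (intro bexI ballI)
 \<comment> \<open>The forgotten coordinates are filled with 0; by the dependence hypothesis the
   filling does not change the value.\<close>
 let ?ext = "\<lambda>w. \<lambda>e\<in>E. if e \<in> A then w e else (0::real)"
 have ext: "?ext \<in> measurable (PiM A (\<lambda>_. unif)) PU"
  unfolding PU_def
 proof (rule measurable_restrict)
  fix e assume "e \<in> E"
  show "(\<lambda>w. if e \<in> A then w e else (0::real)) \<in> measurable (PiM A (\<lambda>_. unif)) unif"
   by (cases "e \<in> A") auto
 qed
 show "(\<lambda>w. f (?ext w)) \<in> measurable (PiM A (\<lambda>_. unif)) N"
  by (rule measurable_compose[OF ext assms(1)])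
 fix U assume U: "U \<in> space PU"
 have "?ext (restrict U A) \<in> space PU" by (auto simp: space_PU)
 then show "f U = f (?ext (restrict U A))"
  by (rule depends_onD[OF assms(2) U]) (use assms(3) in auto)
qed

lemma indep_nn_integral:
 assumes f: "f \<in> borel_measurable PU" "depends_on A f" "A \<subseteq> E"
  and g: "g \<in> borel_measurable PU" "depends_on B g" "B \<subseteq> E" and AB: "A \<inter> B = {}"
 shows "(\<E> U. f U * g U) = (\<E> U. f U) * (\<E> U. (g U :: ennreal))"
proof -
 obtain f' where f': "f' \<in> borel_measurable (PiM A (\<lambda>_. unif))" "\<And>U. U \<in> space PU \<Longrightarrow> f U = f' (restrict U A)"
  using depends_on_extend[OF f] by auto
 obtain g' where g': "g' \<in> borel_measurable (PiM B (\<lambda>_. unif))" "\<And>U. U \<in> space PU \<Longrightarrow> g U = g' (restrict U B)"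
  using depends_on_extend[OF g] by auto
 have rA: "(\<lambda>U. restrict U A) \<in> measurable PU (PiM A (\<lambda>_. unif))"
  and rB: "(\<lambda>U. restrict U B) \<in> measurable PU (PiM B (\<lambda>_. unif))"
  unfolding PU_def using f(3) g(3) by (auto intro!: measurable_restrict_subset)
 interpret A: prob_space "PiM A (\<lambda>_. unif)" by (rule prob_space_PiM) (rule unif.prob_space_axioms)
 interpret B: prob_space "PiM B (\<lambda>_. unif)" by (rule prob_space_PiM) (rule unif.prob_space_axioms)
 interpret dA: prob_space "distr PU (PiM A (\<lambda>_. unif)) (\<lambda>U. restrict U A)"
  by (rule PU.prob_space_distr[OF rA])
 interpret dB: prob_space "distr PU (PiM B (\<lambda>_. unif)) (\<lambda>U. restrict U B)"
  by (rule PU.prob_space_distr[OF rB])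
 have eq: "distr PU (PiM A (\<lambda>_. unif)) (\<lambda>U. restrict U A) \<Otimes>\<^sub>M distr PU (PiM B (\<lambda>_. unif)) (\<lambda>U. restrict U B)
  = distr PU (PiM A (\<lambda>_. unif) \<Otimes>\<^sub>M PiM B (\<lambda>_. unif)) (\<lambda>U. (restrict U A, restrict U B))"
  using indep_coords[OF AB f(3) g(3)] by (simp add: PU.indep_var_distribution_eq)
 have "(\<E> U. f U * g U) = (\<E> U. f' (restrict U A) * g' (restrict U B))"
  by (rule nn_integral_cong) (simp add: f' g')
 also have "... = (\<integral>\<^sup>+z. f' (fst z) * g' (snd z) \<partial>distr PU (PiM A (\<lambda>_. unif) \<Otimes>\<^sub>M PiM B (\<lambda>_. unif)) (\<lambda>U. (restrict U A, restrict U B)))"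
  using f'(1) g'(1) rA rB by (subst nn_integral_distr) auto
 also have "... = (\<integral>\<^sup>+z. f' (fst z) * g' (snd z) \<partial>(distr PU (PiM A (\<lambda>_. unif)) (\<lambda>U. restrict U A) \<Otimes>\<^sub>M distr PU (PiM B (\<lambda>_. unif)) (\<lambda>U. restrict U B)))"
  by (simp add: eq)
 also have "... = (\<integral>\<^sup>+x. \<integral>\<^sup>+y. f' x * g' y \<partial>distr PU (PiM B (\<lambda>_. unif)) (\<lambda>U. restrict U B) \<partial>distr PU (PiM A (\<lambda>_. unif)) (\<lambda>U. restrict U A))"
  using f'(1) g'(1) by (subst dB.nn_integral_fst[symmetric]) auto
 also have "... = (\<integral>\<^sup>+x. f' x \<partial>distr PU (PiM A (\<lambda>_. unif)) (\<lambda>U. restrict U A)) * (\<integral>\<^sup>+y. g' y \<partial>distr PU (PiM B (\<lambda>_. unif)) (\<lambda>U. restrict U B))"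
  using f'(1) g'(1) by (simp add: nn_integral_cmult nn_integral_multc)
 also have "... = (\<E> U. f' (restrict U A)) * (\<E> U. g' (restrict U B))"
  using f'(1) g'(1) rA rB by (simp add: nn_integral_distr)
 also have "(\<E> U. f' (restrict U A)) = (\<E> U. f U)"
  by (rule nn_integral_cong) (simp add: f')
 also have "(\<E> U. g' (restrict U B)) = (\<E> U. g U)"
  by (rule nn_integral_cong) (simp add: g')
 finally show ?thesis .
qed

lemma indep_prob:
 assumes P: "Measurable.pred PU P" "depends_on A P" "A \<subseteq> E"
  and Q: "Measurable.pred PU Q" "depends_on B Q" "B \<subseteq> E" and AB: "A \<inter> B = {}"
 shows "\<P>(U in PU. P U \<and> Q U) = \<P>(U in PU. P U) * \<P>(U in PU. Q U)"
proof -
 note [measurable] = P(1) Q(1)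
 let ?f = "\<lambda>U. if P U then 1 else 0 :: ennreal" and ?g = "\<lambda>U. if Q U then 1 else 0 :: ennreal"
 have int: "(\<E> U. (if R U then 1 else 0)) = emeasure PU {U \<in> space PU. R U}"
  if [measurable]: "Measurable.pred PU R" for R
 proof -
  have "(\<E> U. (if R U then 1 else 0)) = (\<E> U. indicator {U \<in> space PU. R U} U)"
   by (rule nn_integral_cong) auto
  then show ?thesis by simp
 qed
 have dP: "depends_on A ?f"
  by (rule depends_on_comp[OF P(2)])
 have dQ: "depends_on B ?g"
  by (rule depends_on_comp[OF Q(2)])
 have "(\<E> U. ?f U * ?g U) = (\<E> U. ?f U) * (\<E> U. ?g U)"
  by (rule indep_nn_integral[OF _ dP P(3) _ dQ Q(3) AB]) auto
 moreover have "(\<E> U. ?f U * ?g U) = (\<E> U. (if P U \<and> Q U then 1 else 0))"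
  by (rule nn_integral_cong) auto
 ultimately show ?thesis
  by (simp add: int PU.emeasure_eq_measure flip: ennreal_mult)
qed

lemma prob_coords:
 assumes "finite J" "J \<subseteq> E" "\<And>e. e \<in> J \<Longrightarrow> B e \<in> sets borel"
 shows "\<P>(U in PU. \<forall>e\<in>J. U e \<in> B e) = (\<Prod>e\<in>J. measure unif (B e))"
proof -
 have "emeasure PU {U \<in> space PU. \<forall>e\<in>J. U e \<in> B e} = (\<Prod>e\<in>J. emeasure unif (B e))"
  unfolding PU_def using assms by (intro P.emeasure_PiM_Collect) auto
 then show ?thesis
  by (simp add: PU.emeasure_eq_measure unif.emeasure_eq_measure prod_ennreal prod_nonneg)
qed

end

section \<open>Generating functions of cluster sizes\<close>

definition xp :: "real \<Rightarrow> 'a set \<Rightarrow> real" where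
 "xp x K = (if finite K then x ^ card K else 0)"

text \<open>\<open>xp\<close> vanishes on infinite sets for every \<open>x\<close>, also for
  \<open>x = 1\<close>. Hence \<open>phi 1\<close> is the indicator of being infinite, and the
  probability of an infinite cluster is a value of the same functional.\<close>

definition phi :: "real \<Rightarrow> 'a set \<Rightarrow> real" where
 "phi x K = 1 - xp x K"

lemma xp_bounds: "0 \<le> x \<Longrightarrow> x \<le> 1 \<Longrightarrow> 0 \<le> xp x K \<and> xp x K \<le> 1"
 by (auto simp: xp_def power_le_one)

lemma phi_bounds: "0 \<le> x \<Longrightarrow> x \<le> 1 \<Longrightarrow> 0 \<le> phi x K \<and> phi x K \<le> 1"
 using xp_bounds[of x K] by (auto simp: phi_def)

lemma xp_antimono: "0 \<le> x \<Longrightarrow> x \<le> 1 \<Longrightarrow> K \<subseteq> K' \<Longrightarrow> xp x K' \<le> xp x K"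
 by (auto simp: xp_def power_decreasing card_mono dest: finite_subset)

lemma phi_mono: "0 \<le> x \<Longrightarrow> x \<le> 1 \<Longrightarrow> K \<subseteq> K' \<Longrightarrow> phi x K \<le> phi x K'"
 using xp_antimono by (auto simp: phi_def)

lemma xp_Un: "0 \<le> x \<Longrightarrow> x \<le> 1 \<Longrightarrow> xp x A * xp x B \<le> xp x (A \<union> B)"
 by (auto simp: xp_def power_decreasing card_Un_le simp flip: power_add)

text \<open>The factor \<open>xp x A\<close> is kept because, after sprinkling, it weights the
  number of new edges at the old cluster and so produces \<open>card S * x ^ card S\<close>, whose
  expectation is \<open>X\<close>.\<close>

lemma phi_Un: "0 \<le> x \<Longrightarrow> x \<le> 1 \<Longrightarrow> phi x (A \<union> B) \<le> phi x A + xp x A * phi x B"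
 using xp_Un[of x A B] by (auto simp: phi_def algebra_simps)

lemma phi_Un': "0 \<le> x \<Longrightarrow> x \<le> 1 \<Longrightarrow> phi x (A \<union> B) \<le> phi x A + phi x B"
 using phi_Un[of x A B] xp_bounds[of x A] phi_bounds[of x B]
  mult_right_mono[of "xp x A" 1 "phi x B"] by auto

lemma phi_empty [simp]: "phi x {} = 0"
 by (simp add: phi_def xp_def)

lemma phi_UN:
 assumes "0 \<le> x" "x \<le> 1" "finite I"
 shows "phi x (\<Union>i\<in>I. A i) \<le> (\<Sum>i\<in>I. phi x (A i))"
 using assms(3)
proof (induction I)
 case (insert i I)
 then show ?case using phi_Un'[OF assms(1,2), of "A i" "\<Union>i\<in>I. A i"] by auto
qed simp

lemma xp_antimono_x: "0 \<le> x \<Longrightarrow> x \<le> y \<Longrightarrow> xp x K \<le> xp y K"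
 by (auto simp: xp_def power_mono)

lemma phi_antimono_x: "0 \<le> x \<Longrightarrow> x \<le> y \<Longrightarrow> phi y K \<le> phi x K"
 using xp_antimono_x by (auto simp: phi_def)

lemma opn_mono: "p \<le> q \<Longrightarrow> opn E p U \<subseteq> opn E q U"
 by (auto simp: opn_def)

lemma opn_subset: "opn E p U \<subseteq> E"
 by (auto simp: opn_def)

context perc
begin

abbreviation K :: "real \<Rightarrow> ('a set \<Rightarrow> real) \<Rightarrow> 'a set \<Rightarrow> 'a \<Rightarrow> 'a set" where
 "K p U S v \<equiv> component (del (opn E p U) S) v"

text \<open>With \<open>x = exp (- h)\<close> this is the magnetization: the probability that the
  cluster of \<open>v\<close> off \<open>S\<close> meets an independent ghost field of intensity
  \<open>h\<close>.\<close>

definition M :: "real \<Rightarrow> real \<Rightarrow> 'a set \<Rightarrow> 'a \<Rightarrow> real" where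
 "M p x S v = (\<integral>U. phi x (K p U S v) \<partial>PU)"

definition tau :: "real \<Rightarrow> 'a \<Rightarrow> 'a \<Rightarrow> real" where
 "tau p u v = \<P>(U in PU. v \<in> K p U {} u)"

lemma meas_K: "meas_eset (\<lambda>U. del (opn E p U) S)"
 by (rule meas_eset_del[OF meas_eset_opn])

lemma measurable_K_fun:
 assumes "v \<in> V"
 shows "(\<lambda>U. if finite (K p U S v) then (g (K p U S v) :: 'b :: topological_space) else c) \<in> borel_measurable PU"
 by (rule measurable_component_fun[OF meas_K assms]) auto

lemma measurable_phi:
 assumes F: "meas_eset F" and "v \<in> V"
 shows "(\<lambda>U. phi x (component (F U) v)) \<in> borel_measurable PU"
proof -
 have "(\<lambda>U. phi x (component (F U) v)) =
   (\<lambda>U. if finite (component (F U) v) then 1 - x ^ card (component (F U) v) else 1)"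
  by (auto simp: phi_def xp_def)
 then show ?thesis using measurable_component_fun[OF F assms(2), of "\<lambda>S. 1 - x ^ card S" borel 1] by simp
qed

lemma measurable_phi_K [measurable]: "v \<in> V \<Longrightarrow> (\<lambda>U. phi x (K p U S v)) \<in> borel_measurable PU"
 by (rule measurable_phi[OF meas_K])

lemma pred_K_mem [measurable]: "Measurable.pred PU (\<lambda>U. u \<in> K p U S v)"
 by (rule pred_component[OF meas_K])

lemma pred_opn_mem [measurable]: "Measurable.pred PU (\<lambda>U. u \<in> clu p U v)"
 by (rule pred_component[OF meas_eset_opn])

lemma pred_K_eq: "v \<in> V \<Longrightarrow> Measurable.pred PU (\<lambda>U. K p U S v = B)"
 by (rule pred_component_eq[OF meas_K])

lemma pred_K_finite: "v \<in> V \<Longrightarrow> Measurable.pred PU (\<lambda>U. finite (K p U S v))"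
 by (rule pred_component_finite[OF meas_K])

lemma pred_opn: "e \<in> E \<Longrightarrow> Measurable.pred PU (\<lambda>U. e \<in> opn E p U)"
 using meas_eset_pred[OF meas_eset_opn] .

lemma pred_opn' [measurable]: "Measurable.pred PU (\<lambda>U. e \<in> opn E p U)"
 by (cases "e \<in> E") (auto simp: pred_opn, simp add: opn_def)

lemma integrable_phi:
 assumes "meas_eset F" "v \<in> V" "0 \<le> x" "x \<le> 1"
 shows "integrable PU (\<lambda>U. phi x (component (F U) v))"
proof (rule PU.integrable_const_bound[where B=1])
 show "AE U in PU. norm (phi x (component (F U) v)) \<le> 1"
  by (intro AE_I2) (simp add: phi_bounds[OF assms(3,4)])
qed (rule measurable_phi[OF assms(1,2)])

lemma nn_phi:
 assumes "meas_eset F" "v \<in> V" "0 \<le> x" "x \<le> 1"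
 shows "(\<E> U. ennreal (phi x (component (F U) v))) = ennreal (\<integral>U. phi x (component (F U) v) \<partial>PU)"
 by (rule nn_integral_eq_integral[OF integrable_phi[OF assms]]) (use assms phi_bounds in auto)

lemma nn_M:
 assumes "v \<in> V" "0 \<le> x" "x \<le> 1"
 shows "(\<E> U. ennreal (phi x (K p U S v))) = ennreal (M p x S v)"
 unfolding M_def by (rule nn_phi[OF meas_K assms])

lemma M_bounds:
 assumes "v \<in> V" "0 \<le> x" "x \<le> 1"
 shows "0 \<le> M p x S v" "M p x S v \<le> 1"
proof -
 show "0 \<le> M p x S v" unfolding M_def using assms phi_bounds by (intro integral_nonneg_AE) auto
 have "M p x S v \<le> (\<integral>U. 1 \<partial>PU)"
  unfolding M_def using assms phi_bounds by (intro integral_mono integrable_phi meas_K) auto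
 then show "M p x S v \<le> 1" by (simp add: PU.prob_space)
qed

lemma M_mono_gen:
 assumes "v \<in> V" "0 \<le> x" "x \<le> y" "y \<le> 1" "p \<le> q" "S' \<subseteq> S"
 shows "M p y S v \<le> M q x S' v"
 unfolding M_def
proof (rule integral_mono)
 show "integrable PU (\<lambda>U. phi y (K p U S v))" "integrable PU (\<lambda>U. phi x (K q U S' v))"
  using assms by (auto intro!: integrable_phi meas_K)
 fix U
 have "K p U S v \<subseteq> K q U S' v"
  using assms by (intro component_mono) (auto simp: del_def opn_def)
 then have "phi x (K p U S v) \<le> phi x (K q U S' v)" using assms by (intro phi_mono) auto
 moreover have "phi y (K p U S v) \<le> phi x (K p U S v)" using assms by (intro phi_antimono_x) auto
 ultimately show "phi y (K p U S v) \<le> phi x (K q U S' v)" by simp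
qed

lemma tau_bounds: "0 \<le> tau p u v" "tau p u v \<le> 1"
 by (auto simp: tau_def)

lemma tau_sym: "tau p u v = tau p v u"
 unfolding tau_def by (metis component_sym)

lemma tau_refl [simp]: "tau p u u = 1"
 using PU.prob_space by (simp add: tau_def)

lemma tau_mono: "p \<le> q \<Longrightarrow> tau p u v \<le> tau q u v"
 unfolding tau_def
proof (rule PU.finite_measure_mono)
 assume "p \<le> q"
 then show "{U \<in> space PU. v \<in> K p U {} u} \<subseteq> {U \<in> space PU. v \<in> K q U {} u}"
  using component_mono[OF opn_mono, of p q E _ u] by auto
qed simp

lemma depends_on_opn_set:
 assumes "A \<subseteq> B" shows "depends_on B (\<lambda>U. {e \<in> opn E p U. e \<in> A \<and> Q e})"
proof (rule depends_onI)
 fix U U' assume "\<And>e. e \<in> B \<Longrightarrow> (U e :: real) = U' e"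
 then have "U e = U' e" if "e \<in> A" for e using that assms by auto
 then show "{e \<in> opn E p U. e \<in> A \<and> Q e} = {e \<in> opn E p U'. e \<in> A \<and> Q e}"
  by (auto simp: opn_def)
qed

lemma depends_on_K: "depends_on (E - tch S) (\<lambda>U. K p U S v)"
proof -
 have "del (opn E p U) S = {e \<in> opn E p U. e \<in> E - tch S \<and> True}" for U
  by (auto simp: del_def opn_def tch_def)
 then have "(\<lambda>U. K p U S v) = (\<lambda>U. component {e \<in> opn E p U. e \<in> E - tch S \<and> True} v)"
  by simp
 then show ?thesis
  using depends_on_comp[OF depends_on_opn_set[OF order_refl[of "E - tch S"], of p "\<lambda>_. True"],
   of "\<lambda>F. component F v"] by simp
qed

lemma edge_doubleton: "e \<in> E \<Longrightarrow> \<exists>x y. e = {x, y}"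
 by (erule edgeE) auto

text \<open>To recognise that an exploration stops with the set \<open>B\<close> it is enough to
  look at the edges touching \<open>B\<close>; all other edges remain fresh.\<close>

lemma depends_on_K_eq:
 assumes "v \<in> B"
 shows "depends_on (tch B) (\<lambda>U. K p U S v = B)"
proof -
 have eq: "K p U S v = B \<longleftrightarrow>
   component {e \<in> opn E p U. e \<in> tch B \<and> e \<inter> S = {} \<and> e \<subseteq> B} v = B \<and>
   bd {e \<in> opn E p U. e \<in> tch B \<and> e \<inter> S = {}} B = {}" for U
 proof -
  have "{e \<in> del (opn E p U) S. e \<subseteq> B} = {e \<in> opn E p U. e \<in> tch B \<and> e \<inter> S = {} \<and> e \<subseteq> B}"
   by (auto simp: del_def opn_def tch_def dest: edge_doubleton)
  moreover have "bd (del (opn E p U) S) B = bd {e \<in> opn E p U. e \<in> tch B \<and> e \<inter> S = {}} B"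
   by (auto simp: bd_def del_def opn_def tch_def)
  ultimately show ?thesis
   using component_eq_iff[of v B "del (opn E p U) S"] assms
   by (auto simp: del_def opn_def dest: edge_doubleton)
 qed
 show ?thesis unfolding eq
  by (intro depends_on_comp2[where h="(\<and>)"]
     depends_on_comp[OF depends_on_opn_set[OF order_refl], where h="\<lambda>F. component F v = B"]
     depends_on_comp[OF depends_on_opn_set[OF order_refl], where h="\<lambda>F. bd F B = {}"])
qed

section \<open>Conditioning on a finite cluster\<close>

lemma nn_indicator_pred:
 assumes [measurable]: "Measurable.pred PU R"
 shows "(\<E> U. (if R U then 1 else 0)) = ennreal (\<P>(U in PU. R U))"
proof -
 have "(\<E> U. (if R U then 1 else 0)) = (\<E> U. indicator {U \<in> space PU. R U} U)"
  by (rule nn_integral_cong) auto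
 then show ?thesis by (simp add: PU.emeasure_eq_measure)
qed

lemma nn_indep_pred:
 assumes R: "Measurable.pred PU R" "depends_on A R" "A \<subseteq> E"
  and g: "g \<in> borel_measurable PU" "depends_on B g" "B \<subseteq> E" and AB: "A \<inter> B = {}"
 shows "(\<E> U. (if R U then g U else 0)) = ennreal (\<P>(U in PU. R U)) * (\<E> U. g U)"
proof -
 note [measurable] = R(1) g(1)
 have "(\<E> U. (if R U then g U else 0)) = (\<E> U. (if R U then 1 else 0) * g U)"
  by (rule nn_integral_cong) auto
 also have "... = (\<E> U. (if R U then 1 else 0)) * (\<E> U. g U)"
  by (rule indep_nn_integral[OF _ depends_on_comp[OF R(2)] R(3) g AB]) measurable
 finally show ?thesis using nn_indicator_pred[OF R(1)] by simp
qed

lemma nn_single: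
 assumes "B \<in> I"
 shows "(\<integral>\<^sup>+S. (if B = S then h S else 0) \<partial>count_space I) = (h B :: ennreal)"
proof -
 have "(\<integral>\<^sup>+S. (if B = S then h S else 0) \<partial>count_space I) = (\<integral>\<^sup>+S. h B * indicator {B} S \<partial>count_space I)"
  by (rule nn_integral_cong) auto
 also have "... = h B" using assms by (simp add: nn_integral_cmult_indicator)
 finally show ?thesis .
qed

text \<open>Sums over the countably many values of a finite cluster take the place of conditional
  expectations.\<close>

lemma nn_decompose:
 assumes F: "meas_eset F" and v: "v \<in> V"
  and h: "\<And>S. S \<in> FS \<Longrightarrow> h S \<in> borel_measurable PU"
 shows "(\<E> U. (if finite (component (F U) v) then h (component (F U) v) U else 0)) =
  (\<integral>\<^sup>+S. (\<E> U. (if component (F U) v = S then h S U else (0::ennreal))) \<partial>count_space FS)"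
proof -
 have "(\<E> U. (if finite (component (F U) v) then h (component (F U) v) U else 0)) =
   (\<E> U. (\<integral>\<^sup>+S. (if component (F U) v = S then h S U else 0) \<partial>count_space FS))"
 proof (rule nn_integral_cong)
  fix U
  show "(if finite (component (F U) v) then h (component (F U) v) U else 0) =
    (\<integral>\<^sup>+S. (if component (F U) v = S then h S U else 0) \<partial>count_space FS)"
  proof (cases "finite (component (F U) v)")
   case True
   then have "component (F U) v \<in> FS"
    using component_FS[OF meas_eset_subset[OF F] v] by auto
   then show ?thesis using True nn_single[of _ FS "\<lambda>S. h S U"] by simp
  next
   case False
   have "(\<integral>\<^sup>+S. (if component (F U) v = S then h S U else 0) \<partial>count_space FS) = (\<integral>\<^sup>+S. 0 \<partial>count_space FS)"
    by (rule nn_integral_cong) (use False in \<open>auto simp: FS_def\<close>)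
   then show ?thesis using False by simp
  qed
 qed
 also have "... = (\<integral>\<^sup>+S. (\<E> U. (if component (F U) v = S then h S U else 0)) \<partial>count_space FS)"
 proof (rule nn_integral_count_space_nn_integral[OF countable_FS])
  fix S assume "S \<in> FS"
  note [measurable] = h[OF this] pred_component_eq[OF F v]
  show "(\<lambda>U. if component (F U) v = S then h S U else 0) \<in> borel_measurable PU" by measurable
 qed
 finally show ?thesis .
qed

lemma tch_subset: "tch S \<subseteq> E"
 by (auto simp: tch_def)

text \<open>Spatial Markov property: once the cluster is known to be \<open>B\<close>, the edges not
  touching \<open>B\<close> are independent of everything revealed.\<close>

lemma nn_markov:
 assumes v: "v \<in> V" and B: "Measurable.pred PU R" "depends_on (tch B) R"
  and g: "g \<in> borel_measurable PU" "depends_on (E - tch B) g"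
 shows "(\<E> U. (if K p U S v = B \<and> R U then g U else 0)) =
  ennreal (\<P>(U in PU. K p U S v = B \<and> R U)) * (\<E> U. g U)"
proof (cases "v \<in> B")
 case True
 note [measurable] = B(1) pred_K_eq[OF v]
 show ?thesis
  by (rule nn_indep_pred[OF _ depends_on_comp2[OF depends_on_K_eq[OF True] B(2)] tch_subset g])
    auto
next
 case False
 then have "K p U S v \<noteq> B" for U by auto
 then show ?thesis by simp
qed

text \<open>Explore the cluster \<open>B\<close> of \<open>z\<close> off \<open>S\<close>. What the
  full cluster has in addition hangs on vertices \<open>u\<close> of \<open>S\<close> joined to
  \<open>B\<close> by an open edge. Such an edge connects \<open>u\<close> to \<open>z\<close>,
  hence the factor \<open>tau p z u\<close>; the part beyond \<open>u\<close> avoids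
  \<open>B\<close>, hence is independent and contributes at most \<open>M p x {} u\<close>. If
  \<open>B\<close> is infinite, its own term is already 1.\<close>

lemma K_reattach_le:
 assumes z: "z \<in> V" "z \<notin> S" and S: "finite S" "S \<subseteq> V" and x: "0 \<le> x" "x \<le> 1"
 shows "M p x {} z \<le> M p x S z + (\<Sum>u\<in>S. tau p z u * M p x {} u)"
proof -
 let ?B = "\<lambda>U. K p U S z"
 let ?hit = "\<lambda>u U. if finite (?B U) then (if \<exists>b\<in>?B U. {b, u} \<in> opn E p U then ennreal (phi x (K p U (?B U) u)) else 0) else 0"
 have hit_rew: "?hit u U = (if finite (?B U) then (\<lambda>B U. if \<exists>b\<in>B. {b, u} \<in> opn E p U then ennreal (phi x (K p U B u)) else 0) (?B U) U else 0)" for u U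
  by simp
 have m1: "(\<lambda>U. if \<exists>b\<in>B. {b, u} \<in> opn E p U then ennreal (phi x (K p U B u)) else 0) \<in> borel_measurable PU"
  if "B \<in> FS" "u \<in> S" for B u
 proof -
  have [measurable]: "Measurable.pred PU (\<lambda>U. \<exists>b\<in>B. {b, u} \<in> opn E p U)"
   using that by (intro pred_countable_ex) (auto simp: FS_def countable_finite)
  have "u \<in> V" using that S by auto
  then show ?thesis by measurable
 qed
 note hm = measurable_component_dep[OF meas_K[of p S] z(1), of "\<lambda>B U. if \<exists>b\<in>B. {b, u} \<in> opn E p U then ennreal (phi x (K p U B u)) else 0" borel 0 for u]
 have hit_meas: "?hit u \<in> borel_measurable PU" if "u \<in> S" for u
  using hm[OF m1] that by simp
 have hit_int: "(\<E> U. ?hit u U) \<le> ennreal (tau p z u * M p x {} u)" if u: "u \<in> S" for u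
 proof -
  have uV: "u \<in> V" using u S by auto
  let ?R = "\<lambda>B U. \<exists>b\<in>B. {b, u} \<in> opn E p U"
  let ?i = "\<lambda>B. \<E> U. (if ?B U = B then (if ?R B U then 1 else 0) else 0)"
  have R: "Measurable.pred PU (?R B)" if "B \<in> FS" for B
   using that by (intro pred_countable_ex) (auto simp: FS_def countable_finite)
  have dR: "depends_on (tch B) (?R B)" for B
  proof (rule depends_onI)
   fix U U' assume UU: "\<And>e. e \<in> tch B \<Longrightarrow> (U e :: real) = U' e"
   have "{b, u} \<in> opn E p U \<longleftrightarrow> {b, u} \<in> opn E p U'" if "b \<in> B" for b
    using UU[of "{b, u}"] that by (auto simp: opn_def tch_def)
   then show "?R B U = ?R B U'" by auto
  qed
  have "(\<E> U. ?hit u U) =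
    (\<integral>\<^sup>+B. (\<E> U. (if ?B U = B then (if ?R B U then ennreal (phi x (K p U B u)) else 0) else 0)) \<partial>count_space FS)"
   by (rule nn_decompose[where h="\<lambda>B U. if ?R B U then ennreal (phi x (K p U B u)) else 0", OF meas_K[of p S] z(1) m1[OF _ u]])
  also have "... \<le> (\<integral>\<^sup>+B. ?i B * ennreal (M p x {} u) \<partial>count_space FS)"
  proof (rule nn_integral_mono)
   fix B assume "B \<in> space (count_space FS)"
   then have B: "B \<in> FS" by simp
   have "(\<E> U. (if ?B U = B then (if ?R B U then ennreal (phi x (K p U B u)) else 0) else 0)) =
    (\<E> U. (if ?B U = B \<and> ?R B U then ennreal (phi x (K p U B u)) else 0))"
    by (rule nn_integral_cong) auto
   also have "... = ennreal (\<P>(U in PU. ?B U = B \<and> ?R B U)) * (\<E> U. ennreal (phi x (K p U B u)))"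
    by (rule nn_markov[OF z(1) R[OF B] dR])
      (use uV in \<open>auto intro!: depends_on_comp[OF depends_on_K, where h="\<lambda>C. ennreal (phi x C)"]\<close>)
   also have "(\<E> U. ennreal (phi x (K p U B u))) = ennreal (M p x B u)"
    by (rule nn_M[OF uV x])
   also have "ennreal (M p x B u) \<le> ennreal (M p x {} u)"
    using uV x by (intro ennreal_leI M_mono_gen) auto
   also have "ennreal (\<P>(U in PU. ?B U = B \<and> ?R B U)) = (\<E> U. (if ?B U = B \<and> ?R B U then 1 else 0))"
    using R[OF B] pred_K_eq[OF z(1)] by (subst nn_indicator_pred) auto
   also have "... = ?i B"
    by (rule nn_integral_cong) auto
   finally show "(\<E> U. (if ?B U = B then (if ?R B U then ennreal (phi x (K p U B u)) else 0) else 0)) \<le>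
     ?i B * ennreal (M p x {} u)"
    by (simp add: mult_left_mono)
  qed
  also have "... = (\<integral>\<^sup>+B. ?i B \<partial>count_space FS) * ennreal (M p x {} u)"
   by (rule nn_integral_multc) simp
  also have "(\<integral>\<^sup>+B. ?i B \<partial>count_space FS) =
    (\<E> U. (if finite (?B U) then (if ?R (?B U) U then 1 else 0) else 0))"
  proof (rule nn_decompose[where h="\<lambda>B U. if ?R B U then 1 else 0", OF meas_K[of p S] z(1), symmetric])
   fix B assume "B \<in> FS"
   note [measurable] = R[OF this]
   show "(\<lambda>U. if ?R B U then 1 else (0::ennreal)) \<in> borel_measurable PU" by measurable
  qed
  also have "... \<le> (\<E> U. (if u \<in> K p U {} z then 1 else 0))"
  proof (rule nn_integral_mono)
   fix U
   have "u \<in> K p U {} z" if "?R (?B U) U"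
   proof -
    from that obtain b where b: "b \<in> ?B U" "{b, u} \<in> opn E p U" by blast
    then have "b \<in> K p U {} z" using component_mono[of "del (opn E p U) S" "del (opn E p U) {}" z] by (auto simp: del_def)
    then show ?thesis using b by (auto intro: component_step)
   qed
   then show "(if finite (?B U) then (if ?R (?B U) U then 1 else 0) else 0) \<le> (if u \<in> K p U {} z then 1 else (0::ennreal))"
    by auto
  qed
  also have "... = ennreal (tau p z u)"
   unfolding tau_def by (rule nn_indicator_pred) simp
  finally show ?thesis
   using tau_bounds M_bounds[OF uV x] by (simp add: ennreal_mult mult_right_mono)
 qed
 have pt: "ennreal (phi x (K p U {} z)) \<le> ennreal (phi x (?B U)) + (\<Sum>u\<in>S. ?hit u U)" for U
 proof (cases "finite (?B U)")
  case False
  then have "phi x (?B U) = 1" by (simp add: phi_def xp_def)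
  moreover have "ennreal (phi x (K p U {} z)) \<le> 1"
   using ennreal_leI[of "phi x (K p U {} z)" 1] phi_bounds[OF x, of "K p U {} z"] by simp
  ultimately show ?thesis using False by simp
 next
  case True
  let ?I = "{u \<in> S. \<exists>b\<in>?B U. {b, u} \<in> opn E p U}"
  have "K p U {} z \<subseteq> ?B U \<union> (\<Union>u\<in>?I. K p U (?B U) u)"
   using component_reattach[OF _ z(2), of _ "opn E p U"] by fastforce
  then have "phi x (K p U {} z) \<le> phi x (?B U \<union> (\<Union>u\<in>?I. K p U (?B U) u))"
   by (rule phi_mono[OF x])
  also have "... \<le> phi x (?B U) + (\<Sum>u\<in>?I. phi x (K p U (?B U) u))"
   using phi_Un'[OF x] phi_UN[OF x, of ?I "\<lambda>u. K p U (?B U) u"] S by (smt (verit) finite_subset mem_Collect_eq subsetI)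
  finally have "ennreal (phi x (K p U {} z)) \<le> ennreal (phi x (?B U)) + (\<Sum>u\<in>?I. ennreal (phi x (K p U (?B U) u)))"
   by (subst sum_ennreal) (auto simp: phi_bounds[OF x] sum_nonneg ennreal_leI simp flip: ennreal_plus)
  also have "(\<Sum>u\<in>?I. ennreal (phi x (K p U (?B U) u))) = (\<Sum>u\<in>S. ?hit u U)"
   using True S by (subst sum.inter_filter) auto
  finally show ?thesis .
 qed
 have "ennreal (M p x {} z) \<le> (\<E> U. ennreal (phi x (?B U)) + (\<Sum>u\<in>S. ?hit u U))"
  unfolding nn_M[OF z(1) x, symmetric] by (rule nn_integral_mono) (rule pt)
 also have "... = ennreal (M p x S z) + (\<Sum>u\<in>S. \<E> U. ?hit u U)"
 proof (subst nn_integral_add)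
  show "(\<lambda>U. \<Sum>u\<in>S. ?hit u U) \<in> borel_measurable PU"
   using hit_meas by (rule borel_measurable_sum)
  show "(\<E> U. ennreal (phi x (?B U))) + (\<E> U. (\<Sum>u\<in>S. ?hit u U)) =
    ennreal (M p x S z) + (\<Sum>u\<in>S. \<E> U. ?hit u U)"
   unfolding nn_M[OF z(1) x] by (subst nn_integral_sum[OF hit_meas]) auto
 qed (use z in measurable)
 also have "... \<le> ennreal (M p x S z) + (\<Sum>u\<in>S. ennreal (tau p z u * M p x {} u))"
  by (intro add_left_mono sum_mono hit_int)
 also have "... = ennreal (M p x S z + (\<Sum>u\<in>S. tau p z u * M p x {} u))"
  using S tau_bounds M_bounds[OF _ x] z by (subst sum_ennreal) (auto simp: subset_iff sum_nonneg)
 finally show ?thesis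
  using S tau_bounds M_bounds[OF _ x] z by (subst (asm) ennreal_le_iff) (auto simp: subset_iff intro!: add_nonneg_nonneg sum_nonneg)
qed

end

section \<open>Automorphisms and comparability of vertices\<close>

context perc
begin

lemma prob_open:
 assumes "finite D" "D \<subseteq> E" "0 \<le> p" "p \<le> 1"
 shows "\<P>(U in PU. D \<subseteq> opn E p U) = p ^ card D"
proof -
 have "{U \<in> space PU. D \<subseteq> opn E p U} = {U \<in> space PU. \<forall>e\<in>D. U e \<in> {..p}}"
  using assms(2) by (auto simp: opn_def)
 then show ?thesis using prob_coords[OF assms(1,2), of "\<lambda>_. {..p}"] measure_unif_le[OF assms(3,4)] by simp
qed

text \<open>Insert the finite path \<open>D\<close> by force. The cluster of \<open>z\<close> in the
  enlarged graph is independent of the labels on \<open>D\<close>, and when \<open>D\<close> happens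
  to be open it equals the cluster of \<open>y\<close>. Opening \<open>D\<close> costs
  \<open>p ^ card D\<close>.\<close>

lemma finite_energy:
 fixes G :: "'a set \<Rightarrow> ennreal"
 assumes D: "finite D" "D \<subseteq> E - tch S" "y \<in> component D z" and p: "0 \<le> p" "p \<le> 1"
  and V: "y \<in> V" "z \<in> V"
  and G: "\<And>A B. A \<subseteq> B \<Longrightarrow> G A \<le> G B"
  and mG: "\<And>F v. meas_eset F \<Longrightarrow> v \<in> V \<Longrightarrow> (\<lambda>U. G (component (F U) v)) \<in> borel_measurable PU"
 shows "ennreal (p ^ card D) * (\<E> U. G (K p U S z)) \<le> (\<E> U. G (K p U S y))"
proof -
 let ?F = "\<lambda>U. del (opn E p U) S \<union> D"
 have DE: "D \<subseteq> E" using D by auto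
 have mF: "meas_eset ?F"
  unfolding meas_eset_def
 proof (intro conjI ballI allI)
  fix e assume "e \<in> E"
  note [measurable] = meas_eset_pred[OF meas_K this]
  have "Measurable.pred PU (\<lambda>U. e \<in> del (opn E p U) S \<or> e \<in> D)" by measurable
  then show "Measurable.pred PU (\<lambda>U. e \<in> del (opn E p U) S \<union> D)" by simp
 qed (use DE in \<open>auto simp: del_def opn_def\<close>)
 have [measurable]: "Measurable.pred PU (\<lambda>U. D \<subseteq> opn E p U)"
  unfolding subset_iff using D(1) by (intro pred_countable_all[unfolded Ball_def]) (auto simp: countable_finite)
 have "depends_on (E - D) (\<lambda>U. G (component (?F U) z))"
 proof (rule depends_onI)
  fix U U' assume UU: "\<And>e. e \<in> E - D \<Longrightarrow> (U e :: real) = U' e"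
  have "?F U = ?F U'" using UU by (auto simp: del_def opn_def)
  then show "G (component (?F U) z) = G (component (?F U') z)" by simp
 qed
 moreover have "depends_on D (\<lambda>U. D \<subseteq> opn E p U)"
  by (rule depends_onI) (auto simp: opn_def)
 ultimately have "(\<E> U. (if D \<subseteq> opn E p U then G (component (?F U) z) else 0)) =
   ennreal (\<P>(U in PU. D \<subseteq> opn E p U)) * (\<E> U. G (component (?F U) z))"
  using DE by (intro nn_indep_pred[where A=D and B="E - D"] mG mF V) auto
 also have "\<P>(U in PU. D \<subseteq> opn E p U) = p ^ card D"
  by (rule prob_open) (use D DE p in auto)
 finally have eq: "(\<E> U. (if D \<subseteq> opn E p U then G (component (?F U) z) else 0)) =
   ennreal (p ^ card D) * (\<E> U. G (component (?F U) z))" .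
 have "ennreal (p ^ card D) * (\<E> U. G (K p U S z)) \<le> ennreal (p ^ card D) * (\<E> U. G (component (?F U) z))"
  by (intro mult_left_mono nn_integral_mono G component_mono) auto
 also have "... \<le> (\<E> U. G (K p U S y))"
  unfolding eq[symmetric]
 proof (rule nn_integral_mono)
  fix U
  have "component (?F U) z = K p U S y" if "D \<subseteq> opn E p U"
  proof -
   have "?F U = del (opn E p U) S" using that D by (auto simp: del_def tch_def)
   moreover from this have "y \<in> component (del (opn E p U) S) z"
    using D(3) component_mono[of D "del (opn E p U) S" z] by auto
   ultimately show ?thesis by (simp add: component_eq)
  qed
  then show "(if D \<subseteq> opn E p U then G (component (?F U) z) else 0) \<le> G (K p U S y)" by auto
 qed
 finally show ?thesis .
qed

lemma M_finite_energy:
 assumes D: "finite D" "D \<subseteq> E - tch S" "y \<in> component D z" and p: "0 \<le> p" "p \<le> 1"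
  and V: "y \<in> V" "z \<in> V" and x: "0 \<le> x" "x \<le> 1"
 shows "p ^ card D * M p x S z \<le> M p x S y"
proof -
 have "ennreal (p ^ card D) * (\<E> U. ennreal (phi x (K p U S z))) \<le> (\<E> U. ennreal (phi x (K p U S y)))"
  by (rule finite_energy[OF D p V]) (auto intro!: ennreal_leI phi_mono x measurable_compose[OF measurable_phi] )
 then show ?thesis
  using p M_bounds[OF V(1) x] M_bounds[OF V(2) x] V x by (simp add: nn_M flip: ennreal_mult)
qed

text \<open>Labels are pulled back along \<open>f\<close>. Their law is invariant under this, and
  the cluster of \<open>f v\<close> is the image of the cluster of \<open>v\<close> for the pulled
  back labels.\<close>

definition act :: "('a \<Rightarrow> 'a) \<Rightarrow> ('a set \<Rightarrow> real) \<Rightarrow> 'a set \<Rightarrow> real" where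
 "act f U = (\<lambda>e\<in>E. U (f ` e))"

lemma automorphism_edge:
 assumes "f \<in> automorphisms V E"
 shows "inj_on (image f) E" "image f \<in> E \<rightarrow> E" "e \<in> E \<Longrightarrow> \<exists>e'\<in>E. e = f ` e'"
proof -
 have b: "bij_betw f V V" and ed: "\<And>u v. u \<in> V \<Longrightarrow> v \<in> V \<Longrightarrow> {f u, f v} \<in> E \<longleftrightarrow> {u, v} \<in> E"
  using assms by (auto simp: automorphisms_def)
 have inj: "inj_on f V" using b by (rule bij_betw_imp_inj_on)
 show "inj_on (image f) E"
  by (rule inj_onI) (metis inj inj_on_image_eq_iff edge_subset)
 show "image f \<in> E \<rightarrow> E"
 proof
  fix e assume "e \<in> E"
  moreover from this obtain u v where "e = {u, v}" "u \<in> V" "v \<in> V" by (elim edgeE) auto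
  ultimately show "f ` e \<in> E" using ed[of u v] by simp
 qed
 show "\<exists>e'\<in>E. e = f ` e'" if "e \<in> E"
 proof -
  obtain u v where e: "e = {u, v}" "u \<in> V" "v \<in> V" using \<open>e \<in> E\<close> by (elim edgeE) auto
  then have "u \<in> f ` V" "v \<in> f ` V" using b by (auto simp: bij_betw_def)
  then obtain u' v' where "u' \<in> V" "v' \<in> V" "u = f u'" "v = f v'" by blast
  then show ?thesis using ed e \<open>e \<in> E\<close> by (intro bexI[of _ "{u', v'}"]) auto
 qed
qed

lemma distr_act:
 assumes "f \<in> automorphisms V E"
 shows "distr PU PU (act f) = PU"
 unfolding PU_def act_def[abs_def]
 by (rule distr_PiM_reindex[of E "\<lambda>_. unif" "image f" E])
   (use automorphism_edge[OF assms] unif.prob_space_axioms in auto)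

lemma measurable_act [measurable]:
 assumes "f \<in> automorphisms V E"
 shows "act f \<in> measurable PU PU"
 unfolding PU_def act_def[abs_def]
proof (rule measurable_restrict)
 fix e assume "e \<in> E"
 then have "f ` e \<in> E" using automorphism_edge[OF assms] by auto
 then show "(\<lambda>U. U (f ` e)) \<in> measurable (Pi\<^sub>M E (\<lambda>_. unif)) unif"
  by (rule measurable_component_singleton)
qed

lemma component_image:
 assumes f: "f \<in> automorphisms V E" and v: "v \<in> V"
 shows "clu p U (f v) = f ` clu p (act f U) v"
proof
 have b: "bij_betw f V V" and ed: "\<And>u v. u \<in> V \<Longrightarrow> v \<in> V \<Longrightarrow> {f u, f v} \<in> E \<longleftrightarrow> {u, v} \<in> E"
  using f by (auto simp: automorphisms_def)
 have sub: "clu p (act f U) v \<subseteq> V"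
  using v by (intro component_subset_V opn_subset)
 show "f ` clu p (act f U) v \<subseteq> clu p U (f v)"
 proof
  fix w assume "w \<in> f ` clu p (act f U) v"
  then obtain w' where "w = f w'" "w' \<in> clu p (act f U) v" by auto
  from this(2) show "w \<in> clu p U (f v)" unfolding \<open>w = f w'\<close>
  proof (induction rule: component_induct)
   case (step a b)
   then have "{a, b} \<in> E" by (auto simp: opn_def)
   then have "a \<in> V" "b \<in> V" using edge_vertices by auto
   then have "{f a, f b} \<in> opn E p U"
    using step(2) ed[of a b] by (auto simp: opn_def act_def)
   then show ?case using step by (auto intro: component_step)
  qed auto
 qed
 show "clu p U (f v) \<subseteq> f ` clu p (act f U) v"
 proof (rule component_closed)
  show "f v \<in> f ` clu p (act f U) v" by auto
  fix a b assume ab: "{a, b} \<in> opn E p U" "a \<in> f ` clu p (act f U) v"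
  then have "{a, b} \<in> E" by (auto simp: opn_def)
  then have "b \<in> V" using edge_vertices by auto
  then obtain b' where b': "b = f b'" "b' \<in> V" using b by (auto simp: bij_betw_def)
  obtain a' where a': "a = f a'" "a' \<in> clu p (act f U) v" using ab by auto
  then have "a' \<in> V" using sub by auto
  have "{a', b'} \<in> opn E p (act f U)"
   using ab(1) a' b' ed[OF \<open>a' \<in> V\<close> b'(2)] by (auto simp: opn_def act_def)
  then show "b \<in> f ` clu p (act f U) v" using a' b' by (auto intro: component_step)
 qed
qed

text \<open>\<open>G'\<close> is \<open>G\<close> transported by \<open>f\<close>. The two differ
  when the functional refers to a further vertex, as it does for \<open>tau\<close>.\<close>

lemma automorphism_integral:
 fixes G :: "'a set \<Rightarrow> ennreal"
 assumes f: "f \<in> automorphisms V E" and v: "v \<in> V"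
  and mG: "(\<lambda>U. G (clu p U v)) \<in> borel_measurable PU"
  and G: "\<And>A. A \<subseteq> V \<Longrightarrow> G' (f ` A) = G A"
 shows "(\<E> U. G' (clu p U (f v))) = (\<E> U. G (clu p U v))"
proof -
 have "(\<E> U. G' (clu p U (f v))) = (\<E> U. G (clu p (act f U) v))"
  unfolding component_image[OF f v]
  by (intro nn_integral_cong G component_subset_V opn_subset v)
 also have "... = (\<integral>\<^sup>+U. G (clu p U v) \<partial>distr PU PU (act f))"
  using mG by (subst nn_integral_distr[OF measurable_act[OF f]]) auto
 finally show ?thesis by (simp add: distr_act[OF f])
qed

lemma phi_image: "inj_on f A \<Longrightarrow> phi x (f ` A) = phi x A"
 by (auto simp: phi_def xp_def finite_image_iff card_image)

lemma M_automorphism: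
 assumes f: "f \<in> automorphisms V E" and v: "v \<in> V" and x: "0 \<le> x" "x \<le> 1"
 shows "M p x {} (f v) = M p x {} v"
proof -
 have b: "bij_betw f V V" using f by (auto simp: automorphisms_def)
 then have fv: "f v \<in> V" using v by (auto simp: bij_betw_def)
 have "(\<E> U. ennreal (phi x (clu p U (f v)))) = (\<E> U. ennreal (phi x (clu p U v)))"
 proof (rule automorphism_integral[OF f v])
  show "(\<lambda>U. ennreal (phi x (clu p U v))) \<in> borel_measurable PU"
   using measurable_phi_K[OF v, of x p "{}"] by simp
  show "ennreal (phi x (f ` A)) = ennreal (phi x A)" if "A \<subseteq> V" for A
   using b that by (subst phi_image) (auto simp: bij_betw_def intro: inj_on_subset)
 qed
 then show ?thesis
  using nn_M[OF v x, of p "{}"] nn_M[OF fv x, of p "{}"] M_bounds[OF v x, of p "{}"] M_bounds[OF fv x, of p "{}"]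
  by simp
qed

lemma tau_automorphism:
 assumes f: "f \<in> automorphisms V E" and v: "v \<in> V" "u \<in> V"
 shows "tau p (f v) (f u) = tau p v u"
proof -
 have b: "bij_betw f V V" using f by (auto simp: automorphisms_def)
 have "(\<E> U. (if f u \<in> clu p U (f v) then 1 else 0)) = (\<E> U. (if u \<in> clu p U v then 1 else 0))"
  by (rule automorphism_integral[OF f v(1), where G="\<lambda>A. if u \<in> A then 1 else 0" and G'="\<lambda>A. if f u \<in> A then 1 else 0"])
    (use b v in \<open>auto simp: bij_betw_def dest: inj_onD\<close>)
 then show ?thesis
  unfolding tau_def by (subst (asm) (1 2) nn_indicator_pred) auto
qed

lemma gball_automorphism:
 assumes f: "f \<in> automorphisms V E" and S: "S \<subseteq> V"
 shows "f ` gball r S \<subseteq> gball r (f ` S)"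
proof (induction r)
 case (Suc r)
 have ed: "\<And>u v. u \<in> V \<Longrightarrow> v \<in> V \<Longrightarrow> {f u, f v} \<in> E \<longleftrightarrow> {u, v} \<in> E"
  using f by (auto simp: automorphisms_def)
 have "f ` nbh (gball r S) \<subseteq> nbh (f ` gball r S)"
  using ball_V[OF S, of r] ed edge_vertices by (force simp: nbh_def)
 also have "... \<subseteq> nbh (gball r (f ` S))" using Suc by (auto simp: nbh_def)
 finally show ?case by (simp add: ball_Suc)
qed simp

lemma degree_automorphism:
 assumes f: "f \<in> automorphisms V E" and v: "v \<in> V"
 shows "card (tch {f v}) = card (tch {v})"
proof -
 have b: "bij_betw f V V" using f by (auto simp: automorphisms_def)
 have "tch {f v} = image f ` tch {v}"
 proof (intro equalityI subsetI)
  fix e assume "e \<in> tch {f v}"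
  then have e: "e \<in> E" "f v \<in> e" by (auto simp: tch_def)
  then obtain e' where e': "e' \<in> E" "e = f ` e'" using automorphism_edge(3)[OF f e(1)] by auto
  then have "v \<in> e'" using b v e edge_subset[OF e'(1)] by (auto simp: bij_betw_def dest: inj_onD)
  then show "e \<in> image f ` tch {v}" using e' by (auto simp: tch_def)
 next
  fix e assume "e \<in> image f ` tch {v}"
  then show "e \<in> tch {f v}" using automorphism_edge(2)[OF f] by (auto simp: tch_def)
 qed
 then show ?thesis
  using automorphism_edge(1)[OF f] by (simp add: card_image inj_on_subset[OF _ tch_subset])
qed

lemma orbit_representatives:
 assumes "quasi_transitive V E"
 obtains R where "finite R" "R \<subseteq> V" "R \<noteq> {}" "\<And>v. v \<in> V \<Longrightarrow> \<exists>r\<in>R. \<exists>f\<in>automorphisms V E. f r = v"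
proof -
 define orb where "orb v = {f v | f. f \<in> automorphisms V E}" for v
 have "finite (orb ` V)" using assms by (simp add: quasi_transitive_def orb_def[abs_def])
 from finite_subset_image[OF this order_refl]
 obtain R where R: "R \<subseteq> V" "finite R" "orb ` V = orb ` R" by auto
 have id: "id \<in> automorphisms V E" by (auto simp: automorphisms_def)
 show ?thesis
 proof (rule that)
  show "finite R" "R \<subseteq> V" "R \<noteq> {}" using R V_nonempty by auto
  fix v assume "v \<in> V"
  then have "orb v \<in> orb ` R" using R(3) by blast
  then obtain r where r: "r \<in> R" "orb v = orb r" by auto
  have "v \<in> orb v" unfolding orb_def using id by (intro CollectI exI[of _ id]) simp
  then show "\<exists>r\<in>R. \<exists>f\<in>automorphisms V E. f r = v" using r unfolding orb_def by auto
 qed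
qed

lemma card_tch_le:
 assumes d: "\<And>v. v \<in> V \<Longrightarrow> card (tch {v}) \<le> d" and S: "finite S" "S \<subseteq> V"
 shows "card (tch S) \<le> d * card S"
proof -
 have "tch S = (\<Union>v\<in>S. tch {v})" by (auto simp: tch_def)
 also have "card ... \<le> (\<Sum>v\<in>S. card (tch {v}))" by (rule card_UN_le[OF S(1)])
 also have "... \<le> (\<Sum>v\<in>S. d)" using S d by (intro sum_mono) auto
 finally show ?thesis by (simp add: mult.commute)
qed

lemma card_bd_le: "finite S \<Longrightarrow> S \<subseteq> V \<Longrightarrow> card (bd E S) \<le> card (tch S)"
 using card_mono[OF finite_tch bd_tch] inj_bd card_image by metis

lemma bounded_degree:
 assumes "quasi_transitive V E"
 shows "\<exists>d\<ge>1. \<forall>v\<in>V. card (tch {v}) \<le> d"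
proof -
 obtain R where R: "finite R" "R \<subseteq> V" "R \<noteq> {}" "\<And>v. v \<in> V \<Longrightarrow> \<exists>r\<in>R. \<exists>f\<in>automorphisms V E. f r = v"
  by (rule orbit_representatives[OF assms]) (rule that)
 let ?d = "Max ((\<lambda>r. card (tch {r})) ` R)"
 have "card (tch {v}) \<le> ?d" if v: "v \<in> V" for v
 proof -
  obtain r f where "r \<in> R" "f \<in> automorphisms V E" "f r = v" using R(4)[OF v] by auto
  then have "card (tch {v}) = card (tch {r})" using degree_automorphism[of f r] R by auto
  then show ?thesis using R \<open>r \<in> R\<close> by auto
 qed
 then show ?thesis by (intro exI[of _ "max 1 ?d"]) (auto simp: le_max_iff_disj)
qed

lemma finite_path:
 assumes "z \<in> V" "y \<in> V"
 shows "\<exists>D. finite D \<and> D \<subseteq> E \<and> y \<in> component D z"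
 using component_finite_witness1[of y E z] conn assms by (auto simp: connected_graph_def)

text \<open>Automorphisms reduce any two vertices to orbit representatives. Finitely many paths join
  these, and forcing the longest one open gives a constant that depends neither on \<open>p\<close>
  and \<open>x\<close> nor on the vertices.\<close>

lemma integral_comparable:
 assumes qt: "quasi_transitive V E" and plo: "0 < plo" "plo \<le> 1"
 shows "\<exists>c>0. \<forall>p\<in>{plo..1}. \<forall>x\<in>{0..1}. \<forall>u\<in>V. \<forall>v\<in>V. c * M p x {} v \<le> M p x {} u"
proof -
 obtain R where R: "finite R" "R \<subseteq> V" "R \<noteq> {}" "\<And>v. v \<in> V \<Longrightarrow> \<exists>r\<in>R. \<exists>f\<in>automorphisms V E. f r = v"
  by (rule orbit_representatives[OF qt]) (rule that)
 have "\<forall>r\<in>R. \<forall>r'\<in>R. \<exists>D. finite D \<and> D \<subseteq> E \<and> r' \<in> component D r"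
  using finite_path R by blast
 then obtain D where D: "\<And>r r'. r \<in> R \<Longrightarrow> r' \<in> R \<Longrightarrow> finite (D r r') \<and> D r r' \<subseteq> E \<and> r' \<in> component (D r r') r"
  by metis
 define n where "n = Max ((\<lambda>(r, r'). card (D r r')) ` (R \<times> R))"
 have n: "card (D r r') \<le> n" if "r \<in> R" "r' \<in> R" for r r'
  unfolding n_def using R that by (intro Max_ge) force+
 show ?thesis
 proof (intro exI[of _ "plo ^ n"] conjI ballI)
  show "0 < plo ^ n" using plo by simp
  fix p x u v assume p: "p \<in> {plo..1}" and x: "x \<in> {0..1::real}" and uv: "u \<in> V" "v \<in> V"
  obtain r f where r: "r \<in> R" "f \<in> automorphisms V E" "f r = v" using R(4)[OF uv(2)] by auto
  obtain r' f' where r': "r' \<in> R" "f' \<in> automorphisms V E" "f' r' = u" using R(4)[OF uv(1)] by auto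
  have RV: "r \<in> V" "r' \<in> V" using r r' R by auto
  have "plo ^ n * M p x {} r \<le> p ^ card (D r r') * M p x {} r"
  proof (rule mult_right_mono)
   have "plo ^ n \<le> plo ^ card (D r r')" using plo n[OF r(1) r'(1)] by (intro power_decreasing) auto
   also have "... \<le> p ^ card (D r r')" using plo p by (intro power_mono) auto
   finally show "plo ^ n \<le> p ^ card (D r r')" .
  qed (use M_bounds RV x in auto)
  also have "... \<le> M p x {} r'"
   using D[OF r(1) r'(1)] RV p x plo by (intro M_finite_energy) (auto simp: tch_def)
  finally show "plo ^ n * M p x {} v \<le> M p x {} u"
   using M_automorphism[OF r(2) RV(1), of x p] M_automorphism[OF r'(2) RV(2), of x p] r r' x by auto
 qed
qed

end

section \<open>The boundary of a finite set\<close>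

context perc
begin

text \<open>Follow a path of length at most \<open>r\<close> from \<open>S\<close> to
  \<open>z\<close> after its last vertex in \<open>S\<close>. The edges \<open>D\<close> avoid
  \<open>S\<close>, so opening them is compatible with the deletion of \<open>S\<close>; and
  \<open>z\<close> stays close to \<open>y\<close>, which later bounds how many \<open>z\<close>
  share the same boundary edge.\<close>

lemma path_to_set:
 assumes "S \<subseteq> V" "z \<in> gball r S" "z \<notin> S"
 shows "\<exists>(a, y) \<in> bd E S. z \<in> gball r {y} \<and>
  (\<exists>D. finite D \<and> D \<subseteq> E - tch S \<and> card D \<le> r \<and> z \<in> component D y)"
 using assms(2,3)
proof (induction r arbitrary: z)
 case (Suc r)
 show ?case
 proof (cases "z \<in> gball r S")
  case True
  from Suc.IH[OF this Suc.prems(2)]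
  obtain a y where ay: "(a, y) \<in> bd E S" "z \<in> gball r {y}"
   and D: "\<exists>D. finite D \<and> D \<subseteq> E - tch S \<and> card D \<le> r \<and> z \<in> component D y" by auto
  have "z \<in> gball (Suc r) {y}" using ay ball_incr[of r "Suc r" "{y}"] by auto
  moreover have "\<exists>D. finite D \<and> D \<subseteq> E - tch S \<and> card D \<le> Suc r \<and> z \<in> component D y"
   using D le_SucI by blast
  ultimately show ?thesis using ay(1) by (intro bexI[of _ "(a, y)"]) auto
 next
  case False
  then obtain b where b: "b \<in> gball r S" "{b, z} \<in> E"
   using Suc.prems by (auto simp: ball_Suc nbh_def)
  show ?thesis
  proof (cases "b \<in> S")
   case True
   then have "(b, z) \<in> bd E S" using b Suc by (auto simp: bd_def)
   moreover have "z \<in> gball (Suc r) {z}" using subset_ball by auto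
   ultimately show ?thesis by (intro bexI[of _ "(b, z)"]) (auto intro!: exI[of _ "{}"])
  next
   case bS: False
   from Suc.IH[OF b(1) this]
   obtain a y where ay0: "(a, y) \<in> bd E S" "b \<in> gball r {y}"
    and ex: "\<exists>D. finite D \<and> D \<subseteq> E - tch S \<and> card D \<le> r \<and> b \<in> component D y" by auto
   from ex obtain D where D: "finite D" "D \<subseteq> E - tch S" "card D \<le> r" "b \<in> component D y" by auto
   note ay = ay0 D
   have "b \<in> component (insert {b, z} D) y"
    using ay component_mono[of D "insert {b, z} D" y] by auto
   then have "z \<in> component (insert {b, z} D) y" by (rule component_step) auto
   moreover have "{b, z} \<notin> tch S" using bS Suc.prems by (auto simp: tch_def)
   moreover have "z \<in> gball (Suc r) {y}" using ay(2) b(2) by (auto simp: ball_Suc nbh_def)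
   moreover have "card (insert {b, z} D) \<le> Suc r" using ay card_insert_le_m1[of "Suc r" D] by (simp add: card_insert_if)
   ultimately show ?thesis using ay b(2)
    by (intro bexI[of _ "(a, y)"]) (auto intro!: exI[of _ "insert {b, z} D"])
  qed
 qed
qed auto

text \<open>The radius is uniform because it is only needed at the finitely many orbit
  representatives and is then transported by automorphisms.\<close>

lemma ball_tau_large:
 assumes qt: "quasi_transitive V E"
  and inf: "\<And>v Q. v \<in> V \<Longrightarrow> \<exists>B. finite B \<and> B \<subseteq> V \<and> (Q::real) \<le> (\<Sum>u\<in>B. tau p v u)"
 shows "\<exists>r. \<forall>v\<in>V. Q \<le> (\<Sum>u\<in>gball r {v}. tau p v u)"
proof -
 obtain R where R: "finite R" "R \<subseteq> V" "R \<noteq> {}" "\<And>v. v \<in> V \<Longrightarrow> \<exists>r\<in>R. \<exists>f\<in>automorphisms V E. f r = v"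
  by (rule orbit_representatives[OF qt]) (rule that)
 have "\<exists>r. Q \<le> (\<Sum>u\<in>gball r {v}. tau p v u)" if v: "v \<in> V" for v
 proof -
  obtain B where B: "finite B" "B \<subseteq> V" "Q \<le> (\<Sum>u\<in>B. tau p v u)" using inf[OF v] by blast
  have "\<exists>r. B \<subseteq> gball r {v}"
   using B(1,2)
  proof (induction B)
   case (insert w B)
   then obtain r where r: "B \<subseteq> gball r {v}" by auto
   obtain r' where r': "w \<in> gball r' {v}" using insert V_eq_UN_ball[OF v] by auto
   show ?case
    using r r' ball_incr[of r "max r r'" "{v}"] ball_incr[of r' "max r r'" "{v}"]
    by (intro exI[of _ "max r r'"]) auto
  qed auto
  then obtain r where "B \<subseteq> gball r {v}" by auto
  then have "(\<Sum>u\<in>B. tau p v u) \<le> (\<Sum>u\<in>gball r {v}. tau p v u)"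
   using v tau_bounds by (intro sum_mono2 finite_ball) auto
  then show ?thesis using B by (intro exI[of _ r]) simp
 qed
 then obtain rr where rr: "\<And>v. v \<in> V \<Longrightarrow> Q \<le> (\<Sum>u\<in>gball (rr v) {v}. tau p v u)" by metis
 define r where "r = Max (rr ` R)"
 have rR: "Q \<le> (\<Sum>u\<in>gball r {v}. tau p v u)" if "v \<in> R" for v
 proof -
  have v: "v \<in> V" using that R by auto
  have "rr v \<le> r" unfolding r_def using R that by auto
  then have "(\<Sum>u\<in>gball (rr v) {v}. tau p v u) \<le> (\<Sum>u\<in>gball r {v}. tau p v u)"
   using v tau_bounds by (intro sum_mono2 finite_ball ball_incr) auto
  then show ?thesis using rr[OF v] by simp
 qed
 show ?thesis
 proof (intro exI[of _ r] ballI)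
  fix v assume "v \<in> V"
  then obtain ro f where ro: "ro \<in> R" "f \<in> automorphisms V E" "f ro = v" using R(4) by blast
  have oV: "ro \<in> V" using ro R by auto
  have inj: "inj_on f V" using ro by (auto simp: automorphisms_def bij_betw_def)
  have sub: "gball r {ro} \<subseteq> V" using oV by (intro ball_V) auto
  have "(\<Sum>u\<in>gball r {ro}. tau p ro u) = (\<Sum>u\<in>gball r {ro}. tau p v (f u))"
   using sub oV ro tau_automorphism[OF ro(2) oV] by (intro sum.cong) auto
  also have "... = (\<Sum>w\<in>f ` gball r {ro}. tau p v w)"
   using inj sub by (subst sum.reindex) (auto intro: inj_on_subset)
  also have "... \<le> (\<Sum>u\<in>gball r {v}. tau p v u)"
  proof (rule sum_mono2)
   show "f ` gball r {ro} \<subseteq> gball r {v}" using gball_automorphism[OF ro(2), of "{ro}" r] oV ro by simp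
  qed (use \<open>v \<in> V\<close> tau_bounds in \<open>auto intro!: finite_ball\<close>)
  finally show "Q \<le> (\<Sum>u\<in>gball r {v}. tau p v u)" using rR[OF ro(1)] by simp
 qed
qed

text \<open>Infinite susceptibility together with the square bound forces non-amenability. Summing
  \<open>tau\<close> over \<open>v\<close> in \<open>S\<close> and \<open>u\<close> in the ball
  around \<open>S\<close> gives at least \<open>Q * card S\<close>, while by Cauchy-Schwarz the
  square of this sum is at most \<open>Lam * card (gball r S) * card S\<close>.\<close>

lemma ball_growth:
 fixes Lam C :: real
 assumes qt: "quasi_transitive V E"
  and inf: "\<And>v Q. v \<in> V \<Longrightarrow> \<exists>B. finite B \<and> B \<subseteq> V \<and> (Q::real) \<le> (\<Sum>u\<in>B. tau p v u)"
  and Lam: "Lam > 0" "\<And>S A. S \<in> FS \<Longrightarrow> A \<in> FS \<Longrightarrow> (\<Sum>z\<in>A. (\<Sum>u\<in>S. tau p z u)\<^sup>2) \<le> Lam * card S"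
 shows "\<exists>r. \<forall>S\<in>FS. C * card S \<le> card (gball r S)"
proof -
 \<comment> \<open>Chosen so that the comparison of the two bounds leaves exactly the factor
   \<open>C\<close>; the maximum covers a negative \<open>C\<close>.\<close>
 define Q where "Q = sqrt (Lam * max C 0)"
 have Q2: "Q\<^sup>2 = Lam * max C 0" "0 \<le> Q" using Lam by (auto simp: Q_def)
 obtain r where r: "\<And>v. v \<in> V \<Longrightarrow> Q \<le> (\<Sum>u\<in>gball r {v}. tau p v u)"
  using ball_tau_large[OF qt inf, of Q] by blast
 show ?thesis
 proof (intro exI[of _ r] ballI)
  fix S assume S: "S \<in> FS"
  then have SV: "finite S" "S \<subseteq> V" by (auto simp: FS_def)
  have B: "gball r S \<in> FS" using SV finite_ball ball_V by (auto simp: FS_def)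
  have "real (card S) * Q = (\<Sum>v\<in>S. Q)" by simp
  also have "... \<le> (\<Sum>v\<in>S. \<Sum>u\<in>gball r S. tau p v u)"
  proof (rule sum_mono)
   fix v assume v: "v \<in> S"
   have "(\<Sum>u\<in>gball r {v}. tau p v u) \<le> (\<Sum>u\<in>gball r S. tau p v u)"
    using v B tau_bounds by (intro sum_mono2 ball_mono) (auto simp: FS_def)
   then show "Q \<le> (\<Sum>u\<in>gball r S. tau p v u)" using r[of v] v SV by auto
  qed
  finally have "(real (card S) * Q)\<^sup>2 \<le> (\<Sum>v\<in>S. \<Sum>u\<in>gball r S. tau p v u)\<^sup>2"
   using Q2 by (intro power_mono) auto
  also have "... \<le> (\<Sum>v\<in>S. (\<Sum>u\<in>gball r S. tau p v u)\<^sup>2) * card S"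
   by (rule sum_squared_le_sum_of_squares)
  also have "... \<le> Lam * card (gball r S) * card S"
   by (intro mult_right_mono Lam S B) auto
  finally have *: "real (card S) * real (card S) * (Lam * max C 0) \<le> Lam * card (gball r S) * card S"
   unfolding power_mult_distrib Q2 by (simp add: power2_eq_square)
  show "C * card S \<le> card (gball r S)"
  proof (cases "card S = 0")
   case False
   then have "0 < real (card S) * Lam" using Lam by simp
   moreover have "(real (card S) * Lam) * (max C 0 * card S) \<le> (real (card S) * Lam) * card (gball r S)"
    using * by (simp add: ac_simps)
   ultimately have "max C 0 * card S \<le> card (gball r S)" by (meson mult_le_cancel_left_pos)
   moreover have "C * card S \<le> max C 0 * card S" by (intro mult_right_mono) auto
   ultimately show ?thesis by linarith
  qed simp
 qed
qed

lemma card_gball_le: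
 assumes d: "\<And>v. v \<in> V \<Longrightarrow> card (tch {v}) \<le> d" and S: "S \<in> FS"
 shows "card (gball r S) \<le> (1 + d) ^ r * card S"
proof (induction r)
 case (Suc r)
 have B: "finite (gball r S)" "gball r S \<subseteq> V" using S finite_ball ball_V by (auto simp: FS_def)
 have "card (gball (Suc r) S) \<le> card (gball r S) + card (snd ` bd E (gball r S))"
  unfolding ball_Suc nbh_eq by (rule card_Un_le)
 also have "... \<le> card (gball r S) + card (bd E (gball r S))"
  using finite_bd[OF B] by (intro add_left_mono card_image_le)
 also have "... \<le> card (gball r S) + d * card (gball r S)"
  using card_bd_le[OF B] card_tch_le[OF d B] by linarith
 also have "... = (1 + d) * card (gball r S)" by simp
 also have "... \<le> (1 + d) * ((1 + d) ^ r * card S)" using Suc by (intro mult_left_mono) auto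
 finally show ?case by (simp add: ac_simps)
qed simp

text \<open>Off a finite set \<open>S\<close>, most vertices of a large neighbourhood of \<open>S\<close> keep their
 connection probabilities, because \<^term>\<open>\<lambda>z. \<Sum>u\<in>S. tau p z u\<close> is small outside a set of size
 \<open>O(card S)\<close>, while neighbourhoods of \<open>S\<close> are much larger than \<open>S\<close>.\<close>

lemma boundary_influence:
 fixes Lam plo p3 :: real
 assumes qt: "quasi_transitive V E"
  and inf: "\<And>v Q. v \<in> V \<Longrightarrow> \<exists>B. finite B \<and> B \<subseteq> V \<and> (Q::real) \<le> (\<Sum>u\<in>B. tau p3 v u)"
  and Lam: "Lam > 0" "\<And>S A. S \<in> FS \<Longrightarrow> A \<in> FS \<Longrightarrow> (\<Sum>z\<in>A. (\<Sum>u\<in>S. tau p3 z u)\<^sup>2) \<le> Lam * card S"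
  and plo: "0 < plo" "plo \<le> 1" "p3 \<le> 1"
 shows "\<exists>c>0::real. \<forall>p\<in>{plo..p3}. \<forall>x\<in>{0..1}. \<forall>S\<in>FS. \<forall>v\<in>V.
  c * real (card S) * M p x {} v \<le> (\<Sum>(a, y)\<in>bd E S. M p x S y)"
proof -
 obtain d where d: "\<And>v. v \<in> V \<Longrightarrow> card (tch {v}) \<le> d"
  using bounded_degree[OF qt] by blast
 obtain c0 where c0: "c0 > 0" "\<And>p x u v. p \<in> {plo..1} \<Longrightarrow> x \<in> {0..1} \<Longrightarrow> u \<in> V \<Longrightarrow> v \<in> V \<Longrightarrow> c0 * M p x {} v \<le> M p x {} u"
  using integral_comparable[OF qt plo(1,2)] by blast
 define c1 where "c1 = min c0 1"
 have c1: "0 < c1" "c1 \<le> 1" using c0 by (auto simp: c1_def)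
 have cmp: "c1 * M p x {} v \<le> M p x {} u" if "p \<in> {plo..1}" "x \<in> {0..1}" "u \<in> V" "v \<in> V" for p x u v
 proof -
  have "c1 * M p x {} v \<le> c0 * M p x {} v" using that M_bounds[of v x p "{}"] by (intro mult_right_mono) (auto simp: c1_def)
  then show ?thesis using c0(2)[OF that] by simp
 qed
 \<comment> \<open>At a good vertex the loss caused by \<open>S\<close> is at most
   \<open>\<eta> / c1\<close> times \<open>M p x {} v\<close>, that is half of the
   \<open>c1 * M p x {} v\<close> available by comparability.\<close>
 define \<eta> where "\<eta> = c1\<^sup>2 / 2"
 have eta: "0 < \<eta>" "\<eta> < 1" using c1 power_le_one[of c1 2] by (auto simp: \<eta>_def)
 \<comment> \<open>By Chebyshev at most \<open>Lam / \<eta>\<^sup>2 * card S\<close> vertices of the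
   ball are bad; the additional 1 leaves at least \<open>card S\<close> good ones.\<close>
 obtain r where r: "\<And>S. S \<in> FS \<Longrightarrow> (1 + Lam / \<eta>\<^sup>2) * card S \<le> card (gball r S)"
  using ball_growth[OF qt inf Lam, of "1 + Lam / \<eta>\<^sup>2"] by blast
 define Db where "Db = (1 + d) ^ r"
 have Db: "0 < Db" by (simp add: Db_def)
 show ?thesis
 proof (intro exI[of _ "plo ^ r * (c1 / 2) / Db"] conjI ballI)
  show "0 < plo ^ r * (c1 / 2) / Db" using plo c1 Db by simp
  fix p x S v assume p: "p \<in> {plo..p3}" and x: "x \<in> {0..1::real}" and S: "S \<in> FS" and v: "v \<in> V"
  have SV: "finite S" "S \<subseteq> V" using S by (auto simp: FS_def)
  have x': "0 \<le> x" "x \<le> 1" using x by auto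
  have p': "p \<in> {plo..1}" using p plo by auto
  define B where "B = gball r S"
  have B: "B \<in> FS" "finite B" "B \<subseteq> V" using SV finite_ball ball_V by (auto simp: FS_def B_def)
  define Y where "Y = {z \<in> B. (\<Sum>u\<in>S. tau p3 z u) \<le> \<eta>}"
  have "card (B - Y) * \<eta>\<^sup>2 = (\<Sum>z\<in>B - Y. \<eta>\<^sup>2)" by simp
  also have "... \<le> (\<Sum>z\<in>B - Y. (\<Sum>u\<in>S. tau p3 z u)\<^sup>2)"
   using eta by (intro sum_mono power_mono) (auto simp: Y_def)
  also have "... \<le> (\<Sum>z\<in>B. (\<Sum>u\<in>S. tau p3 z u)\<^sup>2)" using B by (intro sum_mono2) auto
  also have "... \<le> Lam * card S" by (rule Lam(2)[OF S B(1)])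
  finally have "real (card (B - Y)) \<le> Lam / \<eta>\<^sup>2 * card S" using eta by (simp add: field_simps)
  moreover have "card B = card Y + card (B - Y)"
  proof -
   have "card (Y \<union> (B - Y)) = card Y + card (B - Y)"
    using B(2) by (intro card_Un_disjoint) (auto simp: Y_def)
   moreover have "Y \<union> (B - Y) = B" by (auto simp: Y_def)
   ultimately show ?thesis by simp
  qed
  ultimately have cY: "real (card S) \<le> card Y" using r[OF S] by (simp add: B_def algebra_simps)
  have Y: "z \<in> V" "z \<notin> S" "z \<in> gball r S" "c1 / 2 * M p x {} v \<le> M p x S z" if "z \<in> Y" for z
  proof -
   show zV: "z \<in> V" and "z \<in> gball r S" using that B by (auto simp: Y_def B_def)
   show zS: "z \<notin> S"
   proof
    assume "z \<in> S"
    then have "tau p3 z z \<le> (\<Sum>u\<in>S. tau p3 z u)" using SV tau_bounds by (intro member_le_sum) auto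
    then show False using that eta by (auto simp: Y_def)
   qed
   have "(\<Sum>u\<in>S. tau p z u * M p x {} u) \<le> (\<Sum>u\<in>S. tau p3 z u * (M p x {} v / c1))"
   proof (rule sum_mono)
    fix u assume u: "u \<in> S"
    have "M p x {} u \<le> M p x {} v / c1" using cmp[OF p' x v, of u] u SV c1 by (auto simp: field_simps)
    then show "tau p z u * M p x {} u \<le> tau p3 z u * (M p x {} v / c1)"
     using p u SV M_bounds[OF _ x'] tau_bounds by (intro mult_mono tau_mono) auto
   qed
   also have "... = (\<Sum>u\<in>S. tau p3 z u) * (M p x {} v / c1)" by (rule sum_distrib_right[symmetric])
   also have "... \<le> \<eta> * (M p x {} v / c1)"
    using that M_bounds[OF v x'] c1 by (intro mult_right_mono) (auto simp: Y_def)
   also have "... = c1 / 2 * M p x {} v" using c1 by (simp add: \<eta>_def power2_eq_square)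
   finally show "c1 / 2 * M p x {} v \<le> M p x S z"
    using K_reattach_le[OF zV zS SV x', of p] cmp[OF p' x zV v] by simp
  qed
  \<comment> \<open>Every good vertex is charged to a boundary edge from which it is reached off
    \<open>S\<close> in at most \<open>r\<close> steps. Moving along these steps loses at most the
    factor \<open>plo ^ r\<close>, and an edge is charged at most \<open>Db\<close> times, since the
    vertices charging it lie in one ball of radius \<open>r\<close>.\<close>
  have "\<forall>z\<in>Y. \<exists>e\<in>bd E S. z \<in> gball r {snd e} \<and> (\<exists>D. finite D \<and> D \<subseteq> E - tch S \<and> card D \<le> r \<and> z \<in> component D (snd e))"
   using path_to_set[OF SV(2) Y(3) Y(2)] by (simp add: case_prod_beta)
  then obtain g where g: "\<And>z. z \<in> Y \<Longrightarrow> g z \<in> bd E S \<and> z \<in> gball r {snd (g z)} \<and> (\<exists>D. finite D \<and> D \<subseteq> E - tch S \<and> card D \<le> r \<and> z \<in> component D (snd (g z)))"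
   by metis
  have fY: "finite Y" using B by (auto simp: Y_def)
  have Mb: "0 \<le> M p x S (snd e)" if "e \<in> bd E S" for e
   using that bd_V[of "fst e" "snd e" S] M_bounds[OF _ x'] by auto
  have "plo ^ r * (c1 / 2) * card S * M p x {} v \<le> (\<Sum>z\<in>Y. plo ^ r * (c1 / 2 * M p x {} v))"
   using cY plo c1 M_bounds[OF v x', of p "{}"] by (simp add: mult_left_mono mult_right_mono ac_simps)
  also have "... \<le> (\<Sum>z\<in>Y. M p x S (snd (g z)))"
  proof (rule sum_mono)
   fix z assume z: "z \<in> Y"
   obtain D where D: "finite D" "D \<subseteq> E - tch S" "card D \<le> r" "z \<in> component D (snd (g z))" using g[OF z] by blast
   have gV: "snd (g z) \<in> V" using g[OF z] bd_V[of "fst (g z)" "snd (g z)" S] by auto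
   have "plo ^ r \<le> plo ^ card D" using plo D by (intro power_decreasing) auto
   also have "... \<le> p ^ card D" using plo p by (intro power_mono) auto
   finally have "plo ^ r * (c1 / 2 * M p x {} v) \<le> p ^ card D * M p x S z"
    using Y(4)[OF z] M_bounds[OF v x', of p "{}"] c1 plo p by (intro mult_mono) auto
   also have "... \<le> M p x S (snd (g z))"
    using D p plo gV Y(1)[OF z] x' by (intro M_finite_energy component_sym[OF D(4)]) auto
   finally show "plo ^ r * (c1 / 2 * M p x {} v) \<le> M p x S (snd (g z))" .
  qed
  also have "... = (\<Sum>e\<in>bd E S. real (card {z \<in> Y. g z = e}) * M p x S (snd e))"
   using g finite_bd[OF SV] by (intro sum_fun_comp[OF fY]) auto
  also have "... \<le> (\<Sum>e\<in>bd E S. real Db * M p x S (snd e))"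
  proof (rule sum_mono)
   fix e assume e: "e \<in> bd E S"
   have eV: "snd e \<in> V" using e bd_V[of "fst e" "snd e" S] by auto
   have "card {z \<in> Y. g z = e} \<le> card (gball r {snd e})"
    using g eV by (intro card_mono finite_ball) auto
   also have "... \<le> Db" using card_gball_le[OF d, of "{snd e}" r] eV by (simp add: Db_def FS_def)
   finally show "real (card {z \<in> Y. g z = e}) * M p x S (snd e) \<le> real Db * M p x S (snd e)"
    using Mb[OF e] by (intro mult_right_mono) auto
  qed
  also have "... = Db * (\<Sum>(a, y)\<in>bd E S. M p x S y)" by (simp add: sum_distrib_left case_prod_beta)
  finally show "plo ^ r * (c1 / 2) / Db * real (card S) * M p x {} v \<le> (\<Sum>(a, y)\<in>bd E S. M p x S y)"
   using Db by (simp add: field_simps)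
 qed
qed

end

section \<open>Sprinkling\<close>

lemma ennreal_le_plusI: "a \<le> b + c \<Longrightarrow> 0 \<le> b \<Longrightarrow> 0 \<le> c \<Longrightarrow> ennreal a \<le> ennreal b + ennreal c"
 using ennreal_leI ennreal_plus by metis

locale bperc = perc +
 fixes d :: nat
 assumes degree: "\<And>v. v \<in> V \<Longrightarrow> card (tch {v}) \<le> d" and d_pos: "1 \<le> d"
begin

lemma card_tch: "S \<in> FS \<Longrightarrow> card (tch S) \<le> d * card S"
 by (rule card_tch_le[OF degree]) (auto simp: FS_def)

lemma card_bd: "S \<in> FS \<Longrightarrow> card (bd E S) \<le> d * card S"
 using card_tch[of S] card_bd_le[of S] by (auto simp: FS_def)

definition ins :: "'a set \<Rightarrow> 'a set set" where
 "ins S = {e \<in> E. e \<subseteq> S}"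

abbreviation edge :: "'a \<times> 'a \<Rightarrow> 'a set" where
 "edge e \<equiv> {fst e, snd e}"

definition conn_in :: "real \<Rightarrow> 'a \<Rightarrow> 'a set \<Rightarrow> ('a set \<Rightarrow> real) \<Rightarrow> bool" where
 "conn_in p v S U \<longleftrightarrow> component {e \<in> opn E p U. e \<subseteq> S} v = S"

lemma inj_edge: "inj_on edge (bd E S)"
 by (auto simp: inj_on_def bd_def doubleton_eq_iff)

lemma edge_bd: "e \<in> bd E S \<Longrightarrow> edge e \<in> E \<and> edge e \<in> tch S \<and> edge e \<notin> ins S \<and> fst e \<in> S \<and> snd e \<in> V \<and> snd e \<notin> S"
 using bd_V[of "fst e" "snd e" S] by (auto simp: tch_def ins_def)

lemma K_eq_iff:
 assumes "v \<in> S"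
 shows "clu p U v = S \<longleftrightarrow> conn_in p v S U \<and> (\<forall>e\<in>bd E S. U (edge e) \<in> {p<..})"
proof -
 have "bd (opn E p U) S = {} \<longleftrightarrow> (\<forall>e\<in>bd E S. U (edge e) \<in> {p<..})"
  by (force simp: bd_def opn_def)
 then show ?thesis
  using component_eq_iff[OF assms, of "opn E p U"] edge_doubleton opn_subset[of E p U]
  by (auto simp: conn_in_def)
qed

lemma depends_on_conn_in: "depends_on (ins S) (conn_in p v S)"
proof -
 have "conn_in p v S = (\<lambda>U. component {e \<in> opn E p U. e \<in> ins S \<and> True} v = S)"
 proof
  fix U
  have "{e \<in> opn E p U. e \<subseteq> S} = {e \<in> opn E p U. e \<in> ins S \<and> True}" by (auto simp: ins_def opn_def)
  then show "conn_in p v S U \<longleftrightarrow> component {e \<in> opn E p U. e \<in> ins S \<and> True} v = S" by (simp add: conn_in_def)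
 qed
 then show ?thesis
  using depends_on_comp[OF depends_on_opn_set[OF order_refl, of "ins S" p "\<lambda>_. True"], of "\<lambda>F. component F v = S"]
  by simp
qed

lemma pred_conn_in [measurable]: "v \<in> V \<Longrightarrow> Measurable.pred PU (conn_in p v S)"
 unfolding conn_in_def[abs_def] by (rule pred_component_eq[OF meas_eset_filter[OF meas_eset_opn]])

lemma pred_bd_in:
 assumes "S \<in> FS" "\<And>e. e \<in> bd E S \<Longrightarrow> B e \<in> sets borel"
 shows "Measurable.pred PU (\<lambda>U. \<forall>e\<in>bd E S. U (edge e) \<in> B e)"
proof (rule pred_countable_all)
 show "countable (bd E S)" using assms finite_bd[of S] by (auto simp: FS_def countable_finite)
 fix e assume e: "e \<in> bd E S"
 then have [measurable]: "B e \<in> sets borel" "(\<lambda>U. U (edge e)) \<in> borel_measurable PU"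
  using assms measurable_coord edge_bd[OF e] by auto
 show "Measurable.pred PU (\<lambda>U. U (edge e) \<in> B e)" by measurable
qed

lemma depends_on_bd_in: "depends_on (tch S - ins S) (\<lambda>U. \<forall>e\<in>bd E S. U (edge e) \<in> B e)"
proof (rule depends_onI)
 fix U U' assume UU: "\<And>e. e \<in> tch S - ins S \<Longrightarrow> (U e :: real) = U' e"
 have "U (edge e) = U' (edge e)" if "e \<in> bd E S" for e
  using edge_bd[OF that] by (intro UU) auto
 then show "(\<forall>e\<in>bd E S. U (edge e) \<in> B e) \<longleftrightarrow> (\<forall>e\<in>bd E S. U' (edge e) \<in> B e)" by auto
qed

lemma prob_conn_bd:
 assumes v: "v \<in> V" and S: "S \<in> FS" and B: "\<And>e. e \<in> bd E S \<Longrightarrow> B e \<in> sets borel"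
 shows "\<P>(U in PU. conn_in p v S U \<and> (\<forall>e\<in>bd E S. U (edge e) \<in> B e)) =
  \<P>(U in PU. conn_in p v S U) * (\<Prod>e\<in>bd E S. measure unif (B e))"
proof -
 have f: "finite (bd E S)" using S finite_bd by (auto simp: FS_def)
 have "\<P>(U in PU. conn_in p v S U \<and> (\<forall>e\<in>bd E S. U (edge e) \<in> B e)) =
  \<P>(U in PU. conn_in p v S U) * \<P>(U in PU. \<forall>e\<in>bd E S. U (edge e) \<in> B e)"
  by (rule indep_prob[OF pred_conn_in[OF v] depends_on_conn_in _ pred_bd_in[OF S B] depends_on_bd_in])
    (auto simp: ins_def tch_def)
 \<comment> \<open>The product formula is indexed by edges, so boundary pairs are renamed through
   the injective map \<open>edge\<close>.\<close>
 also have "{U \<in> space PU. \<forall>e\<in>bd E S. U (edge e) \<in> B e} =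
   {U \<in> space PU. \<forall>e\<in>edge ` bd E S. U e \<in> B (the_inv_into (bd E S) edge e)}"
  using the_inv_into_f_f[OF inj_edge] by auto
 also have "measure PU ... = (\<Prod>e\<in>edge ` bd E S. measure unif (B (the_inv_into (bd E S) edge e)))"
  using f edge_bd B the_inv_into_f_f[OF inj_edge] by (intro prob_coords) auto
 also have "... = (\<Prod>e\<in>bd E S. measure unif (B e))"
  using the_inv_into_f_f[OF inj_edge, of _ S] by (subst prod.reindex[OF inj_edge]) (auto intro!: prod.cong)
 finally show ?thesis .
qed

lemma prob_K_eq:
 assumes v: "v \<in> V" "v \<in> S" and S: "S \<in> FS" and p: "0 \<le> p" "p \<le> 1"
 shows "\<P>(U in PU. clu p U v = S) =
  \<P>(U in PU. conn_in p v S U) * (1 - p) ^ card (bd E S)"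
 unfolding K_eq_iff[OF v(2)] using prob_conn_bd[OF v(1) S, of "\<lambda>_. {p<..}" p] measure_unif_gt[OF p] by simp

text \<open>Given the cluster at level \<open>p\<close>, the labels of its boundary edges are
  independent and uniform on \<open>(p, 1]\<close>, so each lies below \<open>q\<close> with
  probability \<open>(q - p) / (1 - p)\<close>.\<close>

lemma prob_sprinkle:
 assumes v: "v \<in> V" and S: "S \<in> FS" and p: "0 \<le> p" "p \<le> q" "q \<le> 1" "p < 1" and J: "J \<subseteq> bd E S"
 shows "\<P>(U in PU. clu p U v = S \<and> (\<forall>e\<in>J. U (edge e) \<le> q)) =
  \<P>(U in PU. clu p U v = S) * ((q - p) / (1 - p)) ^ card J"
proof (cases "v \<in> S")
 case False
 then have *: "clu p U v \<noteq> S" for U by auto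
 show ?thesis by (simp add: *)
next
 case True
 have f: "finite (bd E S)" using S finite_bd by (auto simp: FS_def)
 have fJ: "finite J" using f J by (rule rev_finite_subset)
 let ?B = "\<lambda>e. if e \<in> J then {p<..q} else {p<..}"
 have eq: "clu p U v = S \<and> (\<forall>e\<in>J. U (edge e) \<le> q) \<longleftrightarrow> conn_in p v S U \<and> (\<forall>e\<in>bd E S. U (edge e) \<in> ?B e)" for U
  unfolding K_eq_iff[OF True] using J by auto
 have "(\<Prod>e\<in>bd E S. measure unif (?B e)) = (\<Prod>e\<in>bd E S. if e \<in> J then q - p else 1 - p)"
  using p by (intro prod.cong) (auto simp: measure_unif_gt measure_unif_ioc)
 also have "... = (q - p) ^ card J * (1 - p) ^ card (bd E S - J)"
  using J f by (simp add: prod.If_cases Int_absorb1 Diff_eq)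
 also have "... = (1 - p) ^ card (bd E S) * ((q - p) / (1 - p)) ^ card J"
 proof -
  have "card (bd E S) = card J + card (bd E S - J)"
   using J f card_mono[OF f J] by (simp add: card_Diff_subset fJ)
  then show ?thesis using p by (simp add: power_add power_divide)
 qed
 finally show ?thesis
  unfolding eq using prob_conn_bd[OF v S, of ?B p] prob_K_eq[OF v True S] p by simp
qed

lemma pred_edge_le: "e \<in> bd E S \<Longrightarrow> Measurable.pred PU (\<lambda>U. U (edge e) \<le> q)"
 using measurable_coord[of "edge e"] edge_bd[of e S] by simp

lemma depends_on_edge_le: "e \<in> bd E S \<Longrightarrow> depends_on (tch S) (\<lambda>U. U (edge e) \<le> q)"
 using edge_bd[of e S] by (intro depends_onI) auto

lemma nn_sprinkle:
 assumes v: "v \<in> V" and S: "S \<in> FS" and p: "0 \<le> p" "p \<le> q" "q \<le> 1" "p < 1" and e: "e \<in> bd E S"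
  and g: "g \<in> borel_measurable PU" "depends_on (E - tch S) g"
 shows "(\<E> U. (if clu p U v = S \<and> U (edge e) \<le> q then g U else 0)) =
  ennreal (\<P>(U in PU. clu p U v = S) * ((q - p) / (1 - p))) * (\<E> U. g U)"
 using nn_markov[OF v pred_edge_le[OF e] depends_on_edge_le[OF e] g, of p "{}"]
  prob_sprinkle[OF v S p, of "{e}"] e by simp

text \<open>For \<open>x = exp (- h)\<close> with \<open>h > 0\<close> this is the derivative of
  \<open>M\<close> in \<open>h\<close>.\<close>

definition X :: "real \<Rightarrow> real \<Rightarrow> 'a \<Rightarrow> ennreal" where
 "X p x v = (\<E> U. (if finite (K p U {} v) then ennreal (real (card (K p U {} v)) * x ^ card (K p U {} v)) else 0))"

lemma nn_K_sum:
 assumes "v \<in> V"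
 shows "(\<E> U. (if finite (clu p U v) then h (clu p U v) else 0)) =
  (\<integral>\<^sup>+S. ennreal (\<P>(U in PU. clu p U v = S)) * h S \<partial>count_space FS)"
proof -
 have "(\<E> U. (if finite (clu p U v) then h (clu p U v) else 0)) =
  (\<integral>\<^sup>+S. (\<E> U. (if clu p U v = S then h S else 0)) \<partial>count_space FS)"
  by (rule nn_decompose[OF meas_eset_opn assms, where h="\<lambda>S _. h S"]) simp
 also have "... = (\<integral>\<^sup>+S. ennreal (\<P>(U in PU. clu p U v = S)) * h S \<partial>count_space FS)"
 proof (rule nn_integral_cong)
  fix S
  have [measurable]: "Measurable.pred PU (\<lambda>U. clu p U v = S)"
   using pred_K_eq[OF assms, of p "{}" S] by simp
  have "(\<E> U. (if clu p U v = S then h S else 0)) =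
    (\<E> U. (if clu p U v = S then 1 else 0) * h S)"
   by (rule nn_integral_cong) auto
  also have "... = (\<E> U. (if clu p U v = S then 1 else 0)) * h S"
   by (rule nn_integral_multc) measurable
  finally show "(\<E> U. (if clu p U v = S then h S else 0)) =
    ennreal (\<P>(U in PU. clu p U v = S)) * h S"
   by (subst (asm) nn_indicator_pred) auto
 qed
 finally show ?thesis .
qed

text \<open>One step of \<open>\<partial>\<^sub>p M \<le> C M \<partial>\<^sub>h M\<close>. The new
  cluster is covered by the old one \<open>S\<close> and by the clusters off \<open>S\<close> behind
  boundary edges that open between the two levels. There are at most \<open>d * card S\<close>
  candidates, each opens with probability \<open>(q - p) / (1 - p)\<close> and then contributes at
  most \<open>m\<close>; the weight \<open>x ^ card S\<close> turns the sum over \<open>S\<close>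
  into \<open>X\<close>.\<close>

lemma sprinkle_upper:
 assumes v: "v \<in> V" and p: "0 \<le> p" "p \<le> q" "q \<le> 1" "p < 1" and x: "0 \<le> x" "x \<le> 1"
  and m: "\<And>y. y \<in> V \<Longrightarrow> M q x {} y \<le> m"
 shows "ennreal (M q x {} v) \<le> ennreal (M p x {} v) + ennreal ((q - p) / (1 - p) * d * m) * X p x v"
proof -
 define D where "D = (q - p) / (1 - p)"
 have D: "0 \<le> D" using p by (simp add: D_def)
 let ?K = "\<lambda>U. clu p U v"
 let ?h = "\<lambda>S U. \<Sum>e\<in>bd E S. if U (edge e) \<le> q then ennreal (x ^ card S * phi x (K q U S (snd e))) else 0"
 have m0: "0 \<le> m" using m[OF v] M_bounds(1)[OF v x, of q "{}"] by simp
 have mh1: "(\<lambda>U. if U (edge e) \<le> q then ennreal (x ^ card S * phi x (K q U S (snd e))) else 0) \<in> borel_measurable PU"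
  if "e \<in> bd E S" for e S
 proof -
  note [measurable] = pred_edge_le[OF that]
  have "snd e \<in> V" using edge_bd[OF that] by auto
  then show ?thesis by measurable
 qed
 have mh: "?h S \<in> borel_measurable PU" for S
  by (rule borel_measurable_sum) (rule mh1)
 have pt: "ennreal (phi x (clu q U v)) \<le> ennreal (phi x (?K U)) + (if finite (?K U) then ?h (?K U) U else 0)" for U
 proof (cases "finite (?K U)")
  case False
  then have "infinite (clu q U v)"
   using component_mono[OF opn_mono[OF p(2)], of E U v] finite_subset by blast
  then show ?thesis using False by (simp add: phi_def xp_def)
 next
  case True
  let ?S = "?K U"
  let ?J = "{e \<in> bd E ?S. U (edge e) \<le> q}"
  have SF: "?S \<in> FS" using True component_subset_V[OF opn_subset v] by (auto simp: FS_def)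
  then have fJ: "finite ?J" using finite_bd[of ?S] by (auto simp: FS_def)
  have "clu q U v \<subseteq> ?S \<union> (\<Union>e\<in>?J. K q U ?S (snd e))"
  proof
   fix w assume "w \<in> clu q U v"
   from component_exit[OF this, of ?S]
   consider "w \<in> ?S" | a y where "(a, y) \<in> bd (opn E q U) ?S" "w \<in> K q U ?S y" by auto
   then show "w \<in> ?S \<union> (\<Union>e\<in>?J. K q U ?S (snd e))"
   proof cases
    case 2
    then have "(a, y) \<in> ?J" by (auto simp: bd_def opn_def)
    then show ?thesis using 2(2) by force
   qed auto
  qed
  then have "phi x (clu q U v) \<le> phi x (?S \<union> (\<Union>e\<in>?J. K q U ?S (snd e)))"
   by (rule phi_mono[OF x])
  also have "... \<le> phi x ?S + xp x ?S * phi x (\<Union>e\<in>?J. K q U ?S (snd e))" by (rule phi_Un[OF x])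
  also have "... \<le> phi x ?S + x ^ card ?S * (\<Sum>e\<in>?J. phi x (K q U ?S (snd e)))"
   using True x fJ by (intro add_left_mono mult_mono phi_UN) (auto simp: xp_def phi_bounds)
  also have "x ^ card ?S * (\<Sum>e\<in>?J. phi x (K q U ?S (snd e))) = (\<Sum>e\<in>?J. x ^ card ?S * phi x (K q U ?S (snd e)))"
   by (rule sum_distrib_left)
  finally have "ennreal (phi x (clu q U v)) \<le>
    ennreal (phi x ?S) + ennreal (\<Sum>e\<in>?J. x ^ card ?S * phi x (K q U ?S (snd e)))"
   by (rule ennreal_le_plusI) (use x in \<open>auto simp: phi_bounds intro!: sum_nonneg\<close>)
  also have "ennreal (\<Sum>e\<in>?J. x ^ card ?S * phi x (K q U ?S (snd e))) =
    (\<Sum>e\<in>?J. ennreal (x ^ card ?S * phi x (K q U ?S (snd e))))"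
   by (rule sum_ennreal[symmetric]) (use x in \<open>auto simp: phi_bounds\<close>)
  also have "... = ?h ?S U"
   using finite_bd[of ?S] SF by (intro sum.inter_filter) (auto simp: FS_def)
  finally show ?thesis using True by simp
 qed
 have intS: "(\<E> U. (if ?K U = S then ?h S U else 0)) \<le>
   ennreal (\<P>(U in PU. ?K U = S)) * (ennreal (D * d * m) * ennreal (real (card S) * x ^ card S))"
  if S: "S \<in> FS" for S
 proof -
  let ?P = "\<P>(U in PU. ?K U = S)"
  note [measurable] = pred_K_eq[OF v, of p "{}" S, simplified]
  have "(\<E> U. (if ?K U = S then ?h S U else 0)) =
    (\<E> U. (\<Sum>e\<in>bd E S. if ?K U = S \<and> U (edge e) \<le> q then ennreal (x ^ card S * phi x (K q U S (snd e))) else 0))"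
   by (rule nn_integral_cong) (auto intro!: sum.cong)
  also have "... = (\<Sum>e\<in>bd E S. \<E> U. (if ?K U = S \<and> U (edge e) \<le> q then ennreal (x ^ card S * phi x (K q U S (snd e))) else 0))"
  proof (rule nn_integral_sum)
   fix e assume e: "e \<in> bd E S"
   note [measurable] = pred_edge_le[OF e]
   have "snd e \<in> V" using edge_bd[OF e] by auto
   then show "(\<lambda>U. if ?K U = S \<and> U (edge e) \<le> q then ennreal (x ^ card S * phi x (K q U S (snd e))) else 0) \<in> borel_measurable PU"
    by measurable
  qed
  also have "... \<le> (\<Sum>e\<in>bd E S. ennreal (?P * D * (x ^ card S * m)))"
  proof (rule sum_mono)
   fix e assume e: "e \<in> bd E S"
   then have eV: "snd e \<in> V" using edge_bd[OF e] by auto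
   have "(\<E> U. (if ?K U = S \<and> U (edge e) \<le> q then ennreal (x ^ card S * phi x (K q U S (snd e))) else 0)) =
     ennreal (?P * D) * (\<E> U. ennreal (x ^ card S * phi x (K q U S (snd e))))"
    unfolding D_def using eV by (intro nn_sprinkle[OF v S p e] depends_on_comp[OF depends_on_K, where h="\<lambda>C. ennreal (x ^ card S * phi x C)"]) measurable
   also have "(\<E> U. ennreal (x ^ card S * phi x (K q U S (snd e)))) = ennreal (x ^ card S * M q x S (snd e))"
    using x eV M_bounds[OF eV x] nn_M[OF eV x, of q S]
    by (simp add: ennreal_mult phi_bounds nn_integral_cmult)
   also have "ennreal (x ^ card S * M q x S (snd e)) \<le> ennreal (x ^ card S * m)"
    using x eV m[OF eV] M_mono_gen[OF eV x(1) order_refl x(2) order_refl, of "{}" S q] by (intro ennreal_leI mult_left_mono) auto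
   finally show "(\<E> U. (if ?K U = S \<and> U (edge e) \<le> q then ennreal (x ^ card S * phi x (K q U S (snd e))) else 0))
     \<le> ennreal (?P * D * (x ^ card S * m))"
    using D m0 x by (subst ennreal_mult) (auto simp: mult_left_mono)
  qed
  also have "... = ennreal (real (card (bd E S)) * (?P * D * (x ^ card S * m)))"
   using D m0 x by (simp add: ennreal_mult ennreal_of_nat_eq_real_of_nat)
  also have "... \<le> ennreal (real (d * card S) * (?P * D * (x ^ card S * m)))"
   using D m0 x of_nat_mono[OF card_bd[OF S], where 'a=real] by (intro ennreal_leI mult_right_mono) auto
  also have "... = ennreal ?P * (ennreal (D * d * m) * ennreal (real (card S) * x ^ card S))"
   using D m0 x by (simp add: ac_simps flip: ennreal_mult)
  finally show ?thesis .
 qed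
 have "ennreal (M q x {} v) = (\<E> U. ennreal (phi x (clu q U v)))"
  using nn_M[OF v x, of q "{}"] by simp
 also have "... \<le> (\<E> U. ennreal (phi x (?K U)) + (if finite (?K U) then ?h (?K U) U else 0))"
  by (rule nn_integral_mono) (rule pt)
 also have "... = (\<E> U. ennreal (phi x (?K U))) + (\<E> U. (if finite (?K U) then ?h (?K U) U else 0))"
  using measurable_phi_K[OF v, of x p "{}"]
  by (intro nn_integral_add measurable_component_dep[OF meas_eset_opn v mh]) auto
 also have "(\<E> U. ennreal (phi x (?K U))) = ennreal (M p x {} v)"
  using nn_M[OF v x, of p "{}"] by simp
 also have "(\<E> U. (if finite (?K U) then ?h (?K U) U else 0)) =
   (\<integral>\<^sup>+S. (\<E> U. (if ?K U = S then ?h S U else 0)) \<partial>count_space FS)"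
  by (rule nn_decompose[OF meas_eset_opn v mh])
 also have "... \<le> (\<integral>\<^sup>+S. ennreal (D * d * m) * (ennreal (\<P>(U in PU. ?K U = S)) * ennreal (real (card S) * x ^ card S)) \<partial>count_space FS)"
  using intS by (intro nn_integral_mono) (simp add: ac_simps)
 also have "... = ennreal (D * d * m) * X p x v"
  unfolding X_def del_empty nn_K_sum[OF v, of p "\<lambda>S. ennreal (real (card S) * x ^ card S)"]
  by (rule nn_integral_cmult) simp
 finally show ?thesis unfolding D_def by (simp add: add_left_mono)
qed

end

section \<open>The lower bound for one sprinkling step\<close>

lemma xp_disjoint_Un:
 "finite S \<Longrightarrow> S \<inter> A = {} \<Longrightarrow> xp x (S \<union> A) = x ^ card S * xp x A"
 by (auto simp: xp_def card_Un_disjoint power_add)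

lemma exp_one_minus_le: "exp (a::real) * (1 - a) \<le> 1"
proof -
 have "1 - a \<le> exp (- a)" using exp_ge_add_one_self[of "- a"] by simp
 then have "exp a * (1 - a) \<le> exp a * exp (- a)" by (intro mult_left_mono) auto
 then show ?thesis by (simp add: exp_minus)
qed

lemma sum_pairs_card:
 assumes "finite I" "J \<subseteq> I"
 shows "(\<Sum>e\<in>I. \<Sum>f\<in>I - {e}. if e \<in> J \<and> f \<in> J then c else (0::real)) = real (card J) * (real (card J) - 1) * c"
proof -
 have fJ: "finite J" using assms by (rule rev_finite_subset)
 have "(\<Sum>f\<in>I - {e}. if e \<in> J \<and> f \<in> J then c else 0) = (if e \<in> J then (real (card J) - 1) * c else 0)" for e
 proof (cases "e \<in> J")
  case True
  have "(\<Sum>f\<in>I - {e}. if e \<in> J \<and> f \<in> J then c else 0) = (\<Sum>f\<in>I - {e}. if f \<in> J then c else 0)" using True by simp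
  also have "... = (\<Sum>f\<in>{f \<in> I - {e}. f \<in> J}. c)" using assms(1) by (subst sum.inter_filter) auto
  also have "{f \<in> I - {e}. f \<in> J} = J - {e}" using assms by auto
  finally show ?thesis using True fJ card_gt_0_iff[of J] by (auto simp: of_nat_diff Suc_leI)
 qed auto
 then have "(\<Sum>e\<in>I. \<Sum>f\<in>I - {e}. if e \<in> J \<and> f \<in> J then c else (0::real)) = (\<Sum>e\<in>I. if e \<in> J then (real (card J) - 1) * c else 0)"
  by simp
 also have "... = (\<Sum>e\<in>{e \<in> I. e \<in> J}. (real (card J) - 1) * c)" using assms(1) by (subst sum.inter_filter) auto
 also have "{e \<in> I. e \<in> J} = J" using assms by auto
 finally show ?thesis by simp
qed

context bperc
begin

text \<open>A Bonferroni inequality for the edges opened between the levels: each opened edge lowers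
  \<open>xp\<close> by \<open>y ^ card S * phi\<close>, and the ordered pairs of opened edges bound
  the overcounting. Behind these edges the clusters are taken at the old level \<open>p\<close>.
  This only makes them smaller, and it matches the influence bound, which is stated at level
  \<open>p\<close>.\<close>

lemma sprinkle_pointwise:
 assumes y: "0 \<le> y" "y \<le> 1" and v: "v \<in> V" and p: "p \<le> q" and K: "clu p U v = S" and S: "S \<in> FS"
 shows "xp y (clu q U v) + (\<Sum>e\<in>bd E S. if U (edge e) \<le> q then y ^ card S * phi y (K p U S (snd e)) else 0)
   \<le> y ^ card S + (\<Sum>e\<in>bd E S. \<Sum>f\<in>bd E S - {e}. if U (edge e) \<le> q \<and> U (edge f) \<le> q then y ^ card S else 0)"
proof -
 define J where "J = {e \<in> bd E S. U (edge e) \<le> q}"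
 have f: "finite (bd E S)" using S finite_bd by (auto simp: FS_def)
 have J: "J \<subseteq> bd E S" "finite J" using f by (auto simp: J_def)
 let ?R = "\<lambda>e. K p U S (snd e)"
 have "S \<union> (\<Union>e\<in>J. ?R e) \<subseteq> clu q U v"
 proof -
  have "S \<subseteq> clu q U v" using component_mono[OF opn_mono[OF p], of E U v] K by auto
  moreover have "?R e \<subseteq> clu q U v" if "e \<in> J" for e
  proof -
   have "component (del (opn E q U) S) (snd e) \<subseteq> clu q U v"
   proof (rule component_enter)
    show "(fst e, snd e) \<in> bd (opn E q U) S" using that by (auto simp: J_def bd_def opn_def)
    show "fst e \<in> clu q U v"
     using that J edge_bd[of e S] \<open>S \<subseteq> clu q U v\<close> by auto
   qed
   then show ?thesis using component_mono[OF del_mono[OF opn_mono[OF p]], of E U S "snd e"] by blast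
  qed
  ultimately show ?thesis by auto
 qed
 then have "xp y (clu q U v) \<le> xp y (S \<union> (\<Union>e\<in>J. ?R e))" by (rule xp_antimono[OF y])
 also have "... = y ^ card S * xp y (\<Union>e\<in>J. ?R e)"
 proof (rule xp_disjoint_Un)
  have "?R e \<inter> S = {}" if "e \<in> J" for e
   using that J edge_bd[of e S] by (intro component_del_disjoint) auto
  then show "S \<inter> (\<Union>e\<in>J. ?R e) = {}" by blast
 qed (use S in \<open>auto simp: FS_def\<close>)
 finally have 1: "xp y (clu q U v) \<le> y ^ card S * xp y (\<Union>e\<in>J. ?R e)" .
 \<comment> \<open>With at most one opened edge this is an equality. With two or more, the sum of
   \<open>phi\<close> is at most \<open>card J\<close>, which is at most
   \<open>card J * (card J - 1)\<close>.\<close>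
 have 2: "xp y (\<Union>e\<in>J. ?R e) + (\<Sum>e\<in>J. phi y (?R e)) \<le> 1 + real (card J) * (real (card J) - 1)"
 proof (cases "card J \<le> 1")
  case True
  then consider "J = {}" | e where "J = {e}" using J(2) card_1_singletonE[of J] by (cases "card J") auto
  then show ?thesis by cases (auto simp: xp_def phi_def)
 next
  case False
  have "(\<Sum>e\<in>J. phi y (?R e)) \<le> (\<Sum>e\<in>J. 1)" by (intro sum_mono) (simp add: phi_bounds[OF y])
  also have "... = real (card J) * 1" by simp
  also have "... \<le> real (card J) * (real (card J) - 1)" using False by (intro mult_left_mono) auto
  finally show ?thesis using xp_bounds[OF y, of "\<Union>e\<in>J. ?R e"] by linarith
 qed
 have 3: "(\<Sum>e\<in>bd E S. if U (edge e) \<le> q then y ^ card S * phi y (?R e) else 0) = y ^ card S * (\<Sum>e\<in>J. phi y (?R e))"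
  unfolding J_def sum_distrib_left using f by (subst sum.inter_filter) auto
 have 4: "(\<Sum>e\<in>bd E S. \<Sum>g\<in>bd E S - {e}. if U (edge e) \<le> q \<and> U (edge g) \<le> q then y ^ card S else 0)
   = real (card J) * (real (card J) - 1) * y ^ card S"
  unfolding sum_pairs_card[OF f J(1), symmetric] by (intro sum.cong) (auto simp: J_def)
 have "y ^ card S * (xp y (\<Union>e\<in>J. ?R e) + (\<Sum>e\<in>J. phi y (?R e))) \<le> y ^ card S * (1 + real (card J) * (real (card J) - 1))"
  using 2 y by (intro mult_left_mono) auto
 then show ?thesis unfolding 3 4 using 1 by (simp add: algebra_simps)
qed

text \<open>Take expectations on \<open>clu p U v = S\<close>. Single opened edges remove at least
  the fraction \<open>\<mu> * (q - p) * card S\<close> of \<open>y ^ card S\<close>, and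
  \<open>1 - a \<le> exp (- a)\<close> absorbs this into the change from \<open>y\<close> to
  \<open>x\<close>. Pairs of opened edges cost an error quadratic in \<open>q - p\<close>, which
  \<open>B\<close> makes uniform in \<open>S\<close>.\<close>

lemma sprinkle_lower_S:
 assumes v: "v \<in> V" and p: "0 \<le> p" "p \<le> q" "q \<le> 1" "p < 1" and x: "0 \<le> x" "x \<le> y" "y \<le> 1"
  and mu: "0 \<le> \<mu>" "\<mu> * real (card S) \<le> (\<Sum>e\<in>bd E S. M p y S (snd e))"
  and xy: "y \<le> x * exp (\<mu> * (q - p))"
  and B: "(real (card S))\<^sup>2 * y ^ card S \<le> B" and S: "S \<in> FS"
 shows "(\<E> U. (if clu p U v = S then ennreal (xp y (clu q U v)) else 0)) \<le>
   ennreal (\<P>(U in PU. clu p U v = S) * (x ^ card S + ((q - p) / (1 - p))\<^sup>2 * (real d)\<^sup>2 * B))"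
proof -
 define D where "D = (q - p) / (1 - p)"
 have D: "0 \<le> D" using p by (simp add: D_def)
 define P where "P = \<P>(U in PU. clu p U v = S)"
 have P: "0 \<le> P" by (simp add: P_def)
 let ?K = "\<lambda>U. clu p U v"
 let ?s = "card S"
 let ?dd = "\<lambda>U. \<Sum>e\<in>bd E S. \<Sum>f\<in>bd E S - {e}. if U (edge e) \<le> q \<and> U (edge f) \<le> q then y ^ ?s else 0"
 let ?PD = "\<Sum>e\<in>bd E S. \<Sum>f\<in>bd E S - {e}. P * D\<^sup>2 * y ^ ?s"
 have y: "0 \<le> y" "y \<le> 1" using x by auto
 have f: "finite (bd E S)" using S finite_bd by (auto simp: FS_def)
 note [measurable] = pred_K_eq[OF v, of p "{}" S, simplified]
 let ?a = "\<lambda>U. if ?K U = S then ennreal (xp y (clu q U v)) else 0"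
 let ?b = "\<lambda>e U. if ?K U = S \<and> U (edge e) \<le> q then ennreal (y ^ ?s * phi y (K p U S (snd e))) else 0"
 let ?c = "\<lambda>U. if ?K U = S then ennreal (y ^ ?s) else 0"
 let ?d = "\<lambda>e f U. if ?K U = S \<and> U (edge e) \<le> q \<and> U (edge f) \<le> q then ennreal (y ^ ?s) else 0"
 have [measurable]: "(\<lambda>U. xp y (clu q U v)) \<in> borel_measurable PU"
  using borel_measurable_diff[OF borel_measurable_const[of 1] measurable_phi_K[OF v, of y q "{}"]] by (simp add: phi_def)
 have ma: "?a \<in> borel_measurable PU" by measurable
 have mb: "?b e \<in> borel_measurable PU" if e: "e \<in> bd E S" for e
 proof -
  note [measurable] = pred_edge_le[OF e]
  have "snd e \<in> V" using edge_bd[OF e] by auto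
  then show ?thesis by measurable
 qed
 have mc: "?c \<in> borel_measurable PU" by measurable
 have md: "?d e f \<in> borel_measurable PU" if "e \<in> bd E S" "f \<in> bd E S" for e f
 proof -
  note [measurable] = pred_edge_le[OF that(1)] pred_edge_le[OF that(2)]
  show ?thesis by measurable
 qed
 have pt: "?a U + (\<Sum>e\<in>bd E S. ?b e U) \<le> ?c U + (\<Sum>e\<in>bd E S. \<Sum>f\<in>bd E S - {e}. ?d e f U)" for U
 proof (cases "?K U = S")
  case True
  have "?a U + (\<Sum>e\<in>bd E S. ?b e U) = ennreal (xp y (clu q U v) + (\<Sum>e\<in>bd E S. if U (edge e) \<le> q then y ^ ?s * phi y (K p U S (snd e)) else 0))"
   using True y by (subst ennreal_plus) (auto simp: xp_bounds phi_bounds intro!: sum_nonneg sum.cong simp flip: sum_ennreal)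
  also have "... \<le> ennreal (y ^ ?s + (?dd U))"
   by (intro ennreal_leI sprinkle_pointwise[OF y v p(2) True S])
  also have "... = ennreal (y ^ ?s) + ennreal (?dd U)"
   using y by (intro ennreal_plus sum_nonneg) auto
  also have "ennreal (?dd U) =
    (\<Sum>e\<in>bd E S. ennreal (\<Sum>f\<in>bd E S - {e}. if U (edge e) \<le> q \<and> U (edge f) \<le> q then y ^ ?s else 0))"
   using y by (intro sum_ennreal[symmetric] sum_nonneg) auto
  also have "... = (\<Sum>e\<in>bd E S. \<Sum>f\<in>bd E S - {e}. ennreal (if U (edge e) \<le> q \<and> U (edge f) \<le> q then y ^ ?s else 0))"
   using y by (intro sum.cong refl sum_ennreal[symmetric]) auto
  also have "... = (\<Sum>e\<in>bd E S. \<Sum>f\<in>bd E S - {e}. ?d e f U)"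
   using True by (intro sum.cong) auto
  finally show ?thesis using True by simp
 qed auto
 have ib: "(\<E> U. ?b e U) = ennreal (P * D * (y ^ ?s * M p y S (snd e)))" if e: "e \<in> bd E S" for e
 proof -
  have eV: "snd e \<in> V" using edge_bd[OF e] by auto
  have "(\<E> U. ?b e U) = ennreal (P * D) * (\<E> U. ennreal (y ^ ?s * phi y (K p U S (snd e))))"
   unfolding D_def P_def using eV
   by (intro nn_sprinkle[OF v S p e] depends_on_comp[OF depends_on_K, where h="\<lambda>C. ennreal (y ^ ?s * phi y C)"]) measurable
  also have "(\<E> U. ennreal (y ^ ?s * phi y (K p U S (snd e)))) = ennreal (y ^ ?s * M p y S (snd e))"
   using y eV M_bounds[OF eV y] nn_M[OF eV y, of p S] by (simp add: ennreal_mult phi_bounds nn_integral_cmult)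
  finally show ?thesis using D P y M_bounds[OF eV y] by (simp flip: ennreal_mult)
 qed
 have const: "(\<E> U. (if R U then ennreal c else 0)) = ennreal (\<P>(U in PU. R U) * c)"
  if [measurable]: "Measurable.pred PU R" and "0 \<le> c" for R c
 proof -
  have "(\<E> U. (if R U then ennreal c else 0)) = (\<E> U. (if R U then 1 else 0) * ennreal c)"
   by (rule nn_integral_cong) auto
  also have "... = (\<E> U. (if R U then 1 else 0)) * ennreal c"
   by (rule nn_integral_multc) measurable
  finally show ?thesis using that by (subst (asm) nn_indicator_pred) (auto simp: ennreal_mult)
 qed
 have ic: "(\<E> U. ?c U) = ennreal (P * y ^ ?s)"
  unfolding P_def using y by (intro const) auto
 have id: "(\<E> U. ?d e f U) = ennreal (P * D\<^sup>2 * y ^ ?s)" if "e \<in> bd E S" "f \<in> bd E S - {e}" for e f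
 proof -
  have *: "Measurable.pred PU (\<lambda>U. ?K U = S \<and> U (edge e) \<le> q \<and> U (edge f) \<le> q)"
  proof -
   note [measurable] = pred_edge_le[OF that(1)] pred_edge_le[of f S]
   have "f \<in> bd E S" using that by auto
   then show ?thesis by measurable
  qed
  have "(\<E> U. ?d e f U) = ennreal (\<P>(U in PU. ?K U = S \<and> U (edge e) \<le> q \<and> U (edge f) \<le> q) * y ^ ?s)"
   by (rule const[OF *]) (use y in simp)
  also have "\<P>(U in PU. ?K U = S \<and> U (edge e) \<le> q \<and> U (edge f) \<le> q) = P * D\<^sup>2"
  proof -
   have "card {e, f} = 2" using that by auto
   then show ?thesis using prob_sprinkle[OF v S p, of "{e, f}"] that by (simp add: P_def D_def)
  qed
  finally show ?thesis .
 qed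
 define W where "W = enn2real (\<E> U. ?a U)"
 have "(\<E> U. ?a U) \<le> (\<E> U. 1)"
  using y xp_bounds[OF y] by (intro nn_integral_mono) (auto intro: order_trans[OF ennreal_leI[of _ 1]])
 then have W: "(\<E> U. ?a U) = ennreal W" "0 \<le> W"
  by (auto simp: W_def PU.emeasure_space_1 ennreal_enn2real_if top_unique)
 have Mn: "0 \<le> M p y S (snd e)" if "e \<in> bd E S" for e
  using edge_bd[OF that] M_bounds[OF _ y] by auto
 have "ennreal (W + (\<Sum>e\<in>bd E S. P * D * (y ^ ?s * M p y S (snd e)))) = (\<E> U. ?a U + (\<Sum>e\<in>bd E S. ?b e U))"
  using W P D y Mn ma mb ib
  by (subst nn_integral_add) (auto simp: nn_integral_sum sum_nonneg ennreal_plus simp flip: sum_ennreal)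
 also have "... \<le> (\<E> U. ?c U + (\<Sum>e\<in>bd E S. \<Sum>f\<in>bd E S - {e}. ?d e f U))"
  by (rule nn_integral_mono) (rule pt)
 also have "... = (\<E> U. ?c U) + (\<E> U. (\<Sum>e\<in>bd E S. \<Sum>f\<in>bd E S - {e}. ?d e f U))"
  by (intro nn_integral_add mc borel_measurable_sum md) auto
 also have "(\<E> U. (\<Sum>e\<in>bd E S. \<Sum>f\<in>bd E S - {e}. ?d e f U)) = (\<Sum>e\<in>bd E S. \<Sum>f\<in>bd E S - {e}. \<E> U. ?d e f U)"
  by (subst nn_integral_sum, (intro borel_measurable_sum md; auto), intro sum.cong refl nn_integral_sum md) auto
 also have "... = (\<Sum>e\<in>bd E S. \<Sum>f\<in>bd E S - {e}. ennreal (P * D\<^sup>2 * y ^ ?s))"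
  by (intro sum.cong refl id) auto
 also have "... = (\<Sum>e\<in>bd E S. ennreal (\<Sum>f\<in>bd E S - {e}. P * D\<^sup>2 * y ^ ?s))"
  using P y by (intro sum.cong refl sum_ennreal) auto
 also have "... = ennreal ?PD"
  using P y by (intro sum_ennreal sum_nonneg) auto
 also have "(\<E> U. ?c U) + ... = ennreal (P * y ^ ?s + ?PD)"
  unfolding ic using P D y by (intro ennreal_plus[symmetric]) (auto intro!: sum_nonneg)
 finally have "W + (\<Sum>e\<in>bd E S. P * D * (y ^ ?s * M p y S (snd e))) \<le> P * y ^ ?s + ?PD"
  using P D y by (subst (asm) ennreal_le_iff) (auto intro!: add_nonneg_nonneg sum_nonneg)
 also have "?PD \<le> (real (card (bd E S)))\<^sup>2 * (P * D\<^sup>2 * y ^ ?s)"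
 proof -
  have "?PD \<le> (\<Sum>e\<in>bd E S. \<Sum>f\<in>bd E S. P * D\<^sup>2 * y ^ ?s)"
   using f P y by (intro sum_mono sum_mono2) auto
  then show ?thesis by (simp add: power2_eq_square)
 qed
 also have "(real (card (bd E S)))\<^sup>2 * (P * D\<^sup>2 * y ^ ?s) \<le> (real d * real ?s)\<^sup>2 * (P * D\<^sup>2 * y ^ ?s)"
  using P y of_nat_mono[OF card_bd[OF S], where 'a=real] by (intro mult_right_mono power_mono) auto
 also have "... = P * D\<^sup>2 * (real d)\<^sup>2 * ((real ?s)\<^sup>2 * y ^ ?s)" by (simp add: power_mult_distrib)
 also have "... \<le> P * D\<^sup>2 * (real d)\<^sup>2 * B" using P B by (intro mult_left_mono) auto
 finally have 1: "W + (\<Sum>e\<in>bd E S. P * D * (y ^ ?s * M p y S (snd e))) \<le> P * y ^ ?s + P * D\<^sup>2 * (real d)\<^sup>2 * B" by simp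
 have "P * ((q - p) * (y ^ ?s * (\<mu> * ?s))) \<le> P * (D * (y ^ ?s * (\<Sum>e\<in>bd E S. M p y S (snd e))))"
 proof (intro mult_left_mono mult_mono P)
  have "(q - p) * (1 - p) \<le> (q - p) * 1" using p by (intro mult_left_mono) auto
  then show "q - p \<le> D" unfolding D_def using p by (simp add: pos_le_divide_eq)
 qed (use mu y D p in \<open>auto intro!: mult_nonneg_nonneg\<close>)
 also have "... = (\<Sum>e\<in>bd E S. P * D * (y ^ ?s * M p y S (snd e)))" by (simp add: sum_distrib_left ac_simps)
 finally have 2: "W \<le> P * (y ^ ?s * (1 - \<mu> * (q - p) * ?s)) + P * D\<^sup>2 * (real d)\<^sup>2 * B"
  using 1 by (simp add: algebra_simps)
 have "y ^ ?s * (1 - \<mu> * (q - p) * ?s) \<le> x ^ ?s"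
 proof (cases "1 - \<mu> * (q - p) * ?s \<le> 0")
  case True
  then have "y ^ ?s * (1 - \<mu> * (q - p) * ?s) \<le> 0" using y by (intro mult_nonneg_nonpos) auto
  then show ?thesis using x by (smt (verit) zero_le_power)
 next
  case False
  have "y ^ ?s * (1 - \<mu> * (q - p) * ?s) \<le> (x * exp (\<mu> * (q - p))) ^ ?s * (1 - \<mu> * (q - p) * ?s)"
   using False y xy by (intro mult_right_mono power_mono) auto
  also have "... = x ^ ?s * (exp (\<mu> * (q - p) * ?s) * (1 - \<mu> * (q - p) * ?s))"
   by (simp add: power_mult_distrib exp_of_nat_mult[symmetric] mult.commute[of "real ?s"])
  also have "... \<le> x ^ ?s * 1" using x by (intro mult_left_mono exp_one_minus_le) auto
  finally show ?thesis by simp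
 qed
 then have "P * (y ^ ?s * (1 - \<mu> * (q - p) * ?s)) \<le> P * x ^ ?s" using P by (intro mult_left_mono)
 then have "W \<le> P * (x ^ ?s + D\<^sup>2 * (real d)\<^sup>2 * B)" using 2 by (simp add: algebra_simps)
 then show ?thesis unfolding W(1) P_def[symmetric] D_def[symmetric] by (rule ennreal_leI)
qed

text \<open>Summed over \<open>S\<close>: raising the level from \<open>p\<close> to
  \<open>q\<close> makes up for lowering \<open>h\<close> by \<open>\<mu> * (q - p)\<close>, up to
  an error quadratic in \<open>q - p\<close>. This is one step along a characteristic.\<close>

lemma sprinkle_lower:
 assumes v: "v \<in> V" and p: "0 \<le> p" "p \<le> q" "q \<le> 1" "p < 1" and x: "0 \<le> x" "x \<le> y" "y \<le> 1"
  and mu: "0 \<le> \<mu>" "\<And>S. S \<in> FS \<Longrightarrow> \<mu> * real (card S) \<le> (\<Sum>e\<in>bd E S. M p y S (snd e))"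
  and xy: "y \<le> x * exp (\<mu> * (q - p))"
  and B: "\<And>s::nat. (real s)\<^sup>2 * y ^ s \<le> B"
 shows "M p x {} v \<le> M q y {} v + ((q - p) / (1 - p))\<^sup>2 * (real d)\<^sup>2 * B"
proof -
 define Q where "Q = ((q - p) / (1 - p))\<^sup>2 * (real d)\<^sup>2 * B"
 have B0: "0 \<le> B" using B[of 0] by simp
 have Q: "0 \<le> Q" using B0 by (simp add: Q_def)
 have x1: "0 \<le> x" "x \<le> 1" and y1: "0 \<le> y" "y \<le> 1" using x by auto
 let ?K = "\<lambda>U. clu p U v"
 have nnxp: "(\<E> U. ennreal (xp z (clu r U v))) = ennreal (1 - M r z {} v)"
  if "0 \<le> z" "z \<le> 1" for z r
 proof -
  have i: "integrable PU (\<lambda>U. phi z (clu r U v))"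
   using integrable_phi[OF meas_eset_opn v that] .
  have "(\<E> U. ennreal (xp z (clu r U v))) = (\<E> U. ennreal (1 - phi z (clu r U v)))"
   by (simp add: phi_def)
  also have "... = ennreal (\<integral>U. 1 - phi z (clu r U v) \<partial>PU)"
   using i by (intro nn_integral_eq_integral) (auto simp: phi_bounds[OF that])
  also have "(\<integral>U. 1 - phi z (clu r U v) \<partial>PU) = 1 - M r z {} v"
   using i by (simp add: M_def PU.prob_space)
  finally show ?thesis .
 qed
 have mxp: "(\<lambda>U. ennreal (xp y (clu q U v))) \<in> borel_measurable PU"
  using borel_measurable_diff[OF borel_measurable_const[of 1] measurable_phi_K[OF v, of y q "{}"]] by (simp add: phi_def)
 have "ennreal (1 - M q y {} v) = (\<E> U. ennreal (xp y (clu q U v)))"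
  by (rule nnxp[OF y1, symmetric])
 also have "... = (\<E> U. (if finite (?K U) then ennreal (xp y (clu q U v)) else 0))"
 proof (rule nn_integral_cong)
  fix U
  have "xp y (clu q U v) = 0" if "infinite (?K U)"
   using that component_mono[OF opn_mono[OF p(2)], of E U v] finite_subset by (auto simp: xp_def)
  then show "ennreal (xp y (clu q U v)) = (if finite (?K U) then ennreal (xp y (clu q U v)) else 0)"
   by auto
 qed
 also have "... = (\<integral>\<^sup>+S. (\<E> U. (if ?K U = S then ennreal (xp y (clu q U v)) else 0)) \<partial>count_space FS)"
  by (rule nn_decompose[OF meas_eset_opn v, where h="\<lambda>_ U. ennreal (xp y (clu q U v))"]) (rule mxp)
 also have "... \<le> (\<integral>\<^sup>+S. ennreal (\<P>(U in PU. ?K U = S)) * ennreal (x ^ card S + Q) \<partial>count_space FS)"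
 proof (rule nn_integral_mono)
  fix S assume "S \<in> space (count_space FS)"
  then have S: "S \<in> FS" by simp
  show "(\<E> U. (if ?K U = S then ennreal (xp y (clu q U v)) else 0))
   \<le> ennreal (\<P>(U in PU. ?K U = S)) * ennreal (x ^ card S + Q)"
   using sprinkle_lower_S[OF v p x mu(1) mu(2)[OF S] xy B S] x1 Q
   by (simp add: Q_def ennreal_mult)
 qed
 also have "... = (\<E> U. (if finite (?K U) then ennreal (x ^ card (?K U) + Q) else 0))"
  by (rule nn_K_sum[OF v, symmetric])
 also have "... \<le> (\<E> U. ennreal (xp x (?K U)) + ennreal Q)"
  using x1 Q by (intro nn_integral_mono) (auto simp: xp_def)
 also have "... = (\<E> U. ennreal (xp x (?K U))) + ennreal Q"
  using borel_measurable_diff[OF borel_measurable_const[of 1] measurable_phi_K[OF v, of x p "{}"]]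
  by (subst nn_integral_add) (auto simp: phi_def PU.emeasure_space_1)
 also have "... = ennreal (1 - M p x {} v + Q)"
  unfolding nnxp[OF x1] using M_bounds[OF v x1] Q by (simp add: ennreal_plus)
 finally have "1 - M q y {} v \<le> 1 - M p x {} v + Q"
  using M_bounds[OF v x1, of p "{}"] M_bounds[OF v y1, of q "{}"] Q by (subst (asm) ennreal_le_iff) auto
 then show ?thesis by (simp add: Q_def)
qed

end

section \<open>Continuity in \<open>x\<close> and the susceptibility\<close>

lemma square_times_power_bounded:
 fixes x :: real
 assumes "0 \<le> x" "x < 1"
 shows "\<exists>B\<ge>0. \<forall>n::nat. (real n)\<^sup>2 * x ^ n \<le> B"
proof -
 have "(\<lambda>n. real n * sqrt x ^ n) \<longlonglongrightarrow> 0"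
  using assms by (intro powser_times_n_limit_0) auto
 then have "Bseq (\<lambda>n. real n * sqrt x ^ n)"
  using convergent_imp_Bseq convergentI by blast
 then obtain K where K: "\<And>n. norm (real n * sqrt x ^ n) \<le> K" by (auto simp: Bseq_def)
 have "(real n)\<^sup>2 * x ^ n \<le> K\<^sup>2" for n
 proof -
  have "(real n)\<^sup>2 * x ^ n = (real n * sqrt x ^ n)\<^sup>2"
   using assms by (simp add: power_mult_distrib power2_eq_square flip: real_sqrt_power)
  also have "... \<le> K\<^sup>2" using K[of n] assms by (intro power_mono) auto
  finally show ?thesis .
 qed
 then show ?thesis by (intro exI[of _ "K\<^sup>2"]) auto
qed

context perc
begin

lemma measurable_phi_opn [measurable]: "v \<in> V \<Longrightarrow> (\<lambda>U. phi x (clu p U v)) \<in> borel_measurable PU"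
 by (rule measurable_phi[OF meas_eset_opn])

text \<open>For a cluster of size \<open>n\<close> the change is at most
  \<open>a * n * y ^ n\<close> with \<open>y = x * exp a\<close>. It is bounded through
  \<open>n\<^sup>2 * y ^ n\<close>, so that one constant \<open>B\<close> serves here and in the
  sprinkling error.\<close>

lemma M_shift:
 assumes v: "v \<in> V" and x: "0 \<le> x" "0 \<le> a" "x * exp a \<le> 1"
  and B: "\<And>n::nat. (real n)\<^sup>2 * (x * exp a) ^ n \<le> B"
 shows "M p x {} v - a * B \<le> M p (x * exp a) {} v"
proof -
 let ?y = "x * exp a"
 have xy: "x \<le> ?y" using x mult_left_mono[of 1 "exp a" x] by simp
 have y: "0 \<le> ?y" "?y \<le> 1" "x \<le> 1" using x xy by auto
 have B0: "0 \<le> B" using B[of 0] by simp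
 have pt: "phi x K - a * B \<le> phi ?y K" for K :: "'a set"
 proof (cases "finite K")
  case True
  let ?n = "card K"
  have "?y ^ ?n - x ^ ?n = ?y ^ ?n * (1 - exp (- (a * ?n)))"
   by (simp add: power_mult_distrib exp_of_nat2_mult[symmetric] algebra_simps flip: exp_add)
  also have "... \<le> ?y ^ ?n * (a * ?n)"
   using exp_ge_add_one_self[of "- (a * ?n)"] y by (intro mult_left_mono) auto
  also have "... \<le> a * ((real ?n)\<^sup>2 * ?y ^ ?n)"
  proof -
   have "real ?n \<le> (real ?n)\<^sup>2" by (cases "?n = 0") (auto simp: power2_eq_square)
   then have "a * ?y ^ ?n * real ?n \<le> a * ?y ^ ?n * (real ?n)\<^sup>2" using x y by (intro mult_left_mono) auto
   then show ?thesis by (simp add: ac_simps)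
  qed
  also have "... \<le> a * B" using B x by (intro mult_left_mono) auto
  finally show ?thesis using True by (simp add: phi_def xp_def)
 qed (use B0 x in \<open>simp add: phi_def xp_def\<close>)
 have i: "integrable PU (\<lambda>U. phi z (K p U {} v))" if "0 \<le> z" "z \<le> 1" for z
  by (rule integrable_phi[OF meas_K v that])
 have "M p x {} v - a * B = (\<integral>U. phi x (K p U {} v) - a * B \<partial>PU)"
  unfolding M_def using i[of x] x y by (simp add: PU.prob_space)
 also have "... \<le> M p ?y {} v"
  unfolding M_def using i[of x] i[of ?y] x y by (intro integral_mono pt) auto
 finally show ?thesis .
qed

text \<open>Characteristics are only followed while \<open>x < 1\<close>; dominated convergence
  extends the resulting lower bound to \<open>x = 1\<close>.\<close>

lemma M_tendsto_one:
 assumes v: "v \<in> V" and m: "x0 < 1" "0 \<le> x0" "\<And>y. x0 \<le> y \<Longrightarrow> y < 1 \<Longrightarrow> m \<le> M p y {} v"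
 shows "m \<le> M p 1 {} v"
proof -
 let ?y = "\<lambda>n. 1 - (1 - x0) / real (Suc n)"
 have y: "x0 \<le> ?y n" "?y n < 1" for n
 proof -
  have "(1 - x0) / real (Suc n) \<le> (1 - x0) / 1" using m by (intro divide_left_mono) auto
  then show "x0 \<le> ?y n" by simp
  show "?y n < 1" using m by simp
 qed
 have lim: "?y \<longlonglongrightarrow> 1 - 0"
  using LIMSEQ_inverse_real_of_nat tendsto_mult_right_zero[OF LIMSEQ_inverse_real_of_nat, of "1 - x0"]
  by (intro tendsto_diff tendsto_const) (simp add: divide_inverse)
 have "(\<lambda>n. M p (?y n) {} v) \<longlonglongrightarrow> M p 1 {} v"
  unfolding M_def
 proof (rule integral_dominated_convergence[where w="\<lambda>_. 1"])
  show "AE U in PU. (\<lambda>n. phi (?y n) (K p U {} v)) \<longlonglongrightarrow> phi 1 (K p U {} v)"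
  proof (rule AE_I2)
   fix U
   have *: "(\<lambda>n. ?y n ^ card (K p U {} v)) \<longlonglongrightarrow> 1 ^ card (K p U {} v)"
    using lim by (intro tendsto_power) simp
   show "(\<lambda>n. phi (?y n) (K p U {} v)) \<longlonglongrightarrow> phi 1 (K p U {} v)"
    using tendsto_diff[OF tendsto_const[of 1] *] unfolding phi_def xp_def by auto
  qed
  show "AE U in PU. norm (phi (?y n) (K p U {} v)) \<le> 1" for n
   using y[of n] m by (intro AE_I2) (simp add: phi_bounds)
  show "(\<lambda>U. phi (?y n) (K p U {} v)) \<in> borel_measurable PU" for n
   by (rule measurable_phi_K[OF v])
  show "(\<lambda>U. phi 1 (K p U {} v)) \<in> borel_measurable PU" by (rule measurable_phi_K[OF v])
 qed simp
 then show ?thesis using m(3) y by (intro LIMSEQ_le_const) auto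
qed

definition chi :: "real \<Rightarrow> 'a \<Rightarrow> ennreal" where
 "chi p v = (\<E> U. (if finite (K p U {} v) then ennreal (real (card (K p U {} v))) else \<infinity>))"

text \<open>Fatou's lemma along \<open>h = 1 / (n + 1)\<close>: the quotient of \<open>phi\<close>
  by \<open>h\<close> tends to the size of a finite cluster and to infinity for an infinite one, so
  the bound also excludes infinite clusters.\<close>

lemma chi_le_liminf:
 assumes v: "v \<in> V" and C: "0 \<le> C" and h: "\<And>h. 0 < h \<Longrightarrow> h \<le> 1 \<Longrightarrow> M p (exp (- h)) {} v \<le> C * h"
 shows "chi p v \<le> ennreal C"
proof -
 let ?f = "\<lambda>n U. ennreal (real (Suc n) * phi (exp (- 1 / real (Suc n))) (K p U {} v))"
 have "chi p v \<le> (\<E> U. liminf (\<lambda>n. ?f n U))"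
  unfolding chi_def
 proof (rule nn_integral_mono)
  fix U
  show "(if finite (K p U {} v) then ennreal (real (card (K p U {} v))) else \<infinity>) \<le> liminf (\<lambda>n. ?f n U)"
  proof (cases "finite (K p U {} v)")
   case True
   let ?s = "real (card (K p U {} v))"
   have "(\<lambda>n. real (Suc n) * (1 - exp (- ?s / real (Suc n)))) \<longlonglongrightarrow> ?s"
   proof -
    have s0: "0 < ?s" using True component_self[of v "del (opn E p U) {}"] by (auto simp: card_gt_0_iff)
    let ?z = "\<lambda>n. - ?s / real (Suc n)"
    have "?z \<longlonglongrightarrow> 0"
     using tendsto_mult_right_zero[OF LIMSEQ_inverse_real_of_nat, of "- ?s"] by (simp add: divide_inverse)
    then have "filterlim ?z (at 0) sequentially" using s0 by (simp add: filterlim_at)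
    from filterlim_compose[OF lim_exp_minus_1 this]
    have "(\<lambda>n. ?s * ((exp (?z n) - 1) / ?z n)) \<longlonglongrightarrow> ?s * 1"
     by (intro tendsto_mult tendsto_const)
    moreover have "?s * ((exp (?z n) - 1) / ?z n) = real (Suc n) * (1 - exp (?z n))" for n
     using s0 by (simp add: field_simps)
    ultimately show ?thesis by simp
   qed
   moreover have "real (Suc n) * (1 - exp (- ?s / real (Suc n))) = real (Suc n) * phi (exp (- 1 / real (Suc n))) (K p U {} v)" for n
    using True by (simp add: phi_def xp_def exp_of_nat_mult[symmetric])
   ultimately have "(\<lambda>n. ?f n U) \<longlonglongrightarrow> ennreal ?s" by (intro tendsto_ennrealI) simp
   then show ?thesis using True by (simp add: lim_imp_Liminf)
  next
   case False
   have "(\<lambda>n. ?f n U) \<longlonglongrightarrow> \<infinity>"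
   proof -
    have "?f n U = of_nat (Suc n)" for n
     using False by (simp add: phi_def xp_def ennreal_of_nat_eq_real_of_nat)
    moreover have "(\<lambda>n. of_nat (Suc n) :: ennreal) \<longlonglongrightarrow> \<infinity>"
     using LIMSEQ_Suc[OF of_nat_tendsto_top_ennreal] by (simp add: infinity_ennreal_def)
    ultimately show ?thesis by simp
   qed
   then show ?thesis by (simp add: lim_imp_Liminf)
  qed
 qed
 also have "... \<le> liminf (\<lambda>n. \<E> U. ?f n U)"
  using v by (intro nn_integral_liminf) measurable
 also have "... \<le> liminf (\<lambda>n. ennreal C)"
 proof (rule Liminf_mono, rule eventuallyI)
  fix n
  let ?x = "exp (- 1 / real (Suc n))"
  have x: "0 \<le> ?x" "?x \<le> 1" by auto
  have "(\<E> U. ?f n U) = ennreal (real (Suc n)) * (\<E> U. ennreal (phi ?x (K p U {} v)))"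
  proof -
   have "(\<E> U. ?f n U) = (\<E> U. ennreal (real (Suc n)) * ennreal (phi ?x (K p U {} v)))"
    by (intro nn_integral_cong ennreal_mult phi_bounds[OF x, THEN conjunct1]) auto
   also have "... = ennreal (real (Suc n)) * (\<E> U. ennreal (phi ?x (K p U {} v)))"
    using v by (intro nn_integral_cmult) measurable
   finally show ?thesis .
  qed
  also have "... = ennreal (real (Suc n) * M p ?x {} v)"
   unfolding nn_M[OF v x] using M_bounds[OF v x] by (simp add: ennreal_mult)
  also have "... \<le> ennreal C"
  proof (rule ennreal_leI)
   have "M p ?x {} v \<le> C * (1 / real (Suc n))" using h[of "1 / real (Suc n)"] by simp
   then show "real (Suc n) * M p ?x {} v \<le> C" by (simp add: field_simps)
  qed
  finally show "(\<E> U. ?f n U) \<le> ennreal C" .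
 qed
 also have "... = ennreal C" by (simp add: Liminf_const)
 finally show ?thesis .
qed

end

section \<open>Characteristics\<close>

locale cperc = bperc +
 fixes plo p3 c :: real
 assumes plo: "0 < plo" "plo < p3" "p3 < 1"
  and c_pos: "0 < c"
  and influence: "\<And>p x S v. p \<in> {plo..p3} \<Longrightarrow> x \<in> {0..1} \<Longrightarrow> S \<in> FS \<Longrightarrow> v \<in> V \<Longrightarrow>
    c * real (card S) * M p x {} v \<le> (\<Sum>e\<in>bd E S. M p x S (snd e))"
begin

text \<open>These are the characteristics of the Burgers-type inequality \<open>\<partial>\<^sub>p M \<ge> c M \<partial>\<^sub>h M\<close>,
 where \<open>x = exp (- h)\<close>.\<close>

lemma characteristic:
 assumes v: "v \<in> V" and p: "plo \<le> p" "0 \<le> s" "p + s \<le> p3" and x: "0 \<le> x" "x * exp (\<kappa> * s) < 1"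
  and kappa: "0 \<le> \<kappa>" "\<kappa> < c * M p x {} v"
 shows "M p x {} v \<le> M (p + s) (x * exp (\<kappa> * s)) {} v"
proof -
 define X where "X = x * exp (\<kappa> * s)"
 define M0 where "M0 = M p x {} v"
 have X: "0 \<le> X" "X < 1" using x by (auto simp: X_def)
 obtain B where B: "0 \<le> B" "\<And>n::nat. (real n)\<^sup>2 * X ^ n \<le> B"
  using square_times_power_bounded[OF X] by blast
 define C where "C = (1 / (1 - p3))\<^sup>2 * (real d)\<^sup>2 * B"
 have C: "0 \<le> C" using B by (simp add: C_def)
 \<comment> \<open>An Euler scheme with \<open>N\<close> steps. Each step loses at most
   \<open>C * (s / N)\<^sup>2\<close>, so the total loss is at most
   \<open>C * s\<^sup>2 / N\<close>. The condition on \<open>N\<close> keeps \<open>c * M\<close>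
   above the slope \<kappa> throughout; its second error term is the price of evaluating
   \<open>M\<close> at the end \<open>y\<close> of the step, where the influence bound is
   applied.\<close>
 have step: "\<forall>j\<le>N. M0 - C * s\<^sup>2 * j / (real N)\<^sup>2 \<le> M (p + s * j / N) (x * exp (\<kappa> * s * j / N)) {} v"
  if N: "0 < N" "\<kappa> \<le> c * (M0 - (C * s\<^sup>2 + \<kappa> * s * B) / N)" for N :: nat
 proof (intro allI impI)
  fix j assume "j \<le> N"
  then show "M0 - C * s\<^sup>2 * j / (real N)\<^sup>2 \<le> M (p + s * j / N) (x * exp (\<kappa> * s * j / N)) {} v"
  proof (induction j)
   case (Suc j)
   define \<delta> where "\<delta> = s / N"
   have d0: "0 \<le> \<delta>" using p by (simp add: \<delta>_def)
   define pj where "pj = p + s * j / N"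
   define xj where "xj = x * exp (\<kappa> * s * j / N)"
   define y where "y = xj * exp (\<kappa> * \<delta>)"
   have jN: "real j / N \<le> 1" "real (Suc j) / N \<le> 1" using Suc N by auto
   have y_eq: "y = x * exp (\<kappa> * s * Suc j / N)"
    using N by (simp add: y_def xj_def \<delta>_def add_divide_distrib distrib_left flip: exp_add)
   have pj': "pj + \<delta> = p + s * Suc j / N"
    using N by (simp add: pj_def \<delta>_def add_divide_distrib distrib_left)
   have le_s: "s * Suc j / N \<le> s" "s * j / N \<le> s"
    using mult_left_mono[OF jN(2) p(2)] mult_left_mono[OF jN(1) p(2)] by auto
   have yX: "y \<le> X"
    unfolding y_eq X_def using le_s kappa x(1) mult_left_mono[OF le_s(1) kappa(1)] by (intro mult_left_mono) auto
   have xj: "0 \<le> xj" "xj \<le> y"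
    using x kappa d0 mult_left_mono[of 1 "exp (\<kappa> * \<delta>)" xj] by (auto simp: xj_def y_def)
   have y1: "0 \<le> y" "y \<le> 1" using xj yX X by auto
   have "0 \<le> s * real j / real N" using p by simp
   then have pj: "plo \<le> pj" "pj \<le> pj + \<delta>" unfolding pj_def using p d0 by linarith+
   have pj3: "pj + \<delta> \<le> p3" unfolding pj' using p le_s by linarith
   note pj = pj pj3
   have By: "(real n)\<^sup>2 * y ^ n \<le> B" for n :: nat
    using B(2)[of n] mult_left_mono[OF power_mono[OF yX y1(1), of n], of "(real n)\<^sup>2"] by simp
   have IH: "M0 - C * s\<^sup>2 * j / (real N)\<^sup>2 \<le> M pj xj {} v" using Suc by (simp add: pj_def xj_def)
   have "C * s\<^sup>2 * j / (real N)\<^sup>2 \<le> C * s\<^sup>2 / N"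
    using mult_left_mono[OF jN(1), of "C * s\<^sup>2 / N"] C by (simp add: power2_eq_square)
   then have "M0 - (C * s\<^sup>2 + \<kappa> * s * B) / N \<le> M pj xj {} v - \<kappa> * \<delta> * B"
    using IH by (simp add: \<delta>_def add_divide_distrib)
   also have "... \<le> M pj y {} v"
    unfolding y_def using M_shift[OF v xj(1), of "\<kappa> * \<delta>" B pj] y1 By kappa d0 by (simp add: y_def)
   finally have "c * (M0 - (C * s\<^sup>2 + \<kappa> * s * B) / N) \<le> c * M pj y {} v"
    using c_pos by (intro mult_left_mono) auto
   then have kM: "\<kappa> \<le> c * M pj y {} v" using N(2) by simp
   have mu: "\<kappa> * real (card S) \<le> (\<Sum>e\<in>bd E S. M pj y S (snd e))" if "S \<in> FS" for S
    using influence[of pj y S v] pj y1 that v mult_right_mono[OF kM, of "real (card S)"] by (simp add: ac_simps)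
   have "M pj xj {} v \<le> M (pj + \<delta>) y {} v + ((pj + \<delta> - pj) / (1 - pj))\<^sup>2 * (real d)\<^sup>2 * B"
    using pj plo d0 xj y1 kappa mu By v by (intro sprinkle_lower[where \<mu>=\<kappa>]) (auto simp: y_def)
   also have "((pj + \<delta> - pj) / (1 - pj))\<^sup>2 * (real d)\<^sup>2 * B \<le> (\<delta> * (1 / (1 - p3)))\<^sup>2 * (real d)\<^sup>2 * B"
    using pj plo d0 B by (intro mult_right_mono power_mono) (auto intro!: divide_left_mono)
   also have "... = C * \<delta>\<^sup>2" by (simp add: C_def power_divide)
   finally have "M pj xj {} v \<le> M (pj + \<delta>) y {} v + C * \<delta>\<^sup>2" by simp
   then have "M0 - C * s\<^sup>2 * Suc j / (real N)\<^sup>2 \<le> M (pj + \<delta>) y {} v"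
    using IH by (simp add: \<delta>_def power_divide add_divide_distrib distrib_left)
   then show ?case unfolding pj' y_eq .
  qed (simp add: M0_def)
 qed
 have "(\<lambda>N. c * (M0 - (C * s\<^sup>2 + \<kappa> * s * B) / real N)) \<longlonglongrightarrow> c * (M0 - 0)"
  by (intro tendsto_intros lim_const_over_n)
 then have "\<forall>\<^sub>F N in sequentially. \<kappa> < c * (M0 - (C * s\<^sup>2 + \<kappa> * s * B) / real N)"
  using kappa by (intro order_tendstoD(1)) (auto simp: M0_def)
 then have ev: "\<forall>\<^sub>F N in sequentially. M0 - C * s\<^sup>2 / real N \<le> M (p + s) X {} v"
  using eventually_gt_at_top[of 0]
 proof eventually_elim
  case (elim N)
  then show ?case using step[of N] by (auto simp: X_def power2_eq_square dest!: spec[of _ N])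
 qed
 have "(\<lambda>N. M0 - C * s\<^sup>2 / real N) \<longlonglongrightarrow> M0 - 0"
  by (intro tendsto_intros lim_const_over_n)
 then have "M0 - 0 \<le> M (p + s) X {} v"
  using ev by (intro tendsto_upperbound) auto
 then show ?thesis by (simp add: M0_def X_def)
qed

text \<open>Stop the characteristic when it reaches a given \<open>y < 1\<close>, use monotonicity
  in the level for the remaining time, and let \<open>y\<close> tend to 1.\<close>

lemma characteristic_theta:
 assumes v: "v \<in> V" and p: "plo \<le> p" "0 \<le> s" "p + s \<le> p3" and x: "0 < x" "x < 1" "1 \<le> x * exp (\<kappa> * s)"
  and kappa: "0 < \<kappa>" "\<kappa> < c * M p x {} v"
 shows "M p x {} v \<le> M (p + s) 1 {} v"
proof (rule M_tendsto_one[OF v x(2)])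
 fix y assume y: "x \<le> y" "y < 1"
 define s' where "s' = ln (y / x) / \<kappa>"
 have s': "0 \<le> s'" using y x kappa by (simp add: s'_def)
 have e: "x * exp (\<kappa> * s') = y" using y x kappa by (simp add: s'_def)
 have "\<kappa> * s' \<le> \<kappa> * s"
 proof -
  have "x * exp (\<kappa> * s') \<le> x * exp (\<kappa> * s)" using e y x by simp
  then show ?thesis using x by simp
 qed
 then have ss: "s' \<le> s" using kappa by simp
 have "M p x {} v \<le> M (p + s') (x * exp (\<kappa> * s')) {} v"
  using p s' ss x y kappa e by (intro characteristic[OF v]) auto
 also have "... \<le> M (p + s) y {} v"
  unfolding e using v y x ss by (intro M_mono_gen) auto
 finally show "M p x {} v \<le> M (p + s) y {} v" .
qed (use x in simp)

text \<open>If the bound failed, the characteristic of slope \<open>h / (q - p)\<close> would arrive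
  at \<open>x = 1\<close> at level \<open>q\<close> with a positive value, against the absence of
  infinite clusters there.\<close>

lemma subcritical_M:
 assumes v: "v \<in> V" and p: "plo \<le> p" "p < q" "q \<le> p3" and th: "M q 1 {} v = 0" and h: "0 < h"
 shows "M p (exp (- h)) {} v \<le> h / (c * (q - p))"
proof (rule ccontr)
 assume neg: "\<not> M p (exp (- h)) {} v \<le> h / (c * (q - p))"
 then have "h / (q - p) < c * M p (exp (- h)) {} v"
  using c_pos p by (simp add: field_simps)
 then have "M p (exp (- h)) {} v \<le> M (p + (q - p)) 1 {} v"
  using p h by (intro characteristic_theta[OF v, where \<kappa>="h / (q - p)"]) (auto simp flip: exp_add)
 then have "M p (exp (- h)) {} v \<le> 0" using th by simp
 moreover have "0 < h / (c * (q - p))" using h c_pos p by simp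
 ultimately show False using neg by simp
qed

end

section \<open>The BK inequality and tree graphs\<close>

definition wt :: "real \<Rightarrow> 'e set \<Rightarrow> 'e set \<Rightarrow> real" where
 "wt p W F = p ^ card F * (1 - p) ^ card (W - F)"

definition expect :: "real \<Rightarrow> 'e set \<Rightarrow> ('e set \<Rightarrow> real) \<Rightarrow> real" where
 "expect p W f = (\<Sum>F\<in>Pow W. wt p W F * f F)"

lemma expect_empty: "expect p {} f = f {}"
 by (simp add: expect_def wt_def)

lemma expect_insert:
 assumes "finite W" "e \<notin> W"
 shows "expect p (insert e W) f = (1 - p) * expect p W f + p * expect p W (\<lambda>F. f (insert e F))"
proof -
 have inj: "inj_on (insert e) (Pow W)" using assms by (auto intro!: inj_onI dest!: insert_ident[THEN iffD1, rotated 2])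
 have "expect p (insert e W) f = (\<Sum>F\<in>Pow W. wt p (insert e W) F * f F) + (\<Sum>F\<in>insert e ` Pow W. wt p (insert e W) F * f F)"
  unfolding expect_def Pow_insert using assms by (intro sum.union_disjoint) auto
 also have "(\<Sum>F\<in>insert e ` Pow W. wt p (insert e W) F * f F) = (\<Sum>F\<in>Pow W. p * (wt p W F * f (insert e F)))"
 proof (subst sum.reindex[OF inj], rule sum.cong)
  fix F assume "F \<in> Pow W"
  then have F: "finite F" "e \<notin> F" "insert e W - insert e F = W - F" using assms by (auto intro: finite_subset)
  then show "((\<lambda>F. wt p (insert e W) F * f F) \<circ> insert e) F = p * (wt p W F * f (insert e F))"
   by (simp add: wt_def)
 qed simp
 also have "(\<Sum>F\<in>Pow W. wt p (insert e W) F * f F) = (\<Sum>F\<in>Pow W. (1 - p) * (wt p W F * f F))"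
 proof (rule sum.cong)
  fix F assume "F \<in> Pow W"
  then have "insert e W - F = insert e (W - F)" "finite (W - F)" "e \<notin> W - F" using assms by auto
  then show "wt p (insert e W) F * f F = (1 - p) * (wt p W F * f F)" by (simp add: wt_def)
 qed simp
 finally show ?thesis by (simp add: expect_def sum_distrib_left)
qed

lemma expect_mono:
 assumes "0 \<le> p" "p \<le> 1" "\<And>F. F \<subseteq> W \<Longrightarrow> f F \<le> g F"
 shows "expect p W f \<le> expect p W g"
 unfolding expect_def using assms by (intro sum_mono mult_left_mono) (auto simp: wt_def)

lemma expect_linear: "expect p W (\<lambda>F. a * f F + b * g F) = a * expect p W f + b * expect p W g"
 by (simp add: expect_def sum.distrib sum_distrib_left algebra_simps)

definition disjointly :: "('e set \<Rightarrow> 'e set \<Rightarrow> bool) \<Rightarrow> 'e set \<Rightarrow> bool" where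
 "disjointly R F \<longleftrightarrow> (\<exists>A B. A \<subseteq> F \<and> B \<subseteq> F \<and> A \<inter> B = {} \<and> R A B)"

text \<open>The induction works because disjoint occurrence of a relation between two edge sets (rather
 than of a pair of events) commutes with unions when the state of one edge is revealed.\<close>

lemma BK_relation:
 assumes "finite W" "0 \<le> p" "p \<le> 1"
  and "\<And>A A' B B'. R A B \<Longrightarrow> A \<subseteq> A' \<Longrightarrow> B \<subseteq> B' \<Longrightarrow> R A' B'"
 shows "expect p W (\<lambda>F. of_bool (disjointly R F)) \<le> expect p W (\<lambda>F. expect p W (\<lambda>G. of_bool (R F G)))"
 using assms(1,4)
proof (induction W arbitrary: R)
 case empty
 then show ?case by (simp add: expect_empty disjointly_def)
next
 case (insert e W)
 have up: "\<And>A A' B B'. R A B \<Longrightarrow> A \<subseteq> A' \<Longrightarrow> B \<subseteq> B' \<Longrightarrow> R A' B'" using insert.prems by blast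
 \<comment> \<open>An open edge \<open>e\<close> may be given to either of the two witnesses, but
   not to both.\<close>
 define R' where "R' A B \<longleftrightarrow> R (insert e A) B \<or> R A (insert e B)" for A B
 have up': "R' A B \<Longrightarrow> A \<subseteq> A' \<Longrightarrow> B \<subseteq> B' \<Longrightarrow> R' A' B'" for A A' B B'
  unfolding R'_def
  using up[of "insert e A" B "insert e A'" B'] up[of A "insert e B" A' "insert e B'"] by blast
 have bx: "disjointly R (insert e F) \<longleftrightarrow> disjointly R' F" if "F \<subseteq> W" for F
 proof
  assume "disjointly R (insert e F)"
  then obtain A B where AB: "A \<subseteq> insert e F" "B \<subseteq> insert e F" "A \<inter> B = {}" "R A B" by (auto simp: disjointly_def)
  have "R' (A - {e}) (B - {e})"
  proof (cases "e \<in> A")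
   case True
   then have "insert e (A - {e}) = A" "B - {e} = B" using AB by auto
   then show ?thesis using AB by (simp add: R'_def)
  next
   case False
   then have "A - {e} = A" "B \<subseteq> insert e (B - {e})" by auto
   then show ?thesis unfolding R'_def using up[OF AB(4) order_refl] by metis
  qed
  then show "disjointly R' F" unfolding disjointly_def using AB by (intro exI[of _ "A - {e}"] exI[of _ "B - {e}"]) auto
 next
  assume "disjointly R' F"
  then obtain A B where AB: "A \<subseteq> F" "B \<subseteq> F" "A \<inter> B = {}" "R' A B" by (auto simp: disjointly_def)
  have e: "e \<notin> A" "e \<notin> B" using AB that insert by auto
  from AB(4) show "disjointly R (insert e F)" unfolding R'_def
  proof
   assume "R (insert e A) B"
   then show ?thesis unfolding disjointly_def using AB e by (intro exI[of _ "insert e A"] exI[of _ B]) auto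
  next
   assume "R A (insert e B)"
   then show ?thesis unfolding disjointly_def using AB e by (intro exI[of _ A] exI[of _ "insert e B"]) auto
  qed
 qed
 have "expect p (insert e W) (\<lambda>F. of_bool (disjointly R F)) =
   (1 - p) * expect p W (\<lambda>F. of_bool (disjointly R F)) + p * expect p W (\<lambda>F. of_bool (disjointly R (insert e F)))"
  using insert by (subst expect_insert) auto
 also have "expect p W (\<lambda>F. of_bool (disjointly R (insert e F))) = expect p W (\<lambda>F. of_bool (disjointly R' F))"
  unfolding expect_def by (intro sum.cong refl) (simp add: bx)
 also have "(1 - p) * expect p W (\<lambda>F. of_bool (disjointly R F)) + p * expect p W (\<lambda>F. of_bool (disjointly R' F))
   \<le> (1 - p) * expect p W (\<lambda>F. expect p W (\<lambda>G. of_bool (R F G))) + p * expect p W (\<lambda>F. expect p W (\<lambda>G. of_bool (R' F G)))"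
  using insert.IH[of R] insert.IH[of R'] up up' assms(2,3) by (intro add_mono mult_left_mono) auto
 also have "... = expect p W (\<lambda>F. expect p W (\<lambda>G. (1 - p) * of_bool (R F G) + p * of_bool (R' F G)))"
  by (simp add: expect_linear)
 also have "... \<le> expect p W (\<lambda>F. expect p W (\<lambda>G.
   (1 - p) * ((1 - p) * of_bool (R F G) + p * of_bool (R F (insert e G)))
   + p * ((1 - p) * of_bool (R (insert e F) G) + p * of_bool (R (insert e F) (insert e G)))))"
 proof (intro expect_mono assms(2,3))
  fix F G
  have imp: "R F G \<Longrightarrow> R F (insert e G)" "R F G \<Longrightarrow> R (insert e F) G"
   "R F (insert e G) \<Longrightarrow> R (insert e F) (insert e G)" "R (insert e F) G \<Longrightarrow> R (insert e F) (insert e G)"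
   using up by (blast intro: subset_insertI)+
  \<comment> \<open>The delicate case is that either copy of \<open>e\<close> alone suffices: two
    independent copies then give \<open>2 * p * (1 - p) + p * p\<close>, and this dominates
    \<open>p\<close> by the inequality here.\<close>
  have pp: "p * p \<le> p" using assms(2,3) mult_left_mono[of p 1 p] by simp
  show "(1 - p) * of_bool (R F G) + p * of_bool (R' F G)
   \<le> (1 - p) * ((1 - p) * of_bool (R F G) + p * of_bool (R F (insert e G)))
   + p * ((1 - p) * of_bool (R (insert e F) G) + p * of_bool (R (insert e F) (insert e G)))"
   unfolding R'_def using imp pp
   by (cases "R F G"; cases "R F (insert e G)"; cases "R (insert e F) G") (auto simp: algebra_simps)
 qed
 also have "... = expect p (insert e W) (\<lambda>F. expect p (insert e W) (\<lambda>G. of_bool (R F G)))"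
  by (simp only: expect_insert[OF insert.hyps] expect_linear) (simp add: algebra_simps)
 finally show ?case .
qed

section \<open>Splitting connections at a branch vertex\<close>

lemma component_insert_edge:
 assumes "i \<in> component (insert {v, y} F) v"
 shows "i \<in> component F v \<or> i \<in> component F y"
 using assms
proof (induction rule: component_induct)
 case (step a b)
 show ?case
 proof (cases "{a, b} \<in> F")
  case True
  then show ?thesis using step by (auto intro: component_step)
 next
  case False
  then have "b = v \<or> b = y" using step by (auto simp: doubleton_eq_iff)
  then show ?thesis by auto
 qed
qed auto

text \<open>Walking from \<open>v\<close> inside \<open>F\<close> until the first vertex \<open>z\<close> at which the targets \<open>I\<close> split.\<close>

lemma connection_split:
 assumes "finite F" "\<And>e. e \<in> F \<Longrightarrow> \<exists>x y. e = {x, y} \<and> x \<noteq> y" "I \<subseteq> component F v" "finite I" "2 \<le> card I"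
 shows "\<exists>z J F0 F1 F2. J \<noteq> {} \<and> J \<subset> I \<and> F0 \<subseteq> F \<and> F1 \<subseteq> F \<and> F2 \<subseteq> F \<and>
  F0 \<inter> F1 = {} \<and> F0 \<inter> F2 = {} \<and> F1 \<inter> F2 = {} \<and>
  z \<in> component F0 v \<and> J \<subseteq> component F1 z \<and> I - J \<subseteq> component F2 z"
 using assms(1,2,3)
proof (induction "card F" arbitrary: F v rule: less_induct)
 case less
 show ?case
 proof (cases "v \<in> I")
  case True
  \<comment> \<open>The walk ends at once: \<open>z = v\<close> and \<open>J = {v}\<close> need no
    edges, and all of \<open>F\<close> serves the other targets.\<close>
  then have "{v} \<subset> I" using assms(5) by (metis card_1_singleton_iff empty_subsetI insert_subset numeral_le_one_iff psubsetI One_nat_def semiring_norm(69))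
  then show ?thesis using less.prems
   by (intro exI[of _ v] exI[of _ "{v}"] exI[of _ "{}"] exI[of _ "{}"] exI[of _ F]) auto
 next
  case vI: False
  obtain y where y: "{v, y} \<in> F" "y \<noteq> v"
  proof -
   obtain i where i: "i \<in> I" using assms(5) by fastforce
   have "\<not> component F v \<subseteq> {v}" using i vI less.prems by auto
   then have "\<exists>y. {v, y} \<in> F \<and> y \<noteq> v" using component_closed[of v "{v}" F] by auto
   then show ?thesis using that by auto
  qed
  define F' where "F' = F - {{v, y}}"
  have F': "finite F'" "F' \<subseteq> F" "{v, y} \<notin> F'" "F = insert {v, y} F'" using less.prems(1) y by (auto simp: F'_def)
  have card': "card F' < card F" using less.prems(1) y unfolding F'_def by (intro psubset_card_mono) auto
  have ed': "\<And>e. e \<in> F' \<Longrightarrow> \<exists>x y. e = {x, y} \<and> x \<noteq> y" using less.prems(2) F' by auto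
  define C where "C = component F' v"
  have cov: "i \<in> C \<or> i \<in> component F' y" if "i \<in> I" for i
   using component_insert_edge[of i v y F'] that less.prems(3) F'(4) by (auto simp: C_def)
  consider "I \<subseteq> C" | "I \<subseteq> component F' y" | "I \<inter> C \<noteq> {}" "\<not> I \<subseteq> C" using cov by blast
  then show ?thesis
  proof cases
   case 1
   from less.hyps[OF card' F'(1) ed'] 1 obtain z J F0 F1 F2 where
    *: "J \<noteq> {}" "J \<subset> I" "F0 \<subseteq> F'" "F1 \<subseteq> F'" "F2 \<subseteq> F'" "F0 \<inter> F1 = {}" "F0 \<inter> F2 = {}" "F1 \<inter> F2 = {}"
    "z \<in> component F0 v" "J \<subseteq> component F1 z" "I - J \<subseteq> component F2 z"
    unfolding C_def by metis
   have "F0 \<subseteq> F" "F1 \<subseteq> F" "F2 \<subseteq> F"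
    using F'(2) *(3-5) by blast+
   then show ?thesis using *(1,2,6-11)
    by (intro exI[of _ z] exI[of _ J] exI[of _ F0] exI[of _ F1] exI[of _ F2] conjI)
  next
   case 2
   from less.hyps[OF card' F'(1) ed'] 2 obtain z J F0 F1 F2 where
    *: "J \<noteq> {}" "J \<subset> I" "F0 \<subseteq> F'" "F1 \<subseteq> F'" "F2 \<subseteq> F'" "F0 \<inter> F1 = {}" "F0 \<inter> F2 = {}" "F1 \<inter> F2 = {}"
    "z \<in> component F0 y" "J \<subseteq> component F1 z" "I - J \<subseteq> component F2 z"
    by metis
   \<comment> \<open>The removed edge is put in front of the stem \<open>F0\<close>.\<close>
   have "y \<in> component (insert {v, y} F0) v" by (rule component_step[OF component_self]) auto
   moreover have "z \<in> component (insert {v, y} F0) y" using *(9) component_mono[of F0 "insert {v, y} F0" y] by auto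
   ultimately have "z \<in> component (insert {v, y} F0) v" by (rule component_trans)
   moreover have "insert {v, y} F0 \<inter> F1 = {}" "insert {v, y} F0 \<inter> F2 = {}"
    using F'(3) *(4-7) by blast+
   moreover have "insert {v, y} F0 \<subseteq> F" "F1 \<subseteq> F" "F2 \<subseteq> F"
    using F'(2) y(1) *(3-5) by blast+
   ultimately show ?thesis using *(1,2,8,10,11)
    by (intro exI[of _ z] exI[of _ J] exI[of _ "insert {v, y} F0"] exI[of _ F1] exI[of _ F2] conjI)
  next
   case 3
   \<comment> \<open>The targets split at \<open>v\<close> itself. Those in \<open>C\<close> are
     reached by edges inside \<open>C\<close>, the others by \<open>{v, y}\<close> followed by edges
     avoiding \<open>C\<close>, so the two edge sets are disjoint.\<close>
   define F1 where "F1 = {f \<in> F'. f \<subseteq> C}"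
   define F2 where "F2 = insert {v, y} (del F' C)"
   have yC: "y \<notin> C"
   proof
    assume "y \<in> C"
    then have "component F' y = C" unfolding C_def by (rule component_eq)
    then show False using 3 cov by auto
   qed
   have disj: "component F' y \<inter> C = {}"
    using yC component_eq[of _ F' v] component_eq[of _ F' y] unfolding C_def by (metis component_self disjoint_iff)
   have "component F' v = C" by (simp add: C_def)
   then have C1: "component F1 v = C"
    using component_eq_iff[of v C F'] ed' unfolding F1_def by (metis C_def component_self)
   have sub2: "component F' y \<subseteq> component F2 v"
   proof
    fix w assume "w \<in> component F' y"
    then have "w \<in> component (del F' C) y"
    proof (induction rule: component_induct)
     case (step a b)
     then have "b \<in> component F' y" by (auto intro: component_step)
     then have "{a, b} \<in> del F' C" using step disj by (auto simp: del_def)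
     then show ?case using step by (auto intro: component_step)
    qed auto
    then have "w \<in> component F2 y" using component_mono[of "del F' C" F2 y] by (auto simp: F2_def)
    moreover have "y \<in> component F2 v" by (rule component_step[OF component_self]) (auto simp: F2_def)
    ultimately show "w \<in> component F2 v" by (blast intro: component_trans)
   qed
   have "F1 \<inter> F2 = {}" unfolding F1_def F2_def del_def using F'(3) ed' by fastforce
   moreover have "I \<inter> C \<subset> I" using 3 by auto
   moreover have "F1 \<subseteq> F" "F2 \<subseteq> F" using F' by (auto simp: F1_def F2_def del_def)
   moreover have "I - I \<inter> C \<subseteq> component F2 v" using cov sub2 by auto
   ultimately show ?thesis using 3 C1
    by (intro exI[of _ v] exI[of _ "I \<inter> C"] exI[of _ "{}"] exI[of _ F1] exI[of _ F2]) auto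
  qed
 qed
qed

context perc
begin

lemma prob_finite_config:
 assumes L: "finite W" "W \<subseteq> E" and p: "0 \<le> p" "p \<le> 1"
 shows "\<P>(U in PU. Q (opn E p U \<inter> W)) = expect p W (\<lambda>F. of_bool (Q F))"
proof -
 have eq: "opn E p U \<inter> W = F \<longleftrightarrow> (\<forall>e\<in>W. U e \<in> (if e \<in> F then {..p} else {p<..}))" if "F \<subseteq> W" for F U
  using that L(2) by (auto simp: opn_def split: if_splits)
 have one: "\<P>(U in PU. opn E p U \<inter> W = F) = wt p W F" if F: "F \<subseteq> W" for F
 proof -
  have "\<P>(U in PU. opn E p U \<inter> W = F) = (\<Prod>e\<in>W. measure unif (if e \<in> F then {..p} else {p<..}))"
   unfolding eq[OF F] by (rule prob_coords[OF L]) auto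
  also have "... = (\<Prod>e\<in>W. if e \<in> F then p else 1 - p)"
   using measure_unif_le[OF p] measure_unif_gt[OF p] by (intro prod.cong) auto
  also have "... = wt p W F"
   using L F by (simp add: prod.If_cases wt_def Int_absorb1 Diff_eq)
  finally show ?thesis .
 qed
 have sets: "{U \<in> space PU. opn E p U \<inter> W = F} \<in> sets PU" if "F \<subseteq> W" for F
 proof -
  have "Measurable.pred PU (\<lambda>U. \<forall>e\<in>W. U e \<in> (if e \<in> F then {..p} else {p<..}))"
  proof (rule pred_countable_all)
   fix e assume "e \<in> W"
   then have [measurable]: "(\<lambda>U. U e) \<in> borel_measurable PU" using L measurable_coord by auto
   show "Measurable.pred PU (\<lambda>U. U e \<in> (if e \<in> F then {..p} else {p<..}))"
    by (cases "e \<in> F") auto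
  qed (use L in \<open>simp add: countable_finite\<close>)
  then show ?thesis unfolding eq[OF that] by simp
 qed
 have "{U \<in> space PU. Q (opn E p U \<inter> W)} = (\<Union>F\<in>{F\<in>Pow W. Q F}. {U \<in> space PU. opn E p U \<inter> W = F})"
  by auto
 also have "measure PU ... = (\<Sum>F\<in>{F\<in>Pow W. Q F}. \<P>(U in PU. opn E p U \<inter> W = F))"
  using L(1) sets by (intro PU.finite_measure_finite_Union) (auto simp: disjoint_family_on_def)
 also have "... = (\<Sum>F\<in>{F\<in>Pow W. Q F}. wt p W F)" by (intro sum.cong) (auto simp: one)
 also have "... = (\<Sum>F\<in>Pow W. if Q F then wt p W F else 0)"
  using L(1) by (intro sum.inter_filter) auto
 also have "... = expect p W (\<lambda>F. of_bool (Q F))"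
  unfolding expect_def by (intro sum.cong) auto
 finally show ?thesis .
qed

definition FE :: "'a set set set" where
 "FE = {D. finite D \<and> D \<subseteq> E}"

lemma countable_FE: "countable FE"
 unfolding FE_def by (rule countable_Collect_finite_subset[OF countable_E])

lemma pred_subset_opn [measurable]: "D \<in> FE \<Longrightarrow> Measurable.pred PU (\<lambda>U. D \<subseteq> opn E p U)"
 unfolding subset_iff by (intro pred_countable_all[unfolded Ball_def]) (auto simp: FE_def countable_finite)

text \<open>An increasing event is represented by a family of finite witnesses. Disjoint occurrence
  is then described by such a family again, \<open>disj A B\<close>, and the BK inequality can be
  iterated.\<close>

definition occ :: "'a set set set \<Rightarrow> 'a set set \<Rightarrow> bool" where
 "occ A F \<longleftrightarrow> (\<exists>D\<in>A. D \<subseteq> F)"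

definition disj :: "'a set set set \<Rightarrow> 'a set set set \<Rightarrow> 'a set set set" where
 "disj A B = {D \<union> D' | D D'. D \<in> A \<and> D' \<in> B \<and> D \<inter> D' = {}}"

lemma disj_FE: "A \<subseteq> FE \<Longrightarrow> B \<subseteq> FE \<Longrightarrow> disj A B \<subseteq> FE"
 by (auto simp: disj_def FE_def)

lemma pred_occ [measurable]: "A \<subseteq> FE \<Longrightarrow> Measurable.pred PU (\<lambda>U. occ A (opn E p U))"
 unfolding occ_def
 by (intro pred_countable_ex countable_subset[OF _ countable_FE] pred_subset_opn) auto

lemma edges_exhaustion:
 obtains W :: "nat \<Rightarrow> 'a set set" where "\<And>n. W n \<in> FE" "incseq W" "\<And>D. D \<in> FE \<Longrightarrow> \<exists>n. D \<subseteq> W n"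
proof
 define f where "f = to_nat_on E"
 have inj: "inj_on f E" unfolding f_def using countable_E by (rule inj_on_to_nat_on)
 let ?L = "\<lambda>n. {e \<in> E. f e \<le> n}"
 show "?L n \<in> FE" for n
 proof -
  have "finite (f ` ?L n)" by (rule finite_subset[of _ "{..n}"]) auto
  then have "finite (?L n)" using inj by (auto dest: finite_imageD intro: inj_on_subset)
  then show ?thesis by (auto simp: FE_def)
 qed
 show "incseq ?L" by (auto simp: incseq_def)
 show "\<exists>n. D \<subseteq> ?L n" if "D \<in> FE" for D
 proof (intro exI subsetI)
  fix e assume "e \<in> D"
  then show "e \<in> ?L (Max (f ` D))" using that by (auto simp: FE_def)
 qed
qed

text \<open>Witnesses of disjoint occurrence are finite, so the events restricted to an exhaustion
  by finite edge sets increase to the full one, and the finite inequality passes to the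
  limit.\<close>

theorem BK:
 assumes A: "A \<subseteq> FE" and B: "B \<subseteq> FE" and p: "0 \<le> p" "p \<le> 1"
 shows "\<P>(U in PU. occ (disj A B) (opn E p U)) \<le>
  \<P>(U in PU. occ A (opn E p U)) * \<P>(U in PU. occ B (opn E p U))"
proof -
 obtain W where L: "\<And>n. W n \<in> FE" "incseq W" "\<And>D. D \<in> FE \<Longrightarrow> \<exists>n. D \<subseteq> W n"
  using edges_exhaustion by blast
 let ?S = "\<lambda>n. {U \<in> space PU. occ (disj A B) (opn E p U \<inter> W n)}"
 have fin: "finite (W n)" "W n \<subseteq> E" for n using L(1)[of n] by (auto simp: FE_def)
 have occ_mono: "occ X F \<Longrightarrow> F \<subseteq> F' \<Longrightarrow> occ X F'" for X F F' by (auto simp: occ_def)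
 have occ_filter: "occ X (F \<inter> W n) \<longleftrightarrow> occ {D \<in> X. D \<subseteq> W n} F" for X F n by (auto simp: occ_def)
 have Sm: "?S n \<in> sets PU" for n
  unfolding occ_filter using disj_FE[OF A B] by (intro predE pred_occ) auto
 have "(\<lambda>n. measure PU (?S n)) \<longlonglongrightarrow> measure PU (\<Union>n. ?S n)"
 proof (rule PU.finite_Lim_measure_incseq)
  show "incseq ?S" using L(2) by (auto simp: incseq_def intro: occ_mono)
 qed (use Sm in auto)
 moreover have "(\<Union>n. ?S n) = {U \<in> space PU. occ (disj A B) (opn E p U)}"
 proof (intro equalityI subsetI)
  fix U assume "U \<in> {U \<in> space PU. occ (disj A B) (opn E p U)}"
  then obtain D where D: "U \<in> space PU" "D \<in> disj A B" "D \<subseteq> opn E p U" by (auto simp: occ_def)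
  then obtain n where "D \<subseteq> W n" using L(3) disj_FE[OF A B] by blast
  then show "U \<in> (\<Union>n. ?S n)" using D by (auto simp: occ_def)
 qed (auto intro: occ_mono)
 moreover have "measure PU (?S n) \<le>
   \<P>(U in PU. occ A (opn E p U)) * \<P>(U in PU. occ B (opn E p U))" for n
 proof -
  let ?e = "expect p (W n)"
  have "measure PU (?S n) = ?e (\<lambda>F. of_bool (occ (disj A B) F))"
   by (rule prob_finite_config[OF fin p])
  also have "... = ?e (\<lambda>F. of_bool (disjointly (\<lambda>X Y. occ A X \<and> occ B Y) F))"
   unfolding expect_def
  proof (intro sum.cong refl arg_cong2[where f="(*)"] arg_cong[where f=of_bool])
   fix F
   show "occ (disj A B) F \<longleftrightarrow> disjointly (\<lambda>X Y. occ A X \<and> occ B Y) F"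
   proof
    assume "occ (disj A B) F"
    then obtain D D' where "D \<in> A" "D' \<in> B" "D \<inter> D' = {}" "D \<union> D' \<subseteq> F" by (auto simp: occ_def disj_def)
    then show "disjointly (\<lambda>X Y. occ A X \<and> occ B Y) F"
     unfolding disjointly_def occ_def by (intro exI[of _ D] exI[of _ D']) auto
   next
    assume "disjointly (\<lambda>X Y. occ A X \<and> occ B Y) F"
    then obtain X Y D D' where "X \<subseteq> F" "Y \<subseteq> F" "X \<inter> Y = {}" "D \<in> A" "D \<subseteq> X" "D' \<in> B" "D' \<subseteq> Y"
     by (auto simp: occ_def disjointly_def)
    moreover from this have "D \<union> D' \<in> disj A B"
     unfolding disj_def by (intro CollectI exI[of _ D] exI[of _ D']) auto
    ultimately show "occ (disj A B) F" unfolding occ_def by (intro bexI[of _ "D \<union> D'"]) auto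
   qed
  qed
  also have "... \<le> ?e (\<lambda>F. ?e (\<lambda>G. of_bool (occ A F \<and> occ B G)))"
   by (rule BK_relation[OF fin(1) p]) (auto intro: occ_mono)
  also have "... = ?e (\<lambda>F. of_bool (occ A F)) * ?e (\<lambda>F. of_bool (occ B F))"
  proof -
   have "?e (\<lambda>G. of_bool (occ A F \<and> occ B G)) = of_bool (occ A F) * ?e (\<lambda>G. of_bool (occ B G))" for F
    unfolding expect_def sum_distrib_left by (intro sum.cong) auto
   then show ?thesis by (simp add: expect_def sum_distrib_right mult.assoc)
  qed
  also have "... = \<P>(U in PU. occ A (opn E p U \<inter> W n)) * \<P>(U in PU. occ B (opn E p U \<inter> W n))"
   by (simp only: prob_finite_config[OF fin p])
  also have "... \<le> \<P>(U in PU. occ A (opn E p U)) * \<P>(U in PU. occ B (opn E p U))"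
   using A B by (intro mult_mono PU.finite_measure_mono) (auto intro: occ_mono)
  finally show ?thesis .
 qed
 ultimately show ?thesis by (intro LIMSEQ_le_const2) auto
qed

definition confam :: "('a set \<Rightarrow> bool) \<Rightarrow> 'a \<Rightarrow> 'a set set set" where
 "confam Q v = {D \<in> FE. Q (component D v)}"

lemma confam_FE: "confam Q v \<subseteq> FE"
 by (auto simp: confam_def)

lemma occ_confam_subset:
 assumes "F \<subseteq> E" "finite I"
 shows "occ (confam (\<lambda>C. I \<subseteq> C) v) F \<longleftrightarrow> I \<subseteq> component F v"
proof
 assume "I \<subseteq> component F v"
 from component_finite_witness[OF assms(2) this] obtain D where "finite D" "D \<subseteq> F" "I \<subseteq> component D v" by blast
 then show "occ (confam (\<lambda>C. I \<subseteq> C) v) F" using assms(1) by (auto simp: occ_def confam_def FE_def)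
next
 assume "occ (confam (\<lambda>C. I \<subseteq> C) v) F"
 then obtain D where "D \<subseteq> F" "I \<subseteq> component D v" by (auto simp: occ_def confam_def)
 then show "I \<subseteq> component F v" using component_mono[of D F v] by blast
qed

lemma occ_confam_exits:
 assumes "F \<subseteq> E"
 shows "occ (confam (\<lambda>C. \<not> C \<subseteq> W) v) F \<longleftrightarrow> \<not> component F v \<subseteq> W"
proof
 assume "\<not> component F v \<subseteq> W"
 then obtain w where w: "w \<in> component F v" "w \<notin> W" by auto
 from component_finite_witness1[OF w(1)] obtain D where "finite D" "D \<subseteq> F" "w \<in> component D v" by blast
 then show "occ (confam (\<lambda>C. \<not> C \<subseteq> W) v) F" using assms(1) w by (auto simp: occ_def confam_def FE_def)
next
 assume "occ (confam (\<lambda>C. \<not> C \<subseteq> W) v) F"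
 then obtain D where "D \<subseteq> F" "\<not> component D v \<subseteq> W" by (auto simp: occ_def confam_def)
 then show "\<not> component F v \<subseteq> W" using component_mono[of D F v] by blast
qed

definition tauI :: "real \<Rightarrow> 'a \<Rightarrow> 'a set \<Rightarrow> real" where
 "tauI p v I = \<P>(U in PU. I \<subseteq> clu p U v)"

lemma tauI_single: "tauI p v {a} = tau p v a"
 by (simp add: tauI_def tau_def)

lemma tauI_nonneg: "0 \<le> tauI p v I"
 by (simp add: tauI_def)

lemma edges_proper: "e \<in> E \<Longrightarrow> \<exists>x y. e = {x, y} \<and> x \<noteq> y"
 by (erule edgeE) auto

text \<open>Open connections from \<open>v\<close> to all of \<open>I\<close> contain three
  edge-disjoint pieces: from \<open>v\<close> to a vertex \<open>z\<close> and from \<open>z\<close>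
  to the two parts of \<open>I\<close>. Two applications of BK bound the probability for each
  \<open>z\<close> and \<open>J\<close>; the rest is a union bound.\<close>

lemma tree_graph:
 assumes v: "v \<in> V" and p: "0 \<le> p" "p \<le> 1" and I: "finite I" "I \<subseteq> V" "2 \<le> card I"
 shows "ennreal (tauI p v I) \<le> (\<integral>\<^sup>+z. ennreal (tau p v z * (\<Sum>J\<in>{J. J \<noteq> {} \<and> J \<subset> I}. tauI p z J * tauI p z (I - J))) \<partial>count_space V)"
proof -
 define fam where "fam z J = disj (confam (\<lambda>C. {z} \<subseteq> C) v) (disj (confam (\<lambda>C. J \<subseteq> C) z) (confam (\<lambda>C. I - J \<subseteq> C) z))" for z J
 have famFE: "fam z J \<subseteq> FE" for z J unfolding fam_def by (intro disj_FE confam_FE)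
 let ?JJ = "{J. J \<noteq> {} \<and> J \<subset> I}"
 let ?q = "\<lambda>z. \<Sum>J\<in>?JJ. tauI p z J * tauI p z (I - J)"
 let ?S = "\<lambda>z U. \<Sum>J\<in>?JJ. if occ (fam z J) (opn E p U) then 1 else (0::ennreal)"
 have fJ: "finite ?JJ" using I by (intro finite_subset[of ?JJ "Pow I"]) auto
 have mI: "Measurable.pred PU (\<lambda>U. I \<subseteq> clu p U v)"
  unfolding subset_iff using I by (intro pred_countable_all[unfolded Ball_def]) (auto simp: countable_finite)
 have ex: "\<exists>z\<in>V. \<exists>J\<in>?JJ. occ (fam z J) (opn E p U)" if U: "I \<subseteq> clu p U v" for U
 proof -
  from component_finite_witness[OF I(1) U] obtain D where D: "finite D" "D \<subseteq> opn E p U" "I \<subseteq> component D v" by blast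
  have DE: "D \<subseteq> E" using D opn_subset by blast
  from connection_split[OF D(1) edges_proper D(3) I(1,3)] DE
  obtain z J F0 F1 F2 where *: "J \<noteq> {}" "J \<subset> I" "F0 \<subseteq> D" "F1 \<subseteq> D" "F2 \<subseteq> D" "F0 \<inter> F1 = {}" "F0 \<inter> F2 = {}" "F1 \<inter> F2 = {}"
    "z \<in> component F0 v" "J \<subseteq> component F1 z" "I - J \<subseteq> component F2 z" by blast
  have zV: "z \<in> V" using component_subset_V[of F0 v] *(3,9) DE v by blast
  have FE: "F0 \<in> FE" "F1 \<in> FE" "F2 \<in> FE" using D(1) DE *(3-5) by (auto simp: FE_def intro: finite_subset)
  have "F1 \<union> F2 \<in> disj (confam (\<lambda>C. J \<subseteq> C) z) (confam (\<lambda>C. I - J \<subseteq> C) z)"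
   unfolding disj_def using * FE by (auto simp: confam_def)
  then have "F0 \<union> (F1 \<union> F2) \<in> fam z J"
   unfolding fam_def disj_def[of "confam (\<lambda>C. {z} \<subseteq> C) v"] using * FE
   by (intro CollectI exI[of _ F0] exI[of _ "F1 \<union> F2"]) (auto simp: confam_def)
  then have "occ (fam z J) (opn E p U)" unfolding occ_def using * D(2) by (intro bexI[of _ "F0 \<union> (F1 \<union> F2)"]) auto
  then show ?thesis using zV * by blast
 qed
 have "ennreal (tauI p v I) = (\<E> U. (if I \<subseteq> clu p U v then 1 else 0))"
  unfolding tauI_def by (rule nn_indicator_pred[OF mI, symmetric])
 also have "... \<le> (\<E> U. (\<integral>\<^sup>+z. (\<Sum>J\<in>?JJ. if occ (fam z J) (opn E p U) then 1 else 0) \<partial>count_space V))"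
 proof (rule nn_integral_mono)
  fix U
  show "(if I \<subseteq> clu p U v then 1 else 0) \<le> (\<integral>\<^sup>+z. ?S z U \<partial>count_space V)"
  proof (cases "I \<subseteq> clu p U v")
   case True
   then obtain z J where zJ: "z \<in> V" "J \<in> ?JJ" "occ (fam z J) (opn E p U)" using ex by blast
   have "1 \<le> ?S z U"
    using member_le_sum[of J ?JJ "\<lambda>J. if occ (fam z J) (opn E p U) then 1 else (0::ennreal)"] zJ fJ by simp
   also have "... = (\<integral>\<^sup>+w. ?S z U * indicator {z} w \<partial>count_space V)"
    using zJ by (simp add: nn_integral_cmult_indicator)
   also have "... \<le> (\<integral>\<^sup>+z. ?S z U \<partial>count_space V)"
    by (intro nn_integral_mono) (auto split: split_indicator)
   finally show ?thesis using True by simp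
  qed simp
 qed
 also have "... = (\<integral>\<^sup>+z. (\<E> U. (\<Sum>J\<in>?JJ. if occ (fam z J) (opn E p U) then 1 else 0)) \<partial>count_space V)"
 proof (rule nn_integral_count_space_nn_integral[OF countable_V])
  fix z
  note [measurable] = pred_occ[OF famFE]
  show "(\<lambda>U. \<Sum>J\<in>?JJ. if occ (fam z J) (opn E p U) then 1 else (0::ennreal)) \<in> borel_measurable PU" by measurable
 qed
 also have "... \<le> (\<integral>\<^sup>+z. ennreal (tau p v z * ?q z) \<partial>count_space V)"
 proof (rule nn_integral_mono)
  fix z
  note [measurable] = pred_occ[OF famFE]
  have "(\<E> U. ?S z U) = (\<Sum>J\<in>?JJ. \<E> U. (if occ (fam z J) (opn E p U) then 1 else 0))"
   by (rule nn_integral_sum) measurable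
  also have "... = (\<Sum>J\<in>?JJ. ennreal (\<P>(U in PU. occ (fam z J) (opn E p U))))"
   by (intro sum.cong refl nn_indicator_pred) measurable
  also have "... \<le> (\<Sum>J\<in>?JJ. ennreal (tau p v z * (tauI p z J * tauI p z (I - J))))"
  proof (intro sum_mono ennreal_leI)
   fix J assume J: "J \<in> ?JJ"
   then have fin: "finite J" "finite (I - J)" using I finite_subset by auto
   have "\<P>(U in PU. occ (fam z J) (opn E p U)) \<le>
     \<P>(U in PU. occ (confam (\<lambda>C. {z} \<subseteq> C) v) (opn E p U)) *
     \<P>(U in PU. occ (disj (confam (\<lambda>C. J \<subseteq> C) z) (confam (\<lambda>C. I - J \<subseteq> C) z)) (opn E p U))"
    unfolding fam_def by (intro BK disj_FE confam_FE p)
   also have "... \<le> \<P>(U in PU. occ (confam (\<lambda>C. {z} \<subseteq> C) v) (opn E p U)) *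
     (\<P>(U in PU. occ (confam (\<lambda>C. J \<subseteq> C) z) (opn E p U)) *
     \<P>(U in PU. occ (confam (\<lambda>C. I - J \<subseteq> C) z) (opn E p U)))"
    by (intro mult_left_mono BK confam_FE p) auto
   also have "... = tau p v z * (tauI p z J * tauI p z (I - J))"
    using fin occ_confam_subset[OF opn_subset[of E p], of "{z}" v]
    by (simp add: occ_confam_subset[OF opn_subset] tau_def tauI_def)
   finally show "\<P>(U in PU. occ (fam z J) (opn E p U)) \<le> tau p v z * (tauI p z J * tauI p z (I - J))" .
  qed
  also have "... = ennreal (tau p v z * ?q z)"
   using tau_bounds tauI_nonneg by (subst sum_ennreal) (auto simp: sum_distrib_left)
  finally show "(\<E> U. ?S z U) \<le> ennreal (tau p v z * ?q z)" .
 qed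
 finally show ?thesis .
qed

end

section \<open>Subcritical moments\<close>

lemma sum_Pow_power:
 assumes "finite N"
 shows "(\<Sum>A\<in>Pow N. (t::real) ^ card A) = (1 + t) ^ card N"
 using assms
proof (induction N)
 case (insert x N)
 have inj: "inj_on (insert x) (Pow N)" using insert by (auto intro!: inj_onI dest!: insert_ident[THEN iffD1, rotated 2])
 have "(\<Sum>A\<in>Pow (insert x N). t ^ card A) = (\<Sum>A\<in>Pow N. t ^ card A) + (\<Sum>A\<in>insert x ` Pow N. t ^ card A)"
  unfolding Pow_insert using insert by (intro sum.union_disjoint) auto
 also have "(\<Sum>A\<in>insert x ` Pow N. t ^ card A) = (\<Sum>A\<in>Pow N. t * t ^ card A)"
 proof (subst sum.reindex[OF inj], rule sum.cong)
  fix A assume "A \<in> Pow N"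
  then have "finite A" "x \<notin> A" using insert finite_subset by auto
  then show "((\<lambda>A. t ^ card A) \<circ> insert x) A = t * t ^ card A" by simp
 qed simp
 finally show ?case using insert by (simp add: sum_distrib_left[symmetric] algebra_simps)
qed simp

text \<open>The constant term and the term of order \<open>k\<close> of the exponential series
  together are at most \<open>exp (t / 2 * n)\<close>, hence at most \<open>(1 + t) ^ n\<close>.
  Isolating the constant term leaves \<open>(1 + t) ^ n - 1\<close>, whose expectation will be small
  with \<open>t\<close>.\<close>

lemma power_le_fact_mult_power:
 assumes t: "0 < t" "t \<le> 1" and k: "1 \<le> k"
 shows "real n ^ k \<le> fact k * (2 / t) ^ k * ((1 + t) ^ n - 1)"
proof -
 have t2: "t / 2 \<le> ln (1 + t)"
 proof -
  have tt: "t * t \<le> t" using t by (intro mult_left_le) auto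
  have "exp (t / 2) \<le> 1 + t / 2 + (t / 2)\<^sup>2" using t by (intro exp_bound) auto
  also have "... = 1 + t / 2 + t * t / 4" by (simp add: power2_eq_square)
  also have "... \<le> 1 + t" using t tt by linarith
  finally show ?thesis using t by (subst ln_ge_iff) auto
 qed
 define x where "x = t / 2 * n"
 have x: "0 \<le> x" using t by (simp add: x_def)
 have sm: "summable (\<lambda>i. x ^ i / fact i)"
  using summable_exp[of x] by (simp add: divide_inverse mult.commute)
 have ex: "exp x = (\<Sum>i. x ^ i / fact i)"
  unfolding exp_def by (simp add: divide_inverse mult.commute)
 have "(t / 2 * n) ^ k / fact k + 1 = (\<Sum>i\<in>{0, k}. x ^ i / fact i)"
  using k by (simp add: x_def)
 also have "... \<le> (\<Sum>i. x ^ i / fact i)"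
  by (rule sum_le_suminf[OF sm]) (use x in auto)
 also have "... = exp (t / 2 * n)" unfolding ex[symmetric] by (simp add: x_def)
 also have "... \<le> exp (ln (1 + t) * n)" using mult_right_mono[OF t2, of "real n"] by simp
 also have "... = (1 + t) ^ n" using t by (simp add: exp_of_nat2_mult)
 finally have "(t / 2 * n) ^ k \<le> fact k * ((1 + t) ^ n - 1)" by (simp add: field_simps)
 then have "(2 / t) ^ k * (t / 2 * n) ^ k \<le> (2 / t) ^ k * (fact k * ((1 + t) ^ n - 1))"
  using t by (intro mult_left_mono) auto
 moreover have "(2 / t) ^ k * (t / 2 * n) ^ k = real n ^ k"
  using t by (simp flip: power_mult_distrib)
 ultimately show ?thesis by (simp add: ac_simps)
qed

context perc
begin

lemma chi_eq_sum:
 assumes v: "v \<in> V"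
 shows "chi p v = (\<integral>\<^sup>+z. ennreal (tau p v z) \<partial>count_space V)"
proof -
 have "chi p v = (\<E> U. (\<integral>\<^sup>+z. (if z \<in> clu p U v then 1 else 0) \<partial>count_space V))"
  unfolding chi_def
 proof (rule nn_integral_cong)
  fix U
  have sub: "clu p U v \<subseteq> V" by (rule component_subset_V[OF opn_subset v])
  have "(\<integral>\<^sup>+z. (if z \<in> clu p U v then 1 else 0) \<partial>count_space V) =
    (\<integral>\<^sup>+z. indicator (clu p U v) z \<partial>count_space V)"
   by (rule nn_integral_cong) (auto split: split_indicator)
  also have "... = emeasure (count_space V) (clu p U v)" using sub by simp
  finally show "(if finite (K p U {} v) then ennreal (real (card (K p U {} v))) else \<infinity>) = (\<integral>\<^sup>+z. (if z \<in> clu p U v then 1 else 0) \<partial>count_space V)"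
   using sub by (simp add: emeasure_count_space ennreal_of_nat_eq_real_of_nat)
 qed
 also have "... = (\<integral>\<^sup>+z. (\<E> U. (if z \<in> clu p U v then 1 else 0)) \<partial>count_space V)"
  by (rule nn_integral_count_space_nn_integral[OF countable_V]) measurable
 also have "... = (\<integral>\<^sup>+z. ennreal (tau p v z) \<partial>count_space V)"
  by (intro nn_integral_cong) (simp add: nn_indicator_pred tau_def)
 finally show ?thesis .
qed

lemma sum_tau_le_chi:
 assumes v: "v \<in> V" and W: "W \<in> FS"
 shows "ennreal (\<Sum>a\<in>W. tau p v a) \<le> chi p v"
proof -
 have "ennreal (\<Sum>a\<in>W. tau p v a) = (\<Sum>a\<in>W. ennreal (tau p v a))"
  using tau_bounds by (intro sum_ennreal[symmetric]) auto
 also have "... = (\<integral>\<^sup>+a. ennreal (tau p v a) \<partial>count_space W)"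
  using W by (intro nn_integral_count_space_finite[symmetric]) (auto simp: FS_def)
 also have "... = (\<integral>\<^sup>+a. ennreal (tau p v a) * indicator W a \<partial>count_space UNIV)"
  by (rule nn_integral_count_space_indicator) simp
 also have "... \<le> (\<integral>\<^sup>+a. ennreal (tau p v a) * indicator V a \<partial>count_space UNIV)"
  using W by (intro nn_integral_mono) (auto simp: FS_def split: split_indicator)
 also have "... = (\<integral>\<^sup>+a. ennreal (tau p v a) \<partial>count_space V)"
  by (rule nn_integral_count_space_indicator[symmetric]) simp
 finally show ?thesis by (simp add: chi_eq_sum[OF v])
qed

text \<open>For sums truncated at sets of size \<open>k\<close>, the tree graph bound gives the
  recursion from \<open>g\<close> to \<open>t * \<xi> + \<xi> * g\<^sup>2\<close>. It preserves the
  bound \<open>2 * t * \<xi>\<close> as long as \<open>4 * t * \<xi>\<^sup>2 \<le> 1\<close>; the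
  truncation is what makes an induction possible.\<close>

lemma exponential_moment_step:
 assumes p: "0 \<le> p" "p \<le> 1" and chi: "\<And>v. v \<in> V \<Longrightarrow> chi p v \<le> ennreal \<xi>" "0 < \<xi>"
  and t: "0 \<le> t" "4 * t * \<xi>\<^sup>2 \<le> 1" and W: "W \<in> FS" and v: "v \<in> V"
 shows "(\<Sum>A\<in>{A. A \<subseteq> W \<and> 1 \<le> card A \<and> card A \<le> k}. t ^ card A * tauI p v A) \<le> 2 * t * \<xi>"
 using v
proof (induction k arbitrary: v)
 case 0
 have e: "{A. A \<subseteq> W \<and> 1 \<le> card A \<and> card A \<le> 0} = {}" by auto
 show ?case unfolding e using t chi by simp
next
 case (Suc k)
 have fL: "finite W" "W \<subseteq> V" using W by (auto simp: FS_def)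
 define S where "S = {A. A \<subseteq> W \<and> 1 \<le> card A \<and> card A \<le> k}"
 define T where "T = {A. A \<subseteq> W \<and> 2 \<le> card A \<and> card A \<le> Suc k}"
 have fS: "finite S" "finite T" using fL(1) by (auto simp: S_def T_def)
 define Y where "Y z = (\<Sum>A\<in>S. t ^ card A * tauI p z A)" for z
 have Y: "0 \<le> Y z" "z \<in> V \<Longrightarrow> Y z \<le> 2 * t * \<xi>" for z
  using t Suc.IH[of z] by (auto simp: Y_def S_def tauI_nonneg intro!: sum_nonneg)
 let ?JJ = "\<lambda>A. {J. J \<noteq> {} \<and> J \<subset> A}"
 let ?j = "\<lambda>z A. \<Sum>J\<in>?JJ A. tauI p z J * tauI p z (A - J)"
 \<comment> \<open>The map from \<open>(A, J)\<close> to \<open>(J, A - J)\<close> is injective, so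
   the double sum is a part of the square. Proper nonempty parts of \<open>A\<close> have at most
   \<open>k\<close> elements.\<close>
 have pairs: "(\<Sum>A\<in>T. \<Sum>J\<in>?JJ A. t ^ card A * (tauI p z J * tauI p z (A - J))) \<le> (Y z)\<^sup>2" for z
 proof -
  let ?g = "\<lambda>(J, L). (t ^ card J * tauI p z J) * (t ^ card L * tauI p z L)"
  let ?m = "\<lambda>(A, J). (J, A - J)"
  have "(\<Sum>A\<in>T. \<Sum>J\<in>?JJ A. t ^ card A * (tauI p z J * tauI p z (A - J))) = (\<Sum>(A, J)\<in>Sigma T ?JJ. t ^ card A * (tauI p z J * tauI p z (A - J)))"
   using fS(2) fL(1) by (intro sum.Sigma) (auto simp: T_def intro!: finite_subset[of "?JJ _" "Pow W"])
  also have "... = (\<Sum>x\<in>Sigma T ?JJ. ?g (?m x))"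
  proof (intro sum.cong refl)
   fix x assume "x \<in> Sigma T ?JJ"
   then obtain A J where x: "x = (A, J)" "A \<in> T" "J \<subset> A" by auto
   then have fin: "finite A" using fL(1) by (auto simp: T_def intro: finite_subset)
   then have "card A = card J + card (A - J)" using x card_mono[of A J] by (subst card_Diff_subset) (auto intro: finite_subset)
   then show "(case x of (A, J) \<Rightarrow> t ^ card A * (tauI p z J * tauI p z (A - J))) = ?g (?m x)"
    using x by (simp add: power_add ac_simps)
  qed
  also have "... = (\<Sum>y\<in>?m ` Sigma T ?JJ. ?g y)"
   by (subst sum.reindex) (auto intro!: inj_onI)
  also have "... \<le> (\<Sum>y\<in>S \<times> S. ?g y)"
  proof (rule sum_mono2)
   show "?m ` Sigma T ?JJ \<subseteq> S \<times> S"
   proof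
    fix y assume "y \<in> ?m ` Sigma T ?JJ"
    then obtain A J where y: "y = (J, A - J)" "A \<in> T" "J \<noteq> {}" "J \<subset> A" by auto
    have fin: "finite A" "finite J" "finite (A - J)" using y fL(1) by (auto simp: T_def intro: finite_subset)
    have "card J < card A" using y fin by (intro psubset_card_mono) auto
    moreover have "card (A - J) < card A" using y fin by (intro psubset_card_mono) auto
    moreover have "card J \<noteq> 0" "card (A - J) \<noteq> 0" using y fin by auto
    ultimately show "y \<in> S \<times> S" using y by (auto simp: S_def T_def)
   qed
  qed (use fS t in \<open>auto simp: tauI_nonneg\<close>)
  also have "... = (Y z)\<^sup>2" by (simp add: Y_def power2_eq_square sum_product sum.cartesian_product)
  finally show ?thesis .
 qed
 have "ennreal (\<Sum>A\<in>T. t ^ card A * tauI p v A) = (\<Sum>A\<in>T. ennreal (t ^ card A) * ennreal (tauI p v A))"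
  using t by (subst sum_ennreal[symmetric]) (auto simp: tauI_nonneg ennreal_mult)
 also have "... \<le> (\<Sum>A\<in>T. ennreal (t ^ card A) * (\<integral>\<^sup>+z. ennreal (tau p v z * ?j z A) \<partial>count_space V))"
 proof (intro sum_mono mult_left_mono)
  fix A assume "A \<in> T"
  then show "ennreal (tauI p v A) \<le> (\<integral>\<^sup>+z. ennreal (tau p v z * ?j z A) \<partial>count_space V)"
   using fL by (intro tree_graph Suc.prems p) (auto simp: T_def intro: finite_subset)
 qed simp
 also have "... = (\<integral>\<^sup>+z. (\<Sum>A\<in>T. ennreal (t ^ card A) * ennreal (tau p v z * ?j z A)) \<partial>count_space V)"
  by (simp add: nn_integral_sum nn_integral_cmult)
 also have "... \<le> (\<integral>\<^sup>+z. ennreal (tau p v z) * ennreal ((2 * t * \<xi>)\<^sup>2) \<partial>count_space V)"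
 proof (rule nn_integral_mono)
  fix z assume "z \<in> space (count_space V)"
  then have z: "z \<in> V" by simp
  have nn: "0 \<le> ?j z A" for A by (intro sum_nonneg) (simp add: tauI_nonneg)
  have "(\<Sum>A\<in>T. ennreal (t ^ card A) * ennreal (tau p v z * ?j z A)) =
    (\<Sum>A\<in>T. ennreal (t ^ card A * (tau p v z * ?j z A)))"
   using t tau_bounds nn by (intro sum.cong refl ennreal_mult[symmetric]) auto
  also have "... = ennreal (\<Sum>A\<in>T. t ^ card A * (tau p v z * ?j z A))"
   using t tau_bounds nn by (intro sum_ennreal) auto
  also have "(\<Sum>A\<in>T. t ^ card A * (tau p v z * ?j z A)) =
    tau p v z * (\<Sum>A\<in>T. \<Sum>J\<in>?JJ A. t ^ card A * (tauI p z J * tauI p z (A - J)))"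
   by (simp add: sum_distrib_left ac_simps)
  also have "... \<le> tau p v z * (2 * t * \<xi>)\<^sup>2"
   using pairs[of z] power_mono[OF Y(2)[OF z] Y(1), of 2] tau_bounds by (intro mult_left_mono) auto
  finally show "(\<Sum>A\<in>T. ennreal (t ^ card A) * ennreal (tau p v z * ?j z A)) \<le> ennreal (tau p v z) * ennreal ((2 * t * \<xi>)\<^sup>2)"
   using tau_bounds by (simp add: ennreal_leI flip: ennreal_mult)
 qed
 also have "... = chi p v * ennreal ((2 * t * \<xi>)\<^sup>2)"
  by (simp add: nn_integral_multc chi_eq_sum[OF Suc.prems])
 also have "... \<le> ennreal \<xi> * ennreal ((2 * t * \<xi>)\<^sup>2)" using chi(1)[OF Suc.prems] by (intro mult_right_mono) auto
 also have "... = ennreal (\<xi> * (2 * t * \<xi>)\<^sup>2)" using chi(2) by (simp add: ennreal_mult)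
 finally have "(\<Sum>A\<in>T. t ^ card A * tauI p v A) \<le> \<xi> * (2 * t * \<xi>)\<^sup>2"
  using chi(2) by (subst (asm) ennreal_le_iff) auto
 also have "... = t * \<xi> * (4 * t * \<xi>\<^sup>2)" by (simp add: power2_eq_square)
 also have "... \<le> t * \<xi> * 1" using t chi(2) by (intro mult_left_mono) auto
 finally have 1: "(\<Sum>A\<in>T. t ^ card A * tauI p v A) \<le> t * \<xi>" by simp
 have "ennreal (\<Sum>a\<in>W. tau p v a) \<le> ennreal \<xi>"
  using sum_tau_le_chi[OF Suc.prems W] chi(1)[OF Suc.prems] by (rule order_trans)
 then have "t * (\<Sum>a\<in>W. tau p v a) \<le> t * \<xi>"
  using chi(2) t by (intro mult_left_mono) (auto simp: ennreal_le_iff)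
 moreover have "(\<Sum>A\<in>(\<lambda>a. {a}) ` W. t ^ card A * tauI p v A) = t * (\<Sum>a\<in>W. tau p v a)"
  by (subst sum.reindex) (auto simp: tauI_single sum_distrib_left)
 moreover have "{A. A \<subseteq> W \<and> 1 \<le> card A \<and> card A \<le> Suc k} = (\<lambda>a. {a}) ` W \<union> T"
 proof (intro equalityI subsetI)
  fix A assume A: "A \<in> {A. A \<subseteq> W \<and> 1 \<le> card A \<and> card A \<le> Suc k}"
  show "A \<in> (\<lambda>a. {a}) ` W \<union> T"
  proof (cases "card A = 1")
   case True
   then obtain a where "A = {a}" by (auto simp: card_1_singleton_iff)
   then show ?thesis using A by auto
  qed (use A in \<open>auto simp: T_def\<close>)
 qed (auto simp: T_def)
 moreover have "(\<lambda>a. {a}) ` W \<inter> T = {}" by (auto simp: T_def)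
 ultimately show ?case using 1 fL(1) fS by (simp add: sum.union_disjoint)
qed

lemma pred_subset_component: "finite I \<Longrightarrow> Measurable.pred PU (\<lambda>U. I \<subseteq> clu p U v)"
 unfolding subset_iff by (intro pred_countable_all[unfolded Ball_def]) (auto simp: countable_finite)

text \<open>\<open>(1 + t) ^ n - 1\<close> is the sum of \<open>t ^ card A\<close> over the nonempty
  subsets of a set of size \<open>n\<close>. Applied to the part of the cluster in \<open>W\<close>,
  its expectation is the sum of \<open>t ^ card A * tauI p v A\<close>.\<close>

lemma exponential_moment_finite:
 assumes p: "0 \<le> p" "p \<le> 1" and chi: "\<And>v. v \<in> V \<Longrightarrow> chi p v \<le> ennreal \<xi>" "0 < \<xi>"
  and t: "0 \<le> t" "4 * t * \<xi>\<^sup>2 \<le> 1" and W: "W \<in> FS" and v: "v \<in> V"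
 shows "(\<E> U. ennreal ((1 + t) ^ card (clu p U v \<inter> W) - 1)) \<le> ennreal (2 * t * \<xi>)"
proof -
 have fL: "finite W" using W by (auto simp: FS_def)
 let ?P = "Pow W - {{}}"
 have pt: "ennreal ((1 + t) ^ card (clu p U v \<inter> W) - 1) =
   (\<Sum>A\<in>?P. ennreal (t ^ card A) * (if A \<subseteq> clu p U v then 1 else 0))" for U
 proof -
  let ?N = "clu p U v \<inter> W"
  have fN: "finite ?N" using fL by auto
  have "(1 + t) ^ card ?N - 1 = (\<Sum>A\<in>Pow ?N. t ^ card A) - 1" by (simp only: sum_Pow_power[OF fN])
  also have "... = (\<Sum>A\<in>Pow ?N - {{}}. t ^ card A)" using fN by (subst sum_diff1) (auto simp del: Pow_Int_eq)
  also have "Pow ?N - {{}} = {A \<in> ?P. A \<subseteq> clu p U v}" by auto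
  also have "(\<Sum>A\<in>.... t ^ card A) = (\<Sum>A\<in>?P. if A \<subseteq> clu p U v then t ^ card A else 0)"
   using fL by (intro sum.inter_filter) auto
  finally have "ennreal ((1 + t) ^ card ?N - 1) = ennreal (\<Sum>A\<in>?P. if A \<subseteq> clu p U v then t ^ card A else 0)" by simp
  also have "... = (\<Sum>A\<in>?P. ennreal (if A \<subseteq> clu p U v then t ^ card A else 0))"
   using t by (intro sum_ennreal[symmetric]) auto
  also have "... = (\<Sum>A\<in>?P. ennreal (t ^ card A) * (if A \<subseteq> clu p U v then 1 else 0))"
   by (intro sum.cong) auto
  finally show ?thesis .
 qed
 have m: "(\<lambda>U. (if A \<subseteq> clu p U v then 1 else 0 :: ennreal)) \<in> borel_measurable PU" if "A \<in> ?P" for A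
 proof -
  have "finite A" using that fL by (auto intro: finite_subset)
  note [measurable] = pred_subset_component[OF this]
  show ?thesis by measurable
 qed
 have "(\<E> U. ennreal ((1 + t) ^ card (clu p U v \<inter> W) - 1)) =
   (\<Sum>A\<in>?P. \<E> U. ennreal (t ^ card A) * (if A \<subseteq> clu p U v then 1 else 0))"
  unfolding pt using m by (intro nn_integral_sum) auto
 also have "... = (\<Sum>A\<in>?P. ennreal (t ^ card A * tauI p v A))"
 proof (intro sum.cong refl)
  fix A assume A: "A \<in> ?P"
  then have "finite A" using fL by (auto intro: finite_subset)
  then have "(\<E> U. (if A \<subseteq> clu p U v then 1 else 0)) = ennreal (tauI p v A)"
   unfolding tauI_def by (intro nn_indicator_pred pred_subset_component)
  then show "(\<E> U. ennreal (t ^ card A) * (if A \<subseteq> clu p U v then 1 else 0)) = ennreal (t ^ card A * tauI p v A)"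
   using t m[OF A] by (simp add: nn_integral_cmult ennreal_mult tauI_nonneg)
 qed
 also have "... = ennreal (\<Sum>A\<in>?P. t ^ card A * tauI p v A)"
  using t by (intro sum_ennreal) (auto simp: tauI_nonneg)
 also have "?P = {A. A \<subseteq> W \<and> 1 \<le> card A \<and> card A \<le> card W}"
 proof (intro equalityI subsetI)
  fix A assume A: "A \<in> ?P"
  then have "finite A" using fL by (auto intro: finite_subset)
  then have "card A \<noteq> 0" using A by auto
  then show "A \<in> {A. A \<subseteq> W \<and> 1 \<le> card A \<and> card A \<le> card W}" using A card_mono[OF fL, of A] by auto
 qed auto
 also have "ennreal (\<Sum>A\<in>.... t ^ card A * tauI p v A) \<le> ennreal (2 * t * \<xi>)"
  by (intro ennreal_leI exponential_moment_step p chi t W v)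
 finally show ?thesis .
qed

lemma vertices_exhaustion:
 obtains W :: "nat \<Rightarrow> 'a set" where "\<And>n. W n \<in> FS" "incseq W" "\<And>D. D \<in> FS \<Longrightarrow> \<exists>n. D \<subseteq> W n"
proof
 define f where "f = to_nat_on V"
 have inj: "inj_on f V" unfolding f_def using countable_V by (rule inj_on_to_nat_on)
 let ?L = "\<lambda>n. {e \<in> V. f e \<le> n}"
 show "?L n \<in> FS" for n
 proof -
  have "finite (f ` ?L n)" by (rule finite_subset[of _ "{..n}"]) auto
  then have "finite (?L n)" using inj by (auto dest: finite_imageD intro: inj_on_subset)
  then show ?thesis by (auto simp: FS_def)
 qed
 show "incseq ?L" by (auto simp: incseq_def)
 show "\<exists>n. D \<subseteq> ?L n" if "D \<in> FS" for D
 proof (intro exI subsetI)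
  fix e assume "e \<in> D"
  then show "e \<in> ?L (Max (f ` D))" using that by (auto simp: FS_def)
 qed
qed

lemma chi_ge_1: "v \<in> V \<Longrightarrow> 1 \<le> chi p v"
 using sum_tau_le_chi[of v "{v}" p] by (simp add: FS_def)

lemma chi_finite_AE:
 assumes v: "v \<in> V" and "chi p v \<le> ennreal \<xi>"
 shows "AE U in PU. finite (clu p U v)"
proof -
 have "(\<lambda>U. if finite (K p U {} v) then ennreal (real (card (K p U {} v))) else \<infinity>) \<in> borel_measurable PU"
  by (rule measurable_K_fun[OF v])
 moreover have "chi p v \<noteq> \<infinity>" using assms(2) by (auto simp: top_unique)
 ultimately have "AE U in PU. (if finite (K p U {} v) then ennreal (real (card (K p U {} v))) else \<infinity>) \<noteq> \<infinity>"
  unfolding chi_def by (intro nn_integral_PInf_AE) auto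
 then show ?thesis by eventually_elim (auto split: if_splits)
qed

lemma moment_bound:
 assumes p: "0 \<le> p" "p \<le> 1" and chi: "\<And>v. v \<in> V \<Longrightarrow> chi p v \<le> ennreal \<xi>" and v: "v \<in> V" and k: "1 \<le> k"
 shows "(\<E> U. (if finite (clu p U v) then ennreal (real (card (clu p U v)) ^ k) else 0))
  \<le> ennreal (fact k * 8 ^ k * \<xi> ^ (2 * k - 1))"
proof -
 have chi1: "1 \<le> \<xi>" using order_trans[OF chi_ge_1[OF v] chi[OF v]] by simp
 \<comment> \<open>The largest admissible value. The factor \<open>(2 / t) ^ k\<close> contributes
   \<open>(8 * \<xi>\<^sup>2) ^ k\<close> and the expectation contributes
   \<open>2 * t * \<xi> = 1 / (2 * \<xi>)\<close>; together they produce the exponent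
   \<open>2 * k - 1\<close>.\<close>
 define t where "t = 1 / (4 * \<xi>\<^sup>2)"
 have chi2: "1 \<le> \<xi>\<^sup>2" using chi1 by (simp add: one_le_power)
 have chi4: "1 \<le> 4 * \<xi>\<^sup>2" using chi2 by linarith
 have t: "0 < t" "t \<le> 1" "4 * t * \<xi>\<^sup>2 \<le> 1" using chi1 chi4 by (auto simp: t_def)
 obtain W where L: "\<And>n. W n \<in> FS" "incseq W" "\<And>D. D \<in> FS \<Longrightarrow> \<exists>n. D \<subseteq> W n"
  using vertices_exhaustion by blast
 let ?N = "\<lambda>n U. card (clu p U v \<inter> W n)"
 have mN: "(\<lambda>U. ennreal (real (?N n U) ^ k)) \<in> borel_measurable PU" for n
 proof -
  have "real (?N n U) = (\<Sum>a\<in>W n. if a \<in> clu p U v then 1 else 0)" for U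
  proof -
   have "(\<Sum>a\<in>W n. if a \<in> clu p U v then 1 else 0) = (\<Sum>a\<in>{a \<in> W n. a \<in> clu p U v}. 1::real)"
    using L(1)[of n] by (intro sum.inter_filter[symmetric]) (auto simp: FS_def)
   then show ?thesis by (simp add: Int_def conj_commute)
  qed
  then show ?thesis by simp
 qed
 have "(\<E> U. (if finite (clu p U v) then ennreal (real (card (clu p U v)) ^ k) else 0))
   \<le> (\<E> U. liminf (\<lambda>n. ennreal (real (?N n U) ^ k)))"
 proof (rule nn_integral_mono)
  fix U
  show "(if finite (clu p U v) then ennreal (real (card (clu p U v)) ^ k) else 0) \<le> liminf (\<lambda>n. ennreal (real (?N n U) ^ k))"
  proof (cases "finite (clu p U v)")
   case True
   then have "clu p U v \<in> FS"
    using component_subset_V[OF opn_subset v] by (auto simp: FS_def)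
   from L(3)[OF this] obtain n where n: "clu p U v \<subseteq> W n" by blast
   have "\<forall>\<^sub>F m in sequentially. ennreal (real (?N m U) ^ k) = ennreal (real (card (clu p U v)) ^ k)"
    using eventually_ge_at_top[of n]
   proof eventually_elim
    case (elim m)
    then have "clu p U v \<inter> W m = clu p U v" using n L(2) by (auto simp: incseq_def)
    then show ?case by simp
   qed
   then have lim: "(\<lambda>m. ennreal (real (?N m U) ^ k)) \<longlonglongrightarrow> ennreal (real (card (clu p U v)) ^ k)"
    by (rule tendsto_eventually)
   show ?thesis using True lim_imp_Liminf[OF _ lim] by simp
  qed simp
 qed
 also have "... \<le> liminf (\<lambda>n. \<E> U. ennreal (real (?N n U) ^ k))"
  by (rule nn_integral_liminf[OF mN])
 also have "... \<le> liminf (\<lambda>n. ennreal (fact k * 8 ^ k * \<xi> ^ (2 * k - 1)))"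
 proof (rule Liminf_mono, rule eventuallyI)
  fix n
  let ?c = "fact k * (2 / t) ^ k :: real"
  have "(\<E> U. ennreal (real (?N n U) ^ k)) \<le> (\<E> U. ennreal ?c * ennreal ((1 + t) ^ ?N n U - 1))"
  proof (rule nn_integral_mono)
   fix U
   have "0 \<le> (1 + t) ^ ?N n U - 1" using t by (simp add: one_le_power)
   then have "ennreal ?c * ennreal ((1 + t) ^ ?N n U - 1) = ennreal (?c * ((1 + t) ^ ?N n U - 1))"
    using t by (intro ennreal_mult[symmetric]) auto
   then show "ennreal (real (?N n U) ^ k) \<le> ennreal ?c * ennreal ((1 + t) ^ ?N n U - 1)"
    using power_le_fact_mult_power[OF t(1,2) k, of "?N n U"] by (simp add: ennreal_leI)
  qed
  also have "... \<le> ennreal ?c * (\<E> U. ennreal ((1 + t) ^ ?N n U - 1))"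
  proof (rule eq_refl, rule nn_integral_cmult)
   have "(1 + t) ^ ?N n U - 1 = (\<Prod>a\<in>W n. if a \<in> clu p U v then 1 + t else 1) - 1" for U
    using L(1)[of n] by (simp add: prod.If_cases FS_def Int_def conj_commute)
   then show "(\<lambda>U. ennreal ((1 + t) ^ ?N n U - 1)) \<in> borel_measurable PU" by simp
  qed
  also have "... \<le> ennreal ?c * ennreal (2 * t * \<xi>)"
   using t chi1 by (intro mult_left_mono exponential_moment_finite p chi L v) auto
  also have "... = ennreal (?c * (2 * t * \<xi>))" using t chi1 by (intro ennreal_mult[symmetric]) auto
  also have "?c * (2 * t * \<xi>) \<le> fact k * 8 ^ k * \<xi> ^ (2 * k - 1)"
  proof -
   have "2 / t = 8 * \<xi>\<^sup>2" using chi1 by (simp add: t_def)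
   moreover have "2 * t * \<xi> = 1 / (2 * \<xi>)" using chi1 by (simp add: t_def power2_eq_square)
   moreover have "(\<xi>\<^sup>2) ^ k = \<xi> ^ (2 * k - 1) * \<xi>"
    using k by (simp add: power_mult[symmetric] flip: power_Suc2)
   ultimately have "?c * (2 * t * \<xi>) = fact k * 8 ^ k * \<xi> ^ (2 * k - 1) / 2"
    using chi1 by (simp add: power_mult_distrib)
   moreover have "0 \<le> fact k * 8 ^ k * \<xi> ^ (2 * k - 1)" using chi1 by simp
   ultimately show ?thesis by linarith
  qed
  finally show "(\<E> U. ennreal (real (?N n U) ^ k)) \<le> ennreal (fact k * 8 ^ k * \<xi> ^ (2 * k - 1))"
   by (simp add: ennreal_leI)
 qed
 also have "... = ennreal (fact k * 8 ^ k * \<xi> ^ (2 * k - 1))" by (simp add: Liminf_const)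
 finally show ?thesis .
qed

end

section \<open>Hellinger comparison\<close>

lemma square_quotient_le_one: "0 < m \<Longrightarrow> \<bar>\<delta>\<bar> \<le> m \<Longrightarrow> (\<delta> / m)\<^sup>2 \<le> (1::real)"
 using abs_le_square_iff[of \<delta> m] by (simp add: power_divide)

text \<open>For a single open edge \<open>(q - \<delta>) * (q + \<delta>) = q\<^sup>2 -
  \<delta>\<^sup>2\<close>, which is at least \<open>1 - (\<delta> / m)\<^sup>2\<close> times
  \<open>q\<^sup>2\<close>; closed edges are alike. Weakening this factor to its square makes the
  lower bound a perfect square, so the geometric mean of the weights can be read off.\<close>

lemma wt_midpoint:
 assumes L: "finite W" "F \<subseteq> W" and m: "0 < m" "m \<le> q" "m \<le> 1 - q" "\<bar>\<delta>\<bar> \<le> m"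
 shows "((1 - (\<delta> / m)\<^sup>2) ^ card W * wt q W F)\<^sup>2 \<le> wt (q - \<delta>) W F * wt (q + \<delta>) W F"
proof -
 define k where "k = (\<delta> / m)\<^sup>2"
 have k: "0 \<le> k" "k \<le> 1" using square_quotient_le_one[of m \<delta>] m by (auto simp: k_def)
 have one: "(1 - k)\<^sup>2 * z\<^sup>2 \<le> (z - \<delta>) * (z + \<delta>)" if "m \<le> z" for z
 proof -
  have "\<delta>\<^sup>2 = k * m\<^sup>2" using m by (simp add: k_def power_divide)
  also have "... \<le> k * z\<^sup>2" using k m that by (intro mult_left_mono power_mono) auto
  finally have "(1 - k) * z\<^sup>2 \<le> (z - \<delta>) * (z + \<delta>)" by (simp add: algebra_simps power2_eq_square)
  moreover have "(1 - k)\<^sup>2 * z\<^sup>2 \<le> (1 - k) * z\<^sup>2"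
   using k mult_right_mono[of "(1 - k) * (1 - k)" "1 - k" "z\<^sup>2"] mult_left_le[of "1 - k" "1 - k"]
   by (simp add: power2_eq_square)
  ultimately show ?thesis by simp
 qed
 have cL: "card W = card F + card (W - F)"
  using L card_mono[OF L] by (simp add: card_Diff_subset finite_subset)
 have "((1 - k) ^ card W * wt q W F)\<^sup>2 = ((1 - k)\<^sup>2 * q\<^sup>2) ^ card F * ((1 - k)\<^sup>2 * (1 - q)\<^sup>2) ^ card (W - F)"
  unfolding cL wt_def by (simp add: power_mult_distrib power_add power2_eq_square mult.assoc mult.left_commute)
 also have "... \<le> ((q - \<delta>) * (q + \<delta>)) ^ card F * ((1 - q - \<delta>) * (1 - q + \<delta>)) ^ card (W - F)"
 proof -
  have "(1 - k)\<^sup>2 * q\<^sup>2 \<le> (q - \<delta>) * (q + \<delta>)" "(1 - k)\<^sup>2 * (1 - q)\<^sup>2 \<le> (1 - q - \<delta>) * (1 - q + \<delta>)"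
   using one[of q] one[of "1 - q"] m by auto
  moreover have "0 \<le> (1 - k)\<^sup>2 * q\<^sup>2" "0 \<le> (1 - k)\<^sup>2 * (1 - q)\<^sup>2" by simp_all
  ultimately show ?thesis using m k by (intro mult_mono[OF power_mono power_mono] zero_le_power mult_nonneg_nonneg) auto
 qed
 also have "... = wt (q - \<delta>) W F * wt (q + \<delta>) W F"
 proof -
  have e: "1 - q - \<delta> = 1 - (q + \<delta>)" "1 - q + \<delta> = 1 - (q - \<delta>)" by auto
  show ?thesis unfolding e wt_def by (simp only: power_mult_distrib) (simp only: ac_simps)
 qed
 finally show ?thesis by (simp add: k_def)
qed

lemma wt_nonneg: "0 \<le> p \<Longrightarrow> p \<le> 1 \<Longrightarrow> 0 \<le> wt p W F"
 by (simp add: wt_def)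

text \<open>Write \<open>f * (b - a)\<close> as
  \<open>f * (sqrt b - sqrt a) * (sqrt b + sqrt a)\<close> and use the inequality between arithmetic
  and geometric means with a free parameter \<open>s\<close>; \<open>r\<close> is a lower bound for
  \<open>sqrt (a * b)\<close>. The terms are arranged as sums of nonnegative quantities so that they
  can be summed over all configurations in the extended reals.\<close>

lemma hellinger_pointwise:
 fixes a b c f s r :: real
 assumes "0 \<le> a" "0 \<le> b" "0 \<le> f" "f \<le> 1" "0 < s" "0 \<le> r" "r\<^sup>2 \<le> a * b"
 shows "f * b + r / s \<le> f * a + (a + b) / (2 * s) + s * f * (a + b)"
proof -
 define x y where "x = sqrt a" and "y = sqrt b"
 have xy: "0 \<le> x" "0 \<le> y" "a = x\<^sup>2" "b = y\<^sup>2" using assms by (auto simp: x_def y_def)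
 have r: "r \<le> x * y"
  using assms xy by (metis power2_le_imp_le power_mult_distrib mult_nonneg_nonneg)
 have "0 \<le> ((y - x) / s - f * (y + x))\<^sup>2" by simp
 then have "2 * f * ((y - x) * (y + x)) / s \<le> ((y - x) / s)\<^sup>2 + (f * (y + x))\<^sup>2"
  by (simp add: power2_diff field_simps)
 then have "2 * f * (b - a) / s \<le> ((y - x) / s)\<^sup>2 + (f * (y + x))\<^sup>2"
  by (simp add: xy power2_eq_square algebra_simps)
 also have "(f * (y + x))\<^sup>2 \<le> f * (2 * (a + b))"
 proof -
  have "(y + x)\<^sup>2 \<le> 2 * (a + b)" using zero_le_power2[of "y - x"] by (simp add: xy power2_eq_square algebra_simps)
  moreover have "f\<^sup>2 \<le> f" using assms mult_left_le[of f f] by (simp add: power2_eq_square)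
  ultimately show ?thesis unfolding power_mult_distrib using assms by (intro mult_mono) auto
 qed
 finally have 1: "2 * f * (b - a) / s \<le> ((y - x) / s)\<^sup>2 + f * (2 * (a + b))" by simp
 have "s * (2 * f * (b - a) / s) \<le> s * (((y - x) / s)\<^sup>2 + f * (2 * (a + b)))"
  using 1 assms by (intro mult_left_mono) auto
 also have "s * (((y - x) / s)\<^sup>2 + f * (2 * (a + b))) = (y - x)\<^sup>2 / s + 2 * (s * f * (a + b))"
  using assms by (simp add: power2_eq_square field_simps)
 finally have 2: "2 * f * (b - a) \<le> (y - x)\<^sup>2 / s + 2 * (s * f * (a + b))" using assms by simp
 have "(y - x)\<^sup>2 \<le> a + b - 2 * r" using r by (simp add: xy power2_diff mult.commute)
 then have "(y - x)\<^sup>2 / s \<le> (a + b - 2 * r) / s" using assms by (intro divide_right_mono) auto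
 then have "2 * f * (b - a) \<le> (a + b) / s - 2 * (r / s) + 2 * (s * f * (a + b))" using 2 by (simp add: diff_divide_distrib)
 then have "f * (b - a) \<le> ((a + b) / s - 2 * (r / s) + 2 * (s * f * (a + b))) / 2"
  by (simp only: le_divide_eq_numeral1 mult.assoc mult.commute[of _ 2])
 also have "... = (a + b) / (2 * s) - r / s + s * f * (a + b)" by (simp add: add_divide_distrib diff_divide_distrib)
 finally show ?thesis by (simp add: algebra_simps)
qed

context bperc
begin

text \<open>The possible sets of open edges of a finite cluster of \<open>v\<close>. Unlike the
  vertex set, such a set has an explicit product as its probability, namely \<open>w v p F\<close>:
  the edges of \<open>F\<close> are open and all other edges touching the cluster are
  closed.\<close>

definition CF :: "'a \<Rightarrow> 'a set set set" where
 "CF v = {F \<in> FE. \<forall>e\<in>F. e \<subseteq> component F v}"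

abbreviation cl :: "'a \<Rightarrow> 'a set set \<Rightarrow> 'a set" where
 "cl v F \<equiv> component F v"

definition w :: "'a \<Rightarrow> real \<Rightarrow> 'a set set \<Rightarrow> real" where
 "w v p F = wt p (tch (cl v F)) F"

lemma countable_CF: "countable (CF v)"
 by (rule countable_subset[OF _ countable_FE]) (auto simp: CF_def)

lemma finite_component: 
 assumes "finite F" "F \<subseteq> E" shows "finite (component F v)"
proof -
 have "component F v \<subseteq> insert v (\<Union>F)"
  by (rule component_closed) auto
 moreover have "finite e" if "e \<in> F" for e using edge_doubleton[of e] that assms(2) by auto
 then have "finite (\<Union>F)" using assms(1) by auto
 ultimately show ?thesis by (meson finite_insert finite_subset)
qed

lemma cl_FS: "v \<in> V \<Longrightarrow> F \<in> CF v \<Longrightarrow> cl v F \<in> FS"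
 using finite_component component_subset_V by (auto simp: CF_def FE_def FS_def)

lemma CF_tch: "F \<in> CF v \<Longrightarrow> F \<subseteq> tch (cl v F)"
 using edge_doubleton by (fastforce simp: CF_def FE_def tch_def)

lemma w_nonneg: "0 \<le> p \<Longrightarrow> p \<le> 1 \<Longrightarrow> 0 \<le> w v p F"
 by (simp add: w_def wt_nonneg)

lemma config_event:
 assumes v: "v \<in> V" and F: "F \<in> CF v"
 shows "opn E p U \<inter> tch (cl v F) = F \<longleftrightarrow> {e \<in> opn E p U. e \<subseteq> clu p U v} = F"
proof
 assume A: "opn E p U \<inter> tch (cl v F) = F"
 have ne: "e \<in> E \<Longrightarrow> e \<noteq> {}" for e using edge_doubleton by fastforce
 have FE: "F \<subseteq> E" using F by (auto simp: CF_def FE_def)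
 have in_eq: "{e \<in> opn E p U. e \<subseteq> cl v F} = F"
 proof (intro equalityI subsetI)
  fix e assume "e \<in> {e \<in> opn E p U. e \<subseteq> cl v F}"
  then have "e \<in> opn E p U" "e \<in> tch (cl v F)" using ne[of e] opn_subset[of E p U] by (auto simp: tch_def)
  then show "e \<in> F" using A by auto
 next
  fix e assume e: "e \<in> F"
  then have "e \<in> opn E p U" using A by auto
  then show "e \<in> {e \<in> opn E p U. e \<subseteq> cl v F}" using F e by (auto simp: CF_def)
 qed
 have bde: "bd (opn E p U) (cl v F) = {}"
 proof (rule ccontr)
  assume "bd (opn E p U) (cl v F) \<noteq> {}"
  then obtain a y where ay: "a \<in> cl v F" "y \<notin> cl v F" "{a, y} \<in> opn E p U" by (auto simp: bd_def)
  then have "{a, y} \<in> opn E p U \<inter> tch (cl v F)" using opn_subset by (auto simp: tch_def)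
  then have "{a, y} \<in> F" using A by simp
  then show False using F ay by (auto simp: CF_def)
 qed
 have "clu p U v = cl v F"
  using component_eq_iff[of v "cl v F" "opn E p U"] edge_doubleton opn_subset[of E p U] in_eq bde by auto
 then show "{e \<in> opn E p U. e \<subseteq> clu p U v} = F" using in_eq by simp
next
 assume A: "{e \<in> opn E p U. e \<subseteq> clu p U v} = F"
 let ?K = "clu p U v"
 have "component {e \<in> opn E p U. e \<subseteq> ?K} v = ?K"
  using component_eq_iff[of v ?K "opn E p U"] edge_doubleton opn_subset[of E p U] by auto
 then have cl: "cl v F = ?K" using A by simp
 show "opn E p U \<inter> tch (cl v F) = F"
  unfolding cl
 proof (intro equalityI subsetI)
  fix e assume e: "e \<in> opn E p U \<inter> tch ?K"
  then obtain x y where xy: "e = {x, y}" "x \<in> ?K" using edge_doubleton[of e] opn_subset[of E p U] by (fastforce simp: tch_def insert_commute)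
  then have "y \<in> ?K" using e by (auto intro: component_step)
  then show "e \<in> F" using A e xy by auto
 next
  fix e assume "e \<in> F"
  then have "e \<in> opn E p U" "e \<subseteq> ?K" using A by auto
  then show "e \<in> opn E p U \<inter> tch ?K" using opn_subset[of E p U] edge_doubleton[of e] by (fastforce simp: tch_def)
 qed
qed

lemma prob_config:
 assumes v: "v \<in> V" and F: "F \<in> CF v" and p: "0 \<le> p" "p \<le> 1"
 shows "\<P>(U in PU. opn E p U \<inter> tch (cl v F) = F) = w v p F"
proof -
 have L: "finite (tch (cl v F))" "tch (cl v F) \<subseteq> E"
  using finite_tch cl_FS[OF v F] tch_subset by (auto simp: FS_def)
 have "\<P>(U in PU. opn E p U \<inter> tch (cl v F) = F) = expect p (tch (cl v F)) (\<lambda>G. of_bool (G = F))"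
  by (rule prob_finite_config[OF L p])
 also have "... = (\<Sum>G\<in>Pow (tch (cl v F)). if G = F then wt p (tch (cl v F)) G else 0)"
  unfolding expect_def by (intro sum.cong) auto
 also have "... = w v p F" using L(1) CF_tch[OF F] by (simp add: w_def)
 finally show ?thesis .
qed

lemma pred_config: "v \<in> V \<Longrightarrow> F \<in> CF v \<Longrightarrow> Measurable.pred PU (\<lambda>U. opn E p U \<inter> tch (cl v F) = F)"
proof -
 assume v: "v \<in> V" and F: "F \<in> CF v"
 have eq: "opn E p U \<inter> tch (cl v F) = F \<longleftrightarrow> (\<forall>e\<in>tch (cl v F). e \<in> opn E p U \<longleftrightarrow> e \<in> F)" for U
  using CF_tch[OF F] by auto
 show ?thesis unfolding eq
  using finite_tch cl_FS[OF v F] by (intro pred_countable_all) (auto simp: FS_def countable_finite)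
qed

lemma nn_config:
 assumes v: "v \<in> V" and p: "0 \<le> p" "p \<le> 1"
 shows "(\<E> U. (if finite (clu p U v) then g (clu p U v) else 0)) =
  (\<integral>\<^sup>+F. g (cl v F) * ennreal (w v p F) \<partial>count_space (CF v))"
proof -
 let ?c = "\<lambda>U F. if opn E p U \<inter> tch (cl v F) = F then g (cl v F) else 0"
 have "(\<E> U. (if finite (clu p U v) then g (clu p U v) else 0)) =
   (\<E> U. (\<integral>\<^sup>+F. ?c U F \<partial>count_space (CF v)))"
 proof (rule nn_integral_cong)
  fix U
  let ?K = "clu p U v"
  let ?F = "{e \<in> opn E p U. e \<subseteq> ?K}"
  have clF: "component ?F v = ?K"
   using component_eq_iff[of v ?K "opn E p U"] edge_doubleton opn_subset[of E p U] by auto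
  show "(if finite ?K then g ?K else 0) = (\<integral>\<^sup>+F. ?c U F \<partial>count_space (CF v))"
  proof (cases "finite ?K")
   case True
   have KS: "?K \<subseteq> V" by (rule component_subset_V[OF opn_subset v])
   have "?F \<subseteq> tch ?K"
   proof
    fix e assume "e \<in> ?F"
    then show "e \<in> tch ?K" using opn_subset[of E p U] edge_doubleton[of e] by (fastforce simp: tch_def)
   qed
   then have fF: "finite ?F" using finite_tch[OF True KS] finite_subset by blast
   have "\<forall>e\<in>?F. e \<subseteq> component ?F v" unfolding clF by auto
   then have FC: "?F \<in> CF v" using fF opn_subset[of E p U] unfolding CF_def FE_def by auto
   have "(\<integral>\<^sup>+F. ?c U F \<partial>count_space (CF v)) =
     (\<integral>\<^sup>+F. (if ?F = F then g (cl v F) else 0) \<partial>count_space (CF v))"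
    by (rule nn_integral_cong) (simp add: config_event[OF v])
   also have "... = g (cl v ?F)" by (rule nn_single[OF FC])
   finally show ?thesis using True clF by simp
  next
   case False
   have "(\<integral>\<^sup>+F. ?c U F \<partial>count_space (CF v)) = (\<integral>\<^sup>+F. 0 \<partial>count_space (CF v))"
   proof (rule nn_integral_cong)
    fix F assume "F \<in> space (count_space (CF v))"
    then have F: "F \<in> CF v" by simp
    have "opn E p U \<inter> tch (cl v F) \<noteq> F"
    proof
     assume "opn E p U \<inter> tch (cl v F) = F"
     then have "?F = F" using config_event[OF v F] by simp
     then show False using False clF cl_FS[OF v F] by (auto simp: FS_def)
    qed
    then show "?c U F = 0" by simp
   qed
   then show ?thesis using False by simp
  qed
 qed
 also have "... = (\<integral>\<^sup>+F. (\<E> U. ?c U F) \<partial>count_space (CF v))"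
 proof (rule nn_integral_count_space_nn_integral[OF countable_CF])
  fix F assume "F \<in> CF v"
  note [measurable] = pred_config[OF v this]
  show "(\<lambda>U. if opn E p U \<inter> tch (cl v F) = F then g (cl v F) else 0) \<in> borel_measurable PU" by measurable
 qed
 also have "... = (\<integral>\<^sup>+F. g (cl v F) * ennreal (w v p F) \<partial>count_space (CF v))"
 proof (rule nn_integral_cong)
  fix F assume "F \<in> space (count_space (CF v))"
  then have F: "F \<in> CF v" by simp
  note [measurable] = pred_config[OF v F]
  have "(\<E> U. ?c U F) =
    (\<E> U. g (cl v F) * (if opn E p U \<inter> tch (cl v F) = F then 1 else 0))"
   by (rule nn_integral_cong) auto
  also have "... = g (cl v F) * (\<E> U. (if opn E p U \<inter> tch (cl v F) = F then 1 else 0))"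
   by (rule nn_integral_cmult) measurable
  finally show "(\<E> U. ?c U F) = g (cl v F) * ennreal (w v p F)"
   using prob_config[OF v F p] by (simp add: nn_indicator_pred)
 qed
 finally show ?thesis .
qed

lemma w_midpoint:
 assumes v: "v \<in> V" and F: "F \<in> CF v" and m: "0 < m" "m \<le> q" "m \<le> 1 - q" "\<bar>\<delta>\<bar> \<le> m"
 shows "((1 - (\<delta> / m)\<^sup>2) ^ (d * card (cl v F)) * w v q F)\<^sup>2 \<le> w v (q - \<delta>) F * w v (q + \<delta>) F"
proof -
 have S: "cl v F \<in> FS" by (rule cl_FS[OF v F])
 have L: "finite (tch (cl v F))" using S finite_tch by (auto simp: FS_def)
 have k: "0 \<le> (\<delta> / m)\<^sup>2" "(\<delta> / m)\<^sup>2 \<le> 1" using square_quotient_le_one[of m \<delta>] m by auto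
 have "((1 - (\<delta> / m)\<^sup>2) ^ (d * card (cl v F)) * w v q F)\<^sup>2 \<le> ((1 - (\<delta> / m)\<^sup>2) ^ card (tch (cl v F)) * w v q F)\<^sup>2"
  using k card_tch[OF S] m by (intro power_mono mult_right_mono power_decreasing mult_nonneg_nonneg w_nonneg) auto
 also have "... \<le> w v (q - \<delta>) F * w v (q + \<delta>) F"
  unfolding w_def by (rule wt_midpoint[OF L CF_tch[OF F] m])
 finally show ?thesis .
qed

lemma nn_config_prob:
 assumes v: "v \<in> V" and p: "0 \<le> p" "p \<le> 1"
 shows "(\<integral>\<^sup>+F. ennreal (w v p F) \<partial>count_space (CF v)) = ennreal (\<P>(U in PU. finite (clu p U v)))"
 using nn_config[OF v p, of "\<lambda>_. 1"] nn_indicator_pred[OF pred_K_finite[OF v, of p "{}"]] by simp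

text \<open>The Hellinger distance between the laws of the cluster at two nearby parameters is controlled
 by the expected number of edges touching the cluster.\<close>

lemma hellinger_increment:
 fixes \<xi> :: real
 assumes v: "v \<in> V" and x: "0 \<le> x" "x \<le> 1" and m: "0 < m" "m \<le> q" "m \<le> 1 - q" "0 < \<delta>" "\<delta> \<le> m"
  and fin: "AE U in PU. finite (clu (q + \<delta>) U v)" and chi: "chi q v \<le> ennreal \<xi>"
 shows "M (q + \<delta>) x {} v - M (q - \<delta>) x {} v \<le> 3 * (\<delta> / m) * sqrt (d * \<xi> * M (q + \<delta>) x {} v)"
proof -
 let ?nn = "\<lambda>F. ennreal (real (card (cl v F)))"
 let ?w = "\<lambda>p F. ennreal (w v p F)"
 let ?f = "\<lambda>F. ennreal (phi x (cl v F))"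
 let ?p = "q - \<delta>" and ?r = "q + \<delta>"
 define \<kappa> where "\<kappa> = (\<delta> / m)\<^sup>2"
 have prs: "0 \<le> ?p" "?p \<le> 1" "0 \<le> q" "q \<le> 1" "0 \<le> ?r" "?r \<le> 1" using m by auto
 have xi1: "1 \<le> \<xi>" using order_trans[OF chi_ge_1[OF v] chi] by simp
 have finAE: "AE U in PU. finite (clu p U v)" if "p \<le> ?r" for p
  using fin by eventually_elim (rule finite_subset[OF component_mono[OF opn_mono[OF that]]])
 have tot: "(\<integral>\<^sup>+F. ?w p F \<partial>count_space (CF v)) = 1" if "0 \<le> p" "p \<le> ?r" for p
 proof -
  have "\<P>(U in PU. finite (clu p U v)) = 1"
   using finAE[OF that(2)] pred_K_finite[OF v, of p "{}"] by (subst PU.prob_Collect_eq_1) auto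
  then show ?thesis using nn_config_prob[OF v, of p] that prs by simp
 qed
 have Mc: "(\<integral>\<^sup>+F. ?f F * ?w p F \<partial>count_space (CF v)) = ennreal (M p x {} v)"
  if "0 \<le> p" "p \<le> ?r" for p
 proof -
  have "(\<integral>\<^sup>+F. ?f F * ?w p F \<partial>count_space (CF v)) =
    (\<E> U. (if finite (clu p U v) then ennreal (phi x (clu p U v)) else 0))"
   using that prs by (intro nn_config[OF v, symmetric]) auto
  also have "... = (\<E> U. ennreal (phi x (clu p U v)))"
   using finAE[OF that(2)] by (intro nn_integral_cong_AE) (auto elim: eventually_mono)
  finally show ?thesis using nn_M[OF v x, of p "{}"] by simp
 qed
 have chiC: "(\<integral>\<^sup>+F. ?nn F * ?w q F \<partial>count_space (CF v)) \<le> ennreal \<xi>"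
 proof -
  have "(\<integral>\<^sup>+F. ?nn F * ?w q F \<partial>count_space (CF v)) =
    (\<E> U. (if finite (clu q U v) then ennreal (real (card (clu q U v))) else 0))"
   using prs by (intro nn_config[OF v, symmetric]) auto
  also have "... \<le> chi q v" unfolding chi_def by (intro nn_integral_mono) auto
  finally show ?thesis using chi by (rule order_trans)
 qed
 have k: "0 \<le> \<kappa>" "\<kappa> \<le> 1" using square_quotient_le_one[of m \<delta>] m by (auto simp: \<kappa>_def)
 have main: "M ?r x {} v - M ?p x {} v \<le> \<kappa> * d * \<xi> / s + 2 * s * M ?r x {} v" if s: "0 < s" for s
 proof -
  let ?M = "\<lambda>p. M p x {} v"
  have Mn: "0 \<le> ?M p" for p by (rule M_bounds(1)[OF v x])
  have pt: "?f F * ?w ?r F + ennreal (1 / s) * ?w q F \<le>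
    ?f F * ?w ?p F + ennreal (1 / (2 * s)) * (?w ?p F + ?w ?r F)
    + ennreal s * (?f F * ?w ?p F + ?f F * ?w ?r F)
    + ennreal (\<kappa> * d / s) * (?nn F * ?w q F)" (is "?L \<le> ?R")
   if F: "F \<in> CF v" for F
  proof -
   define a b c f where "a = w v ?p F" and "b = w v ?r F" and "c = w v q F" and "f = phi x (cl v F)"
   have nn: "0 \<le> a" "0 \<le> b" "0 \<le> c" "0 \<le> f" "f \<le> 1"
    unfolding a_def b_def c_def f_def using prs phi_bounds[OF x] by (auto intro: w_nonneg)
   let ?n = "d * card (cl v F)"
   have "f * b + ((1 - \<kappa>) ^ ?n * c) / s \<le> f * a + (a + b) / (2 * s) + s * f * (a + b)"
    using w_midpoint[OF v F m(1-3), of \<delta>] m k nn s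
    by (intro hellinger_pointwise) (auto simp: a_def b_def c_def \<kappa>_def)
   \<comment> \<open>Bernoulli's inequality makes the loss linear in the cluster size, so that \<xi>
     controls its expectation; at most \<open>d\<close> edges per vertex touch the cluster.\<close>
   moreover have "(1 - \<kappa> * ?n) * c \<le> (1 - \<kappa>) ^ ?n * c"
    using Bernoulli_inequality[of "- \<kappa>" ?n] k nn by (intro mult_right_mono) (auto simp: mult.commute)
   then have "((1 - \<kappa> * ?n) * c) / s \<le> ((1 - \<kappa>) ^ ?n * c) / s" using s by (intro divide_right_mono) auto
   ultimately have "f * b + ((1 - \<kappa> * ?n) * c) / s \<le> f * a + (a + b) / (2 * s) + s * f * (a + b)" by linarith
   then have "f * b + 1 / s * c \<le> f * a + 1 / (2 * s) * (a + b) + s * (f * a + f * b) + \<kappa> * d / s * (card (cl v F) * c)"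
    by (simp add: algebra_simps diff_divide_distrib add_divide_distrib)
   then have "ennreal (f * b + 1 / s * c) \<le> ennreal (f * a + 1 / (2 * s) * (a + b) + s * (f * a + f * b) + \<kappa> * d / s * (card (cl v F) * c))"
    by (rule ennreal_leI)
   moreover have "ennreal (f * b + u1 * c) = ennreal f * ennreal b + ennreal u1 * ennreal c"
    "ennreal (f * a + u2 * (a + b) + s * (f * a + f * b) + u3 * (card (cl v F) * c)) =
     ennreal f * ennreal a + ennreal u2 * (ennreal a + ennreal b)
     + ennreal s * (ennreal f * ennreal a + ennreal f * ennreal b)
     + ennreal u3 * (?nn F * ennreal c)" if "0 \<le> u1" "0 \<le> u2" "0 \<le> u3" for u1 u2 u3
    using nn s that by (simp_all add: ennreal_mult ennreal_plus)
   moreover have "0 \<le> 1 / s" "0 \<le> 1 / (2 * s)" "0 \<le> \<kappa> * d / s" using s k by auto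
   ultimately show ?thesis
    by (simp only: a_def[symmetric] b_def[symmetric] c_def[symmetric] f_def[symmetric])
  qed
  have "(\<integral>\<^sup>+F. ?f F * ?w ?r F + ennreal (1 / s) * ?w q F \<partial>count_space (CF v)) \<le>
   (\<integral>\<^sup>+F. ?f F * ?w ?p F + ennreal (1 / (2 * s)) * (?w ?p F + ?w ?r F)
    + ennreal s * (?f F * ?w ?p F + ?f F * ?w ?r F)
    + ennreal (\<kappa> * d / s) * (?nn F * ?w q F) \<partial>count_space (CF v))"
   by (intro nn_integral_mono pt) simp
  also have "(\<integral>\<^sup>+F. ?f F * ?w ?r F + ennreal (1 / s) * ?w q F \<partial>count_space (CF v))
    = ennreal (?M ?r) + ennreal (1 / s)"
   using m prs by (simp add: nn_integral_add nn_integral_cmult Mc tot)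
  also have "(\<integral>\<^sup>+F. ?f F * ?w ?p F + ennreal (1 / (2 * s)) * (?w ?p F + ?w ?r F)
    + ennreal s * (?f F * ?w ?p F + ?f F * ?w ?r F)
    + ennreal (\<kappa> * d / s) * (?nn F * ?w q F) \<partial>count_space (CF v))
    = ennreal (?M ?p) + ennreal (1 / (2 * s)) * (1 + 1) + ennreal s * (ennreal (?M ?p) + ennreal (?M ?r))
    + ennreal (\<kappa> * d / s) * (\<integral>\<^sup>+F. ?nn F * ?w q F \<partial>count_space (CF v))"
   using m prs by (simp add: nn_integral_add nn_integral_cmult Mc tot)
  also have "... \<le> ennreal (?M ?p) + ennreal (1 / (2 * s)) * (1 + 1) + ennreal s * (ennreal (?M ?p) + ennreal (?M ?r))
    + ennreal (\<kappa> * d / s) * ennreal \<xi>"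
   by (intro add_left_mono mult_left_mono chiC) auto
  also have "... = ennreal (?M ?p + 1 / (2 * s) * 2 + s * (?M ?p + ?M ?r) + \<kappa> * d / s * \<xi>)"
  proof -
   have "ennreal (?M ?p) + ennreal u1 * (1 + 1) + ennreal s * (ennreal (?M ?p) + ennreal (?M ?r)) + ennreal u2 * ennreal \<xi> =
    ennreal (?M ?p + u1 * 2 + s * (?M ?p + ?M ?r) + u2 * \<xi>)" if "0 \<le> u1" "0 \<le> u2" for u1 u2
   proof -
    have "(1 + 1 :: ennreal) = ennreal 2" by simp
    then show ?thesis using that s Mn xi1 by (simp only:) (simp add: ennreal_mult ennreal_plus)
   qed
   moreover have "0 \<le> 1 / (2 * s)" "0 \<le> \<kappa> * d / s" using s k by auto
   ultimately show ?thesis by (simp only:)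
  qed
  finally have "ennreal (?M ?r + 1 / s) \<le> ennreal (?M ?p + 1 / (2 * s) * 2 + s * (?M ?p + ?M ?r) + \<kappa> * d / s * \<xi>)"
   using s Mn by (simp add: ennreal_plus)
  then have "?M ?r + 1 / s \<le> ?M ?p + 1 / (2 * s) * 2 + s * (?M ?p + ?M ?r) + \<kappa> * d / s * \<xi>"
   using s k Mn xi1 by (subst (asm) ennreal_le_iff) auto
  moreover have "1 / (2 * s) * 2 = 1 / s" by simp
  moreover have "s * (?M ?p + ?M ?r) \<le> 2 * s * ?M ?r"
   using s m M_mono_gen[OF v x(1) order_refl x(2), of ?p ?r "{}" "{}"] by simp
  moreover have "\<kappa> * d / s * \<xi> = \<kappa> * d * \<xi> / s" by simp
  ultimately show ?thesis by linarith
 qed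
 show ?thesis
 proof (cases "M ?r x {} v = 0")
  case True
  then show ?thesis using M_bounds(1)[OF v x, of ?p "{}"] by simp
 next
  case False
  then have M0: "0 < M ?r x {} v" using M_bounds(1)[OF v x, of ?r "{}"] by simp
  define z where "z = sqrt (d * \<xi> * M ?r x {} v)"
  have dx: "0 < d * \<xi>" using d_pos xi1 by simp
  have z: "0 < z" "z\<^sup>2 = d * \<xi> * M ?r x {} v" using dx M0 by (auto simp: z_def)
  \<comment> \<open>This balances the two terms: they become one and two times
    \<open>(\<delta> / m) * z\<close>, whence the factor 3.\<close>
  define s where "s = (\<delta> / m) * z / M ?r x {} v"
  have s: "0 < s" using m z M0 by (simp add: s_def)
  have "\<kappa> * d * \<xi> / s = \<kappa> * (d * \<xi> * M ?r x {} v) / ((\<delta> / m) * z)"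
   using M0 by (simp add: s_def)
  also have "... = (\<delta> / m) * z"
   unfolding z(2)[symmetric] \<kappa>_def using z(1) m(1,4) by (simp add: power2_eq_square)
  finally have "\<kappa> * d * \<xi> / s = (\<delta> / m) * z" .
  moreover have "2 * s * M ?r x {} v = 2 * ((\<delta> / m) * z)" using M0 by (simp add: s_def)
  ultimately show ?thesis using main[OF s] unfolding z_def[symmetric] by simp
 qed
qed

text \<open>Cauchy-Schwarz between the cluster laws at \<open>q - \<delta>\<close> and
  \<open>q + \<delta>\<close>: on clusters of at most \<open>B\<close> vertices the geometric mean
  of their weights is at least \<open>(1 - (\<delta> / m)\<^sup>2) ^ (d * B)\<close> times the
  weight at \<open>q\<close>. Since \<delta> may have either sign, events can be moved upwards and
  downwards.\<close>

lemma hellinger_transfer: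
 assumes v: "v \<in> V" and m: "0 < m" "m \<le> q" "m \<le> 1 - q" "\<bar>\<delta>\<bar> \<le> m" and N: "\<And>n. n \<in> N \<Longrightarrow> n \<le> B"
  and b: "0 < b" "b \<le> (1 - (\<delta> / m)\<^sup>2) ^ (d * B) * \<P>(U in PU. finite (clu q U v) \<and> card (clu q U v) \<in> N)"
  and R: "\<P>(U in PU. finite (clu (q + \<delta>) U v) \<and> card (clu (q + \<delta>) U v) \<in> N) \<le> R"
 shows "b\<^sup>2 \<le> R * \<P>(U in PU. finite (clu (q - \<delta>) U v) \<and> card (clu (q - \<delta>) U v) \<in> N)"
proof -
 let ?w = "\<lambda>p F. ennreal (w v p F)"
 let ?p = "q - \<delta>" and ?r = "q + \<delta>"
 have prs: "0 \<le> ?p" "?p \<le> 1" "0 \<le> q" "q \<le> 1" "0 \<le> ?r" "?r \<le> 1" using m by auto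
 define PP where "PP p = \<P>(U in PU. finite (clu p U v) \<and> card (clu p U v) \<in> N)" for p
 define \<kappa> where "\<kappa> = (\<delta> / m)\<^sup>2"
 have k: "0 \<le> \<kappa>" "\<kappa> \<le> 1" using square_quotient_le_one[of m \<delta>] m by (auto simp: \<kappa>_def)
 let ?g = "\<lambda>S. if card S \<in> N then 1 else (0::ennreal)"
 have P: "(\<integral>\<^sup>+F. ?g (cl v F) * ?w p F \<partial>count_space (CF v)) = ennreal (PP p)" if "0 \<le> p" "p \<le> 1" for p
 proof -
  have [measurable]: "Measurable.pred PU (\<lambda>U. finite (clu p U v) \<and> card (clu p U v) \<in> N)"
  proof -
   have "(\<lambda>U. if finite (clu p U v) then card (clu p U v) \<in> N else False) \<in> measurable PU (count_space UNIV)"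
    by (rule measurable_component_fun[OF meas_eset_opn v]) auto
   moreover have "(\<lambda>U. if finite (clu p U v) then card (clu p U v) \<in> N else False) =
    (\<lambda>U. finite (clu p U v) \<and> card (clu p U v) \<in> N)" by auto
   ultimately show ?thesis by simp
  qed
  have "(\<integral>\<^sup>+F. ?g (cl v F) * ?w p F \<partial>count_space (CF v)) =
    (\<E> U. (if finite (clu p U v) then ?g (clu p U v) else 0))"
   by (rule nn_config[OF v that, symmetric])
  also have "... = (\<E> U. (if finite (clu p U v) \<and> card (clu p U v) \<in> N then 1 else 0))"
   by (rule nn_integral_cong) auto
  also have "... = ennreal (PP p)" unfolding PP_def by (rule nn_indicator_pred) measurable
  finally show ?thesis .
 qed
 have PPn: "0 \<le> PP p" for p by (simp add: PP_def)
 have main: "2 * b \<le> t * PP ?p + PP ?r / t" if t: "0 < t" for t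
 proof -
  have pt: "ennreal (2 * (1 - \<kappa>) ^ (d * B)) * (?g (cl v F) * ?w q F) \<le>
    ennreal t * (?g (cl v F) * ?w ?p F) + ennreal (1 / t) * (?g (cl v F) * ?w ?r F)"
   if F: "F \<in> CF v" for F
  proof (cases "card (cl v F) \<in> N")
   case True
   define a b' c where "a = w v ?p F" and "b' = w v ?r F" and "c = w v q F"
   have nn: "0 \<le> a" "0 \<le> b'" "0 \<le> c"
    unfolding a_def b'_def c_def using prs by (auto intro: w_nonneg)
   have "(1 - \<kappa>) ^ (d * B) * c \<le> (1 - \<kappa>) ^ (d * card (cl v F)) * c"
    using N[OF True] k nn by (intro mult_right_mono power_decreasing) auto
   also have "... \<le> sqrt (a * b')"
    using w_midpoint[OF v F m] unfolding \<kappa>_def a_def b'_def c_def by (intro real_le_rsqrt) auto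
   finally have 1: "(1 - \<kappa>) ^ (d * B) * c \<le> sqrt (a * b')" .
   have "sqrt (a * b') = sqrt ((t * a) * (b' / t))" using t by simp
   also have "... \<le> (t * a + b' / t) / 2" using t nn by (intro arith_geo_mean_sqrt) auto
   finally have "2 * (1 - \<kappa>) ^ (d * B) * c \<le> t * a + 1 / t * b'" using 1 by simp
   then have "ennreal (2 * (1 - \<kappa>) ^ (d * B) * c) \<le> ennreal (t * a + 1 / t * b')" by (rule ennreal_leI)
   moreover have split: "ennreal (t * a + u * b') = ennreal t * ennreal a + ennreal u * ennreal b'" if "0 \<le> u" for u
    using nn t that by (simp add: ennreal_mult ennreal_plus)
   have "ennreal (t * a + 1 / t * b') = ennreal t * ennreal a + ennreal (1 / t) * ennreal b'" using t by (intro split) simp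
   ultimately have "ennreal (2 * (1 - \<kappa>) ^ (d * B) * c) \<le> ennreal t * ennreal a + ennreal (1 / t) * ennreal b'"
    by (simp only:)
   then show ?thesis using True nn k
    by (simp only: a_def[symmetric] b'_def[symmetric] c_def[symmetric]) (simp add: ennreal_mult)
  qed simp
  have "ennreal (2 * (1 - \<kappa>) ^ (d * B)) * ennreal (PP q) =
    (\<integral>\<^sup>+F. ennreal (2 * (1 - \<kappa>) ^ (d * B)) * (?g (cl v F) * ?w q F) \<partial>count_space (CF v))"
   using P[OF prs(3,4)] by (subst nn_integral_cmult) auto
  also have "... \<le> (\<integral>\<^sup>+F. ennreal t * (?g (cl v F) * ?w ?p F) + ennreal (1 / t) * (?g (cl v F) * ?w ?r F) \<partial>count_space (CF v))"
   by (intro nn_integral_mono pt) simp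
  also have "... = ennreal t * ennreal (PP ?p) + ennreal (1 / t) * ennreal (PP ?r)"
   using P[OF prs(1,2)] P[OF prs(5,6)] by (subst nn_integral_add, simp, simp, subst (1 2) nn_integral_cmult) auto
  also have "... = ennreal (t * PP ?p + 1 / t * PP ?r)"
  proof -
   have "ennreal (t * PP ?p + u * PP ?r) = ennreal t * ennreal (PP ?p) + ennreal u * ennreal (PP ?r)" if "0 \<le> u" for u
    using t PPn that by (simp add: ennreal_mult ennreal_plus)
   from this[of "1 / t"] show ?thesis using t by simp
  qed
  finally have "ennreal (2 * (1 - \<kappa>) ^ (d * B) * PP q) \<le> ennreal (t * PP ?p + 1 / t * PP ?r)"
   using k PPn by (simp add: ennreal_mult)
  then have "2 * ((1 - \<kappa>) ^ (d * B) * PP q) \<le> t * PP ?p + PP ?r / t"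
   using t PPn by (subst (asm) ennreal_le_iff) auto
  then show ?thesis using b(2) unfolding PP_def \<kappa>_def by linarith
 qed
 have R0: "PP ?r \<le> R" using R by (simp add: PP_def)
 show ?thesis
 proof (cases "R \<le> 0")
  case True
  then have "PP ?r = 0" "R = 0" using R0 PPn[of ?r] by auto
  \<comment> \<open>Here \<open>main\<close> with \<open>t = b\<close> yields
    \<open>2 * b \<le> b\<close>, so this case cannot occur.\<close>
  have "PP ?p \<le> 1" by (simp add: PP_def)
  then have "b * PP ?p \<le> b * 1" using b(1) by (intro mult_left_mono) auto
  then have "2 * b \<le> b" using main[of b] b(1) \<open>PP ?r = 0\<close> by simp
  then show ?thesis using b(1) by simp
 next
  case False
  then have R': "0 < R" by simp
  \<comment> \<open>The weight \<open>t = R / b\<close> makes the second term at most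
    \<open>b\<close>.\<close>
  have "2 * b \<le> R / b * PP ?p + PP ?r / (R / b)" using main[of "R / b"] R' b(1) by simp
  also have "PP ?r / (R / b) \<le> R / (R / b)" using R0 R' b(1) by (intro divide_right_mono) auto
  also have "R / (R / b) = b" using R' b(1) by simp
  finally have "b \<le> R / b * PP ?p" by simp
  then have "b * b \<le> b * (R / b * PP ?p)" using b(1) by (intro mult_left_mono) auto
  then show ?thesis using b(1) unfolding PP_def by (simp add: power2_eq_square)
 qed
qed

end

section \<open>The critical window\<close>

text \<open>A convex decreasing function falls over an initial step \<kappa> at least in proportion
  to its fall over the whole interval. For \<open>M\<close> this is concavity in
  \<open>h\<close>.\<close>

lemma exp_chord:
 fixes h H \<kappa> :: real
 assumes "0 < \<kappa>" "h + \<kappa> \<le> H"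
 shows "\<kappa> * (exp (- h) ^ n - exp (- H) ^ n) \<le> (H - h) * (exp (- h) ^ n - exp (- (h + \<kappa>)) ^ n)"
proof -
 define u where "u = \<kappa> / (H - h)"
 have u: "0 \<le> u" "u \<le> 1" "u * (H - h) = \<kappa>" using assms by (auto simp: u_def)
 have e: "exp (- z) ^ n = exp (- (z * n))" for z :: real
  by (simp add: exp_of_nat2_mult[symmetric])
 have eq: "- ((h + \<kappa>) * n) = (1 - u) * (- (h * n)) + u * (- (H * n))"
  unfolding u(3)[symmetric] by (simp add: algebra_simps)
 have "exp (- ((h + \<kappa>) * n)) \<le> (1 - u) * exp (- (h * n)) + u * exp (- (H * n))"
  unfolding eq using convex_onD[OF exp_convex u(1,2), of "- (h * n)" "- (H * n)"] by simp
 then have "u * (exp (- h) ^ n - exp (- H) ^ n) \<le> exp (- h) ^ n - exp (- (h + \<kappa>)) ^ n"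
  unfolding e by (simp add: algebra_simps)
 then have "(H - h) * (u * (exp (- h) ^ n - exp (- H) ^ n)) \<le> (H - h) * (exp (- h) ^ n - exp (- (h + \<kappa>)) ^ n)"
  using assms by (intro mult_left_mono) auto
 then show ?thesis using u(3) by (simp add: mult.assoc[symmetric] mult.commute[of "H - h" u])
qed

lemma phi_chord:
 assumes "0 < \<kappa>" "h + \<kappa> \<le> H" "0 \<le> h"
 shows "\<kappa> * (phi (exp (- H)) S - phi (exp (- h)) S) \<le> (H - h) * (phi (exp (- (h + \<kappa>))) S - phi (exp (- h)) S)"
 using exp_chord[OF assms(1,2), of "card S"] by (simp add: phi_def xp_def)

lemma mult_exp_minus_le: "(z::real) * exp (- z) \<le> 1 - exp (- z)"
proof -
 have "(z + 1) * exp (- z) \<le> exp z * exp (- z)"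
  using exp_ge_add_one_self[of z] by (intro mult_right_mono) (auto simp: add.commute)
 then show ?thesis by (simp add: algebra_simps flip: exp_add)
qed

lemma one_minus_exp_ge: "0 \<le> (z::real) \<Longrightarrow> z - z\<^sup>2 / 2 \<le> 1 - exp (- z)"
proof -
 assume z: "0 \<le> z"
 let ?g = "\<lambda>z::real. 1 - exp (- z) - z + z\<^sup>2 / 2"
 have "?g 0 \<le> ?g z"
 proof (rule DERIV_nonneg_imp_nondecreasing[OF z])
  fix y :: real assume "0 \<le> y" "y \<le> z"
  have "(?g has_real_derivative (exp (- y) - 1 + y)) (at y)"
   by (auto intro!: derivative_eq_intros)
  moreover have "0 \<le> exp (- y) - 1 + y" using exp_ge_add_one_self[of "- y"] by linarith
  ultimately show "\<exists>D. (?g has_real_derivative D) (at y) \<and> 0 \<le> D" by blast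
 qed
 then show ?thesis by simp
qed

context bperc
begin

lemma M_chord:
 assumes v: "v \<in> V" and k: "0 < \<kappa>" "h + \<kappa> \<le> H" "0 \<le> h"
 shows "\<kappa> * (M p (exp (- H)) {} v - M p (exp (- h)) {} v) \<le> (H - h) * (M p (exp (- (h + \<kappa>))) {} v - M p (exp (- h)) {} v)"
proof -
 have i: "integrable PU (\<lambda>U. phi (exp (- z)) (K p U {} v))" if "0 \<le> z" for z
  using that by (intro integrable_phi[OF meas_K v]) auto
 have "\<kappa> * (M p (exp (- H)) {} v - M p (exp (- h)) {} v) = (\<integral>U. \<kappa> * (phi (exp (- H)) (K p U {} v) - phi (exp (- h)) (K p U {} v)) \<partial>PU)"
  unfolding M_def using i[of H] i[of h] k by simp
 also have "... \<le> (\<integral>U. (H - h) * (phi (exp (- (h + \<kappa>))) (K p U {} v) - phi (exp (- h)) (K p U {} v)) \<partial>PU)"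
  using i[of H] i[of h] i[of "h + \<kappa>"] k phi_chord[OF k] by (intro integral_mono) (auto simp del: minus_add_distrib)
 also have "... = (H - h) * (M p (exp (- (h + \<kappa>))) {} v - M p (exp (- h)) {} v)"
  unfolding M_def using i[of "h + \<kappa>"] i[of h] k by (simp del: minus_add_distrib)
 finally show ?thesis .
qed

text \<open>Concavity in \<open>h\<close> together with a nonnegative value at
  \<open>h = 0\<close>.\<close>

lemma M_scale:
 assumes v: "v \<in> V" and t: "0 < t" "t \<le> 1" and H: "0 < H"
 shows "t * M p (exp (- H)) {} v \<le> M p (exp (- (t * H))) {} v"
proof -
 have "(t * H) * (M p (exp (- H)) {} v - M p (exp (- 0)) {} v) \<le> (H - 0) * (M p (exp (- (0 + t * H))) {} v - M p (exp (- 0)) {} v)"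
  using t H by (intro M_chord[OF v]) auto
 then have "H * (t * M p (exp (- H)) {} v + (1 - t) * M p 1 {} v) \<le> H * M p (exp (- (t * H))) {} v"
  by (simp add: algebra_simps)
 then have "t * M p (exp (- H)) {} v + (1 - t) * M p 1 {} v \<le> M p (exp (- (t * H))) {} v"
  using H by simp
 moreover have "0 \<le> (1 - t) * M p 1 {} v" using t M_bounds(1)[OF v, of 1 p] by simp
 ultimately show ?thesis by linarith
qed

lemma M_le_chi:
 assumes v: "v \<in> V" and "chi p v \<le> ennreal \<xi>" and h: "0 \<le> h" and xi: "0 \<le> \<xi>"
 shows "M p (exp (- h)) {} v \<le> \<xi> * h"
proof -
 have x: "0 \<le> exp (- h)" "exp (- h) \<le> 1" using h by auto
 have "ennreal (M p (exp (- h)) {} v) = (\<E> U. ennreal (phi (exp (- h)) (K p U {} v)))"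
  by (rule nn_M[OF v x, symmetric])
 also have "... \<le> (\<E> U. ennreal h * (if finite (K p U {} v) then ennreal (real (card (K p U {} v))) else \<infinity>))"
 \<comment> \<open>For \<open>h = 0\<close> the right integrand is
   \<open>0 * \<infinity> = 0\<close> on infinite clusters while \<open>phi\<close> is 1 there, so
   almost sure finiteness has to be used first.\<close>
 proof (cases "h = 0")
  case True
  have "M p 1 {} v = 0"
  proof -
   have "ennreal (M p 1 {} v) = (\<E> U. ennreal (phi 1 (K p U {} v)))"
    using nn_M[OF v, of 1 p "{}"] by simp
   also have "... = (\<E> U. 0)"
    using chi_finite_AE[OF v assms(2)] by (intro nn_integral_cong_AE) (auto elim!: eventually_mono simp: phi_def xp_def)
   finally show ?thesis using M_bounds(1)[OF v, of 1 p "{}"] by (simp add: ennreal_eq_0_iff)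
  qed
  then show ?thesis using nn_M[OF v, of 1 p "{}"] True by simp
 next
  case False
  show ?thesis
  proof (rule nn_integral_mono)
   fix U
   show "ennreal (phi (exp (- h)) (K p U {} v)) \<le> ennreal h * (if finite (K p U {} v) then ennreal (real (card (K p U {} v))) else \<infinity>)"
   proof (cases "finite (K p U {} v)")
    case True
    have "1 - exp (- h) ^ card (K p U {} v) \<le> h * card (K p U {} v)"
     using exp_ge_add_one_self[of "- (h * card (K p U {} v))"] by (simp add: exp_of_nat2_mult[symmetric])
    then show ?thesis using True h by (simp add: phi_def xp_def ennreal_mult[symmetric] ennreal_leI)
   qed (use False h in \<open>simp add: ennreal_mult_top\<close>)
  qed
 qed
 also have "... = ennreal h * chi p v"
  unfolding chi_def by (rule nn_integral_cmult) (rule measurable_K_fun[OF v])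
 also have "... \<le> ennreal h * ennreal \<xi>" using assms(2) by (rule mult_left_mono) simp
 also have "... = ennreal (\<xi> * h)" using h xi by (simp add: ennreal_mult mult.commute)
 finally show ?thesis using h xi by (subst (asm) ennreal_le_iff) auto
qed

text \<open>For a concave function vanishing or positive at 0 the derivative is at most
  \<open>M / h\<close>; pointwise this is \<open>z * exp (- z) \<le> 1 - exp (- z)\<close> with
  \<open>z\<close> equal to \<open>h\<close> times the cluster size.\<close>

lemma X_le_M:
 assumes v: "v \<in> V" and h: "0 < h"
 shows "X p (exp (- h)) v \<le> ennreal (M p (exp (- h)) {} v / h)"
proof -
 have x: "0 \<le> exp (- h)" "exp (- h) \<le> 1" using h by auto
 have "X p (exp (- h)) v \<le> (\<E> U. ennreal (1 / h) * ennreal (phi (exp (- h)) (K p U {} v)))"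
  unfolding X_def
 proof (rule nn_integral_mono)
  fix U
  show "(if finite (K p U {} v) then ennreal (real (card (K p U {} v)) * exp (- h) ^ card (K p U {} v)) else 0)
   \<le> ennreal (1 / h) * ennreal (phi (exp (- h)) (K p U {} v))"
  proof (cases "finite (K p U {} v)")
   case True
   have *: "real (card (K p U {} v)) * exp (- h) ^ card (K p U {} v) \<le> 1 / h * phi (exp (- h)) (K p U {} v)"
    using mult_exp_minus_le[of "h * card (K p U {} v)"] True h
    by (simp add: phi_def xp_def exp_of_nat2_mult[symmetric] field_simps)
   have "ennreal (1 / h * phi (exp (- h)) (K p U {} v)) = ennreal (1 / h) * ennreal (phi (exp (- h)) (K p U {} v))"
    using h phi_bounds[OF x] by (intro ennreal_mult) auto
   then show ?thesis using True ennreal_leI[OF *] by simp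
  qed simp
 qed
 also have "... = ennreal (1 / h) * ennreal (M p (exp (- h)) {} v)"
  unfolding nn_M[OF v x, symmetric] using v by (intro nn_integral_cmult) measurable
 also have "... = ennreal (M p (exp (- h)) {} v / h)"
  using h M_bounds(1)[OF v x, of p "{}"] by (simp add: ennreal_mult[symmetric])
 finally show ?thesis .
qed

lemma X_le_chi: "0 \<le> x \<Longrightarrow> x \<le> 1 \<Longrightarrow> X p x v \<le> chi p v"
 unfolding X_def chi_def by (intro nn_integral_mono) (auto intro!: ennreal_leI mult_left_le power_le_one)

text \<open>For the supremum \<open>m\<close> over all vertices one sprinkling step gives
  \<open>m \<le> a + m / 2\<close>. The supremum is finite because \<open>M\<close> is at most 1, so
  the last term can be absorbed.\<close>

lemma sprinkle_upper_sup:
 assumes p: "0 \<le> p" "p \<le> q" "q \<le> 1" "p < 1" and x: "0 \<le> x" "x \<le> 1"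
  and a: "\<And>y. y \<in> V \<Longrightarrow> M p x {} y \<le> a" and b: "\<And>y. y \<in> V \<Longrightarrow> X p x y \<le> ennreal b" "0 \<le> b"
  and half: "(q - p) / (1 - p) * d * b \<le> 1 / 2" and v: "v \<in> V"
 shows "M q x {} v \<le> 2 * a"
proof -
 define m where "m = (SUP y\<in>V. M q x {} y)"
 have bdd: "bdd_above ((\<lambda>y. M q x {} y) ` V)"
  using M_bounds(2)[OF _ x] by (intro bdd_aboveI[of _ 1]) auto
 have m: "M q x {} y \<le> m" if "y \<in> V" for y
  unfolding m_def by (rule cSUP_upper[OF that bdd])
 have m0: "0 \<le> m" using m[OF v] M_bounds(1)[OF v x, of q "{}"] by simp
 have "M q x {} y \<le> a + m / 2" if y: "y \<in> V" for y
 proof -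
  define D where "D = (q - p) / (1 - p)"
  have D: "0 \<le> D" using p by (simp add: D_def)
  have a0: "0 \<le> a" using a[OF y] M_bounds(1)[OF y x, of p "{}"] by simp
  have "ennreal (M q x {} y) \<le> ennreal (M p x {} y) + ennreal (D * d * m) * X p x y"
   unfolding D_def by (rule sprinkle_upper[OF y p x m])
  also have "... \<le> ennreal a + ennreal (D * d * m) * ennreal b"
   using a[OF y] b(1)[OF y] by (intro add_mono mult_left_mono ennreal_leI) auto
  also have "... = ennreal (a + D * d * m * b)"
   using a0 D m0 b(2) by (simp add: ennreal_mult ennreal_plus)
  finally have "M q x {} y \<le> a + D * d * m * b"
   using a0 D m0 b(2) by (subst (asm) ennreal_le_iff) auto
  also have "D * d * m * b = m * (D * d * b)" by simp
  also have "... \<le> m * (1 / 2)" using half m0 unfolding D_def by (rule mult_left_mono)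
  finally show ?thesis by simp
 qed
 then have "m \<le> a + m / 2" unfolding m_def using v by (intro cSUP_least) auto
 then show ?thesis using m[OF v] by simp
qed

end

locale mperc = cperc +
 fixes pc c1 :: real
 assumes pc: "plo < pc" "pc < p3" and c1_pos: "0 < c1"
  and comparable: "\<And>p x u v. p \<in> {plo..p3} \<Longrightarrow> x \<in> {0..1} \<Longrightarrow> u \<in> V \<Longrightarrow> v \<in> V \<Longrightarrow> c1 * M p x {} v \<le> M p x {} u"
  and theta_sub: "\<And>p v. p < pc \<Longrightarrow> v \<in> V \<Longrightarrow> M p 1 {} v = 0"
  and theta_super: "\<And>p v. pc < p \<Longrightarrow> p \<le> p3 \<Longrightarrow> v \<in> V \<Longrightarrow> 0 < M p 1 {} v"
begin

text \<open>Vanishing of the infinite cluster probability is available only strictly below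
  \<open>pc\<close>, so the characteristic is stopped halfway.\<close>

lemma subcritical_M':
 assumes v: "v \<in> V" and p: "plo \<le> p" "p < pc" and h: "0 < h"
 shows "M p (exp (- h)) {} v \<le> 2 * h / (c * (pc - p))"
proof -
 have "M p (exp (- h)) {} v \<le> h / (c * ((p + pc) / 2 - p))"
  using p pc by (intro subcritical_M v h theta_sub) auto
 also have "(p + pc) / 2 - p = (pc - p) / 2" by (simp add: field_simps)
 finally show ?thesis by (simp add: mult.commute)
qed

lemma chi_upper:
 assumes v: "v \<in> V" and p: "plo \<le> p" "p < pc"
 shows "chi p v \<le> ennreal (2 / (c * (pc - p)))"
proof (rule chi_le_liminf[OF v])
 show "0 \<le> 2 / (c * (pc - p))" using c_pos p by simp
 show "M p (exp (- h)) {} v \<le> 2 / (c * (pc - p)) * h" if "0 < h" for h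
  using subcritical_M'[OF v p that] by simp
qed

text \<open>A smaller value would, by comparability, be small at all vertices. Sprinkling past
  \<open>pc\<close> would then give \<open>M \<le> 2 * b * h\<close> for all \<open>h\<close> at a
  supercritical level and exclude infinite clusters there.\<close>

lemma chi_lower:
 assumes v: "v \<in> V" and p: "plo \<le> p" "p < pc"
 shows "ennreal (c1 * (1 - p3) / (4 * d * (pc - p))) \<le> chi p v"
proof (rule ccontr)
 assume "\<not> ?thesis"
 then have small: "chi p v < ennreal (c1 * (1 - p3) / (4 * d * (pc - p)))" by simp
 define b where "b = (1 - p3) / (4 * d * (pc - p))"
 have d0: "0 < real d" using d_pos by simp
 have p01: "0 < p" "p < 1" "p < p3" using p pc plo by auto
 have b0: "0 < b" using d0 p plo by (simp add: b_def)
 have cv: "chi p v \<le> ennreal (c1 * b)" using small by (simp add: b_def)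
 have cy: "chi p y \<le> ennreal b" if y: "y \<in> V" for y
 proof (rule chi_le_liminf[OF y])
  fix h :: real assume h: "0 < h"
  have "c1 * M p (exp (- h)) {} y \<le> M p (exp (- h)) {} v"
   using p pc plo h y v by (intro comparable) auto
  also have "... \<le> c1 * b * h" using b0 c1_pos h by (intro M_le_chi[OF v cv]) auto
  finally show "M p (exp (- h)) {} y \<le> b * h" using c1_pos by (simp add: mult.assoc)
 qed (use b0 in simp)
 define q where "q = min p3 (pc + (pc - p))"
 have q: "pc < q" "q \<le> p3" "q - p \<le> 2 * (pc - p)" "p \<le> q" using p pc by (auto simp: q_def)
 have half: "(q - p) / (1 - p) * d * b \<le> 1 / 2"
 proof -
  have "(q - p) / (1 - p) * d * b \<le> 2 * (pc - p) / (1 - p3) * d * b"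
   using q p plo p01 d0 b0 by (intro mult_right_mono frac_le) auto
  also have "... = 1 / 2" using p d0 plo by (simp add: b_def)
  finally show ?thesis .
 qed
 have "M q 1 {} v \<le> 2 * (b * h)" if h: "0 < h" for h
 proof -
  have "M q 1 {} v \<le> M q (exp (- h)) {} v" using h v by (intro M_mono_gen) auto
  also have "... \<le> 2 * (b * h)"
  proof (rule sprinkle_upper_sup[OF _ _ _ _ _ _ _ _ _ half v])
   show "M p (exp (- h)) {} y \<le> b * h" if "y \<in> V" for y
    using M_le_chi[OF that cy[OF that]] h b0 by simp
   show "X p (exp (- h)) y \<le> ennreal b" if "y \<in> V" for y
    using order_trans[OF X_le_chi cy[OF that]] h by simp
  qed (use q p01 plo h b0 in auto)
  finally show ?thesis .
 qed
 from this[of "M q 1 {} v / (4 * b)"] show False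
  using theta_super[OF q(1,2) v] b0 by simp
qed

text \<open>Raise the level from \<open>p\<close> to \<open>p + 2 * \<delta>\<close> at fixed
  \<open>h\<close>. By the influence bound this is worth at least a step
  \<open>2 * \<mu> * \<delta>\<close> in \<open>h\<close>, where \<open>\<mu> = c * M\<close>; by
  the Hellinger bound it is worth at most \<open>\<delta> * r\<close>; concavity compares the small
  step in \<open>h\<close> with the whole interval up to \<open>H\<close>. The claim is the limit as
  \<delta> tends to 0.\<close>

lemma hellinger_gain:
 fixes \<xi> W m :: real
 assumes v: "v \<in> V" and p: "plo \<le> p" "p < p'" "p' < pc" and h: "0 < h" "h < H"
  and xi: "\<And>q. p < q \<Longrightarrow> q \<le> p' \<Longrightarrow> chi q v \<le> ennreal \<xi>"
  and W: "M p' (exp (- h)) {} v \<le> W" and m: "0 < m" "m \<le> plo" "m \<le> 1 - p3"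
 shows "c * M p (exp (- h)) {} v * (M p (exp (- H)) {} v - M p (exp (- h)) {} v)
   \<le> (H - h) / 2 * (3 / m * sqrt (d * \<xi> * W))"
proof (rule field_le_epsilon)
 fix e :: real assume e: "0 < e"
 let ?y = "exp (- h)"
 define \<mu> where "\<mu> = c * M p ?y {} v"
 have y: "0 \<le> ?y" "?y < 1" "?y \<le> 1" using h by auto
 have mu0: "0 \<le> \<mu>" using c_pos M_bounds(1)[OF v y(1,3)] by (simp add: \<mu>_def)
 obtain B where B: "0 \<le> B" "\<And>n::nat. (real n)\<^sup>2 * ?y ^ n \<le> B"
  using square_times_power_bounded[OF y(1,2)] by blast
 have xi0: "0 \<le> \<xi>" using order_trans[OF chi_ge_1[OF v] xi[of p']] p by simp
 have W0: "0 \<le> W" using W M_bounds(1)[OF v y(1,3), of p' "{}"] by simp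
 define Q where "Q = (H - h) / 2 * (4 * (1 / (1 - p3))\<^sup>2 * (real d)\<^sup>2 * B)"
 have Q: "0 \<le> Q" using h B by (simp add: Q_def)
 define \<delta> where "\<delta> = min (min m ((p' - p) / 2)) (min ((H - h) / (2 * \<mu> + 1)) (e / (Q + 1)))"
 have d: "\<delta> \<le> m" "\<delta> \<le> (p' - p) / 2" "\<delta> \<le> (H - h) / (2 * \<mu> + 1)" "\<delta> \<le> e / (Q + 1)"
  unfolding \<delta>_def by linarith+
 have "0 < (p' - p) / 2" "0 < (H - h) / (2 * \<mu> + 1)" "0 < e / (Q + 1)" using p h e Q mu0 by auto
 then have "0 < \<delta>" using m unfolding \<delta>_def min_less_iff_conj by blast
 note d = this d
 have d3: "p + 2 * \<delta> \<le> p'" using d(3) by simp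
 have dQ: "Q * \<delta> \<le> e"
 proof -
  have "\<delta> * (Q + 1) \<le> e" using d(5) Q by (simp add: pos_le_divide_eq)
  then show ?thesis using d(1) by (simp add: algebra_simps)
 qed
 have dmu: "2 * \<mu> * \<delta> \<le> H - h"
 proof -
  have "\<delta> * (2 * \<mu> + 1) \<le> H - h" using d(4) mu0 by (subst (asm) pos_le_divide_eq) auto
  then show ?thesis using d(1) by (simp add: algebra_simps)
 qed
 let ?k = "2 * \<mu> * \<delta>"
 let ?q = "p + 2 * \<delta>"
 define r where "r = 3 / m * sqrt (d * \<xi> * W)"
 have p01: "0 < p" "?q < p3" "p < p3" using p pc plo d d3 by auto
 have gain: "M p (exp (- (h + ?k))) {} v - M p ?y {} v \<le> \<delta> * r + 4 * (1 / (1 - p3))\<^sup>2 * (real d)\<^sup>2 * B * \<delta>\<^sup>2"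
 proof -
  have "M p (exp (- (h + ?k))) {} v \<le> M ?q ?y {} v + ((?q - p) / (1 - p))\<^sup>2 * (real d)\<^sup>2 * B"
  proof (rule sprinkle_lower[OF v])
   show "\<mu> * real (card S) \<le> (\<Sum>e\<in>bd E S. M p ?y S (snd e))" if "S \<in> FS" for S
    using influence[of p ?y S v] p pc y that v by (simp add: \<mu>_def ac_simps)
   show "?y \<le> exp (- (h + ?k)) * exp (\<mu> * (?q - p))" by (simp flip: exp_add)
  qed (use p01 plo d mu0 h B in auto)
  also have "((?q - p) / (1 - p))\<^sup>2 * (real d)\<^sup>2 * B \<le> (2 * \<delta> * (1 / (1 - p3)))\<^sup>2 * (real d)\<^sup>2 * B"
   using p01 plo d B by (intro mult_right_mono power_mono) (auto intro!: divide_left_mono)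
  also have "... = 4 * (1 / (1 - p3))\<^sup>2 * (real d)\<^sup>2 * B * \<delta>\<^sup>2" by (simp add: power2_eq_square)
  finally have 1: "M p (exp (- (h + ?k))) {} v \<le> M ?q ?y {} v + 4 * (1 / (1 - p3))\<^sup>2 * (real d)\<^sup>2 * B * \<delta>\<^sup>2" by simp
  have WQ: "M ?q ?y {} v \<le> W" using M_mono_gen[OF v y(1) order_refl y(3) d3, of "{}" "{}"] W by simp
  have "M (p + \<delta> + \<delta>) ?y {} v - M (p + \<delta> - \<delta>) ?y {} v \<le> 3 * (\<delta> / m) * sqrt (d * \<xi> * M (p + \<delta> + \<delta>) ?y {} v)"
  proof (rule hellinger_increment[OF v y(1,3) m(1)])
   show "AE U in PU. finite (clu (p + \<delta> + \<delta>) U v)"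
    using d d3 p by (intro chi_finite_AE[OF v xi]) auto
   show "chi (p + \<delta>) v \<le> ennreal \<xi>" using d d3 p by (intro xi) auto
  qed (use d m p p01 in auto)
  also have "p + \<delta> + \<delta> = ?q" by simp
  also have "p + \<delta> - \<delta> = p" by simp
  also have "3 * (\<delta> / m) * sqrt (d * \<xi> * M ?q ?y {} v) \<le> 3 * (\<delta> / m) * sqrt (d * \<xi> * W)"
   using WQ xi0 d m by (intro mult_left_mono real_sqrt_le_mono) auto
  also have "... = \<delta> * r" by (simp add: r_def)
  finally show ?thesis using 1 by linarith
 qed
 show "c * M p ?y {} v * (M p (exp (- H)) {} v - M p ?y {} v) \<le> (H - h) / 2 * (3 / m * sqrt (d * \<xi> * W)) + e"
 proof (cases "\<mu> = 0")
  case True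
  then have "c * M p ?y {} v = 0" by (simp add: \<mu>_def)
  moreover have "0 \<le> (H - h) / 2 * (3 / m * sqrt (d * \<xi> * W)) + e" using h m xi0 W0 e by simp
  ultimately show ?thesis by (simp only: mult_zero_left)
 next
  case False
  have "?k * (M p (exp (- H)) {} v - M p ?y {} v) \<le> (H - h) * (M p (exp (- (h + ?k))) {} v - M p ?y {} v)"
   using False mu0 d dmu h by (intro M_chord[OF v]) auto
  also have "... \<le> (H - h) * (\<delta> * r + 4 * (1 / (1 - p3))\<^sup>2 * (real d)\<^sup>2 * B * \<delta>\<^sup>2)"
   using gain h by (intro mult_left_mono) auto
  also have "... = 2 * \<delta> * ((H - h) / 2 * r + Q * \<delta>)"
  proof -
   have "(H - h) * (\<delta> * r + 4 * k * D * B * \<delta>\<^sup>2) = 2 * \<delta> * ((H - h) / 2 * r + (H - h) / 2 * (4 * k * D * B) * \<delta>)" for k D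
    by (simp add: power2_eq_square field_simps)
   then show ?thesis unfolding Q_def .
  qed
  also have "... \<le> 2 * \<delta> * ((H - h) / 2 * r + e)" using dQ d by (intro mult_left_mono) auto
  finally have "2 * \<delta> * (\<mu> * (M p (exp (- H)) {} v - M p ?y {} v)) \<le> 2 * \<delta> * ((H - h) / 2 * r + e)"
   by (simp only: ac_simps)
  then show ?thesis using d unfolding \<mu>_def r_def by simp
 qed
qed

text \<open>Let \<open>F\<close> and \<open>G\<close> be the values of \<open>M\<close> at
  \<open>h = \<epsilon>\<^sup>2\<close> and \<open>h = r\<^sup>2 * \<epsilon>\<^sup>2\<close>.
  Either \<open>F \<le> 2 * G\<close>, and the subcritical bound on \<open>G\<close> suffices, or
  \<open>F - G\<close> is at least \<open>F / 2\<close>, and \<open>hellinger_gain\<close> bounds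
  \<open>G * (F - G)\<close> and thereby \<open>F\<^sup>2\<close>. The point of \<open>r\<close> is
  that the distance to \<open>pc\<close> carries \<open>r ^ 4\<close> while the bound loses only
  \<open>r ^ 3\<close>: the spare factor \<open>r\<close> pays for crossing \<open>pc\<close>
  later.\<close>

lemma critical_window_below:
 "\<exists>A>0. \<forall>r\<in>{0<..1}. \<forall>\<epsilon>>0. \<forall>v\<in>V. plo \<le> pc - r ^ 4 * \<epsilon> \<longrightarrow> M (pc - r ^ 4 * \<epsilon>) (exp (- \<epsilon>\<^sup>2)) {} v \<le> A * \<epsilon> / r ^ 3"
proof -
 define m where "m = min plo (1 - p3)"
 have m: "0 < m" "m \<le> plo" "m \<le> 1 - p3" using plo by (auto simp: m_def)
 define L where "L = 12 * sqrt d / (m * c\<^sup>2)"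
 have d0: "0 < real d" using d_pos by simp
 have L: "0 < L" using d0 m c_pos by (simp add: L_def)
 define A where "A = 4 / c + sqrt L"
 have A: "0 < A" using c_pos L by (simp add: A_def add_pos_nonneg)
 have "M (pc - r ^ 4 * \<epsilon>) (exp (- \<epsilon>\<^sup>2)) {} v \<le> A * \<epsilon> / r ^ 3"
  if r: "0 < r" "r \<le> 1" and e: "0 < \<epsilon>" and v: "v \<in> V" and lo: "plo \<le> pc - r ^ 4 * \<epsilon>" for r \<epsilon> v
 proof -
  define e' where "e' = r ^ 4 * \<epsilon>"
  define p where "p = pc - e'"
  have e': "0 < e'" using r e by (simp add: e'_def)
  have p: "plo \<le> p" "p < pc" "pc - p = e'" using lo e' by (auto simp: p_def e'_def)
  define H h where "H = \<epsilon>\<^sup>2" and "h = r\<^sup>2 * H"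
  have H: "0 < H" using e by (simp add: H_def)
  have r2: "0 < r\<^sup>2" "r\<^sup>2 \<le> 1" using r by (auto simp: power_le_one)
  define F G where "F = M p (exp (- H)) {} v" and "G = M p (exp (- h)) {} v"
  have h: "0 < h" "h \<le> H" using r2 H mult_right_mono[OF r2(2), of H] by (auto simp: h_def)
  have F0: "0 \<le> F" unfolding F_def using H by (intro M_bounds[OF v]) auto
  have G1: "r\<^sup>2 * F \<le> G" unfolding F_def G_def h_def by (rule M_scale[OF v r2 H])
  have G2: "G \<le> 2 / c * \<epsilon> / r\<^sup>2"
  proof -
   have "G \<le> 2 * h / (c * (pc - p))" unfolding G_def by (rule subcritical_M'[OF v p(1,2) h(1)])
   also have "... = 2 / c * \<epsilon> / r\<^sup>2" unfolding p(3) e'_def h_def H_def using r e c_pos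
    by (simp add: field_simps power2_eq_square eval_nat_numeral)
   finally show ?thesis .
  qed
  have "F \<le> A * \<epsilon> / r ^ 3"
  proof (cases "F \<le> 2 * G")
   case True
   then have "F \<le> 4 / c * \<epsilon> / r\<^sup>2" using G2 by simp
   also have "... \<le> A * \<epsilon> / r ^ 3"
    using A e r L c_pos power_decreasing[of 2 3 r] by (intro frac_le mult_right_mono) (auto simp: A_def)
   finally show ?thesis .
  next
   case False
   then have F: "2 * G < F" by simp
   have hH: "h < H"
   proof (rule ccontr)
    assume "\<not> h < H"
    then have "F = G" using h by (simp add: F_def G_def)
    moreover have "0 \<le> G" unfolding G_def using h by (intro M_bounds[OF v]) auto
    ultimately show False using F by simp
   qed
   define p' where "p' = (p + pc) / 2"
   have p': "p < p'" "p' < pc" "pc - p' = e' / 2" using p by (auto simp: p'_def field_simps)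
   define \<xi> where "\<xi> = 4 / (c * e')"
   define W where "W = 4 * h / (c * e')"
   have "c * G * (F - G) \<le> (H - h) / 2 * (3 / m * sqrt (d * \<xi> * W))"
    unfolding F_def G_def
   proof (rule hellinger_gain[OF v p(1) p'(1,2) h(1) hH _ _ m])
    show "M p' (exp (- h)) {} v \<le> W"
     using subcritical_M'[OF v _ p'(2) h(1)] p p' by (simp add: W_def)
    show "chi q v \<le> ennreal \<xi>" if "p < q" "q \<le> p'" for q
    proof -
     have "chi q v \<le> ennreal (2 / (c * (pc - q)))" using that p p' by (intro chi_upper v) auto
     also have "... \<le> ennreal (2 / (c * (e' / 2)))"
      using that p p' e' c_pos by (intro ennreal_leI divide_left_mono mult_left_mono) auto
     finally show ?thesis by (simp add: \<xi>_def)
    qed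
   qed
   also have "sqrt (d * \<xi> * W) = 4 * sqrt d * r * \<epsilon> / (c * e')"
   proof -
    have "d * \<xi> * W = d * (4 * r * \<epsilon> / (c * e'))\<^sup>2"
     by (simp add: \<xi>_def W_def h_def H_def power2_eq_square)
    then have "sqrt (d * \<xi> * W) = sqrt (d * (4 * r * \<epsilon> / (c * e'))\<^sup>2)" by (simp only:)
    also have "... = sqrt d * (4 * r * \<epsilon> / (c * e'))"
     unfolding real_sqrt_mult real_sqrt_abs using r e c_pos e' by simp
    finally show ?thesis by simp
   qed
   also have "(H - h) / 2 * (3 / m * (4 * sqrt d * r * \<epsilon> / (c * e'))) \<le> H / 2 * (3 / m * (4 * sqrt d * r * \<epsilon> / (c * e')))"
    using h e r m c_pos e' by (intro mult_right_mono) auto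
   also have "... = c * (L / 2 * \<epsilon>\<^sup>2 / r ^ 3)"
    unfolding H_def e'_def L_def using r e m c_pos by (simp add: field_simps power2_eq_square eval_nat_numeral)
   finally have 1: "c * (G * (F - G)) \<le> c * (L / 2 * \<epsilon>\<^sup>2 / r ^ 3)" by (simp only: mult.assoc)
   then have 1: "G * (F - G) \<le> L / 2 * \<epsilon>\<^sup>2 / r ^ 3" using c_pos by (simp only: mult_le_cancel_left_pos)
   have "r\<^sup>2 * F * (F / 2) \<le> G * (F - G)"
    using G1 F F0 r2 by (intro mult_mono) (auto intro: order_trans[OF _ G1])
   also have "... \<le> L / 2 * \<epsilon>\<^sup>2 / r ^ 3" by (rule 1)
   finally have "r\<^sup>2 * F\<^sup>2 \<le> L * \<epsilon>\<^sup>2 / r ^ 3" by (simp add: power2_eq_square)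
   then have "r ^ 4 * (r\<^sup>2 * F\<^sup>2) \<le> r ^ 4 * (L * \<epsilon>\<^sup>2 / r ^ 3)" using r by (intro mult_left_mono) auto
   then have "(r ^ 3 * F)\<^sup>2 \<le> r * (L * \<epsilon>\<^sup>2)"
    using r by (simp add: power2_eq_square eval_nat_numeral field_simps)
   also have "... \<le> 1 * (L * \<epsilon>\<^sup>2)" using r L by (intro mult_right_mono) auto
   also have "... = (sqrt L * \<epsilon>)\<^sup>2" using L by (simp add: power_mult_distrib)
   finally have "(r ^ 3 * F)\<^sup>2 \<le> (sqrt L * \<epsilon>)\<^sup>2" .
   then have "r ^ 3 * F \<le> sqrt L * \<epsilon>" by (rule power2_le_imp_le) (use L e in simp)
   also have "... \<le> A * \<epsilon>" using e c_pos by (intro mult_right_mono) (auto simp: A_def)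
   finally show ?thesis using r by (simp add: pos_le_divide_eq mult.commute)
  qed
  then show ?thesis by (simp add: F_def H_def p_def e'_def)
 qed
 then show ?thesis using A by (intro exI[of _ A]) auto
qed

lemma critical_window:
 "\<exists>C>0. \<forall>\<epsilon>>0. \<forall>v\<in>V. plo \<le> pc - \<epsilon> \<longrightarrow> pc + \<epsilon> \<le> p3 \<longrightarrow> M (pc + \<epsilon>) (exp (- \<epsilon>\<^sup>2)) {} v \<le> C * \<epsilon>"
proof -
 obtain A where A: "A > 0"
  and below: "\<And>r \<epsilon> v. r \<in> {0<..1} \<Longrightarrow> 0 < \<epsilon> \<Longrightarrow> v \<in> V \<Longrightarrow> plo \<le> pc - r ^ 4 * \<epsilon> \<Longrightarrow>
   M (pc - r ^ 4 * \<epsilon>) (exp (- \<epsilon>\<^sup>2)) {} v \<le> A * \<epsilon> / r ^ 3"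
  using critical_window_below by blast
 have d0: "0 < real d" using d_pos by simp
 define D where "D = 4 * d * A / (1 - p3)"
 have D: "0 < D" using d0 A plo by (simp add: D_def)
 \<comment> \<open>Sprinkling from \<open>pc - \<epsilon>\<close> to \<open>pc + \<epsilon>\<close>
   has the coefficient \<open>r * D / 2\<close>, which must not exceed one half to be
   absorbed.\<close>
 define r where "r = min 1 (1 / D)"
 have r: "0 < r" "r \<le> 1" "r * D \<le> 1"
 proof -
  show "0 < r" "r \<le> 1" using D by (auto simp: r_def)
  have "r \<le> 1 / D" by (simp add: r_def)
  then show "r * D \<le> 1" using D by (simp add: pos_le_divide_eq)
 qed
 have "M (pc + \<epsilon>) (exp (- \<epsilon>\<^sup>2)) {} v \<le> (2 * A / r ^ 7) * \<epsilon>"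
  if e: "0 < \<epsilon>" and v: "v \<in> V" and lo: "plo \<le> pc - \<epsilon>" and hi: "pc + \<epsilon> \<le> p3" for \<epsilon> v
 proof -
  define e' where "e' = \<epsilon> / r ^ 4"
  have e': "0 < e'" "r ^ 4 * e' = \<epsilon>" using e r by (auto simp: e'_def)
  have ee: "\<epsilon> \<le> e'" using e r power_le_one[of r 4] e'(2) mult_right_mono[of "r ^ 4" 1 e'] e'(1) by simp
  define a where "a = A * e' / r ^ 3"
  have a: "0 < a" using A e' r by (simp add: a_def)
  have Ma: "M (pc - \<epsilon>) (exp (- e'\<^sup>2)) {} y \<le> a" if "y \<in> V" for y
   using below[of r e' y] r e' lo that by (simp add: a_def)
  have "M (pc + \<epsilon>) (exp (- \<epsilon>\<^sup>2)) {} v \<le> M (pc + \<epsilon>) (exp (- e'\<^sup>2)) {} v"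
   using ee e v by (intro M_mono_gen) (auto intro: power_mono)
  also have "... \<le> 2 * a"
  proof (rule sprinkle_upper_sup[OF _ _ _ _ _ _ Ma _ _ _ v])
   show "X (pc - \<epsilon>) (exp (- e'\<^sup>2)) y \<le> ennreal (a / e'\<^sup>2)" if y: "y \<in> V" for y
   proof -
    have "X (pc - \<epsilon>) (exp (- e'\<^sup>2)) y \<le> ennreal (M (pc - \<epsilon>) (exp (- e'\<^sup>2)) {} y / e'\<^sup>2)"
     using e' by (intro X_le_M y) auto
    also have "... \<le> ennreal (a / e'\<^sup>2)" using Ma[OF y] e' by (intro ennreal_leI divide_right_mono) auto
    finally show ?thesis .
   qed
   have "(pc + \<epsilon> - (pc - \<epsilon>)) / (1 - (pc - \<epsilon>)) * d * (a / e'\<^sup>2) \<le> 2 * \<epsilon> / (1 - p3) * d * (a / e'\<^sup>2)"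
    using e a d0 pc plo by (intro mult_right_mono frac_le) auto
   also have "... = r * D / 2"
   proof -
    have *: "\<epsilon> / r ^ 3 = r * e'" unfolding e'(2)[symmetric] using r by (simp add: eval_nat_numeral)
    have "2 * \<epsilon> / (1 - p3) * d * (a / e'\<^sup>2) = 2 * d * A / (1 - p3) * (\<epsilon> / r ^ 3) / e'"
     unfolding a_def using e'(1) by (simp add: power2_eq_square ac_simps)
    also have "... = r * D / 2" unfolding * D_def using e'(1) plo by (simp add: field_simps)
    finally show ?thesis .
   qed
   also have "... \<le> 1 / 2" using r by simp
   finally show "(pc + \<epsilon> - (pc - \<epsilon>)) / (1 - (pc - \<epsilon>)) * d * (a / e'\<^sup>2) \<le> 1 / 2" .
  qed (use e a lo hi plo pc in auto)
  also have "2 * a = (2 * A / r ^ 7) * \<epsilon>"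
   unfolding a_def e'_def using r by (simp add: field_simps eval_nat_numeral)
  finally show ?thesis .
 qed
 moreover have "0 < 2 * A / r ^ 7" using A r by simp
 ultimately show ?thesis by blast
qed

text \<open>Integrate \<open>1 - exp (- z) \<ge> z - z\<^sup>2 / 2\<close>: a lower bound on the
  first moment and an upper bound on the second suffice.\<close>

lemma M_quadratic_lower:
 assumes v: "v \<in> V" and ch: "chi p v \<le> ennreal \<xi>" "ennreal b \<le> chi p v" "0 \<le> b"
  and S2: "(\<E> U. (if finite (clu p U v) then ennreal (real (card (clu p U v)) ^ 2) else 0)) \<le> ennreal B"
  and h: "0 \<le> h" and B: "0 \<le> B"
 shows "h * b - h\<^sup>2 / 2 * B \<le> M p (exp (- h)) {} v"
proof -
 have x: "0 \<le> exp (- h)" "exp (- h) \<le> 1" using h by auto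
 let ?N = "\<lambda>U. real (card (clu p U v))"
 let ?ph = "\<lambda>U. ennreal (phi (exp (- h)) (clu p U v))"
 let ?S = "\<lambda>n U. if finite (clu p U v) then ?N U ^ n else 0"
 have fin: "AE U in PU. finite (clu p U v)" by (rule chi_finite_AE[OF v ch(1)])
 have mN [measurable]: "(\<lambda>U. ennreal (if finite (clu p U v) then real (card (clu p U v)) ^ n else 0)) \<in> borel_measurable PU" for n
 proof -
  have "(\<lambda>U. if finite (clu p U v) then ennreal (real (card (clu p U v)) ^ n) else ennreal 0) \<in> borel_measurable PU"
   by (rule measurable_component_fun[OF meas_eset_opn v]) auto
  then show ?thesis unfolding if_distrib[of ennreal] .
 qed
 have chi_eq: "chi p v = (\<E> U. ennreal (?S 1 U))"
  unfolding chi_def using fin by (intro nn_integral_cong_AE) (auto elim!: eventually_mono)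
 have "ennreal h * chi p v \<le> (\<E> U. ?ph U + ennreal (h\<^sup>2 / 2) * ennreal (?S 2 U))"
  unfolding chi_eq
 proof (subst nn_integral_cmult[symmetric], measurable, rule nn_integral_mono)
  fix U
  show "ennreal h * ennreal (?S 1 U) \<le>
    ?ph U + ennreal (h\<^sup>2 / 2) * ennreal (?S 2 U)"
  proof (cases "finite (clu p U v)")
   case True
   have "h * ?N U \<le> (1 - exp (- h) ^ card (clu p U v)) + h\<^sup>2 / 2 * ?N U ^ 2"
    using one_minus_exp_ge[of "h * ?N U"] h by (simp add: exp_of_nat2_mult[symmetric] power_mult_distrib)
   then have "ennreal (h * ?N U) \<le> ennreal (phi (exp (- h)) (clu p U v) + h\<^sup>2 / 2 * ?N U ^ 2)"
    using True by (intro ennreal_leI) (simp add: phi_def xp_def)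
   also have "... = ?ph U + ennreal (h\<^sup>2 / 2) * ennreal (?N U ^ 2)"
    using phi_bounds[OF x, of "clu p U v"] by (simp add: ennreal_plus ennreal_mult[symmetric])
   finally show ?thesis using True h by (simp add: ennreal_mult[symmetric])
  qed simp
 qed
 also have "... = ennreal (M p (exp (- h)) {} v) + ennreal (h\<^sup>2 / 2) * (\<E> U. ennreal (?S 2 U))"
  unfolding nn_M[OF v x, of p "{}", unfolded del_empty, symmetric] nn_integral_cmult[OF mN, symmetric]
  by (rule nn_integral_add) (use v in measurable)
 also have "... \<le> ennreal (M p (exp (- h)) {} v) + ennreal (h\<^sup>2 / 2) * ennreal B"
  using S2 by (intro add_left_mono mult_left_mono) (simp_all add: if_distrib[of ennreal] cong: if_cong)
 also have "... = ennreal (M p (exp (- h)) {} v + h\<^sup>2 / 2 * B)"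
  using M_bounds(1)[OF v x, of p "{}"] B by (simp add: ennreal_plus ennreal_mult[symmetric])
 finally have "ennreal h * chi p v \<le> ennreal (M p (exp (- h)) {} v + h\<^sup>2 / 2 * B)" .
 moreover have "ennreal (h * b) \<le> ennreal h * chi p v"
  using ch(2,3) h by (simp add: ennreal_mult mult_left_mono)
 ultimately have "ennreal (h * b) \<le> ennreal (M p (exp (- h)) {} v + h\<^sup>2 / 2 * B)" by simp
 then show ?thesis using M_bounds(1)[OF v x, of p "{}"] B by (subst (asm) ennreal_le_iff) auto
qed

lemma second_moment_upper:
 assumes v: "v \<in> V" and p: "plo \<le> p" "p < pc"
 shows "(\<E> U. (if finite (clu p U v) then ennreal (real (card (clu p U v)) ^ 2) else 0))
  \<le> ennreal (1024 / (c * (pc - p)) ^ 3)"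
proof -
 have "(\<E> U. (if finite (clu p U v) then ennreal (real (card (clu p U v)) ^ 2) else 0))
   \<le> ennreal (fact 2 * 8 ^ 2 * (2 / (c * (pc - p))) ^ (2 * 2 - 1))"
  using p pc plo by (intro moment_bound v chi_upper) auto
 also have "fact 2 * 8 ^ 2 * (2 / (c * (pc - p))) ^ (2 * 2 - 1) = 1024 / (c * (pc - p)) ^ 3"
  by (simp add: power_divide)
 finally show ?thesis .
qed

lemma M_lower:
 "\<exists>a>0. \<exists>b>0. \<forall>\<epsilon>>0. \<forall>v\<in>V. plo \<le> pc - \<epsilon> \<longrightarrow> b * \<epsilon> \<le> M (pc - \<epsilon>) (exp (- a * \<epsilon>\<^sup>2)) {} v"
proof -
 define b0 where "b0 = c1 * (1 - p3) / (4 * d)"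
 have b0: "0 < b0" using c1_pos plo d_pos by (simp add: b0_def)
 define B where "B = 1024 / c ^ 3"
 have B: "0 < B" using c_pos by (simp add: B_def)
 \<comment> \<open>The maximiser of the quadratic lower bound; half of the linear term
   remains.\<close>
 define a where "a = b0 / B"
 have a: "0 < a" using b0 B by (simp add: a_def)
 have "(b0 * a / 2) * \<epsilon> \<le> M (pc - \<epsilon>) (exp (- a * \<epsilon>\<^sup>2)) {} v"
  if e: "0 < \<epsilon>" and v: "v \<in> V" and lo: "plo \<le> pc - \<epsilon>" for \<epsilon> v
 proof -
  let ?h = "a * \<epsilon>\<^sup>2"
  have "(b0 * a / 2) * \<epsilon> = ?h * (b0 / \<epsilon>) - ?h\<^sup>2 / 2 * (B / \<epsilon> ^ 3)"
   using e B by (simp add: a_def field_simps power2_eq_square eval_nat_numeral)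
  also have "... \<le> M (pc - \<epsilon>) (exp (- ?h)) {} v"
  proof (rule M_quadratic_lower[OF v])
   show "chi (pc - \<epsilon>) v \<le> ennreal (2 / (c * \<epsilon>))" using chi_upper[OF v lo] e by simp
   show "ennreal (b0 / \<epsilon>) \<le> chi (pc - \<epsilon>) v" using chi_lower[OF v lo] e by (simp add: b0_def)
   show "(\<E> U. (if finite (clu (pc - \<epsilon>) U v) then ennreal (real (card (clu (pc - \<epsilon>) U v)) ^ 2) else 0))
    \<le> ennreal (B / \<epsilon> ^ 3)"
    using second_moment_upper[OF v lo] e by (simp add: B_def power_mult_distrib)
  qed (use a b0 B e in auto)
  finally show ?thesis by simp
 qed
 moreover have "0 < b0 * a / 2" using a b0 by simp
 ultimately show ?thesis using a by blast
qed

text \<open>Start a characteristic at \<open>pc - e1\<close>, where \<open>M_lower\<close> gives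
  \<open>M\<close> of order \<open>e1\<close> at \<open>h = a * e1\<^sup>2\<close>. If
  \<open>e1\<close> is a small enough multiple of \<epsilon>, a slope of order \<open>e1\<close>
  brings \<open>h\<close> down to 0 before the level \<open>pc + \<epsilon>\<close>.\<close>

lemma theta_lower:
 "\<exists>b>0. \<forall>\<epsilon>>0. \<forall>v\<in>V. plo \<le> pc - \<epsilon> \<longrightarrow> pc + \<epsilon> \<le> p3 \<longrightarrow> b * \<epsilon> \<le> M (pc + \<epsilon>) 1 {} v"
proof -
 obtain a b where ab: "0 < a" "0 < b"
  and Mlow: "\<And>\<epsilon> v. 0 < \<epsilon> \<Longrightarrow> v \<in> V \<Longrightarrow> plo \<le> pc - \<epsilon> \<Longrightarrow> b * \<epsilon> \<le> M (pc - \<epsilon>) (exp (- a * \<epsilon>\<^sup>2)) {} v"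
  using M_lower by blast
 define u where "u = min 1 (c * b / (2 * a))"
 have u: "0 < u" "u \<le> 1" using ab c_pos by (auto simp: u_def)
 have ua: "u * a \<le> c * b / 2"
 proof -
  have "u \<le> c * b / (2 * a)" by (simp add: u_def)
  then show ?thesis using ab by (simp add: field_simps)
 qed
 have "(b * u) * \<epsilon> \<le> M (pc + \<epsilon>) 1 {} v"
  if e: "0 < \<epsilon>" and v: "v \<in> V" and lo: "plo \<le> pc - \<epsilon>" and hi: "pc + \<epsilon> \<le> p3" for \<epsilon> v
 proof -
  define e1 where "e1 = u * \<epsilon>"
  have e1: "0 < e1" "e1 \<le> \<epsilon>" using u e mult_right_mono[of u 1 \<epsilon>] by (auto simp: e1_def)
  have lo1: "plo \<le> pc - e1" using lo e1 by simp
  have M1: "b * e1 \<le> M (pc - e1) (exp (- a * e1\<^sup>2)) {} v" by (rule Mlow[OF e1(1) v lo1])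
  have "M (pc - e1) (exp (- a * e1\<^sup>2)) {} v \<le> M (pc - e1 + (e1 + \<epsilon>)) 1 {} v"
  proof (rule characteristic_theta[OF v, where \<kappa>="c * b * e1 / 2"])
   show "c * b * e1 / 2 < c * M (pc - e1) (exp (- a * e1\<^sup>2)) {} v"
   proof -
    have "c * (b * e1) \<le> c * M (pc - e1) (exp (- a * e1\<^sup>2)) {} v" using M1 c_pos by (intro mult_left_mono) auto
    moreover have "0 < c * (b * e1)" using ab c_pos e1 by simp
    ultimately show ?thesis by simp
   qed
   have "a * e1\<^sup>2 = e1 * (u * a) * \<epsilon>" by (simp add: e1_def power2_eq_square)
   also have "... \<le> e1 * (c * b / 2) * \<epsilon>" using ua e1 e by (intro mult_right_mono mult_left_mono) auto
   also have "... \<le> c * b * e1 / 2 * (e1 + \<epsilon>)" using e1 ab c_pos by (simp add: algebra_simps)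
   finally show "1 \<le> exp (- a * e1\<^sup>2) * exp (c * b * e1 / 2 * (e1 + \<epsilon>))" by (simp flip: exp_add)
  qed (use lo1 e e1 hi ab c_pos in auto)
  then show ?thesis using M1 by (simp add: e1_def)
 qed
 moreover have "0 < b * u" using ab u by simp
 ultimately show ?thesis by blast
qed

end

section \<open>Lower bounds on moments\<close>

lemma fact_le_self_power: "fact k \<le> (real k) ^ k"
 using fact_le_power[of k, where 'a=real] by simp

lemma power_ge_exp:
 fixes t :: real
 assumes "0 \<le> t" "t \<le> 1 / 2"
 shows "exp (- 2 * t * real n) \<le> (1 - t) ^ n"
proof -
 have "exp (- 2 * t) \<le> 1 - t"
 proof -
  have "2 * t - (2 * t)\<^sup>2 / 2 \<le> 1 - exp (- (2 * t))" using assms by (intro one_minus_exp_ge) simp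
  moreover have "2 * t\<^sup>2 \<le> t" using assms mult_left_mono[of t "1 / 2" "2 * t"] by (simp add: power2_eq_square)
  ultimately show ?thesis by (simp add: power_mult_distrib)
 qed
 then have "exp (- 2 * t) ^ n \<le> (1 - t) ^ n" by (rule power_mono) simp
 moreover have "exp (- 2 * t) ^ n = exp (- 2 * t * real n)" by (rule exp_of_nat2_mult[symmetric])
 ultimately show ?thesis by (simp only:)
qed

context bperc
begin

abbreviation PK :: "real \<Rightarrow> 'a \<Rightarrow> nat set \<Rightarrow> real" where
 "PK p v N \<equiv> \<P>(U in PU. finite (clu p U v) \<and> card (clu p U v) \<in> N)"

definition mom :: "real \<Rightarrow> nat \<Rightarrow> 'a \<Rightarrow> ennreal" where
 "mom p k v = (\<E> U. (if finite (clu p U v) then ennreal (real (card (clu p U v)) ^ k) else 0))"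

lemma pred_PK:
 assumes v: "v \<in> V"
 shows "Measurable.pred PU (\<lambda>U. finite (clu p U v) \<and> card (clu p U v) \<in> N)"
proof -
 have "(\<lambda>U. if finite (clu p U v) then card (clu p U v) \<in> N else False) \<in> measurable PU (count_space UNIV)"
  by (rule measurable_component_fun[OF meas_eset_opn v]) auto
 moreover have "(\<lambda>U. if finite (clu p U v) then card (clu p U v) \<in> N else False) =
  (\<lambda>U. finite (clu p U v) \<and> card (clu p U v) \<in> N)" by auto
 ultimately show ?thesis by simp
qed

lemma nn_PK:
 assumes v: "v \<in> V" and s: "0 \<le> s"
 shows "(\<E> U. (if finite (clu p U v) \<and> card (clu p U v) \<in> N then ennreal s else 0)) = ennreal (s * PK p v N)"
proof -
 note [measurable] = pred_PK[OF v, of p N]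
 have "(\<E> U. (if finite (clu p U v) \<and> card (clu p U v) \<in> N then ennreal s else 0)) =
  (\<E> U. ennreal s * (if finite (clu p U v) \<and> card (clu p U v) \<in> N then 1 else 0))"
  by (rule nn_integral_cong) auto
 also have "... = ennreal s * ennreal (PK p v N)"
  by (subst nn_integral_cmult, measurable) (simp only: nn_indicator_pred[OF pred_PK[OF v]])
 finally show ?thesis using s by (simp add: ennreal_mult)
qed

lemma PK_moment:
 assumes v: "v \<in> V" and s: "0 \<le> s" and N: "\<And>n. n \<in> N \<Longrightarrow> s \<le> real n"
 shows "ennreal (s ^ k * PK p v N) \<le> mom p k v"
 unfolding nn_PK[OF v zero_le_power[OF s], symmetric] mom_def
 using s N by (intro nn_integral_mono) (auto intro!: ennreal_leI power_mono)

lemma PK_le_M: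
 assumes v: "v \<in> V" and h: "0 \<le> h" and N: "\<And>n. n \<in> N \<Longrightarrow> z \<le> h * real n" and z: "0 \<le> z"
 shows "(1 - exp (- z)) * PK p v N \<le> M p (exp (- h)) {} v"
proof -
 have x: "0 \<le> exp (- h)" "exp (- h) \<le> 1" using h by auto
 have z1: "0 \<le> 1 - exp (- z)" using z by simp
 have "ennreal ((1 - exp (- z)) * PK p v N) \<le> (\<E> U. ennreal (phi (exp (- h)) (K p U {} v)))"
  unfolding nn_PK[OF v z1, symmetric]
 proof (rule nn_integral_mono)
  fix U
  show "(if finite (clu p U v) \<and> card (clu p U v) \<in> N then ennreal (1 - exp (- z)) else 0)
   \<le> ennreal (phi (exp (- h)) (K p U {} v))"
   using N[of "card (clu p U v)"]
   by (auto simp: phi_def xp_def exp_of_nat2_mult[symmetric] intro!: ennreal_leI)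
 qed
 also have "... = ennreal (M p (exp (- h)) {} v)" by (rule nn_M[OF v x])
 finally show ?thesis using M_bounds(1)[OF v x, of p "{}"] by (subst (asm) ennreal_le_iff) auto
qed

text \<open>Sizes in \<open>N1\<close> and \<open>N2\<close> are bounded by their probabilities. For
  the remaining sizes \<open>\<eta> * n \<le> 1\<close>, so \<open>phi\<close> at \<eta> is at least
  half of its linear approximation, and \<open>phi\<close> at \<open>h\<close> is at most
  \<open>2 * h / \<eta>\<close> times it.\<close>

lemma M_split:
 assumes v: "v \<in> V" and fin: "AE U in PU. finite (clu p U v)" and h: "0 \<le> h" "0 < \<eta>"
  and N: "\<And>n. n \<in> N1 \<or> n \<in> N2 \<or> \<eta> * real n \<le> 1"
 shows "M p (exp (- h)) {} v \<le> PK p v N1 + PK p v N2 + 2 * h / \<eta> * M p (exp (- \<eta>)) {} v"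
proof -
 have x: "0 \<le> exp (- h)" "exp (- h) \<le> 1" "0 \<le> exp (- \<eta>)" "exp (- \<eta>) \<le> 1" using h by auto
 let ?K = "\<lambda>U. clu p U v"
 let ?i = "\<lambda>N U. if finite (?K U) \<and> card (?K U) \<in> N then ennreal 1 else 0"
 have mi [measurable]: "?i N \<in> borel_measurable PU" for N
 proof -
  note [measurable] = pred_PK[OF v, of p N]
  show ?thesis by measurable
 qed
 have mp [measurable]: "(\<lambda>U. ennreal (phi (exp (- \<eta>)) (?K U))) \<in> borel_measurable PU" using v by measurable
 have "ennreal (M p (exp (- h)) {} v) = (\<E> U. ennreal (phi (exp (- h)) (?K U)))"
  using nn_M[OF v x(1,2), of p "{}"] by simp
 also have "... \<le> (\<E> U. ?i N1 U + ?i N2 U + ennreal (2 * h / \<eta>) * ennreal (phi (exp (- \<eta>)) (?K U)))"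
 proof (rule nn_integral_mono_AE)
  show "AE U in PU. ennreal (phi (exp (- h)) (?K U)) \<le> ?i N1 U + ?i N2 U + ennreal (2 * h / \<eta>) * ennreal (phi (exp (- \<eta>)) (?K U))"
   using fin
  proof eventually_elim
   case (elim U)
   have le1: "ennreal (phi (exp (- h)) (?K U)) \<le> 1" using phi_bounds[OF x(1,2), of "?K U"] by (simp add: ennreal_leI[of _ 1, simplified])
   let ?n = "real (card (?K U))"
   consider "card (?K U) \<in> N1" | "card (?K U) \<in> N2" | "\<eta> * ?n \<le> 1" using N by blast
   then show ?case
   proof cases
    case 1
    then have "?i N1 U = 1" using elim by simp
    then show ?thesis using le1 by (simp add: add_increasing2)
   next
    case 2
    then have "?i N2 U = 1" using elim by simp
    then show ?thesis using le1 by (simp add: add_increasing add_increasing2)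
   next
    case 3
    have "(\<eta> * ?n)\<^sup>2 \<le> \<eta> * ?n" using 3 h mult_left_le[of "\<eta> * ?n" "\<eta> * ?n"] by (simp add: power2_eq_square)
    then have lo: "\<eta> * ?n / 2 \<le> 1 - exp (- (\<eta> * ?n))" using one_minus_exp_ge[of "\<eta> * ?n"] h by simp
    have "1 - exp (- (h * ?n)) \<le> h * ?n" using exp_ge_add_one_self[of "- (h * ?n)"] by simp
    also have "... = 2 * h / \<eta> * (\<eta> * ?n / 2)" using h by simp
    also have "... \<le> 2 * h / \<eta> * (1 - exp (- (\<eta> * ?n)))" using lo h by (intro mult_left_mono) auto
    finally have "phi (exp (- h)) (?K U) \<le> 2 * h / \<eta> * phi (exp (- \<eta>)) (?K U)"
     using elim by (simp add: phi_def xp_def exp_of_nat2_mult[symmetric])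
    then have "ennreal (phi (exp (- h)) (?K U)) \<le> ennreal (2 * h / \<eta> * phi (exp (- \<eta>)) (?K U))" by (rule ennreal_leI)
    also have "... = ennreal (2 * h / \<eta>) * ennreal (phi (exp (- \<eta>)) (?K U))"
     using h phi_bounds[OF x(3,4)] by (intro ennreal_mult) auto
    finally show ?thesis by (simp add: add_increasing)
   qed
  qed
 qed
 also have "... = ennreal (PK p v N1) + ennreal (PK p v N2) + ennreal (2 * h / \<eta>) * ennreal (M p (exp (- \<eta>)) {} v)"
  using nn_PK[OF v, of 1 p N1] nn_PK[OF v, of 1 p N2] nn_M[OF v x(3,4), of p "{}"]
  by (simp add: nn_integral_add nn_integral_cmult)
 also have "... = ennreal (PK p v N1 + PK p v N2 + 2 * h / \<eta> * M p (exp (- \<eta>)) {} v)"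
  using h M_bounds(1)[OF v x(3,4), of p "{}"] by (simp add: ennreal_plus ennreal_mult[symmetric])
 finally show ?thesis using h M_bounds(1)[OF v x(3,4), of p "{}"] by (subst (asm) ennreal_le_iff) auto
qed

end

context mperc
begin

text \<open>\<open>M_lower\<close> provides a total of \<open>b * e\<close> to distribute over the
  sizes. Small sizes contribute at most \<open>2 * \<alpha> * C * t * e\<close>, by the critical
  window at scale \<open>\<eta> = e / t\<close>; large sizes are limited by the second moment. The
  constants \<open>t\<close> and \<open>A\<close> are chosen so that each of these takes at most a
  quarter.\<close>

lemma window_probability:
 "\<exists>a>0. \<exists>A>0. \<exists>b>0. \<exists>e0>0. \<forall>e\<in>{0<..<e0}. \<forall>v\<in>V. b * e \<le> PK (pc - e) v {n. a \<le> e\<^sup>2 * real n \<and> e\<^sup>2 * real n \<le> A}"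
proof -
 obtain C where C: "0 < C"
  and CW: "\<And>\<epsilon> v. 0 < \<epsilon> \<Longrightarrow> v \<in> V \<Longrightarrow> plo \<le> pc - \<epsilon> \<Longrightarrow> pc + \<epsilon> \<le> p3 \<Longrightarrow> M (pc + \<epsilon>) (exp (- \<epsilon>\<^sup>2)) {} v \<le> C * \<epsilon>"
  using critical_window by blast
 obtain \<alpha> b where ab: "0 < \<alpha>" "0 < b"
  and LB: "\<And>\<epsilon> v. 0 < \<epsilon> \<Longrightarrow> v \<in> V \<Longrightarrow> plo \<le> pc - \<epsilon> \<Longrightarrow> b * \<epsilon> \<le> M (pc - \<epsilon>) (exp (- \<alpha> * \<epsilon>\<^sup>2)) {} v"
  using M_lower by blast
 define t where "t = b / (8 * \<alpha> * C)"
 have t: "0 < t" using ab C by (simp add: t_def)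
 define a where "a = t\<^sup>2"
 have a: "0 < a" using t by (simp add: a_def)
 define A where "A = sqrt (4 * 1024 / (c ^ 3 * b))"
 have A: "0 < A" "A\<^sup>2 = 4 * 1024 / (c ^ 3 * b)" using ab c_pos by (auto simp: A_def)
 define e0 where "e0 = min (min (pc - plo) (t * (pc - plo))) (t * (p3 - pc))"
 have e0: "0 < e0" using pc t by (simp add: e0_def)
 have "(b / 2) * e \<le> PK (pc - e) v {n. a \<le> e\<^sup>2 * real n \<and> e\<^sup>2 * real n \<le> A}"
  if e: "0 < e" "e < e0" and v: "v \<in> V" for e v
 proof -
  define q where "q = pc - e"
  define \<eta> where "\<eta> = e / t"
  have eta: "0 < \<eta>" "\<eta> \<le> pc - plo" "\<eta> \<le> p3 - pc"
   using e t by (auto simp: \<eta>_def e0_def pos_divide_le_eq mult.commute)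
  have q: "plo \<le> q" "q < pc" using e by (auto simp: q_def e0_def)
  let ?N1 = "{n. a \<le> e\<^sup>2 * real n \<and> e\<^sup>2 * real n \<le> A}" and ?N2 = "{n. A < e\<^sup>2 * real n}"
  have "b * e \<le> M q (exp (- (\<alpha> * e\<^sup>2))) {} v" using LB[OF e(1) v] q by (simp add: q_def)
  also have "... \<le> PK q v ?N1 + PK q v ?N2 + 2 * (\<alpha> * e\<^sup>2) / \<eta>\<^sup>2 * M q (exp (- \<eta>\<^sup>2)) {} v"
  proof (rule M_split[OF v])
   show "AE U in PU. finite (clu q U v)" by (rule chi_finite_AE[OF v chi_upper[OF v q]])
   show "n \<in> ?N1 \<or> n \<in> ?N2 \<or> \<eta>\<^sup>2 * real n \<le> 1" for n
   proof -
    have "\<eta>\<^sup>2 * real n = e\<^sup>2 * real n / a" by (simp add: \<eta>_def a_def power_divide)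
    then show ?thesis using a by (auto simp: pos_divide_le_eq)
   qed
  qed (use ab e eta in auto)
  also have "2 * (\<alpha> * e\<^sup>2) / \<eta>\<^sup>2 * M q (exp (- \<eta>\<^sup>2)) {} v \<le> b / 4 * e"
  proof -
   have "M q (exp (- \<eta>\<^sup>2)) {} v \<le> M (pc + \<eta>) (exp (- \<eta>\<^sup>2)) {} v"
    using e eta v by (intro M_mono_gen) (auto simp: q_def)
   also have "... \<le> C * \<eta>" using eta v by (intro CW) auto
   finally have "2 * (\<alpha> * e\<^sup>2) / \<eta>\<^sup>2 * M q (exp (- \<eta>\<^sup>2)) {} v \<le> 2 * (\<alpha> * e\<^sup>2) / \<eta>\<^sup>2 * (C * \<eta>)"
    using ab by (intro mult_left_mono) auto
   also have "... = 2 * \<alpha> * C * t * e" using e t by (simp add: \<eta>_def power2_eq_square field_simps)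
   also have "... = b / 4 * e" using ab C by (simp add: t_def)
   finally show ?thesis .
  qed
  also have "PK q v ?N2 \<le> b / 4 * e"
  proof -
   let ?s = "A / e\<^sup>2"
   have "ennreal (?s ^ 2 * PK q v ?N2) \<le> mom q 2 v"
    using e A by (intro PK_moment v) (auto simp: pos_divide_le_eq mult.commute)
   also have "... \<le> ennreal (1024 / (c * (pc - q)) ^ 3)"
    unfolding mom_def by (rule second_moment_upper[OF v q])
   finally have "?s ^ 2 * PK q v ?N2 \<le> 1024 / (c * e) ^ 3"
    using e c_pos by (subst (asm) ennreal_le_iff) (auto simp: q_def)
   moreover have "0 < ?s ^ 2" using A e by simp
   ultimately have "PK q v ?N2 \<le> 1024 / (c * e) ^ 3 / ?s ^ 2"
    by (simp only: pos_le_divide_eq mult.commute[of _ "?s ^ 2"])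
   also have "... = b / 4 * e"
    unfolding power_divide A(2) using e c_pos ab by (simp add: field_simps power2_eq_square eval_nat_numeral)
   finally show ?thesis .
  qed
  finally show ?thesis by (simp add: q_def)
 qed
 then have "\<forall>e\<in>{0<..<e0}. \<forall>v\<in>V. (b / 2) * e \<le> PK (pc - e) v {n. a \<le> e\<^sup>2 * real n \<and> e\<^sup>2 * real n \<le> A}"
  by (intro ballI) (simp only: greaterThanLessThan_iff)
 moreover have "0 < b / 2" using ab by simp
 ultimately show ?thesis using a A(1) e0 by (intro exI[of _ a] exI[of _ A] exI[of _ "b / 2"] exI[of _ e0] conjI)
qed

lemma moment_lower:
 "\<exists>c'>0. \<exists>\<delta>>0. \<forall>k\<ge>1. \<forall>\<epsilon>\<in>{0<..<\<delta>}. \<forall>v\<in>V. \<forall>p\<in>{pc - \<epsilon>, pc + \<epsilon>}. ennreal (c' ^ k * fact k / \<epsilon> ^ (2 * k - 1)) \<le> mom p k v"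
proof -
 obtain C where C: "0 < C"
  and CW: "\<And>\<epsilon> v. 0 < \<epsilon> \<Longrightarrow> v \<in> V \<Longrightarrow> plo \<le> pc - \<epsilon> \<Longrightarrow> pc + \<epsilon> \<le> p3 \<Longrightarrow> M (pc + \<epsilon>) (exp (- \<epsilon>\<^sup>2)) {} v \<le> C * \<epsilon>"
  using critical_window by blast
 obtain a A b e0 where a: "0 < a" and A: "0 < A" and b: "0 < b" and e0: "0 < e0"
  and WP0: "\<forall>e\<in>{0<..<e0}. \<forall>v\<in>V. b * e \<le> PK (pc - e) v {n. a \<le> e\<^sup>2 * real n \<and> e\<^sup>2 * real n \<le> A}"
  using window_probability by (elim exE conjE)
 have WP: "b * e \<le> PK (pc - e) v {n. a \<le> e\<^sup>2 * real n \<and> e\<^sup>2 * real n \<le> A}" if "0 < e" "e < e0" "v \<in> V" for e v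
  using WP0 that by (simp only: greaterThanLessThan_iff)
 define m where "m = min plo (1 - p3)"
 have m: "0 < m" "m \<le> plo" "m \<le> 1 - p3" using plo by (auto simp: m_def)
 define \<delta>0 where "\<delta>0 = min (min e0 (m / 4)) (min (pc - plo) (p3 - pc))"
 have d0: "0 < \<delta>0" using e0 m pc by (simp add: \<delta>0_def)
 define L where "L = 16 * A * d / m\<^sup>2"
 define z where "z = 1 - exp (- a)"
 have z: "0 < z" using a by (simp add: z_def)
 define g where "g = b\<^sup>2 * z / C"
 have g: "0 < g" using b z C by (simp add: g_def)
 \<comment> \<open>The factor \<open>min 1 g / 2\<close> absorbs the prefactor \<open>g / k\<close>,
   since \<open>k \<le> 2 ^ k\<close>.\<close>
 define c' where "c' = a * (exp (- L) * min 1 g / 2)"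
 have c': "0 < c'" using a g by (simp add: c'_def)
 have "ennreal (c' ^ k * fact k / \<epsilon> ^ (2 * k - 1)) \<le> mom p k v"
  if k: "1 \<le> k" and ep: "0 < \<epsilon>" "\<epsilon> < \<delta>0" and v: "v \<in> V" and p: "p = pc - \<epsilon> \<or> p = pc + \<epsilon>" for k \<epsilon> v p
 proof -
  \<comment> \<open>The window at distance \<open>e\<close> from \<open>pc\<close> contains sizes
    \<open>n\<close> of order \<open>k / \<epsilon>\<^sup>2\<close>, for which \<open>n ^ k\<close>
    is of order \<open>k ^ k / \<epsilon> ^ (2 * k)\<close> up to exponential factors, and
    \<open>k ^ k \<ge> fact k\<close>. The Hellinger cost is exponential in
    \<open>\<epsilon>\<^sup>2 * n\<close>, hence only in \<open>k\<close>.\<close>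
  define e where "e = \<epsilon> / sqrt (real k)"
  have sk: "1 \<le> sqrt (real k)" using k by simp
  have e: "0 < e" "e \<le> \<epsilon>" "e\<^sup>2 = \<epsilon>\<^sup>2 / k"
   using ep sk k mult_left_mono[OF sk, of \<epsilon>] by (auto simp: e_def power_divide pos_divide_le_eq)
  have e2: "0 < e\<^sup>2" using e(1) by simp
  let ?N = "{n. a \<le> e\<^sup>2 * real n \<and> e\<^sup>2 * real n \<le> A}"
  define q where "q = pc - e"
  \<comment> \<open>The event is transferred from the midpoint \<open>q\<close> to \<open>p\<close>.
    The third point \<open>q + \<theta>\<close> is the reflection of \<open>p\<close> and lies at
    most at \<open>pc + \<epsilon>\<close>, where the critical window bounds the probability of
    large clusters.\<close>
  define \<theta> where "\<theta> = q - p"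
  have th: "\<bar>\<theta>\<bar> \<le> 2 * \<epsilon>" using p e ep by (auto simp: \<theta>_def q_def)
  have eps: "\<epsilon> < e0" "4 * \<epsilon> < m" "\<epsilon> \<le> pc - plo" "\<epsilon> \<le> p3 - pc" using ep by (auto simp: \<delta>0_def)
  have q: "m \<le> q" "m \<le> 1 - q" using m pc plo e eps by (auto simp: q_def)
  define R where "R = C * \<epsilon> / z"
  have PR: "PK (q + \<theta>) v ?N \<le> R"
  proof -
   have "(1 - exp (- a)) * PK (q + \<theta>) v ?N \<le> M (q + \<theta>) (exp (- \<epsilon>\<^sup>2)) {} v"
   proof (rule PK_le_M[OF v])
    show "a \<le> \<epsilon>\<^sup>2 * real n" if "n \<in> ?N" for n
    proof -
     have "e\<^sup>2 * real n \<le> \<epsilon>\<^sup>2 * real n" using e by (intro mult_right_mono power_mono) auto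
     then show ?thesis using that by simp
    qed
   qed (use a in auto)
   also have "... \<le> M (pc + \<epsilon>) (exp (- \<epsilon>\<^sup>2)) {} v"
    using p e ep v by (intro M_mono_gen) (auto simp: \<theta>_def q_def)
   also have "... \<le> C * \<epsilon>" using ep eps v by (intro CW) auto
   finally show ?thesis using z by (simp add: R_def z_def pos_le_divide_eq mult.commute)
  qed
  define B where "B = nat \<lfloor>A / e\<^sup>2\<rfloor>"
  have NB: "n \<le> B" if "n \<in> ?N" for n
  proof -
   have "real n \<le> A / e\<^sup>2" using that e2 by (simp add: pos_le_divide_eq mult.commute)
   then show ?thesis unfolding B_def by (simp add: le_nat_floor)
  qed
  have BA: "real B \<le> A / e\<^sup>2" unfolding B_def using A e2 by (intro of_nat_floor) auto
  have kap: "(\<theta> / m)\<^sup>2 \<le> 4 * \<epsilon>\<^sup>2 / m\<^sup>2" "(\<theta> / m)\<^sup>2 \<le> 1 / 2"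
  proof -
   have "\<theta>\<^sup>2 \<le> (2 * \<epsilon>)\<^sup>2" using th ep abs_le_square_iff[of \<theta> "2 * \<epsilon>"] by simp
   then show 1: "(\<theta> / m)\<^sup>2 \<le> 4 * \<epsilon>\<^sup>2 / m\<^sup>2" by (simp add: power_divide power_mult_distrib divide_right_mono)
   have "(4 * \<epsilon>)\<^sup>2 \<le> m\<^sup>2" using eps ep by (intro power_mono) auto
   then have "4 * \<epsilon>\<^sup>2 / m\<^sup>2 \<le> 1 / 4" using m by (simp add: power_mult_distrib field_simps)
   then show "(\<theta> / m)\<^sup>2 \<le> 1 / 2" using 1 by linarith
  qed
  have ex: "exp (- (L * k / 2)) \<le> (1 - (\<theta> / m)\<^sup>2) ^ (d * B)"
  proof -
   have "(\<theta> / m)\<^sup>2 * (d * real B) \<le> 4 * \<epsilon>\<^sup>2 / m\<^sup>2 * (d * (A / e\<^sup>2))"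
    using kap BA A by (intro mult_mono) auto
   also have "... = L * k / 4" unfolding e(3) L_def using ep k by (simp add: field_simps)
   finally have "exp (- (L * k / 2)) \<le> exp (- 2 * (\<theta> / m)\<^sup>2 * real (d * B))" by simp
   also have "... \<le> (1 - (\<theta> / m)\<^sup>2) ^ (d * B)" by (rule power_ge_exp[OF _ kap(2)]) simp
   finally show ?thesis .
  qed
  define bb where "bb = exp (- (L * k / 2)) * (b * e)"
  have "bb\<^sup>2 \<le> R * PK (q - \<theta>) v ?N"
  proof (rule hellinger_transfer[OF v m(1) q _ NB _ _ PR])
   show "\<bar>\<theta>\<bar> \<le> m" using th eps by linarith
   show "0 < bb" using b e by (simp add: bb_def)
   show "bb \<le> (1 - (\<theta> / m)\<^sup>2) ^ (d * B) * PK q v ?N"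
    unfolding bb_def
   proof (intro mult_mono ex order_trans[OF exp_ge_zero ex])
    show "b * e \<le> PK q v ?N" unfolding q_def by (rule WP) (use e eps v in auto)
    show "0 \<le> b * e" using e(1) b by simp
   qed
  qed
  then have 1: "bb\<^sup>2 / R \<le> PK p v ?N"
  proof -
   have "0 < R" using C z ep by (simp add: R_def)
   moreover have "q - \<theta> = p" by (simp add: \<theta>_def)
   ultimately show ?thesis using \<open>bb\<^sup>2 \<le> R * PK (q - \<theta>) v ?N\<close>
    by (simp only: pos_divide_le_eq mult.commute[of R])
  qed
  have "bb\<^sup>2 / R = exp (- L) ^ k * g * \<epsilon> / k"
  proof -
   have "bb\<^sup>2 = exp (- (L * k)) * (b\<^sup>2 * (\<epsilon>\<^sup>2 / k))"
    unfolding bb_def power_mult_distrib e(3) by (simp add: power2_eq_square flip: exp_add)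
   moreover have "exp (- (L * k)) = exp (- L) ^ k" using exp_of_nat2_mult[of "- L" k] by simp
   ultimately show ?thesis
    unfolding R_def g_def using ep z C by (simp add: power2_eq_square field_simps)
  qed
  then have 2: "exp (- L) ^ k * g * \<epsilon> / k \<le> PK p v ?N" using 1 by simp
  have "c' ^ k * fact k / \<epsilon> ^ (2 * k - 1) \<le> (a / e\<^sup>2) ^ k * (exp (- L) ^ k * g * \<epsilon> / k)"
  proof -
   have mg: "(min 1 g / 2) ^ k \<le> g / k"
   proof -
    have "min 1 g ^ k \<le> min 1 g ^ 1" using g k by (intro power_decreasing) auto
    moreover have "real k \<le> 2 ^ k" using of_nat_less_two_power[where n=k] by (simp add: less_imp_le)
    ultimately have "min 1 g ^ k / 2 ^ k \<le> g / k" using g k by (intro frac_le) auto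
    then show ?thesis by (simp add: power_divide)
   qed
   have "c' ^ k * fact k / \<epsilon> ^ (2 * k - 1) = (a ^ k * exp (- L) ^ k) * ((min 1 g / 2) ^ k * fact k) / \<epsilon> ^ (2 * k - 1)"
    unfolding c'_def power_mult_distrib times_divide_eq_right[symmetric] by simp
   also have "... \<le> (a ^ k * exp (- L) ^ k) * (g / k * real k ^ k) / \<epsilon> ^ (2 * k - 1)"
    using mg fact_le_self_power[of k] g k a ep
    by (intro divide_right_mono mult_left_mono mult_mono) auto
   also have "... = (a / e\<^sup>2) ^ k * (exp (- L) ^ k * g * \<epsilon> / k)"
   proof -
    have "2 * k = Suc (2 * k - 1)" using k by simp
    then have "(\<epsilon>\<^sup>2) ^ k = \<epsilon> * \<epsilon> ^ (2 * k - 1)" by (metis power_mult power_Suc)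
    then show ?thesis unfolding e(3) using ep k by (simp add: power_divide power_mult_distrib ac_simps)
   qed
   finally show ?thesis .
  qed
  also have "... \<le> (a / e\<^sup>2) ^ k * PK p v ?N" using 2 a by (intro mult_left_mono) auto
  finally have "ennreal (c' ^ k * fact k / \<epsilon> ^ (2 * k - 1)) \<le> ennreal ((a / e\<^sup>2) ^ k * PK p v ?N)" by (rule ennreal_leI)
  also have "... \<le> mom p k v"
   using a e2 by (intro PK_moment[OF v]) (auto simp: pos_divide_le_eq mult.commute)
  finally show ?thesis .
 qed
 then show ?thesis using c' d0 by (intro exI[of _ c'] exI[of _ \<delta>0] conjI allI impI ballI) auto
qed

end

section \<open>Finite clusters above the critical point\<close>

lemma square_sum_mult:
 fixes a :: "'b \<Rightarrow> real"
 shows "(\<Sum>y\<in>A. \<Sum>z\<in>A. a y * a z * c) = (\<Sum>u\<in>A. a u)\<^sup>2 * c"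
proof -
 have "(\<Sum>z\<in>A. a y * a z * c) = a y * (sum a A * c)" for y
  by (simp add: sum_distrib_left sum_distrib_right mult.assoc)
 then have "(\<Sum>y\<in>A. \<Sum>z\<in>A. a y * a z * c) = (\<Sum>y\<in>A. a y * (sum a A * c))" by simp
 also have "... = sum a A * (sum a A * c)" by (rule sum_distrib_right[symmetric])
 finally show ?thesis by (simp add: power2_eq_square)
qed

context perc
begin

lemma measurable_ennreal_indicator:
 assumes [measurable]: "Measurable.pred PU P"
 shows "(\<lambda>U. if P U then 1 else (0::ennreal)) \<in> borel_measurable PU"
 by measurable

abbreviation exfam :: "'a set \<Rightarrow> 'a \<Rightarrow> 'a set set set" where
 "exfam W \<equiv> confam (\<lambda>C. \<not> C \<subseteq> W)"

abbreviation tofam :: "'a \<Rightarrow> 'a \<Rightarrow> 'a set set set" where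
 "tofam w \<equiv> confam (\<lambda>C. {w} \<subseteq> C)"

text \<open>An infinite cluster has no finite witness, so BK is applied to the event of leaving a
  finite set \<open>W\<close>, which afterwards increases to \<open>V\<close>.\<close>

definition pex :: "real \<Rightarrow> 'a set \<Rightarrow> 'a \<Rightarrow> real" where
 "pex p W v = \<P>(U in PU. \<not> clu p U v \<subseteq> W)"

lemma pred_exits [measurable]: "Measurable.pred PU (\<lambda>U. \<not> clu p U v \<subseteq> W)"
 unfolding occ_confam_exits[OF opn_subset, symmetric] by (rule pred_occ[OF confam_FE])

text \<open>If the clusters of \<open>y\<close> and \<open>z\<close> differ, their witnesses have no
  edge in common. Otherwise apply \<open>connection_split\<close> to the targets \<open>z\<close>
  and a vertex \<open>g\<close> outside \<open>W\<close>, which are distinct because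
  \<open>z\<close> lies in \<open>W\<close>: some \<open>w\<close> branches to \<open>z\<close> and
  to the outside.\<close>

lemma exits_split:
 assumes F: "F \<subseteq> E" and y: "y \<in> V" and z: "z \<in> W"
  and ex: "\<not> component F y \<subseteq> W" "\<not> component F z \<subseteq> W"
 shows "occ (disj (exfam W y) (exfam W z)) F \<or>
  (\<exists>w\<in>V. occ (disj (tofam w y) (disj (tofam z w) (exfam W w))) F)"
proof (cases "z \<in> component F y")
 case True
 obtain g where g: "g \<in> component F y" "g \<notin> W" using ex by auto
 define I where "I = {z, g}"
 have I: "finite I" "I \<subseteq> component F y" "2 \<le> card I" using True g z by (auto simp: I_def card_insert_if)
 from component_finite_witness[OF I(1,2)] obtain D where D: "finite D" "D \<subseteq> F" "I \<subseteq> component D y" by blast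
 have DE: "D \<subseteq> E" using D F by blast
 from connection_split[OF D(1) edges_proper D(3) I(1,3)] DE
 obtain w J F0 F1 F2 where *: "J \<noteq> {}" "J \<subset> I" "F0 \<subseteq> D" "F1 \<subseteq> D" "F2 \<subseteq> D" "F0 \<inter> F1 = {}" "F0 \<inter> F2 = {}" "F1 \<inter> F2 = {}"
   "w \<in> component F0 y" "J \<subseteq> component F1 w" "I - J \<subseteq> component F2 w" by blast
 have wV: "w \<in> V" using component_subset_V[of F0 y] *(3,9) DE y by blast
 have "\<exists>G1 G2. G1 \<subseteq> D \<and> G2 \<subseteq> D \<and> F0 \<inter> G1 = {} \<and> F0 \<inter> G2 = {} \<and> G1 \<inter> G2 = {} \<and> z \<in> component G1 w \<and> g \<in> component G2 w"
 proof (cases "z \<in> J")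
  case True
  then have "g \<notin> J" using *(1,2) by (auto simp: I_def)
  then show ?thesis using True *(4-8,10,11) by (intro exI[of _ F1] exI[of _ F2]) (auto simp: I_def)
 next
  case False
  then have "g \<in> J" using *(1,2) by (auto simp: I_def)
  then show ?thesis using False *(4-8,10,11) by (intro exI[of _ F2] exI[of _ F1]) (auto simp: I_def)
 qed
 then obtain G1 G2 where G: "G1 \<subseteq> D" "G2 \<subseteq> D" "F0 \<inter> G1 = {}" "F0 \<inter> G2 = {}" "G1 \<inter> G2 = {}"
  "z \<in> component G1 w" "g \<in> component G2 w" by blast
 have FE: "F0 \<in> FE" "G1 \<in> FE" "G2 \<in> FE" using D(1) DE *(3) G(1,2) by (auto simp: FE_def intro: finite_subset)
 have "G1 \<union> G2 \<in> disj (tofam z w) (exfam W w)"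
  unfolding disj_def using G FE g by (auto simp: confam_def)
 then have "F0 \<union> (G1 \<union> G2) \<in> disj (tofam w y) (disj (tofam z w) (exfam W w))"
  unfolding disj_def[of "tofam w y"] using * G FE
  by (intro CollectI exI[of _ F0] exI[of _ "G1 \<union> G2"]) (auto simp: confam_def)
 then have "occ (disj (tofam w y) (disj (tofam z w) (exfam W w))) F"
  unfolding occ_def by (rule bexI[rotated]) (use *(3) G(1,2) D(2) in blast)
 then show ?thesis using wV by blast
next
 case False
 have wit: "\<exists>D\<in>exfam W u. D \<subseteq> F \<and> (\<forall>e\<in>D. e \<subseteq> component F u)" if u: "\<not> component F u \<subseteq> W" for u
 proof -
  let ?C = "component F u"
  obtain g where g: "g \<in> ?C" "g \<notin> W" using u by auto
  have "component {e \<in> F. e \<subseteq> ?C} u = ?C"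
   using component_eq_iff[of u ?C F] edge_doubleton F by auto
  then have "g \<in> component {e \<in> F. e \<subseteq> ?C} u" using g by simp
  from component_finite_witness1[OF this] obtain D where
   "finite D" "D \<subseteq> {e \<in> F. e \<subseteq> ?C}" "g \<in> component D u" by blast
  then show ?thesis using g F by (intro bexI[of _ D]) (auto simp: confam_def FE_def)
 qed
 from wit[OF ex(1)] obtain D1 where D1: "D1 \<in> exfam W y" "D1 \<subseteq> F" "\<forall>e\<in>D1. e \<subseteq> component F y" by blast
 from wit[OF ex(2)] obtain D2 where D2: "D2 \<in> exfam W z" "D2 \<subseteq> F" "\<forall>e\<in>D2. e \<subseteq> component F z" by blast
 have "component F y \<inter> component F z = {}"
 proof (rule ccontr)
  assume "component F y \<inter> component F z \<noteq> {}"
  then obtain x where x: "x \<in> component F y" "x \<in> component F z" by auto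
  then have "component F y = component F z" using component_eq[OF x(1)] component_eq[OF x(2)] by simp
  then show False using False by auto
 qed
 moreover have "e \<noteq> {}" if "e \<in> D1" for e using edge_doubleton[of e] that D1(2) F by auto
 ultimately have "D1 \<inter> D2 = {}" using D1(3) D2(3) by blast
 then have "D1 \<union> D2 \<in> disj (exfam W y) (exfam W z)" using D1 D2 by (auto simp: disj_def)
 then have "occ (disj (exfam W y) (exfam W z)) F"
  unfolding occ_def by (rule bexI[rotated]) (use D1(2) D2(2) in auto)
 then show ?thesis by (rule disjI1)
qed

text \<open>A union bound over the branch vertex \<open>w\<close>, with BK used twice for the
  branching event and once for disjoint exits.\<close>

lemma pair_exits:
 assumes p: "0 \<le> p" "p \<le> 1" and y: "y \<in> V" and z: "z \<in> W"
 shows "ennreal (\<P>(U in PU. \<not> clu p U y \<subseteq> W \<and> \<not> clu p U z \<subseteq> W)) \<le>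
  ennreal (pex p W y * pex p W z) + (\<integral>\<^sup>+w. ennreal (tau p y w * tau p w z * pex p W w) \<partial>count_space V)"
proof -
 define A where "A = disj (exfam W y) (exfam W z)"
 define B where "B w = disj (tofam w y) (disj (tofam z w) (exfam W w))" for w
 have FE: "A \<subseteq> FE" "B w \<subseteq> FE" for w
  unfolding A_def B_def by (intro disj_FE confam_FE)+
 note [measurable] = pred_occ[OF FE(1)] pred_occ[OF FE(2)]
 have "ennreal (\<P>(U in PU. \<not> clu p U y \<subseteq> W \<and> \<not> clu p U z \<subseteq> W))
  = (\<E> U. (if \<not> clu p U y \<subseteq> W \<and> \<not> clu p U z \<subseteq> W then 1 else 0))"
  by (rule nn_indicator_pred[symmetric]) measurable
 also have "... \<le> (\<E> U. (if occ A (opn E p U) then 1 else 0) + (if \<exists>w\<in>V. occ (B w) (opn E p U) then 1 else 0))"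
 proof (rule nn_integral_mono)
  fix U
  show "(if \<not> clu p U y \<subseteq> W \<and> \<not> clu p U z \<subseteq> W then 1 else 0) \<le>
   (if occ A (opn E p U) then 1 else 0) + (if \<exists>w\<in>V. occ (B w) (opn E p U) then 1 else (0::ennreal))"
   using exits_split[OF opn_subset[of E p U] y z] by (auto simp: A_def B_def)
 qed
 also have "... = (\<E> U. (if occ A (opn E p U) then 1 else 0)) + (\<E> U. (if \<exists>w\<in>V. occ (B w) (opn E p U) then 1 else 0))"
 proof -
  have "Measurable.pred PU (\<lambda>U. \<exists>w\<in>V. occ (B w) (opn E p U))"
   by (rule pred_countable_ex[OF countable_V pred_occ[OF FE(2)]])
  then show ?thesis by (intro nn_integral_add measurable_ennreal_indicator pred_occ[OF FE(1)])
 qed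
 also have "(\<E> U. (if \<exists>w\<in>V. occ (B w) (opn E p U) then 1 else 0)) \<le>
  (\<E> U. (\<integral>\<^sup>+w. (if occ (B w) (opn E p U) then 1 else 0) \<partial>count_space V))"
 proof (rule nn_integral_mono)
  fix U
  show "(if \<exists>w\<in>V. occ (B w) (opn E p U) then 1 else 0) \<le> (\<integral>\<^sup>+w. (if occ (B w) (opn E p U) then 1 else (0::ennreal)) \<partial>count_space V)"
  proof (cases "\<exists>w\<in>V. occ (B w) (opn E p U)")
   case True
   then obtain w where "w \<in> V" "occ (B w) (opn E p U)" by blast
   then have "1 = (\<integral>\<^sup>+u. (if occ (B u) (opn E p U) then 1 else (0::ennreal)) * indicator {w} u \<partial>count_space V)"
    by (simp add: nn_integral_cmult_indicator)
   also have "... \<le> (\<integral>\<^sup>+w. (if occ (B w) (opn E p U) then 1 else (0::ennreal)) \<partial>count_space V)"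
    by (intro nn_integral_mono) (auto split: split_indicator)
   finally show ?thesis using True by simp
  qed auto
 qed
 also have "(\<E> U. (\<integral>\<^sup>+w. (if occ (B w) (opn E p U) then 1 else 0) \<partial>count_space V))
   = (\<integral>\<^sup>+w. (\<E> U. (if occ (B w) (opn E p U) then 1 else 0)) \<partial>count_space V)"
  by (rule nn_integral_count_space_nn_integral[OF countable_V]) measurable
 also have "... = (\<integral>\<^sup>+w. ennreal (\<P>(U in PU. occ (B w) (opn E p U))) \<partial>count_space V)"
  by (intro nn_integral_cong nn_indicator_pred) measurable
 also have "... \<le> (\<integral>\<^sup>+w. ennreal (tau p y w * tau p w z * pex p W w) \<partial>count_space V)"
 proof (intro nn_integral_mono ennreal_leI)
  fix w
  have "\<P>(U in PU. occ (B w) (opn E p U)) \<le>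
     \<P>(U in PU. occ (tofam w y) (opn E p U)) *
     \<P>(U in PU. occ (disj (tofam z w) (exfam W w)) (opn E p U))"
   unfolding B_def by (intro BK disj_FE confam_FE p)
  also have "... \<le> \<P>(U in PU. occ (tofam w y) (opn E p U)) *
     (\<P>(U in PU. occ (tofam z w) (opn E p U)) *
     \<P>(U in PU. occ (exfam W w) (opn E p U)))"
   by (intro mult_left_mono BK confam_FE p) auto
  also have "... = tau p y w * (tau p w z * pex p W w)"
   using occ_confam_subset[OF opn_subset[of E p], of "{w}" y] occ_confam_subset[OF opn_subset[of E p], of "{z}" w]
   by (simp add: occ_confam_exits[OF opn_subset] tau_def pex_def)
  finally show "\<P>(U in PU. occ (B w) (opn E p U)) \<le> tau p y w * tau p w z * pex p W w" by simp
 qed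
 also have "(\<E> U. (if occ A (opn E p U) then 1 else 0)) = ennreal (\<P>(U in PU. occ A (opn E p U)))"
  by (rule nn_indicator_pred) measurable
 also have "... \<le> ennreal (pex p W y * pex p W z)"
 proof (rule ennreal_leI)
  have "\<P>(U in PU. occ A (opn E p U)) \<le>
     \<P>(U in PU. occ (exfam W y) (opn E p U)) * \<P>(U in PU. occ (exfam W z) (opn E p U))"
   unfolding A_def by (intro BK confam_FE p)
  then show "\<P>(U in PU. occ A (opn E p U)) \<le> pex p W y * pex p W z"
   by (simp add: occ_confam_exits[OF opn_subset] pex_def)
 qed
 finally show ?thesis by (simp add: add_mono)
qed

lemma pex_bounds: "0 \<le> pex p W v" "pex p W v \<le> 1"
 by (auto simp: pex_def)

lemma pex_tendsto:
 assumes v: "v \<in> V" and L: "\<And>n. W n \<in> FS" "incseq W" "\<And>D. D \<in> FS \<Longrightarrow> \<exists>n. D \<subseteq> W n"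
 shows "(\<lambda>n. pex p (W n) v) \<longlonglongrightarrow> M p 1 {} v"
proof -
 let ?A = "\<lambda>n. {U \<in> space PU. \<not> clu p U v \<subseteq> W n}"
 have "(\<lambda>n. measure PU (?A n)) \<longlonglongrightarrow> measure PU (\<Inter>n. ?A n)"
 proof (rule PU.finite_Lim_measure_decseq)
  show "decseq ?A" using L(2) by (fastforce simp: decseq_def incseq_def)
 qed auto
 moreover have "(\<Inter>n. ?A n) = {U \<in> space PU. infinite (clu p U v)}"
 proof (intro equalityI subsetI)
  fix U assume U: "U \<in> (\<Inter>n. ?A n)"
  then have nl: "\<not> clu p U v \<subseteq> W n" for n by auto
  have "infinite (clu p U v)"
  proof
   assume "finite (clu p U v)"
   then have "clu p U v \<in> FS" using component_subset_V[OF opn_subset v] by (auto simp: FS_def)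
   then show False using L(3) nl by blast
  qed
  then show "U \<in> {U \<in> space PU. infinite (clu p U v)}" using U by auto
 next
  fix U assume "U \<in> {U \<in> space PU. infinite (clu p U v)}"
  then show "U \<in> (\<Inter>n. ?A n)" using L(1) by (auto simp: FS_def dest: finite_subset)
 qed
 moreover have "\<P>(U in PU. infinite (clu p U v)) = M p 1 {} v"
 proof -
  note [measurable] = pred_K_finite[OF v, of p "{}", unfolded del_empty]
  have "ennreal (\<P>(U in PU. infinite (clu p U v))) = (\<E> U. (if infinite (clu p U v) then 1 else 0))"
   by (rule nn_indicator_pred[symmetric]) measurable
  also have "... = (\<E> U. ennreal (phi 1 (K p U {} v)))"
   by (rule nn_integral_cong) (simp add: phi_def xp_def)
  also have "... = ennreal (M p 1 {} v)" by (rule nn_M[OF v]) auto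
  finally show ?thesis using M_bounds(1)[OF v, of 1 p "{}"] by (subst (asm) ennreal_inj) auto
 qed
 ultimately show ?thesis by (simp add: pex_def)
qed

lemma nn_integral_count_le:
 assumes G0: "\<And>w. 0 \<le> G w" and Lam: "\<And>B. B \<in> FS \<Longrightarrow> (\<Sum>w\<in>B. G w) \<le> (L::real)"
 shows "(\<integral>\<^sup>+w. ennreal (G w) \<partial>count_space V) \<le> ennreal L"
proof -
 obtain W where LL: "\<And>n. W n \<in> FS" "incseq W" "\<And>D. D \<in> FS \<Longrightarrow> \<exists>n. D \<subseteq> W n"
  using vertices_exhaustion by blast
 have "(\<integral>\<^sup>+w. ennreal (G w) \<partial>count_space V) = (\<integral>\<^sup>+w. (SUP n. ennreal (G w) * indicator (W n) w) \<partial>count_space V)"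
 proof (rule nn_integral_cong)
  fix w assume "w \<in> space (count_space V)"
  then have "{w} \<in> FS" by (auto simp: FS_def)
  then obtain n where n: "w \<in> W n" using LL(3) by blast
  show "ennreal (G w) = (SUP n. ennreal (G w) * indicator (W n) w)"
  proof (rule antisym)
   show "ennreal (G w) \<le> (SUP n. ennreal (G w) * indicator (W n) w)" using n by (intro SUP_upper2[of n]) auto
   show "(SUP n. ennreal (G w) * indicator (W n) w) \<le> ennreal (G w)" by (intro SUP_least) (auto split: split_indicator)
  qed
 qed
 also have "... = (SUP n. \<integral>\<^sup>+w. ennreal (G w) * indicator (W n) w \<partial>count_space V)"
 proof (rule nn_integral_monotone_convergence_SUP)
  show "incseq (\<lambda>n w. ennreal (G w) * indicator (W n) w)"
   using LL(2) by (auto simp: incseq_def le_fun_def split: split_indicator)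
 qed simp
 also have "... \<le> ennreal L"
 proof (rule SUP_least)
  fix n
  have f: "finite (W n)" "W n \<subseteq> V" using LL(1)[of n] by (auto simp: FS_def)
  have "(\<integral>\<^sup>+w. ennreal (G w) * indicator (W n) w \<partial>count_space V) = (\<Sum>w\<in>W n. ennreal (G w))"
   using f by (simp add: nn_integral_count_space_indicator[symmetric] nn_integral_count_space_finite
    nn_integral_restrict_space[symmetric] restrict_count_space Int_absorb2)
  also have "... = ennreal (\<Sum>w\<in>W n. G w)" using G0 by (intro sum_ennreal) auto
  also have "... \<le> ennreal L" using Lam[OF LL(1)[of n]] by (intro ennreal_leI) simp
  finally show "(\<integral>\<^sup>+w. ennreal (G w) * indicator (W n) w \<partial>count_space V) \<le> ennreal L" .
 qed
 finally show ?thesis .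
qed

text \<open>Sum \<open>pair_exits\<close> over \<open>y\<close> and \<open>z\<close> in
  \<open>A\<close>. By symmetry of \<open>tau\<close> the branch term becomes the square of
  \<open>\<Sum>u\<in>A. tau p w u\<close> times the escape probability of \<open>w\<close>, so the
  square bound controls it by \<open>\<beta> * L\<close>. The same square is a summable majorant in
  \<open>w\<close>, which justifies the limit as \<open>W\<close> grows.\<close>

lemma pair_infinite:
 assumes p: "0 \<le> p" "p \<le> 1" and A: "A \<in> FS" and th: "\<And>w. w \<in> V \<Longrightarrow> M p 1 {} w \<le> \<beta>" and b: "0 \<le> \<beta>"
  and Lam: "\<And>B. B \<in> FS \<Longrightarrow> (\<Sum>w\<in>B. (\<Sum>u\<in>A. tau p w u)\<^sup>2) \<le> L" and L0: "0 \<le> L"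
 shows "(\<Sum>y\<in>A. \<Sum>z\<in>A. \<P>(U in PU. infinite (clu p U y) \<and> infinite (clu p U z)))
   \<le> (\<beta> * real (card A))\<^sup>2 + \<beta> * L"
proof -
 obtain W where LL: "\<And>n. W n \<in> FS" "incseq W" "\<And>D. D \<in> FS \<Longrightarrow> \<exists>n. D \<subseteq> W n"
  using vertices_exhaustion by blast
 have fA: "finite A" "A \<subseteq> V" using A by (auto simp: FS_def)
 define G where "G w = (\<Sum>u\<in>A. tau p w u)\<^sup>2" for w
 have G0: "0 \<le> G w" for w by (simp add: G_def)
 let ?P = "\<lambda>y z. \<P>(U in PU. infinite (clu p U y) \<and> infinite (clu p U z))"
 let ?t = "\<lambda>n y z w. tau p y w * tau p w z * pex p (W n) w"
 let ?x = "\<lambda>n. pex p (W n)"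
 have GL: "(\<integral>\<^sup>+w. ennreal (G w) \<partial>count_space V) \<le> ennreal L"
  using Lam by (intro nn_integral_count_le G0) (simp add: G_def)
 have step: "ennreal (\<Sum>y\<in>A. \<Sum>z\<in>A. ?P y z) \<le> ennreal ((\<Sum>y\<in>A. ?x n y)\<^sup>2) + (\<integral>\<^sup>+w. ennreal (G w * ?x n w) \<partial>count_space V)"
  if n: "A \<subseteq> W n" for n
 proof -
  have fL: "finite (W n)" using LL(1)[of n] by (auto simp: FS_def)
  have "ennreal (\<Sum>y\<in>A. \<Sum>z\<in>A. ?P y z) = (\<Sum>y\<in>A. \<Sum>z\<in>A. ennreal (?P y z))"
   by (simp add: sum_nonneg)
  also have "... \<le> (\<Sum>y\<in>A. \<Sum>z\<in>A. ennreal (?x n y * ?x n z) + (\<integral>\<^sup>+w. ennreal (?t n y z w) \<partial>count_space V))"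
  proof (intro sum_mono)
   fix y z assume yz: "y \<in> A" "z \<in> A"
   have "?P y z \<le> \<P>(U in PU. \<not> clu p U y \<subseteq> W n \<and> \<not> clu p U z \<subseteq> W n)"
    using fL by (intro PU.finite_measure_mono) (auto dest: finite_subset)
   then have "ennreal (?P y z) \<le> ennreal (\<P>(U in PU. \<not> clu p U y \<subseteq> W n \<and> \<not> clu p U z \<subseteq> W n))"
    by (rule ennreal_leI)
   also have "... \<le> ennreal (?x n y * ?x n z) + (\<integral>\<^sup>+w. ennreal (?t n y z w) \<partial>count_space V)"
    using yz fA n by (intro pair_exits p) auto
   finally show "ennreal (?P y z) \<le> ..." .
  qed
  also have "... = (\<Sum>y\<in>A. \<Sum>z\<in>A. ennreal (?x n y * ?x n z)) + (\<Sum>y\<in>A. \<Sum>z\<in>A. \<integral>\<^sup>+w. ennreal (?t n y z w) \<partial>count_space V)"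
   by (simp add: sum.distrib)
  also have "(\<Sum>y\<in>A. \<Sum>z\<in>A. ennreal (?x n y * ?x n z)) = ennreal ((\<Sum>y\<in>A. ?x n y)\<^sup>2)"
   by (simp add: pex_bounds sum_nonneg power2_eq_square sum_product)
  also have "(\<Sum>y\<in>A. \<Sum>z\<in>A. \<integral>\<^sup>+w. ennreal (?t n y z w) \<partial>count_space V)
   = (\<integral>\<^sup>+w. (\<Sum>y\<in>A. \<Sum>z\<in>A. ennreal (?t n y z w)) \<partial>count_space V)"
   by (simp add: nn_integral_sum)
  also have "... = (\<integral>\<^sup>+w. ennreal (G w * ?x n w) \<partial>count_space V)"
  proof (rule nn_integral_cong)
   fix w
   have "(\<Sum>y\<in>A. \<Sum>z\<in>A. ennreal (?t n y z w)) = ennreal (\<Sum>y\<in>A. \<Sum>z\<in>A. ?t n y z w)"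
    by (simp add: tau_bounds pex_bounds sum_nonneg)
   also have "(\<Sum>y\<in>A. \<Sum>z\<in>A. ?t n y z w) = G w * ?x n w"
   proof -
    have "(\<Sum>y\<in>A. \<Sum>z\<in>A. ?t n y z w) = (\<Sum>y\<in>A. \<Sum>z\<in>A. tau p w y * tau p w z * ?x n w)"
     by (intro sum.cong refl) (metis tau_sym)
    then show ?thesis unfolding G_def by (simp add: square_sum_mult)
   qed
   finally show "(\<Sum>y\<in>A. \<Sum>z\<in>A. ennreal (?t n y z w)) = ennreal (G w * ?x n w)" .
  qed
  finally show ?thesis .
 qed
 have lim1: "(\<lambda>n. ennreal ((\<Sum>y\<in>A. ?x n y)\<^sup>2)) \<longlonglongrightarrow> ennreal ((\<Sum>y\<in>A. M p 1 {} y)\<^sup>2)"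
  using fA by (intro tendsto_ennrealI tendsto_power tendsto_sum pex_tendsto LL) auto
 have lim2: "(\<lambda>n. \<integral>\<^sup>+w. ennreal (G w * ?x n w) \<partial>count_space V) \<longlonglongrightarrow> (\<integral>\<^sup>+w. ennreal (G w * M p 1 {} w) \<partial>count_space V)"
 proof (rule nn_integral_dominated_convergence[where w="\<lambda>w. ennreal (G w)"])
  show "AE w in count_space V. ennreal (G w * ?x n w) \<le> ennreal (G w)" for n
   using G0 pex_bounds by (intro AE_I2 ennreal_leI) (simp add: mult_left_le)
  show "(\<integral>\<^sup>+w. ennreal (G w) \<partial>count_space V) < \<infinity>" using GL by (simp add: le_less_trans)
  show "AE w in count_space V. (\<lambda>n. ennreal (G w * ?x n w)) \<longlonglongrightarrow> ennreal (G w * M p 1 {} w)"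
   by (intro AE_I2 tendsto_ennrealI tendsto_mult_left pex_tendsto LL) auto
 qed auto
 obtain N where N: "A \<subseteq> W N" using LL(3) A by blast
 have ev: "\<forall>\<^sub>F n in sequentially. ennreal (\<Sum>y\<in>A. \<Sum>z\<in>A. ?P y z) \<le> ennreal ((\<Sum>y\<in>A. ?x n y)\<^sup>2) + (\<integral>\<^sup>+w. ennreal (G w * ?x n w) \<partial>count_space V)"
  using eventually_ge_at_top[of N]
 proof eventually_elim
  case (elim n)
  then show ?case using step N LL(2) unfolding incseq_def by blast
 qed
 have "ennreal (\<Sum>y\<in>A. \<Sum>z\<in>A. ?P y z) \<le> ennreal ((\<Sum>y\<in>A. M p 1 {} y)\<^sup>2) + (\<integral>\<^sup>+w. ennreal (G w * M p 1 {} w) \<partial>count_space V)"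
  by (rule tendsto_lowerbound[OF tendsto_add[OF lim1 lim2] ev]) simp
 also have "... \<le> ennreal ((\<beta> * real (card A))\<^sup>2) + ennreal \<beta> * ennreal L"
 proof (intro add_mono)
  have "(\<Sum>y\<in>A. M p 1 {} y) \<le> \<beta> * real (card A)"
   using sum_bounded_above[of A "\<lambda>y. M p 1 {} y" \<beta>] th fA by (auto simp: mult.commute)
  moreover have "0 \<le> (\<Sum>y\<in>A. M p 1 {} y)" using fA by (intro sum_nonneg M_bounds) auto
  ultimately show "ennreal ((\<Sum>y\<in>A. M p 1 {} y)\<^sup>2) \<le> ennreal ((\<beta> * real (card A))\<^sup>2)"
   by (intro ennreal_leI power_mono)
  have "(\<integral>\<^sup>+w. ennreal (G w * M p 1 {} w) \<partial>count_space V) \<le> (\<integral>\<^sup>+w. ennreal \<beta> * ennreal (G w) \<partial>count_space V)"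
  proof (rule nn_integral_mono)
   fix w assume "w \<in> space (count_space V)"
   then have "G w * M p 1 {} w \<le> \<beta> * G w" using mult_left_mono[OF th[of w] G0[of w]] by (simp add: mult.commute[of \<beta>])
   then show "ennreal (G w * M p 1 {} w) \<le> ennreal \<beta> * ennreal (G w)" using b G0 by (simp add: ennreal_mult[symmetric] ennreal_leI)
  qed
  also have "... = ennreal \<beta> * (\<integral>\<^sup>+w. ennreal (G w) \<partial>count_space V)" by (rule nn_integral_cmult) simp
  also have "... \<le> ennreal \<beta> * ennreal L" using GL by (rule mult_left_mono) simp
  finally show "(\<integral>\<^sup>+w. ennreal (G w * M p 1 {} w) \<partial>count_space V) \<le> ennreal \<beta> * ennreal L" .
 qed
 also have "... = ennreal ((\<beta> * real (card A))\<^sup>2 + \<beta> * L)" using b L0 by (simp add: ennreal_mult ennreal_plus)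
 finally show ?thesis using b L0 by (subst (asm) ennreal_le_iff) auto
qed

end

section \<open>Second moments and boundary edges leading to infinity\<close>

lemma power_exp_le_fact: "0 \<le> (z::real) \<Longrightarrow> z ^ k * exp (- z) \<le> fact k"
proof -
 assume z: "0 \<le> z"
 have "z ^ k / fact k \<le> exp z"
 proof -
  have "(\<Sum>i\<in>{k}. z ^ i /\<^sub>R fact i) \<le> (\<Sum>i. z ^ i /\<^sub>R fact i)"
   using z summable_exp_generic[of z] by (intro sum_le_suminf) auto
  then show ?thesis by (simp add: exp_def divide_inverse mult.commute)
 qed
 then have "z ^ k \<le> fact k * exp z" by (simp add: pos_divide_le_eq mult.commute)
 then have "z ^ k * exp (- z) \<le> fact k * exp z * exp (- z)" by (intro mult_right_mono) auto
 then show ?thesis by (simp add: mult.assoc flip: exp_add)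
qed

context prob_space
begin

text \<open>A Paley-Zygmund bound from a pointwise inequality: where \<open>Z\<close> is at least
  \<open>\<mu> / 2\<close> it is at most \<open>t * Z\<^sup>2 + 1 / (4 * t)\<close>, and
  \<open>t\<close> is chosen such that the second moment uses up only a quarter of \<mu>.\<close>

lemma second_moment_lower:
 assumes Z: "Z \<in> borel_measurable M" "\<And>x. 0 \<le> Z x" "\<And>x. Z x \<le> B"
  and mu: "0 < \<mu>" "\<mu> \<le> (\<integral>x. Z x \<partial>M)" and R: "(\<integral>x. (Z x)\<^sup>2 \<partial>M) \<le> R * \<mu>\<^sup>2" "0 < R"
 shows "1 / (4 * R) \<le> prob {x \<in> space M. \<mu> / 2 \<le> Z x}"
proof -
 note [measurable] = Z(1)
 let ?P = "prob {x \<in> space M. \<mu> / 2 \<le> Z x}"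
 have iZ: "integrable M Z" using Z by (intro integrable_const_bound[where B=B]) auto
 have iZ2: "integrable M (\<lambda>x. (Z x)\<^sup>2)"
  using Z by (intro integrable_const_bound[where B="B\<^sup>2"]) (auto intro!: AE_I2 power_mono)
 have iI: "integrable M (indicator {x \<in> space M. \<mu> / 2 \<le> Z x} :: 'a \<Rightarrow> real)"
  by (intro integrable_real_indicator) (auto simp: less_top[symmetric])
 define t where "t = 1 / (4 * R * \<mu>)"
 have t: "0 < t" using R mu by (simp add: t_def)
 have pt: "Z x \<le> \<mu> / 2 + t * (Z x)\<^sup>2 + 1 / (4 * t) * indicator {x \<in> space M. \<mu> / 2 \<le> Z x} x" if x: "x \<in> space M" for x
 proof (cases "\<mu> / 2 \<le> Z x")
  case True
  have "0 \<le> (2 * t * Z x - 1)\<^sup>2" by simp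
  then have "4 * t * Z x \<le> 4 * t * (t * (Z x)\<^sup>2) + 1" by (simp add: power2_eq_square algebra_simps)
  then have "Z x \<le> (4 * t * (t * (Z x)\<^sup>2) + 1) / (4 * t)" using t by (simp add: pos_le_divide_eq mult.commute)
  also have "... = t * (Z x)\<^sup>2 + 1 / (4 * t)" using t by (simp add: add_divide_distrib)
  finally show ?thesis using True x mu by simp
 next
  case False
  then show ?thesis using t by (simp add: add_increasing2)
 qed
 have "\<mu> \<le> (\<integral>x. \<mu> / 2 + t * (Z x)\<^sup>2 + 1 / (4 * t) * indicator {x \<in> space M. \<mu> / 2 \<le> Z x} x \<partial>M)"
  using mu(2) by (rule order_trans) (intro integral_mono iZ Bochner_Integration.integrable_add integrable_mult_right iZ2 iI pt; simp)
 also have "... = \<mu> / 2 + t * (\<integral>x. (Z x)\<^sup>2 \<partial>M) + 1 / (4 * t) * ?P"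
  using iZ2 iI by (simp add: prob_space del: le_divide_eq_numeral1 divide_le_eq_numeral1)
 also have "t * (\<integral>x. (Z x)\<^sup>2 \<partial>M) \<le> t * (R * \<mu>\<^sup>2)" using R t by (intro mult_left_mono) auto
 also have "t * (R * \<mu>\<^sup>2) = \<mu> / 4" using R mu by (simp add: t_def power2_eq_square)
 also have "1 / (4 * t) = R * \<mu>" by (simp add: t_def)
 finally have "\<mu> \<le> \<mu> / 2 + \<mu> / 4 + R * \<mu> * ?P" by simp
 moreover have "\<mu> * (4 * R * ?P) = 4 * (R * \<mu> * ?P)" by simp
 ultimately have "\<mu> * 1 \<le> \<mu> * (4 * R * ?P)" by linarith
 then have "1 \<le> 4 * R * ?P" using mu by (simp only: mult_le_cancel_left_pos)
 then show ?thesis using R by (simp add: pos_divide_le_eq mult.commute)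
qed

end

context bperc
begin

definition Jinf :: "real \<Rightarrow> 'a set \<Rightarrow> ('a set \<Rightarrow> real) \<Rightarrow> ('a \<times> 'a) set" where
 "Jinf q S U = {e \<in> bd E S. infinite (K q U S (snd e))}"

lemma finite_bd_FS: "S \<in> FS \<Longrightarrow> finite (bd E S)"
 using finite_bd by (auto simp: FS_def)

lemma Jinf_subset: "Jinf q S U \<subseteq> bd E S"
 by (auto simp: Jinf_def)

lemma depends_on_Jinf: "depends_on (E - tch S) (Jinf q S)"
proof (rule depends_onI)
 fix U U' assume *: "U \<in> space PU" "U' \<in> space PU" "\<And>e. e \<in> E - tch S \<Longrightarrow> U e = U' e"
 have "K q U S y = K q U' S y" for y
  by (rule depends_onD[OF depends_on_K *])
 then show "Jinf q S U = Jinf q S U'" by (simp add: Jinf_def)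
qed

lemma pred_Jinf:
 assumes S: "S \<in> FS"
 shows "Measurable.pred PU (\<lambda>U. Q (Jinf q S U))"
proof -
 have f: "finite (bd E S)" by (rule finite_bd_FS[OF S])
 have eq: "Q (Jinf q S U) \<longleftrightarrow> (\<exists>J\<in>{J\<in>Pow (bd E S). Q J}. \<forall>e\<in>bd E S. (infinite (K q U S (snd e)) \<longleftrightarrow> e \<in> J))" for U
 proof
  assume "Q (Jinf q S U)"
  then show "\<exists>J\<in>{J\<in>Pow (bd E S). Q J}. \<forall>e\<in>bd E S. (infinite (K q U S (snd e)) \<longleftrightarrow> e \<in> J)"
   by (intro bexI[of _ "Jinf q S U"]) (auto simp: Jinf_def)
 next
  assume "\<exists>J\<in>{J\<in>Pow (bd E S). Q J}. \<forall>e\<in>bd E S. (infinite (K q U S (snd e)) \<longleftrightarrow> e \<in> J)"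
  then obtain J where J: "J \<subseteq> bd E S" "Q J" "\<forall>e\<in>bd E S. (infinite (K q U S (snd e)) \<longleftrightarrow> e \<in> J)" by blast
  then have "Jinf q S U = J" by (auto simp: Jinf_def)
  then show "Q (Jinf q S U)" using J by simp
 qed
 show ?thesis unfolding eq
 proof (intro pred_countable_ex pred_countable_all)
  fix J e assume "e \<in> bd E S"
  then have "snd e \<in> V" using edge_bd[of e S] by auto
  from pred_K_finite[OF this, of q S] have [measurable]: "Measurable.pred PU (\<lambda>U. finite (K q U S (snd e)))" .
  show "Measurable.pred PU (\<lambda>U. infinite (K q U S (snd e)) = (e \<in> J))" by measurable
 qed (use f in \<open>auto simp: countable_finite\<close>)
qed

text \<open>Three independent ingredients: the edges inside \<open>S\<close>, the boundary edges,
  and the edges not touching \<open>S\<close>, which determine \<open>Jinf\<close>. The boundary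
  constraint may depend on \<open>Jinf\<close>, hence the sum over its values.\<close>

lemma prob_joint:
 assumes v: "v \<in> V" and S: "S \<in> FS" and B: "\<And>J e. e \<in> bd E S \<Longrightarrow> B J e \<in> sets borel"
 shows "\<P>(U in PU. conn_in p v S U \<and> (\<forall>e\<in>bd E S. U (edge e) \<in> B (Jinf q S U) e) \<and> Q (Jinf q S U)) =
  (\<Sum>J\<in>{J\<in>Pow (bd E S). Q J}. \<P>(U in PU. conn_in p v S U) * (\<Prod>e\<in>bd E S. measure unif (B J e)) * \<P>(U in PU. Jinf q S U = J))"
  and "Measurable.pred PU (\<lambda>U. conn_in p v S U \<and> (\<forall>e\<in>bd E S. U (edge e) \<in> B (Jinf q S U) e) \<and> Q (Jinf q S U))"
proof -
 let ?BQ = "\<lambda>U. (\<forall>e\<in>bd E S. U (edge e) \<in> B (Jinf q S U) e) \<and> Q (Jinf q S U)"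
 let ?s = "(\<Sum>J\<in>{J\<in>Pow (bd E S). Q J}. \<P>(U in PU. conn_in p v S U) * (\<Prod>e\<in>bd E S. measure unif (B J e)) * \<P>(U in PU. Jinf q S U = J))"
 have f: "finite (bd E S)" by (rule finite_bd_FS[OF S])
 let ?X = "\<lambda>J U. conn_in p v S U \<and> (\<forall>e\<in>bd E S. U (edge e) \<in> B J e)"
 have mX: "Measurable.pred PU (?X J)" for J
  using pred_conn_in[OF v] pred_bd_in[OF S B] by (intro pred_intros_logic)
 have dX: "depends_on (tch S) (?X J)" for J
  by (intro depends_on_comp2[of "tch S" _ _ "(\<and>)"] depends_on_mono[OF depends_on_conn_in] depends_on_mono[OF depends_on_bd_in])
   (use edge_doubleton in \<open>fastforce simp: ins_def tch_def\<close>)+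
 have mJ: "Measurable.pred PU (\<lambda>U. Jinf q S U = J)" for J by (rule pred_Jinf[OF S])
 have dJ: "depends_on (E - tch S) (\<lambda>U. Jinf q S U = J)" for J
  by (rule depends_on_comp[OF depends_on_Jinf])
 have set: "{U \<in> space PU. conn_in p v S U \<and> ?BQ U}
  = (\<Union>J\<in>{J\<in>Pow (bd E S). Q J}. {U \<in> space PU. ?X J U \<and> Jinf q S U = J})"
  using Jinf_subset by auto
 have sets: "{U \<in> space PU. ?X J U \<and> Jinf q S U = J} \<in> sets PU" for J
  using sets.sets_Collect_conj[OF mJ[of J, unfolded pred_def] mX[of J, unfolded pred_def]] by simp
 have fJ: "finite {J\<in>Pow (bd E S). Q J}" using f by auto
 show "Measurable.pred PU (\<lambda>U. conn_in p v S U \<and> ?BQ U)"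
  unfolding pred_def set using fJ sets by (intro sets.finite_UN) auto
 show "\<P>(U in PU. conn_in p v S U \<and> ?BQ U) =
  ?s"
  unfolding set
 proof (subst PU.finite_measure_finite_Union[OF fJ])
  show "disjoint_family_on (\<lambda>J. {U \<in> space PU. ?X J U \<and> Jinf q S U = J}) {J \<in> Pow (bd E S). Q J}"
   by (auto simp: disjoint_family_on_def)
  show "(\<Sum>J\<in>{J \<in> Pow (bd E S). Q J}. \<P>(U in PU. ?X J U \<and> Jinf q S U = J)) =
   ?s"
  proof (rule sum.cong[OF refl])
   fix J
   have "\<P>(U in PU. ?X J U \<and> Jinf q S U = J) = \<P>(U in PU. ?X J U) * \<P>(U in PU. Jinf q S U = J)"
    by (rule indep_prob[OF mX dX _ mJ dJ]) (auto simp: tch_def)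
   also have "\<P>(U in PU. ?X J U) = \<P>(U in PU. conn_in p v S U) * (\<Prod>e\<in>bd E S. measure unif (B J e))"
    by (rule prob_conn_bd[OF v S B])
   finally show "\<P>(U in PU. ?X J U \<and> Jinf q S U = J) =
    \<P>(U in PU. conn_in p v S U) * (\<Prod>e\<in>bd E S. measure unif (B J e)) * \<P>(U in PU. Jinf q S U = J)" .
  qed
 qed (use sets in auto)
qed

text \<open>\<open>S\<close> is the cluster at level \<open>p\<close> after the edges to infinite clusters at level \<open>q\<close> have been
 removed, and at least \<open>t\<close> edges lead from \<open>S\<close> to such clusters.\<close>

definition iso :: "real \<Rightarrow> real \<Rightarrow> real \<Rightarrow> 'a \<Rightarrow> 'a set \<Rightarrow> ('a set \<Rightarrow> real) \<Rightarrow> bool" where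
 "iso p q t v S U \<longleftrightarrow> conn_in p v S U \<and>
   (\<forall>e\<in>bd E S. U (edge e) \<in> (if e \<in> Jinf q S U then {q<..} else {p<..})) \<and> t \<le> real (card (Jinf q S U))"

lemma pred_iso: "v \<in> V \<Longrightarrow> S \<in> FS \<Longrightarrow> Measurable.pred PU (iso p q t v S)"
 unfolding iso_def[abs_def]
 by (rule prob_joint(2)[where B="\<lambda>J e. if e \<in> J then {q<..} else {p<..}"]) auto

text \<open>Compared with \<open>iso\<close>, having cluster \<open>S\<close> requires the edges of
  \<open>Jinf\<close> to be closed at level \<open>p\<close> and not only at level \<open>q\<close>.
  Each of them costs a factor \<open>exp (- (p - q))\<close>, and there are at least
  \<open>t\<close>.\<close>

lemma closed_le_iso:
 assumes v: "v \<in> V" "v \<in> S" and S: "S \<in> FS" and p: "0 \<le> q" "q \<le> p" "p \<le> 1"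
 shows "\<P>(U in PU. clu p U v = S) * \<P>(U in PU. t \<le> real (card (Jinf q S U)))
   = \<P>(U in PU. clu p U v = S \<and> t \<le> real (card (Jinf q S U)))"
  and "\<P>(U in PU. clu p U v = S \<and> t \<le> real (card (Jinf q S U)))
   \<le> exp (- (p - q) * t) * \<P>(U in PU. iso p q t v S U)"
proof -
 let ?pr = "\<lambda>J. \<Prod>e\<in>bd E S. measure unif (if e \<in> J then {q<..} else {p<..})"
 have f: "finite (bd E S)" by (rule finite_bd_FS[OF S])
 let ?Q = "\<lambda>J. t \<le> real (card J)"
 let ?C = "\<P>(U in PU. conn_in p v S U)"
 let ?P = "\<lambda>J. \<P>(U in PU. Jinf q S U = J)"
 have "\<P>(U in PU. clu p U v = S \<and> ?Q (Jinf q S U)) =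
   \<P>(U in PU. clu p U v = S) * \<P>(U in PU. ?Q (Jinf q S U))"
  using pred_K_eq[OF v(1), of p "{}" S] depends_on_K_eq[OF v(2), of p "{}"] pred_Jinf[OF S, of ?Q q] depends_on_comp[OF depends_on_Jinf[of S q], where h="?Q"]
  by (intro indep_prob[of _ "tch S" _ "E - tch S"]) (auto simp: tch_def)
 then show "\<P>(U in PU. clu p U v = S) * \<P>(U in PU. ?Q (Jinf q S U))
   = \<P>(U in PU. clu p U v = S \<and> ?Q (Jinf q S U))" by simp
 have "\<P>(U in PU. clu p U v = S \<and> ?Q (Jinf q S U)) =
   \<P>(U in PU. conn_in p v S U \<and> (\<forall>e\<in>bd E S. U (edge e) \<in> {p<..}) \<and> ?Q (Jinf q S U))"
  unfolding K_eq_iff[OF v(2)] by (simp only: conj_assoc)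
 also have "... = (\<Sum>J\<in>{J\<in>Pow (bd E S). ?Q J}. ?C * (\<Prod>e\<in>bd E S. measure unif {p<..}) * ?P J)"
  by (rule prob_joint(1)[OF v(1) S, where B="\<lambda>_ _. {p<..}"]) auto
 also have "... \<le> (\<Sum>J\<in>{J\<in>Pow (bd E S). ?Q J}. exp (- (p - q) * t) * (?C * ?pr J * ?P J))"
 proof (rule sum_mono)
  fix J assume J: "J \<in> {J\<in>Pow (bd E S). ?Q J}"
  have fJ: "finite J" using J f finite_subset by auto
  have c: "card (bd E S) = card J + card (bd E S - J)"
   using J f fJ card_mono[OF f, of J] by (simp add: card_Diff_subset)
  have "(1 - p) ^ card J \<le> exp (- (p - q) * t) * (1 - q) ^ card J"
  proof -
   have "1 - p \<le> exp (- (p - q)) * (1 - q)"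
   proof -
    have "1 - (p - q) \<le> exp (- (p - q))" using exp_ge_add_one_self[of "- (p - q)"] by linarith
    then have "(1 - (p - q)) * (1 - q) \<le> exp (- (p - q)) * (1 - q)" using p by (intro mult_right_mono) auto
    moreover have "1 - p \<le> (1 - (p - q)) * (1 - q)"
     using mult_nonneg_nonneg[of "p - q" q] p by (simp add: algebra_simps)
    ultimately show ?thesis by simp
   qed
   then have "(1 - p) ^ card J \<le> (exp (- (p - q)) * (1 - q)) ^ card J" using p by (intro power_mono) auto
   also have "... = exp (- (p - q) * real (card J)) * (1 - q) ^ card J"
    by (simp only: power_mult_distrib exp_of_nat2_mult)
   also have "... \<le> exp (- (p - q) * t) * (1 - q) ^ card J"
   proof -
    have "- (p - q) * real (card J) \<le> - (p - q) * t"
     using J p mult_left_mono[of t "real (card J)" "p - q"] by (simp only: mult_minus_left neg_le_iff_le) auto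
    then show ?thesis using p by (intro mult_right_mono) (simp_all only: exp_le_cancel_iff zero_le_power diff_ge_0_iff_ge order_trans[of q p 1])
   qed
   finally show ?thesis .
  qed
  then have "(\<Prod>e\<in>bd E S. measure unif {p<..}) \<le> exp (- (p - q) * t) * ?pr J"
  proof -
   have "?pr J = (\<Prod>e\<in>bd E S. if e \<in> J then 1 - q else 1 - p)"
    using p by (intro prod.cong) (auto simp: measure_unif_gt)
   also have "... = (1 - q) ^ card J * (1 - p) ^ card (bd E S - J)"
    using J f by (simp add: prod.If_cases Int_absorb1 Diff_eq)
   finally have e: "?pr J = (1 - q) ^ card J * (1 - p) ^ card (bd E S - J)" .
   have "(\<Prod>e\<in>bd E S. measure unif {p<..}) = (1 - p) ^ card J * (1 - p) ^ card (bd E S - J)"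
    using p measure_unif_gt[of p] by (simp add: c power_add)
   also have "... \<le> (exp (- (p - q) * t) * (1 - q) ^ card J) * (1 - p) ^ card (bd E S - J)"
    using \<open>(1 - p) ^ card J \<le> exp (- (p - q) * t) * (1 - q) ^ card J\<close> p by (intro mult_right_mono) auto
   finally show ?thesis unfolding e by (simp only: mult.assoc)
  qed
  then have "(\<Prod>e\<in>bd E S. measure unif {p<..}) * (?C * ?P J) \<le> (exp (- (p - q) * t) * ?pr J) * (?C * ?P J)"
   by (intro mult_right_mono) auto
  then show "?C * (\<Prod>e\<in>bd E S. measure unif {p<..}) * ?P J \<le> exp (- (p - q) * t) * (?C * ?pr J * ?P J)"
   by (simp only: ac_simps)
 qed
 also have "... = exp (- (p - q) * t) * \<P>(U in PU. iso p q t v S U)"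
  unfolding iso_def sum_distrib_left[symmetric]
  by (subst prob_joint(1)[OF v(1) S, where B="\<lambda>J e. if e \<in> J then {q<..} else {p<..}"]) auto
 finally show "\<P>(U in PU. clu p U v = S \<and> ?Q (Jinf q S U))
   \<le> exp (- (p - q) * t) * \<P>(U in PU. iso p q t v S U)" .
qed

text \<open>Delete from the open graph at level \<open>p\<close> all edges touching an infinite
  cluster of level \<open>q\<close>; then \<open>S\<close> is the component of \<open>v\<close>.
  Indeed all boundary edges of \<open>S\<close> are closed at level \<open>q\<close>, so vertices of
  \<open>S\<close> have finite clusters there, while each boundary edge open at level
  \<open>p\<close> leads to an infinite one. The recipe does not mention \<open>S\<close>, so the
  events are disjoint for different \<open>S\<close>.\<close>

lemma iso_determines:
 assumes v: "v \<in> V" "v \<in> S" and S: "S \<in> FS" and q: "q \<le> p" and W: "iso p q t v S U"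
 shows "component {e \<in> opn E p U. \<forall>x\<in>e. finite (clu q U x)} v = S"
  and "clu p U v \<noteq> S \<Longrightarrow> infinite (clu p U v)"
proof -
 let ?F = "{e \<in> opn E p U. \<forall>x\<in>e. finite (clu q U x)}"
 have fS: "finite S" using S by (auto simp: FS_def)
 have c: "conn_in p v S U" and b: "\<And>e. e \<in> bd E S \<Longrightarrow> U (edge e) \<in> (if e \<in> Jinf q S U then {q<..} else {p<..})"
  using W by (auto simp: iso_def)
 have closed_q: "bd (opn E q U) S = {}"
 proof (rule ccontr)
  assume "bd (opn E q U) S \<noteq> {}"
  then obtain a y where ay: "(a, y) \<in> bd (opn E q U) S" by auto
  then have "(a, y) \<in> bd E S" "U {a, y} \<le> q" by (auto simp: bd_def opn_def)
  then show False using b[of "(a, y)"] q by (auto split: if_splits)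
 qed
 have inS: "finite (clu q U x)" if "x \<in> S" for x
 proof -
  have "clu q U x \<subseteq> S"
   using that closed_q by (intro component_closed) (auto simp: bd_def)
  then show ?thesis using fS finite_subset by blast
 qed
 have "{e \<in> ?F. e \<subseteq> S} = {e \<in> opn E p U. e \<subseteq> S}" using inS by auto
 moreover have "bd ?F S = {}"
 proof (rule ccontr)
  assume "bd ?F S \<noteq> {}"
  then obtain a y where ay: "a \<in> S" "y \<notin> S" "{a, y} \<in> opn E p U" "finite (clu q U y)" by (auto simp: bd_def)
  then have bd: "(a, y) \<in> bd E S" "U {a, y} \<le> p" by (auto simp: bd_def opn_def)
  then have "(a, y) \<in> Jinf q S U" using b[of "(a, y)"] by (auto split: if_splits)
  then have "infinite (K q U S y)" by (auto simp: Jinf_def)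
  then have "infinite (clu q U y)"
   using component_mono[of "del (opn E q U) S" "opn E q U" y] finite_subset by (auto simp: del_def)
  then show False using ay by simp
 qed
 moreover have "\<exists>x y. e = {x, y}" if "e \<in> ?F" for e
  using that edge_doubleton opn_subset[of E p U] by blast
 ultimately show "component ?F v = S"
  using component_eq_iff[OF v(2), of ?F] c by (simp only: conn_in_def)
 assume ne: "clu p U v \<noteq> S"
 have Sv: "S \<subseteq> clu p U v"
  using c component_mono[of "{e \<in> opn E p U. e \<subseteq> S}" "opn E p U" v] by (auto simp: conn_in_def)
 have "bd (opn E p U) S \<noteq> {}"
  using component_eq_iff[OF v(2), of "opn E p U"] edge_doubleton opn_subset[of E p U] c ne by (auto simp: conn_in_def)
 then obtain a y where ay: "(a, y) \<in> bd (opn E p U) S" by auto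
 then have bd: "(a, y) \<in> bd E S" "U {a, y} \<le> p" "a \<in> S" by (auto simp: bd_def opn_def)
 then have "(a, y) \<in> Jinf q S U" using b[of "(a, y)"] by (auto split: if_splits)
 then have "infinite (K q U S y)" by (auto simp: Jinf_def)
 moreover have "K q U S y \<subseteq> K p U S y" by (intro component_mono del_mono opn_mono q)
 moreover have "K p U S y \<subseteq> clu p U v"
  using component_enter[OF ay] Sv bd(3) by auto
 ultimately show "infinite (clu p U v)" by (meson finite_subset)
qed

lemma iso_total:
 assumes v: "v \<in> V" and q: "q \<le> p"
 shows "(\<integral>\<^sup>+S. ennreal (\<P>(U in PU. v \<in> S \<and> iso p q (t S) v S U \<and> clu p U v \<noteq> S)) \<partial>count_space FS) \<le> ennreal (M p 1 {} v)"
proof -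
 let ?A = "\<lambda>S U. v \<in> S \<and> iso p q (t S) v S U \<and> clu p U v \<noteq> S"
 let ?n = "\<lambda>U. \<integral>\<^sup>+S. (if ?A S U then 1 else (0::ennreal)) \<partial>count_space FS"
 have mA: "Measurable.pred PU (?A S)" if "S \<in> FS" for S
 proof -
  note [measurable] = pred_iso[OF v that, of p q "t S"] pred_K_eq[OF v, of p "{}" S, simplified]
  show ?thesis by measurable
 qed
 have "(\<integral>\<^sup>+S. ennreal (\<P>(U in PU. ?A S U)) \<partial>count_space FS) = (\<integral>\<^sup>+S. (\<E> U. (if ?A S U then 1 else 0)) \<partial>count_space FS)"
  by (intro nn_integral_cong nn_indicator_pred[symmetric] mA) simp
 also have "... = (\<E> U. (\<integral>\<^sup>+S. (if ?A S U then 1 else 0) \<partial>count_space FS))"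
  by (intro nn_integral_count_space_nn_integral[OF countable_FS, symmetric] measurable_ennreal_indicator mA)
 also have "... \<le> (\<E> U. ennreal (phi 1 (K p U {} v)))"
 proof (rule nn_integral_mono)
  fix U
  let ?T = "component {e \<in> opn E p U. \<forall>x\<in>e. finite (clu q U x)} v"
  show "?n U \<le> ennreal (phi 1 (K p U {} v))"
  proof (cases "\<exists>S\<in>FS. ?A S U")
   case True
   then have inf: "infinite (K p U {} v)" using iso_determines(2)[OF v _ _ q] by auto
   have "?n U \<le> (\<integral>\<^sup>+S. 1 * indicator {?T} S \<partial>count_space FS)"
    using iso_determines(1)[OF v _ _ q] by (intro nn_integral_mono) (auto split: split_indicator)
   also have "... \<le> 1"
   proof (cases "?T \<in> FS")
    case False
    then have "(\<integral>\<^sup>+S. 1 * indicator {?T} S \<partial>count_space FS) = (\<integral>\<^sup>+S. 0 \<partial>count_space FS)"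
     by (intro nn_integral_cong) (auto split: split_indicator)
    then show ?thesis by simp
   qed (simp add: nn_integral_cmult_indicator)
   finally show ?thesis using inf by (simp add: phi_def xp_def)
  next
   case False
   then have "?n U = (\<integral>\<^sup>+S. 0 \<partial>count_space FS)"
    by (intro nn_integral_cong) auto
   then show ?thesis by simp
  qed
 qed
 also have "... = ennreal (M p 1 {} v)" by (rule nn_M[OF v]) auto
 finally show ?thesis .
qed

lemma card_Jinf: "S \<in> FS \<Longrightarrow> real (card (Jinf q S U)) = (\<Sum>e\<in>bd E S. phi 1 (K q U S (snd e)))"
proof -
 assume S: "S \<in> FS"
 have "(\<Sum>e\<in>bd E S. phi 1 (K q U S (snd e))) = (\<Sum>e\<in>bd E S. if infinite (K q U S (snd e)) then 1 else (0::real))"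
  by (intro sum.cong) (auto simp: phi_def xp_def)
 also have "... = real (card (Jinf q S U))"
  using finite_bd_FS[OF S] by (simp add: Jinf_def sum.inter_filter[symmetric])
 finally show ?thesis by simp
qed

lemma sum_bd_le:
 assumes S: "S \<in> FS" and g: "\<And>y. 0 \<le> g y"
 shows "(\<Sum>e\<in>bd E S. g (snd e)) \<le> real d * (\<Sum>y\<in>snd ` bd E S. g y)"
proof -
 have f: "finite (bd E S)" by (rule finite_bd_FS[OF S])
 have "(\<Sum>e\<in>bd E S. g (snd e)) = (\<Sum>y\<in>snd ` bd E S. \<Sum>e\<in>{e \<in> bd E S. snd e = y}. g (snd e))"
  by (rule sum.image_gen[OF f])
 also have "... \<le> (\<Sum>y\<in>snd ` bd E S. real d * g y)"
 proof (rule sum_mono)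
  fix y assume y: "y \<in> snd ` bd E S"
  then have yV: "y \<in> V" using edge_bd by auto
  have "card {e \<in> bd E S. snd e = y} \<le> card (tch {y})"
  proof (rule card_inj_on_le[of edge])
   show "inj_on edge {e \<in> bd E S. snd e = y}" by (rule inj_on_subset[OF inj_edge]) auto
   show "edge ` {e \<in> bd E S. snd e = y} \<subseteq> tch {y}" using edge_bd by (auto simp: tch_def)
   show "finite (tch {y})" using yV by (intro finite_tch) auto
  qed
  then have "card {e \<in> bd E S. snd e = y} \<le> d" using degree[OF yV] by simp
  then have "real (card {e \<in> bd E S. snd e = y}) * g y \<le> real d * g y"
   using g by (intro mult_right_mono) auto
  then show "(\<Sum>e\<in>{e \<in> bd E S. snd e = y}. g (snd e)) \<le> real d * g y" by simp
 qed
 finally show ?thesis by (simp add: sum_distrib_left)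
qed

text \<open>Dropping the deletion of \<open>S\<close> only enlarges the clusters, and each outer
  boundary vertex is counted at most \<open>d\<close> times, which reduces the claim to
  \<open>pair_infinite\<close>.\<close>

lemma Jinf_second_moment:
 assumes q: "0 \<le> q" "q \<le> 1" and S: "S \<in> FS" and th: "\<And>w. w \<in> V \<Longrightarrow> M q 1 {} w \<le> \<beta>" and b: "0 \<le> \<beta>"
  and Lam: "\<And>A B. A \<in> FS \<Longrightarrow> B \<in> FS \<Longrightarrow> (\<Sum>w\<in>B. (\<Sum>u\<in>A. tau q w u)\<^sup>2) \<le> W * real (card A)" and L0: "0 \<le> W"
 shows "(\<integral>U. (real (card (Jinf q S U)))\<^sup>2 \<partial>PU) \<le> (real d)\<^sup>2 * ((\<beta> * (real d * real (card S)))\<^sup>2 + \<beta> * (W * (real d * real (card S))))"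
proof -
 define A where "A = snd ` bd E S"
 have f: "finite (bd E S)" by (rule finite_bd_FS[OF S])
 have A: "A \<in> FS" using f edge_bd by (auto simp: A_def FS_def)
 have cA: "real (card A) \<le> real d * real (card S)"
 proof -
  have "card A \<le> card (bd E S)" unfolding A_def by (rule card_image_le[OF f])
  then have "card A \<le> d * card S" using card_bd[OF S] by simp
  then show ?thesis by (metis of_nat_le_iff of_nat_mult)
 qed
 let ?i = "\<lambda>U y. phi 1 (clu q U y)"
 have i01: "0 \<le> ?i U y" "?i U y \<le> 1" for U y using phi_bounds[of 1] by auto
 let ?I = "\<lambda>y z. {U \<in> space PU. infinite (clu q U y) \<and> infinite (clu q U z)}"
 let ?P = "\<lambda>y z. \<P>(U in PU. infinite (clu q U y) \<and> infinite (clu q U z))"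
 have pP: "Measurable.pred PU (\<lambda>U. infinite (clu q U y) \<and> infinite (clu q U z))" if "y \<in> A" "z \<in> A" for y z
 proof -
  have "y \<in> V" "z \<in> V" using that A by (auto simp: FS_def)
  note [measurable] = pred_component_finite[OF meas_eset_opn this(1)] pred_component_finite[OF meas_eset_opn this(2)]
  show ?thesis by measurable
 qed
 have pt: "(real (card (Jinf q S U)))\<^sup>2 \<le> (real d)\<^sup>2 * (\<Sum>y\<in>A. \<Sum>z\<in>A. indicator (?I y z) U)"
  if U: "U \<in> space PU" for U
 proof -
  have "real (card (Jinf q S U)) \<le> (\<Sum>e\<in>bd E S. ?i U (snd e))"
   unfolding card_Jinf[OF S] by (intro sum_mono phi_mono component_mono) (auto simp: del_def)
  also have "... \<le> real d * (\<Sum>y\<in>A. ?i U y)" unfolding A_def by (rule sum_bd_le[OF S]) (rule i01)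
  finally have "(real (card (Jinf q S U)))\<^sup>2 \<le> (real d * (\<Sum>y\<in>A. ?i U y))\<^sup>2" by (intro power_mono) auto
  also have "... = (real d)\<^sup>2 * (\<Sum>y\<in>A. \<Sum>z\<in>A. ?i U y * ?i U z)"
   by (simp add: power_mult_distrib power2_eq_square sum_product)
  also have "(\<Sum>y\<in>A. \<Sum>z\<in>A. ?i U y * ?i U z) = (\<Sum>y\<in>A. \<Sum>z\<in>A. indicator (?I y z) U)"
   using U by (intro sum.cong) (auto simp: phi_def xp_def)
  finally show ?thesis .
 qed
 have ii: "integrable PU (\<lambda>U. indicator (?I y z) U :: real)" if "y \<in> A" "z \<in> A" for y z
  using pP[OF that] by (intro integrable_real_indicator) (auto simp: pred_def less_top[symmetric])
 have iJ: "integrable PU (\<lambda>U. (real (card (Jinf q S U)))\<^sup>2)"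
 proof (rule PU.integrable_const_bound[where B="(real (card (bd E S)))\<^sup>2"])
  show "AE U in PU. norm ((real (card (Jinf q S U)))\<^sup>2) \<le> (real (card (bd E S)))\<^sup>2"
   using card_mono[OF f Jinf_subset] by (intro AE_I2) (auto intro!: power_mono)
  have "(\<lambda>U. (\<Sum>e\<in>bd E S. phi 1 (K q U S (snd e)))\<^sup>2) \<in> borel_measurable PU"
   using edge_bd by (intro borel_measurable_power borel_measurable_sum measurable_phi_K) auto
  then show "(\<lambda>U. (real (card (Jinf q S U)))\<^sup>2) \<in> borel_measurable PU" by (simp add: card_Jinf[OF S])
 qed
 have "(\<integral>U. (real (card (Jinf q S U)))\<^sup>2 \<partial>PU) \<le> (\<integral>U. (real d)\<^sup>2 * (\<Sum>y\<in>A. \<Sum>z\<in>A. indicator (?I y z) U) \<partial>PU)"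
  by (intro integral_mono iJ pt integrable_mult_right Bochner_Integration.integrable_sum ii)
 also have "... = (real d)\<^sup>2 * (\<Sum>y\<in>A. \<Sum>z\<in>A. ?P y z)"
 proof -
  have "(\<integral>U. (\<Sum>y\<in>A. \<Sum>z\<in>A. (indicator (?I y z) U :: real)) \<partial>PU)
   = (\<Sum>y\<in>A. \<integral>U. (\<Sum>z\<in>A. (indicator (?I y z) U :: real)) \<partial>PU)"
   by (rule Bochner_Integration.integral_sum) (intro Bochner_Integration.integrable_sum ii)
  also have "... = (\<Sum>y\<in>A. \<Sum>z\<in>A. (\<integral>U. (indicator (?I y z) U :: real) \<partial>PU))"
   by (intro sum.cong refl Bochner_Integration.integral_sum ii)
  also have "... = (\<Sum>y\<in>A. \<Sum>z\<in>A. ?P y z)"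
   by (intro sum.cong refl) (simp add: Int_absorb2 Collect_restrict)
  finally show ?thesis by simp
 qed
 also have "... \<le> (real d)\<^sup>2 * ((\<beta> * real (card A))\<^sup>2 + \<beta> * (W * real (card A)))"
  using L0 Lam[OF A] by (intro mult_left_mono pair_infinite q A th b) auto
 also have "... \<le> (real d)\<^sup>2 * ((\<beta> * (real d * real (card S)))\<^sup>2 + \<beta> * (W * (real d * real (card S))))"
  using cA b L0 by (intro mult_left_mono add_mono power_mono mult_nonneg_nonneg) auto
 finally show ?thesis .
qed

lemma Jinf_first_moment:
 assumes S: "S \<in> FS"
 shows "(\<integral>U. real (card (Jinf q S U)) \<partial>PU) = (\<Sum>e\<in>bd E S. M q 1 S (snd e))"
 unfolding card_Jinf[OF S] M_def
 using edge_bd by (intro Bochner_Integration.integral_sum integrable_phi meas_K) auto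

end

locale sperc = mperc +
 fixes Lam :: real
 assumes Lam_pos: "0 < Lam"
  and Lam: "\<And>A B. A \<in> FS \<Longrightarrow> B \<in> FS \<Longrightarrow> (\<Sum>w\<in>B. (\<Sum>u\<in>A. tau p3 w u)\<^sup>2) \<le> Lam * real (card A)"
begin

lemma Lam_mono:
 assumes "q \<le> p3" "A \<in> FS" "B \<in> FS"
 shows "(\<Sum>w\<in>B. (\<Sum>u\<in>A. tau q w u)\<^sup>2) \<le> Lam * real (card A)"
proof -
 have "(\<Sum>w\<in>B. (\<Sum>u\<in>A. tau q w u)\<^sup>2) \<le> (\<Sum>w\<in>B. (\<Sum>u\<in>A. tau p3 w u)\<^sup>2)"
  using assms by (intro sum_mono power_mono tau_mono sum_nonneg tau_bounds) auto
 then show ?thesis using Lam[OF assms(2,3)] by linarith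
qed

text \<open>The mean is at least of order \<open>\<epsilon> * card S\<close>, by the influence bound
  at \<open>x = 1\<close> and \<open>theta_lower\<close>. The condition
  \<open>1 \<le> \<epsilon> * card S\<close> puts the linear term of the second moment below a
  multiple of the squared mean.\<close>

lemma Jinf_probability:
 "\<exists>b>0. \<exists>R>0. \<forall>\<epsilon>>0. plo \<le> pc - \<epsilon> \<longrightarrow> pc + \<epsilon> \<le> p3 \<longrightarrow> (\<forall>S\<in>FS. 1 \<le> \<epsilon> * real (card S) \<longrightarrow>
   1 / R \<le> \<P>(U in PU. b * \<epsilon> * real (card S) \<le> real (card (Jinf (pc + \<epsilon>) S U))))"
proof -
 obtain C where C: "0 < C"
  and CW: "\<And>\<epsilon> v. 0 < \<epsilon> \<Longrightarrow> v \<in> V \<Longrightarrow> plo \<le> pc - \<epsilon> \<Longrightarrow> pc + \<epsilon> \<le> p3 \<Longrightarrow> M (pc + \<epsilon>) (exp (- \<epsilon>\<^sup>2)) {} v \<le> C * \<epsilon>"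
  using critical_window by blast
 obtain b where b: "0 < b"
  and TL: "\<And>\<epsilon> v. 0 < \<epsilon> \<Longrightarrow> v \<in> V \<Longrightarrow> plo \<le> pc - \<epsilon> \<Longrightarrow> pc + \<epsilon> \<le> p3 \<Longrightarrow> b * \<epsilon> \<le> M (pc + \<epsilon>) 1 {} v"
  using theta_lower by blast
 define R0 where "R0 = (real d)\<^sup>2 * ((C * real d)\<^sup>2 + C * Lam * real d) / (c * b)\<^sup>2"
 have dpos: "0 < real d" using d_pos by simp
 have R0: "0 < R0" using dpos C Lam_pos c_pos b by (auto simp: R0_def intro!: divide_pos_pos mult_pos_pos add_nonneg_pos)
 have "1 / (4 * R0) \<le> \<P>(U in PU. c * b / 2 * \<epsilon> * real (card S) \<le> real (card (Jinf (pc + \<epsilon>) S U)))"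
  if e: "0 < \<epsilon>" "plo \<le> pc - \<epsilon>" "pc + \<epsilon> \<le> p3" and S: "S \<in> FS" and big: "1 \<le> \<epsilon> * real (card S)" for \<epsilon> S
 proof -
  let ?q = "pc + \<epsilon>" and ?s = "real (card S)"
  define \<mu> where "\<mu> = c * b * \<epsilon> * ?s"
  have s0: "0 < ?s" using big e by (cases "?s = 0") auto
  have mu: "0 < \<mu>" using c_pos b e s0 by (simp add: \<mu>_def)
  have q: "0 \<le> ?q" "?q \<le> 1" "?q \<in> {plo..p3}" using e pc plo by auto
  obtain v where v: "v \<in> V" using conn by (auto simp: connected_graph_def)
  have f: "finite (bd E S)" by (rule finite_bd_FS[OF S])
  have "1 / (4 * R0) \<le> \<P>(U in PU. \<mu> / 2 \<le> real (card (Jinf ?q S U)))"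
  proof (rule PU.second_moment_lower)
   show "(\<lambda>U. real (card (Jinf ?q S U))) \<in> borel_measurable PU"
    unfolding card_Jinf[OF S] using edge_bd by (intro borel_measurable_sum measurable_phi_K) auto
   show "real (card (Jinf ?q S U)) \<le> real (card (bd E S))" for U
    using card_mono[OF f Jinf_subset] by simp
   show "\<mu> \<le> (\<integral>U. real (card (Jinf ?q S U)) \<partial>PU)"
   proof -
    have "\<mu> \<le> c * ?s * M ?q 1 {} v"
     using mult_left_mono[OF TL[OF e(1) v e(2,3)], of "c * ?s"] c_pos by (simp add: \<mu>_def ac_simps)
    also have "... \<le> (\<Sum>e\<in>bd E S. M ?q 1 S (snd e))" using q S v by (intro influence) auto
    finally show ?thesis by (simp add: Jinf_first_moment[OF S])
   qed
   have "(\<integral>U. (real (card (Jinf ?q S U)))\<^sup>2 \<partial>PU) \<le> (real d)\<^sup>2 * ((C * \<epsilon> * (real d * ?s))\<^sup>2 + C * \<epsilon> * (Lam * (real d * ?s)))"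
   proof (rule Jinf_second_moment[OF q(1,2) S])
    show "M ?q 1 {} w \<le> C * \<epsilon>" if w: "w \<in> V" for w
    proof -
     have "M ?q 1 {} w \<le> M ?q (exp (- \<epsilon>\<^sup>2)) {} w" using w by (intro M_mono_gen) auto
     then show ?thesis using CW[OF e(1) w e(2,3)] by simp
    qed
   qed (use C e Lam_mono Lam_pos in auto)
   also have "... \<le> (real d)\<^sup>2 * ((C * \<epsilon> * (real d * ?s))\<^sup>2 + (C * Lam * real d) * (\<epsilon> * ?s)\<^sup>2)"
   proof -
    have "\<epsilon> * ?s \<le> (\<epsilon> * ?s)\<^sup>2" using mult_left_mono[OF big, of "\<epsilon> * ?s"] e by (simp add: power2_eq_square)
    then have "(C * Lam * real d) * (\<epsilon> * ?s) \<le> (C * Lam * real d) * (\<epsilon> * ?s)\<^sup>2"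
     using C Lam_pos by (intro mult_left_mono) auto
    then show ?thesis by (intro mult_left_mono add_left_mono) (auto simp: ac_simps)
   qed
   also have "... = R0 * \<mu>\<^sup>2"
    unfolding R0_def \<mu>_def using c_pos b by (simp add: power_mult_distrib field_simps)
   finally show "(\<integral>U. (real (card (Jinf ?q S U)))\<^sup>2 \<partial>PU) \<le> R0 * \<mu>\<^sup>2" .
  qed (use mu R0 in auto)
  then show ?thesis by (simp add: \<mu>_def)
 qed
 moreover have "0 < c * b / 2" "0 < 4 * R0" using c_pos b R0 by auto
 ultimately show ?thesis by (intro exI[of _ "c * b / 2"] exI[of _ "4 * R0"] conjI allI impI ballI)
qed

text \<open>The condition on \<open>t\<close> makes the exponential factor at most one half, so at
  least half of the probability of \<open>iso\<close> belongs to configurations whose cluster is not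
  \<open>S\<close>. Only this part forces an infinite cluster and is summable over \<open>S\<close>
  by \<open>iso_total\<close>.\<close>

lemma cluster_le_iso:
 assumes v: "v \<in> V" "v \<in> S" and S: "S \<in> FS" and p: "0 \<le> q" "q \<le> p" "p \<le> 1" and t: "1 \<le> (p - q) * t"
  and R: "0 < R" "1 / R \<le> \<P>(U in PU. t \<le> real (card (Jinf q S U)))"
 shows "\<P>(U in PU. clu p U v = S) \<le>
  2 * R * exp (- (p - q) * t) * \<P>(U in PU. v \<in> S \<and> iso p q t v S U \<and> clu p U v \<noteq> S)"
proof -
 let ?W = "\<P>(U in PU. iso p q t v S U)"
 let ?D = "\<P>(U in PU. v \<in> S \<and> iso p q t v S U \<and> clu p U v \<noteq> S)"
 let ?Q = "\<P>(U in PU. clu p U v = S \<and> t \<le> real (card (Jinf q S U)))"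
 let ?PK = "\<P>(U in PU. clu p U v = S)"
 note [measurable] = pred_iso[OF v(1) S, of p q t] pred_K_eq[OF v(1), of p "{}" S, simplified] pred_Jinf[OF S, of "\<lambda>J. t \<le> real (card J)" q]
 have Q: "?Q \<le> exp (- (p - q) * t) * ?W" by (rule closed_le_iso(2)[OF v S p])
 have "exp (- (p - q) * t) \<le> 1 / 2"
 proof -
  have "1 + (p - q) * t \<le> exp ((p - q) * t)" using exp_ge_add_one_self[of "(p - q) * t"] by simp
  then have "2 \<le> exp ((p - q) * t)" using t by linarith
  then have "inverse (exp ((p - q) * t)) \<le> inverse 2" by (intro le_imp_inverse_le) auto
  moreover have "exp (- (p - q) * t) = inverse (exp ((p - q) * t))" by (simp only: mult_minus_left exp_minus)
  ultimately show ?thesis by simp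
 qed
 then have Q2: "?Q \<le> ?W / 2" using Q mult_right_mono[of "exp (- (p - q) * t)" "1 / 2" ?W] by simp
 have "?W \<le> ?D + ?Q"
 proof -
  have "?W \<le> measure PU ({U \<in> space PU. v \<in> S \<and> iso p q t v S U \<and> clu p U v \<noteq> S} \<union>
   {U \<in> space PU. clu p U v = S \<and> t \<le> real (card (Jinf q S U))})"
  proof (rule PU.finite_measure_mono)
   have "t \<le> real (card (Jinf q S U))" if "iso p q t v S U" for U using that by (simp add: iso_def)
   then show "{U \<in> space PU. iso p q t v S U} \<subseteq> {U \<in> space PU. v \<in> S \<and> iso p q t v S U \<and> clu p U v \<noteq> S} \<union>
    {U \<in> space PU. clu p U v = S \<and> t \<le> real (card (Jinf q S U))}" using v(2) by auto
  qed measurable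
  also have "... \<le> ?D + ?Q" by (rule measure_Un_le) measurable
  finally show ?thesis .
 qed
 then have W: "?W \<le> 2 * ?D" using Q2 by simp
 have "?PK * (1 / R) \<le> ?PK * \<P>(U in PU. t \<le> real (card (Jinf q S U)))"
  using R by (intro mult_left_mono) auto
 also have "... = ?Q" by (rule closed_le_iso(1)[OF v S p])
 also have "... \<le> exp (- (p - q) * t) * (2 * ?D)" by (rule order_trans[OF Q mult_left_mono[OF W exp_ge_zero]])
 finally show ?thesis using R by (simp add: pos_divide_le_eq ac_simps)
qed

text \<open>Sizes up to \<open>L / \<epsilon>\<^sup>2\<close> are controlled by the critical window
  through \<open>phi\<close>. For larger \<open>S\<close> the probability is, up to a constant,
  \<open>exp (- \<kappa> * \<epsilon>\<^sup>2 * card S)\<close> times that of events of total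
  probability \<open>O(\<epsilon>)\<close>, and
  \<open>n ^ k * exp (- \<kappa> * \<epsilon>\<^sup>2 * n)\<close> never exceeds
  \<open>fact k / (\<kappa> * \<epsilon>\<^sup>2) ^ k\<close>.\<close>

lemma supercritical_moment:
 "\<exists>C'>0. \<exists>\<delta>>0. \<forall>k\<ge>1. \<forall>\<epsilon>\<in>{0<..<\<delta>}. \<forall>v\<in>V. mom (pc + \<epsilon>) k v \<le> ennreal (C' ^ k * fact k / \<epsilon> ^ (2 * k - 1))"
proof -
 obtain C where C: "0 < C"
  and CW: "\<And>\<epsilon> v. 0 < \<epsilon> \<Longrightarrow> v \<in> V \<Longrightarrow> plo \<le> pc - \<epsilon> \<Longrightarrow> pc + \<epsilon> \<le> p3 \<Longrightarrow> M (pc + \<epsilon>) (exp (- \<epsilon>\<^sup>2)) {} v \<le> C * \<epsilon>"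
  using critical_window by blast
 obtain b R where b: "0 < b" and R: "0 < R"
  and JP: "\<And>\<epsilon> S. 0 < \<epsilon> \<Longrightarrow> plo \<le> pc - \<epsilon> \<Longrightarrow> pc + \<epsilon> \<le> p3 \<Longrightarrow> S \<in> FS \<Longrightarrow> 1 \<le> \<epsilon> * real (card S) \<Longrightarrow>
   1 / R \<le> \<P>(U in PU. b * \<epsilon> * real (card S) \<le> real (card (Jinf (pc + \<epsilon>) S U)))"
  using Jinf_probability by blast
 \<comment> \<open>The product of the level difference \<open>\<epsilon> / 2\<close> and the density
   \<open>b * \<epsilon> / 2\<close> of edges leading to infinity, divided by
   \<open>\<epsilon>\<^sup>2\<close>.\<close>
 define \<kappa> where "\<kappa> = b / 4"
 have kap: "0 < \<kappa>" using b by (simp add: \<kappa>_def)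
 \<comment> \<open>For \<open>\<epsilon>\<^sup>2 * card S > L\<close>, the bound
   \<open>L \<ge> 2\<close> gives \<open>\<epsilon> / 2 * card S \<ge> 1\<close>, as
   \<open>Jinf_probability\<close> needs, and \<open>\<kappa> * L \<ge> 1\<close> gives
   \<open>(p - q) * t S \<ge> 1\<close>.\<close>
 define L where "L = 2 + 1 / \<kappa>"
 have L: "2 \<le> L" "1 \<le> \<kappa> * L" using kap by (auto simp: L_def algebra_simps)
 \<comment> \<open>Since \<open>D\<close> is at least 1, the constant prefactors disappear into
   \<open>D ^ k\<close>.\<close>
 define D where "D = 2 * C + 2 * R * C + 1"
 have D: "1 \<le> D" using C R by (simp add: D_def)
 define C' where "C' = D * (L + 1 / \<kappa>)"
 have C': "0 < C'" using D L kap by (simp add: C'_def add_pos_pos)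
 define \<delta>0 where "\<delta>0 = min 1 (min (pc - plo) (p3 - pc))"
 have d0: "0 < \<delta>0" using pc by (simp add: \<delta>0_def)
 have "mom (pc + \<epsilon>) k v \<le> ennreal (C' ^ k * fact k / \<epsilon> ^ (2 * k - 1))"
  if k: "1 \<le> k" and e: "0 < \<epsilon>" "\<epsilon> < \<delta>0" and v: "v \<in> V" for k \<epsilon> v
 proof -
  have eps: "\<epsilon> \<le> 1" "plo \<le> pc - \<epsilon>" "pc + \<epsilon> \<le> p3" "plo \<le> pc - \<epsilon> / 2" "pc + \<epsilon> / 2 \<le> p3"
   using e by (auto simp: \<delta>0_def)
  define p q where "p = pc + \<epsilon>" and "q = pc + \<epsilon> / 2"
  have pq: "0 \<le> q" "q \<le> p" "p \<le> 1" "0 \<le> p" using e eps pc plo by (auto simp: p_def q_def)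
  have e2: "0 < \<epsilon>\<^sup>2" using e by simp
  let ?k' = "fact k / (\<kappa> * \<epsilon>\<^sup>2) ^ k"
  let ?K = "\<lambda>U. clu p U v"
  define t where "t S = b * (\<epsilon> / 2) * real (card S)" for S :: "'a set"
  have pqt: "(p - q) * t S = \<kappa> * \<epsilon>\<^sup>2 * real (card S)" for S
   by (simp add: p_def q_def t_def \<kappa>_def power2_eq_square)
  define h where "h = \<epsilon>\<^sup>2 / L"
  let ?ph = "\<lambda>U. ennreal (phi (exp (- h)) (?K U))"
  have h: "0 < h" "h \<le> \<epsilon>\<^sup>2" using e2 L by (auto simp: h_def pos_divide_le_eq)
  have Mh: "M p (exp (- h)) {} v \<le> C * \<epsilon>"
  proof -
   have "M p (exp (- h)) {} v \<le> M p (exp (- \<epsilon>\<^sup>2)) {} v" using h v by (intro M_mono_gen) auto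
   then show ?thesis using CW[OF e(1) v eps(2,3)] by (simp add: p_def)
  qed
  have th: "M p 1 {} v \<le> C * \<epsilon>"
  proof -
   have "M p 1 {} v \<le> M p (exp (- \<epsilon>\<^sup>2)) {} v" using v by (intro M_mono_gen) auto
   then show ?thesis using CW[OF e(1) v eps(2,3)] by (simp add: p_def)
  qed
  have ek: "(\<epsilon>\<^sup>2) ^ k = \<epsilon> * \<epsilon> ^ (2 * k - 1)"
  proof -
   have "2 * k = Suc (2 * k - 1)" using k by simp
   then show ?thesis by (metis power_mult power_Suc)
  qed
  let ?big = "\<lambda>S. if L < \<epsilon>\<^sup>2 * real (card S) then ennreal (real (card S) ^ k) else 0"
  have x: "0 \<le> exp (- h)" "exp (- h) \<le> 1" using h by auto
  have mphi: "(\<lambda>U. ?ph U) \<in> borel_measurable PU" using v by measurable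
  have mbig: "(\<lambda>U. if finite (?K U) then ?big (?K U) else 0) \<in> borel_measurable PU"
   by (rule measurable_component_fun[OF meas_eset_opn v]) auto
  have "mom p k v \<le> (\<E> U. ennreal ((L / \<epsilon>\<^sup>2) ^ k * 2) * ?ph U + (if finite (?K U) then ?big (?K U) else 0))"
   unfolding mom_def
  proof (rule nn_integral_mono)
   fix U
   show "(if finite (?K U) then ennreal (real (card (?K U)) ^ k) else 0) \<le>
    ennreal ((L / \<epsilon>\<^sup>2) ^ k * 2) * ?ph U + (if finite (?K U) then ?big (?K U) else 0)"
   proof (cases "finite (?K U) \<and> \<not> L < \<epsilon>\<^sup>2 * real (card (?K U))")
    case True
    let ?n = "real (card (?K U))"
    have n: "?n \<le> L / \<epsilon>\<^sup>2" "h * ?n \<le> 1" using True e2 L by (auto simp: h_def pos_le_divide_eq pos_divide_le_eq mult.commute)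
    have "(h * ?n)\<^sup>2 \<le> h * ?n" using n h mult_left_le[of "h * ?n" "h * ?n"] by (simp add: power2_eq_square)
    then have "h * ?n / 2 \<le> phi (exp (- h)) (?K U)"
     using one_minus_exp_ge[of "h * ?n"] h True by (simp add: phi_def xp_def exp_of_nat2_mult[symmetric])
    then have n2: "?n \<le> L / \<epsilon>\<^sup>2 * 2 * phi (exp (- h)) (?K U)"
     using e2 L by (simp add: h_def field_simps)
    have "?n ^ k = ?n ^ (k - 1) * ?n" using k by (metis Suc_pred' less_eq_Suc_le One_nat_def power_Suc2)
    also have "... \<le> (L / \<epsilon>\<^sup>2) ^ (k - 1) * (L / \<epsilon>\<^sup>2 * 2 * phi (exp (- h)) (?K U))"
     using n n2 L by (intro mult_mono power_mono) auto
    also have "... = (L / \<epsilon>\<^sup>2) ^ (k - 1) * (L / \<epsilon>\<^sup>2) * 2 * phi (exp (- h)) (?K U)" by (simp only: mult.assoc)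
    also have "(L / \<epsilon>\<^sup>2) ^ (k - 1) * (L / \<epsilon>\<^sup>2) = (L / \<epsilon>\<^sup>2) ^ k" using k by (metis Suc_pred' less_eq_Suc_le One_nat_def power_Suc2)
    finally have "ennreal (?n ^ k) \<le> ennreal ((L / \<epsilon>\<^sup>2) ^ k * 2 * phi (exp (- h)) (?K U))" by (rule ennreal_leI)
    also have "... = ennreal ((L / \<epsilon>\<^sup>2) ^ k * 2) * ?ph U"
     using L phi_bounds[OF x] by (intro ennreal_mult) auto
    finally show ?thesis using True by (simp add: add_increasing2)
   qed (auto simp: add_increasing)
  qed
  also have "... = ennreal ((L / \<epsilon>\<^sup>2) ^ k * 2) * ennreal (M p (exp (- h)) {} v) + (\<E> U. (if finite (?K U) then ?big (?K U) else 0))"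
   unfolding nn_M[OF v x, of p "{}", unfolded del_empty, symmetric] nn_integral_cmult[OF mphi, symmetric]
   by (rule nn_integral_add) (use mphi mbig in measurable)
  also have "(\<E> U. (if finite (?K U) then ?big (?K U) else 0)) = (\<integral>\<^sup>+S. ennreal (\<P>(U in PU. ?K U = S)) * ?big S \<partial>count_space FS)"
   by (rule nn_K_sum[OF v])
  also have "... \<le> (\<integral>\<^sup>+S. ennreal (2 * R * ?k') * ennreal (\<P>(U in PU. v \<in> S \<and> iso p q (t S) v S U \<and> ?K U \<noteq> S)) \<partial>count_space FS)"
  proof (rule nn_integral_mono)
   fix S assume "S \<in> space (count_space FS)"
   then have S: "S \<in> FS" by simp
   let ?P = "\<P>(U in PU. v \<in> S \<and> iso p q (t S) v S U \<and> ?K U \<noteq> S)"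
   show "ennreal (\<P>(U in PU. ?K U = S)) * ?big S \<le> ennreal (2 * R * ?k') * ennreal ?P"
   proof (cases "v \<in> S \<and> L < \<epsilon>\<^sup>2 * real (card S)")
    case False
    have "\<P>(U in PU. ?K U = S) = 0" if "v \<notin> S"
    proof -
     have "{U \<in> space PU. ?K U = S} = {}" using that by auto
     then show ?thesis by (simp only: measure_empty)
    qed
    then show ?thesis using False by auto
   next
    case True
    let ?n = "real (card S)"
    have big: "1 \<le> (p - q) * t S"
    proof -
     have "\<kappa> * L \<le> \<kappa> * (\<epsilon>\<^sup>2 * ?n)" using True kap by (intro mult_left_mono) auto
     then show ?thesis unfolding pqt using L by simp
    qed
    have "\<epsilon>\<^sup>2 * ?n \<le> \<epsilon> * ?n" using eps e by (intro mult_right_mono) (auto simp: power2_eq_square mult_left_le)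
    then have en: "1 \<le> \<epsilon> / 2 * ?n" using True L by simp
    have "\<P>(U in PU. ?K U = S) \<le> 2 * R * exp (- (p - q) * t S) * ?P"
    proof (rule cluster_le_iso[OF v _ S pq(1-3) big R])
     show "1 / R \<le> \<P>(U in PU. t S \<le> real (card (Jinf q S U)))"
      using JP[OF _ eps(4,5) S en] e by (simp add: t_def q_def)
    qed (use True in simp)
    then have "\<P>(U in PU. ?K U = S) * ?n ^ k \<le> 2 * R * exp (- (p - q) * t S) * ?P * ?n ^ k"
     by (rule mult_right_mono) simp
    also have "... = 2 * R * (?n ^ k * exp (- (p - q) * t S)) * ?P" by simp
    also have "... \<le> 2 * R * ?k' * ?P"
    proof -
     have "(\<kappa> * \<epsilon>\<^sup>2 * ?n) ^ k * exp (- (\<kappa> * \<epsilon>\<^sup>2 * ?n)) \<le> fact k" using kap by (intro power_exp_le_fact) simp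
     then have "(\<kappa> * \<epsilon>\<^sup>2) ^ k * (?n ^ k * exp (- (p - q) * t S)) \<le> fact k"
      by (simp only: mult_minus_left pqt power_mult_distrib[of "\<kappa> * \<epsilon>\<^sup>2"] mult.assoc[of "(\<kappa> * \<epsilon>\<^sup>2) ^ k"])
     moreover have "0 < (\<kappa> * \<epsilon>\<^sup>2) ^ k" using kap e2 by simp
     ultimately have "?n ^ k * exp (- (p - q) * t S) \<le> fact k / (\<kappa> * \<epsilon>\<^sup>2) ^ k"
      by (simp only: pos_le_divide_eq mult.commute)
     then show ?thesis using R by (intro mult_right_mono mult_left_mono) auto
    qed
    finally have "ennreal (\<P>(U in PU. ?K U = S) * ?n ^ k) \<le> ennreal (2 * R * ?k' * ?P)"
     by (rule ennreal_leI)
    moreover have "ennreal (2 * R * ?k' * ?P) = ennreal (2 * R * ?k') * ennreal ?P"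
     by (rule ennreal_mult) (use R kap in auto)
    moreover have "ennreal (\<P>(U in PU. ?K U = S) * ?n ^ k) = ennreal (\<P>(U in PU. ?K U = S)) * ennreal (?n ^ k)"
     by (rule ennreal_mult) auto
    moreover have "?big S = ennreal (?n ^ k)" using True by simp
    ultimately show ?thesis by (simp only:)
   qed
  qed
  also have "... = ennreal (2 * R * ?k') * (\<integral>\<^sup>+S. ennreal (\<P>(U in PU. v \<in> S \<and> iso p q (t S) v S U \<and> ?K U \<noteq> S)) \<partial>count_space FS)"
   by (rule nn_integral_cmult) simp
  also have "... \<le> ennreal (2 * R * ?k') * ennreal (C * \<epsilon>)"
   using order_trans[OF iso_total[OF v pq(2), of t] ennreal_leI[OF th]] by (rule mult_left_mono) simp
  also have "ennreal ((L / \<epsilon>\<^sup>2) ^ k * 2) * ennreal (M p (exp (- h)) {} v) \<le> ennreal ((L / \<epsilon>\<^sup>2) ^ k * 2) * ennreal (C * \<epsilon>)"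
   using Mh by (intro mult_left_mono ennreal_leI) auto
  also have "ennreal ((L / \<epsilon>\<^sup>2) ^ k * 2) * ennreal (C * \<epsilon>) + ennreal (2 * R * ?k') * ennreal (C * \<epsilon>)
    = ennreal ((L / \<epsilon>\<^sup>2) ^ k * 2 * (C * \<epsilon>) + 2 * R * ?k' * (C * \<epsilon>))"
  proof -
   have "ennreal u * ennreal z + ennreal w * ennreal z = ennreal (u * z + w * z)" if "0 \<le> u" "0 \<le> w" "0 \<le> z" for u w z
    using that by (simp add: ennreal_mult ennreal_plus)
   moreover have "0 \<le> (L / \<epsilon>\<^sup>2) ^ k * 2" "0 \<le> 2 * R * ?k'" "0 \<le> C * \<epsilon>"
    using L C R kap e by auto
   ultimately show ?thesis by (simp only:)
  qed
  also have "... \<le> ennreal (C' ^ k * fact k / \<epsilon> ^ (2 * k - 1))"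
  proof (rule ennreal_leI)
   have Lk: "L ^ k \<le> (L + 1 / \<kappa>) ^ k * fact k"
   proof -
    have "L ^ k * 1 \<le> (L + 1 / \<kappa>) ^ k * fact k" using L kap by (intro mult_mono power_mono) auto
    then show ?thesis by simp
   qed
   have kk: "(1 / \<kappa>) ^ k * fact k \<le> (L + 1 / \<kappa>) ^ k * fact k" using L kap by (intro mult_right_mono power_mono) auto
   have "(L / \<epsilon>\<^sup>2) ^ k * 2 * (C * \<epsilon>) + 2 * R * ?k' * (C * \<epsilon>)
    = (2 * C * L ^ k + 2 * R * C * ((1 / \<kappa>) ^ k * fact k)) / \<epsilon> ^ (2 * k - 1)"
    unfolding power_divide power_mult_distrib ek using e kap by (simp add: field_simps)
   also have "... \<le> (2 * C * ((L + 1 / \<kappa>) ^ k * fact k) + 2 * R * C * ((L + 1 / \<kappa>) ^ k * fact k)) / \<epsilon> ^ (2 * k - 1)"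
    using Lk kk C R e by (intro divide_right_mono add_mono mult_left_mono) auto
   also have "... = (2 * C + 2 * R * C) * ((L + 1 / \<kappa>) ^ k * fact k) / \<epsilon> ^ (2 * k - 1)" by (simp only: distrib_right)
   also have "... \<le> D ^ k * ((L + 1 / \<kappa>) ^ k * fact k) / \<epsilon> ^ (2 * k - 1)"
   proof -
    have "2 * C + 2 * R * C \<le> D ^ 1" by (simp add: D_def)
    also have "... \<le> D ^ k" using D k by (intro power_increasing) auto
    finally show ?thesis using e L kap by (intro divide_right_mono mult_right_mono) auto
   qed
   also have "... = C' ^ k * fact k / \<epsilon> ^ (2 * k - 1)" by (simp only: C'_def power_mult_distrib mult.assoc)
   finally show "(L / \<epsilon>\<^sup>2) ^ k * 2 * (C * \<epsilon>) + 2 * R * ?k' * (C * \<epsilon>) \<le> C' ^ k * fact k / \<epsilon> ^ (2 * k - 1)" .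
  qed
  finally show ?thesis by (simp add: p_def)
 qed
 then show ?thesis using C' d0 by (intro exI[of _ C'] exI[of _ \<delta>0] conjI allI impI ballI) auto
qed

end

context sperc
begin

lemma moment_bounds:
 "\<exists>c'>0. \<exists>C'>0. \<exists>\<delta>>0. \<delta> \<le> pc \<and> (\<forall>k\<ge>1. \<forall>\<epsilon>\<in>{0<..<\<delta>}. \<forall>v\<in>V. \<forall>p\<in>{pc - \<epsilon>, pc + \<epsilon>}.
   ennreal (c' ^ k * fact k / \<epsilon> ^ (2 * k - 1)) \<le> mom p k v \<and> mom p k v \<le> ennreal (C' ^ k * fact k / \<epsilon> ^ (2 * k - 1)))"
proof -
 obtain c' \<delta>1 where c': "0 < c'" and d1: "0 < \<delta>1"
  and low: "\<And>k \<epsilon> v p. 1 \<le> k \<Longrightarrow> \<epsilon> \<in> {0<..<\<delta>1} \<Longrightarrow> v \<in> V \<Longrightarrow> p \<in> {pc - \<epsilon>, pc + \<epsilon>} \<Longrightarrow> ennreal (c' ^ k * fact k / \<epsilon> ^ (2 * k - 1)) \<le> mom p k v"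
  using moment_lower by blast
 obtain C2 \<delta>2 where C2: "0 < C2" and d2: "0 < \<delta>2"
  and up2: "\<And>k \<epsilon> v. 1 \<le> k \<Longrightarrow> \<epsilon> \<in> {0<..<\<delta>2} \<Longrightarrow> v \<in> V \<Longrightarrow> mom (pc + \<epsilon>) k v \<le> ennreal (C2 ^ k * fact k / \<epsilon> ^ (2 * k - 1))"
  using supercritical_moment by blast
 define C1 where "C1 = 8 * (1 + 2 / c)\<^sup>2"
 have "0 < 1 + 2 / c" using c_pos by (intro add_pos_pos) auto
 then have C1: "0 < C1" by (simp add: C1_def)
 have up1: "mom (pc - \<epsilon>) k v \<le> ennreal (C1 ^ k * fact k / \<epsilon> ^ (2 * k - 1))"
  if k: "1 \<le> k" and e: "0 < \<epsilon>" "\<epsilon> < pc - plo" and v: "v \<in> V" for k \<epsilon> v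
 proof -
  have "mom (pc - \<epsilon>) k v \<le> ennreal (fact k * 8 ^ k * (2 / (c * \<epsilon>)) ^ (2 * k - 1))"
   unfolding mom_def
  proof (rule moment_bound)
   show "chi (pc - \<epsilon>) u \<le> ennreal (2 / (c * \<epsilon>))" if "u \<in> V" for u
    using chi_upper[OF that, of "pc - \<epsilon>"] e by simp
  qed (use e pc plo v k in auto)
  also have "... \<le> ennreal (C1 ^ k * fact k / \<epsilon> ^ (2 * k - 1))"
  proof (rule ennreal_leI)
   have "(2 / c) ^ (2 * k - 1) \<le> (1 + 2 / c) ^ (2 * k - 1)" using c_pos by (intro power_mono) auto
   also have "... \<le> (1 + 2 / c) ^ (2 * k)" using c_pos by (intro power_increasing) auto
   also have "... = ((1 + 2 / c)\<^sup>2) ^ k" by (rule power_mult)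
   finally have "fact k * 8 ^ k * (2 / c) ^ (2 * k - 1) \<le> fact k * 8 ^ k * ((1 + 2 / c)\<^sup>2) ^ k"
    by (intro mult_left_mono) auto
   then have "fact k * 8 ^ k * (2 / c) ^ (2 * k - 1) / \<epsilon> ^ (2 * k - 1) \<le> fact k * 8 ^ k * ((1 + 2 / c)\<^sup>2) ^ k / \<epsilon> ^ (2 * k - 1)"
    using e by (intro divide_right_mono) auto
   then show "fact k * 8 ^ k * (2 / (c * \<epsilon>)) ^ (2 * k - 1) \<le> C1 ^ k * fact k / \<epsilon> ^ (2 * k - 1)"
    by (simp add: C1_def power_mult_distrib power_divide ac_simps)
  qed
  finally show ?thesis .
 qed
 define C' where "C' = max C1 C2"
 have C': "0 < C'" "C1 \<le> C'" "C2 \<le> C'" using C1 by (auto simp: C'_def)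
 define \<delta> where "\<delta> = min (min \<delta>1 \<delta>2) (pc - plo)"
 have d: "0 < \<delta>" "\<delta> \<le> \<delta>1" "\<delta> \<le> \<delta>2" "\<delta> \<le> pc - plo" using d1 d2 pc by (auto simp: \<delta>_def)
 have "mom p k v \<le> ennreal (C' ^ k * fact k / \<epsilon> ^ (2 * k - 1))"
  if k: "1 \<le> k" and e: "\<epsilon> \<in> {0<..<\<delta>}" and v: "v \<in> V" and p: "p \<in> {pc - \<epsilon>, pc + \<epsilon>}" for k \<epsilon> v p
 proof -
  have "\<exists>D\<in>{C1, C2}. mom p k v \<le> ennreal (D ^ k * fact k / \<epsilon> ^ (2 * k - 1))"
   using p up1[OF k _ _ v, of \<epsilon>] up2[OF k _ v, of \<epsilon>] e d by auto
  then obtain D where D: "D \<in> {C1, C2}" "mom p k v \<le> ennreal (D ^ k * fact k / \<epsilon> ^ (2 * k - 1))" by blast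
  have "D ^ k * fact k / \<epsilon> ^ (2 * k - 1) \<le> C' ^ k * fact k / \<epsilon> ^ (2 * k - 1)"
   using D(1) C' C1 C2 e by (intro divide_right_mono mult_right_mono power_mono) auto
  then show ?thesis using D(2) by (meson ennreal_leI order_trans)
 qed
 moreover have "ennreal (c' ^ k * fact k / \<epsilon> ^ (2 * k - 1)) \<le> mom p k v"
  if "1 \<le> k" "\<epsilon> \<in> {0<..<\<delta>}" "v \<in> V" "p \<in> {pc - \<epsilon>, pc + \<epsilon>}" for k \<epsilon> v p
  using that d by (intro low) auto
 moreover have "\<delta> \<le> pc" using d plo by simp
 ultimately show ?thesis using c' C'(1) d(1)
  by (intro exI[of _ c'] exI[of _ C'] exI[of _ \<delta>] conjI allI impI ballI)
qed

end

section \<open>Transfer from edge labels to the percolation measures\<close>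

context perc
begin

definition thr :: "real \<Rightarrow> ('a set \<Rightarrow> real) \<Rightarrow> 'a set \<Rightarrow> bool" where
 "thr p U = (\<lambda>e\<in>E. U e \<le> p)"

text \<open>A right inverse of thresholding: closed edges get the label 2, which exceeds every
  level. It transports measurability from labels to configurations.\<close>

definition lift :: "('a set \<Rightarrow> bool) \<Rightarrow> 'a set \<Rightarrow> real" where
 "lift \<omega> = (\<lambda>e\<in>E. if \<omega> e then 0 else 2)"

lemma measurable_thr: "thr p \<in> measurable PU (percolation E p')"
 unfolding percolation_def thr_def[abs_def]
proof (rule measurable_restrict)
 fix e assume "e \<in> E"
 then have [measurable]: "(\<lambda>U. U e) \<in> borel_measurable PU" by (rule measurable_coord)
 have "Measurable.pred PU (\<lambda>U. U e \<le> p)" by measurable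
 then show "(\<lambda>U. U e \<le> p) \<in> measurable PU (measure_pmf (bernoulli_pmf p'))"
  by (simp add: measurable_def)
qed

lemma measurable_lift: "lift \<in> measurable (percolation E p) PU"
 unfolding PU_def lift_def[abs_def]
proof (rule measurable_restrict)
 fix e assume e: "e \<in> E"
 have "(\<lambda>\<omega>. \<omega> e) \<in> measurable (percolation E p) (measure_pmf (bernoulli_pmf p))"
  unfolding percolation_def by (rule measurable_component_singleton[OF e])
 then have "(\<lambda>\<omega>. (\<lambda>b. if b then 0 else (2::real)) (\<omega> e)) \<in> measurable (percolation E p) unif"
  by (rule measurable_compose) (simp add: measurable_def)
 then show "(\<lambda>\<omega>. if \<omega> e then 0 else (2::real)) \<in> measurable (percolation E p) unif" by simp
qed

lemma cluster_thr: "cluster E (thr p U) v = clu p U v"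
 unfolding cluster_def by (rule arg_cong[where f="\<lambda>F. component F v"]) (auto simp: thr_def opn_def)

lemma cluster_lift: "0 \<le> p \<Longrightarrow> p < 2 \<Longrightarrow> cluster E \<omega> v = clu p (lift \<omega>) v"
 unfolding cluster_def by (rule arg_cong[where f="\<lambda>F. component F v"]) (auto simp: lift_def opn_def)

lemma percolation_eq_distr:
 assumes p: "0 \<le> p" "p \<le> 1"
 shows "percolation E p = distr PU (percolation E p) (thr p)"
proof -
 let ?B = "measure_pmf (bernoulli_pmf p)"
 interpret B: product_prob_space "\<lambda>_. ?B" E
  by (simp add: product_prob_space_def product_sigma_finite_def measure_pmf.sigma_finite_measure_axioms
   product_prob_space_axioms_def measure_pmf.prob_space_axioms)
 have "distr PU (percolation E p) (thr p) = PiM E (\<lambda>_. ?B)"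
 proof (rule B.PiM_eq)
  show "sets (distr PU (percolation E p) (thr p)) = sets (PiM E (\<lambda>_. ?B))" by (simp add: percolation_def)
  fix J F assume J: "finite J" "J \<subseteq> E" and F: "\<And>e. e \<in> J \<Longrightarrow> F e \<in> sets ?B"
  let ?A = "prod_emb E (\<lambda>_. ?B) J (Pi\<^sub>E J F)"
  have A: "?A \<in> sets (percolation E p)"
   unfolding percolation_def using J by (intro sets_PiM_I) auto
  let ?G = "\<lambda>e. {u::real. (u \<le> p) \<in> F e}"
  have G: "?G e \<in> sets borel" and mG: "measure unif (?G e) = measure ?B (F e)" for e
  proof -
   have "F e \<in> Pow UNIV" by simp
   then have cases: "F e = {} \<or> F e = {True} \<or> F e = {False} \<or> F e = UNIV"
    unfolding UNIV_bool by auto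
   have *: "{u. u \<le> p} = {..p}" "{u. \<not> u \<le> p} = {p<..}" by auto
   have **: "measure ?B {True} = p" "measure ?B {False} = 1 - p"
    using p by (simp_all add: measure_pmf_single)
   show "?G e \<in> sets borel" using cases by (elim disjE) (simp_all add: *)
   show "measure unif (?G e) = measure ?B (F e)"
    using cases
   proof (elim disjE)
    assume "F e = UNIV"
    then show ?thesis using unif.prob_space by simp
   qed (simp_all add: * ** measure_unif_le[OF p] measure_unif_gt[OF p])
  qed
  have "emeasure (distr PU (percolation E p) (thr p)) ?A = emeasure PU (thr p -` ?A \<inter> space PU)"
   using A measurable_thr by (rule emeasure_distr[rotated])
  also have "thr p -` ?A \<inter> space PU = {U \<in> space PU. \<forall>e\<in>J. U e \<in> ?G e}"
   using J by (auto simp: prod_emb_def thr_def PiE_iff extensional_def subset_iff)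
  also have "emeasure PU {U \<in> space PU. \<forall>e\<in>J. U e \<in> ?G e} = ennreal (\<Prod>e\<in>J. measure unif (?G e))"
   using prob_coords[OF J, of ?G] G by (simp add: PU.emeasure_eq_measure)
  also have "... = (\<Prod>e\<in>J. emeasure ?B (F e))"
   by (simp add: mG measure_pmf.emeasure_eq_measure prod_ennreal)
  finally show "emeasure (distr PU (percolation E p) (thr p)) (prod_emb E (\<lambda>_. ?B) J (Pi\<^sub>E J F)) = (\<Prod>e\<in>J. emeasure ?B (F e))" .
 qed
 then show ?thesis by (simp add: percolation_def)
qed

lemma nn_percolation:
 assumes p: "0 \<le> p" "p \<le> 1" and h: "(\<lambda>U. h (clu p U v)) \<in> borel_measurable PU"
 shows "(\<integral>\<^sup>+\<omega>. h (cluster E \<omega> v) \<partial>percolation E p) = (\<E> U. h (clu p U v))"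
proof -
 have m: "(\<lambda>\<omega>. h (cluster E \<omega> v)) \<in> borel_measurable (percolation E p)"
  using measurable_compose[OF measurable_lift[of p] h] p by (simp add: cluster_lift[of p])
 have "(\<integral>\<^sup>+\<omega>. h (cluster E \<omega> v) \<partial>percolation E p) = (\<integral>\<^sup>+\<omega>. h (cluster E \<omega> v) \<partial>distr PU (percolation E p) (thr p))"
  using percolation_eq_distr[OF p] by simp
 also have "... = (\<E> U. h (cluster E (thr p U) v))"
  using m by (intro nn_integral_distr[OF measurable_thr]) simp
 finally show ?thesis by (simp add: cluster_thr)
qed

lemma two_point_eq_tau:
 assumes p: "0 \<le> p" "p \<le> 1" and v: "v \<in> V"
 shows "two_point E p v u = tau p v u"
proof -
 let ?A = "{\<omega> \<in> space (percolation E p). u \<in> cluster E \<omega> v}"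
 have "Measurable.pred PU (\<lambda>U. u \<in> clu p U v)"
  using pred_K_mem[of u p "{}" v] by simp
 from measurable_compose[OF measurable_lift[of p] this]
 have m: "?A \<in> sets (percolation E p)"
  using p by (simp add: cluster_lift[of p] pred_def)
 have "two_point E p v u = measure (distr PU (percolation E p) (thr p)) ?A"
  unfolding two_point_def using percolation_eq_distr[OF p] by simp
 also have "... = measure PU (thr p -` ?A \<inter> space PU)"
  by (rule measure_distr[OF measurable_thr m])
 also have "thr p -` ?A \<inter> space PU = {U \<in> space PU. u \<in> clu p U v}"
  using measurable_space[OF measurable_thr[of p p]] by (auto simp: cluster_thr)
 finally show ?thesis by (simp add: tau_def)
qed

lemma AE_finite_iff:
 assumes p: "0 \<le> p" "p \<le> 1"
 shows "(AE \<omega> in percolation E p. \<forall>v\<in>V. finite (cluster E \<omega> v)) \<longleftrightarrow> (\<forall>v\<in>V. M p 1 {} v = 0)"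
proof -
 have one: "(AE U in PU. finite (clu p U v)) \<longleftrightarrow> M p 1 {} v = 0" if v: "v \<in> V" for v
 proof -
  have "(\<E> U. ennreal (phi 1 (clu p U v))) = ennreal (M p 1 {} v)"
   using nn_M[OF v, of 1 p "{}"] by simp
  then have "M p 1 {} v = 0 \<longleftrightarrow> (\<E> U. ennreal (phi 1 (clu p U v))) = 0"
   using M_bounds(1)[OF v, of 1 p "{}"] by (simp add: ennreal_eq_0_iff)
  also have "... \<longleftrightarrow> (AE U in PU. ennreal (phi 1 (clu p U v)) = 0)"
   using v by (intro nn_integral_0_iff_AE) measurable
  also have "... \<longleftrightarrow> (AE U in PU. finite (clu p U v))"
   by (intro AE_cong) (auto simp: phi_def xp_def)
  finally show ?thesis by simp
 qed
 have "Measurable.pred PU (\<lambda>U. \<forall>v\<in>V. finite (clu p U v))"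
  by (intro pred_countable_all[OF countable_V] pred_component_finite meas_eset_opn)
 from measurable_compose[OF measurable_lift[of p] this]
 have m: "{\<omega> \<in> space (percolation E p). \<forall>v\<in>V. finite (cluster E \<omega> v)} \<in> sets (percolation E p)"
  using p by (simp add: cluster_lift[of p] pred_def)
 have "(AE \<omega> in percolation E p. \<forall>v\<in>V. finite (cluster E \<omega> v)) \<longleftrightarrow>
   (AE \<omega> in distr PU (percolation E p) (thr p). \<forall>v\<in>V. finite (cluster E \<omega> v))"
  by (simp only: percolation_eq_distr[OF p, symmetric])
 also have "... \<longleftrightarrow> (AE U in PU. \<forall>v\<in>V. finite (clu p U v))"
  by (subst AE_distr_iff[OF measurable_thr m]) (simp add: cluster_thr)
 also have "... \<longleftrightarrow> (\<forall>v\<in>V. AE U in PU. finite (clu p U v))"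
  by (rule AE_ball_countable[OF countable_V])
 finally show ?thesis using one by simp
qed

end

context bperc
begin

lemma cluster_size_eq: "cluster_size E \<omega> v = (if finite (cluster E \<omega> v) then ennreal (real (card (cluster E \<omega> v))) else \<infinity>)"
 by (simp add: cluster_size_def emeasure_count_space ennreal_of_nat_eq_real_of_nat)

lemma truncated_moment_eq_mom:
 assumes p: "0 \<le> p" "p \<le> 1" and v: "v \<in> V"
 shows "truncated_moment E p k v = mom p k v"
proof -
 have "truncated_moment E p k v = (\<integral>\<^sup>+\<omega>. (\<lambda>C. if finite C then ennreal (real (card C) ^ k) else 0) (cluster E \<omega> v) \<partial>percolation E p)"
  unfolding truncated_moment_def
  by (rule nn_integral_cong) (auto simp: cluster_size_eq ennreal_power split: split_indicator)
 also have "... = mom p k v"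
  unfolding mom_def
  by (rule nn_percolation[OF p]) (rule measurable_component_fun[OF meas_eset_opn v]; simp)
 finally show ?thesis .
qed

lemma moment_eq_mom:
 assumes p: "0 \<le> p" "p \<le> 1" and v: "v \<in> V" and th: "M p 1 {} v = 0"
 shows "moment E p k v = mom p k v"
proof -
 have "ennreal (M p 1 {} v) = (\<E> U. ennreal (phi 1 (K p U {} v)))" by (rule nn_M[OF v, symmetric]) auto
 then have "(\<E> U. ennreal (phi 1 (clu p U v))) = 0" using th by simp
 then have "AE U in PU. ennreal (phi 1 (clu p U v)) = 0"
  using v by (subst (asm) nn_integral_0_iff_AE) measurable
 then have fin: "AE U in PU. finite (clu p U v)"
  by eventually_elim (auto simp: phi_def xp_def split: if_splits)
 have "moment E p k v = (\<integral>\<^sup>+\<omega>. (\<lambda>C. if finite C then ennreal (real (card C) ^ k) else \<infinity> ^ k) (cluster E \<omega> v) \<partial>percolation E p)"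
  unfolding moment_def
  by (rule nn_integral_cong) (auto simp: cluster_size_eq ennreal_power)
 also have "... = (\<E> U. (if finite (clu p U v) then ennreal (real (card (clu p U v)) ^ k) else \<infinity> ^ k))"
  by (rule nn_percolation[OF p]) (rule measurable_component_fun[OF meas_eset_opn v]; simp)
 also have "... = mom p k v"
  unfolding mom_def using fin by (intro nn_integral_cong_AE) (auto elim!: eventually_mono)
 finally show ?thesis .
qed

end

section \<open>Critical exponents\<close>

text \<open>If \<open>a < b\<close>, the lower bound from \<open>a\<close> and the upper bound from
  \<open>b\<close> would put \<open>x powr (a + \<eta>)\<close> below a multiple of
  \<open>x powr (b - \<eta>)\<close> as \<open>x\<close> tends to 0. With \<eta> a quarter of the
  gap, the exponents still differ by \<open>2 * \<eta>\<close>, which is impossible.\<close>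

lemma has_power_law_le:
 assumes F: "F \<noteq> bot" and lim: "filterlim (\<lambda>p. \<bar>p - p0\<bar>) (at_right 0) F"
  and a: "has_power_law F p0 f a" and b: "has_power_law F p0 f b"
 shows "b \<le> a"
proof (rule ccontr)
 assume "\<not> b \<le> a"
 then have ab: "a < b" by simp
 define \<eta> where "\<eta> = (b - a) / 4"
 have eta: "0 < \<eta>" using ab by (simp add: \<eta>_def)
 obtain \<epsilon> c C where 1: "(\<epsilon> \<longlongrightarrow> 0) F" "0 < c" "0 < C"
  "\<forall>\<^sub>F p in F. ennreal (c * \<bar>p - p0\<bar> powr (a + \<epsilon> p)) \<le> f p \<and> f p \<le> ennreal (C * \<bar>p - p0\<bar> powr (a - \<epsilon> p))"
  using a unfolding has_power_law_def by blast
 obtain \<epsilon>' c' C' where 2: "(\<epsilon>' \<longlongrightarrow> 0) F" "0 < c'" "0 < C'"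
  "\<forall>\<^sub>F p in F. ennreal (c' * \<bar>p - p0\<bar> powr (b + \<epsilon>' p)) \<le> f p \<and> f p \<le> ennreal (C' * \<bar>p - p0\<bar> powr (b - \<epsilon>' p))"
  using b unfolding has_power_law_def by blast
 have pos: "\<forall>\<^sub>F p in F. \<bar>p - p0\<bar> \<in> {0<..<1}"
  using filterlim_iff[THEN iffD1, OF lim, rule_format, OF eventually_at_right_real[of 0 1]] by simp
 have e1: "\<forall>\<^sub>F p in F. \<epsilon> p < \<eta>" using 1(1) eta by (rule order_tendstoD)
 have e2: "\<forall>\<^sub>F p in F. \<epsilon>' p < \<eta>" using 2(1) eta by (rule order_tendstoD)
 have ev: "\<forall>\<^sub>F p in F. c \<le> C' * \<bar>p - p0\<bar> powr (2 * \<eta>)"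
  using 1(4) 2(4) pos e1 e2
 proof eventually_elim
  case (elim p)
  define x where "x = \<bar>p - p0\<bar>"
  have x: "0 < x" "x < 1" using elim(3) by (auto simp: x_def)
  have "ennreal (c * x powr (a + \<epsilon> p)) \<le> ennreal (C' * x powr (b - \<epsilon>' p))"
   using elim(1,2) by (auto simp: x_def intro: order_trans)
  then have "c * x powr (a + \<epsilon> p) \<le> C' * x powr (b - \<epsilon>' p)" using 2(3) by (simp add: ennreal_le_iff)
  also have "... \<le> C' * x powr (b - \<eta>)" using 2(3) x elim(5) by (intro mult_left_mono powr_mono') auto
  finally have "c * x powr (a + \<epsilon> p) \<le> C' * x powr (b - \<eta>)" .
  moreover have "c * x powr (a + \<eta>) \<le> c * x powr (a + \<epsilon> p)"
   using x elim(4) 1(2) by (intro mult_left_mono powr_mono') auto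
  ultimately have "c * x powr (a + \<eta>) \<le> C' * x powr (b - \<eta>)" by simp
  also have "b - \<eta> = (a + \<eta>) + 2 * \<eta>" by (simp add: \<eta>_def field_simps)
  also have "C' * x powr ((a + \<eta>) + 2 * \<eta>) = C' * x powr (2 * \<eta>) * x powr (a + \<eta>)"
   unfolding powr_add[of x "a + \<eta>" "2 * \<eta>"] by simp
  finally show ?case using x by (simp add: x_def)
 qed
 have "((\<lambda>x::real. C' * x powr (2 * \<eta>)) \<longlongrightarrow> C' * 0 powr (2 * \<eta>)) (at_right 0)"
  using eta by (intro tendsto_mult tendsto_const tendsto_powr2) (auto intro!: tendsto_ident_at eventually_at_rightI[of 0 1])
 then have "((\<lambda>p. C' * \<bar>p - p0\<bar> powr (2 * \<eta>)) \<longlongrightarrow> C' * 0 powr (2 * \<eta>)) F"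
  by (rule filterlim_compose) (rule lim)
 from tendsto_lowerbound[OF this ev F] show False using 1(2) by simp
qed

lemma has_power_law_unique:
 assumes "F \<noteq> bot" "filterlim (\<lambda>p. \<bar>p - p0\<bar>) (at_right 0) F" "has_power_law F p0 f a" "has_power_law F p0 f b"
 shows "a = b"
 using has_power_law_le[OF assms] has_power_law_le[OF assms(1,2,4,3)] by simp

text \<open>The moments \<open>k = 1\<close> and \<open>k = 2\<close> determine \<gamma> and then
  \<Delta>, because a power law has at most one exponent.\<close>

lemma exponents_iff:
 assumes F: "F \<noteq> bot" and lim: "filterlim (\<lambda>p. \<bar>p - p0\<bar>) (at_right 0) F" and V: "V \<noteq> {}"
  and law: "\<And>v k. v \<in> V \<Longrightarrow> 1 \<le> k \<Longrightarrow> has_power_law F p0 (f k v) (- 1 - (real k - 1) * 2)"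
 shows "(\<forall>v\<in>V. \<forall>k\<ge>1. has_power_law F p0 (f k v) (- \<gamma> - (real k - 1) * \<Delta>)) \<longleftrightarrow> \<gamma> = 1 \<and> \<Delta> = 2"
proof
 assume L: "\<forall>v\<in>V. \<forall>k\<ge>1. has_power_law F p0 (f k v) (- \<gamma> - (real k - 1) * \<Delta>)"
 obtain v where v: "v \<in> V" using V by blast
 have eq: "- \<gamma> - (real k - 1) * \<Delta> = - 1 - (real k - 1) * 2" if "1 \<le> k" for k
  using has_power_law_unique[OF F lim _ law[OF v that]] L v that by blast
 show "\<gamma> = 1 \<and> \<Delta> = 2" using eq[of 1] eq[of 2] by simp
qed (use law in auto)

lemma abs_diff_at_right:
 fixes p0 :: real
 shows "filterlim (\<lambda>p. \<bar>p - p0\<bar>) (at_right 0) (at p0 within S)"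
proof -
 have "((\<lambda>p. \<bar>p - p0\<bar>) \<longlongrightarrow> \<bar>p0 - p0\<bar>) (at p0 within S)"
  by (intro tendsto_intros)
 moreover have "\<forall>\<^sub>F p in at p0 within S. \<bar>p - p0\<bar> \<in> {0<..}"
  using eventually_neq_at_within[of p0 p0 S] by eventually_elim auto
 ultimately show ?thesis by (auto simp: filterlim_at eventually_conj_iff elim: eventually_mono)
qed

lemma powi_eq: "1 \<le> k \<Longrightarrow> x powi (- 2 * int k + 1) = 1 / (x::real) ^ (2 * k - 1)"
proof -
 assume k: "1 \<le> k"
 have "- 2 * int k + 1 = - int (2 * k - 1)" using k by simp
 then show ?thesis by (simp only: power_int_minus power_int_of_nat inverse_eq_divide)
qed

lemma powr_eq: "1 \<le> k \<Longrightarrow> 0 < x \<Longrightarrow> x powr (- 1 - (real k - 1) * 2) = 1 / x ^ (2 * k - 1)"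
proof -
 assume k: "1 \<le> k" and x: "0 < x"
 have "- 1 - (real k - 1) * 2 = - real (2 * k - 1)" using k by (simp add: of_nat_diff)
 then show ?thesis using x by (simp only: powr_minus powr_realpow inverse_eq_divide)
qed

text \<open>The \<open>o(1)\<close> term can be taken to be 0; for fixed \<open>k\<close> the
  quantities \<open>c ^ k * fact k\<close> and \<open>C ^ k * fact k\<close> are constants.\<close>

lemma power_lawI:
 assumes k: "1 \<le> k" and c: "0 < c" "0 < C"
  and ev: "\<forall>\<^sub>F p in at p0 within S. ennreal (c ^ k * fact k / \<bar>p - p0\<bar> ^ (2 * k - 1)) \<le> f p \<and> f p \<le> ennreal (C ^ k * fact k / \<bar>p - p0\<bar> ^ (2 * k - 1))"
 shows "has_power_law (at p0 within S) p0 f (- 1 - (real k - 1) * 2)"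
 unfolding has_power_law_def
proof (intro exI conjI)
 show "((\<lambda>_. 0 :: real) \<longlongrightarrow> 0) (at p0 within S)" by simp
 show "0 < c ^ k * fact k" "0 < C ^ k * fact k" using c by auto
 show "\<forall>\<^sub>F p in at p0 within S. ennreal (c ^ k * fact k * \<bar>p - p0\<bar> powr (- 1 - (real k - 1) * 2 + 0)) \<le> f p \<and>
   f p \<le> ennreal (C ^ k * fact k * \<bar>p - p0\<bar> powr (- 1 - (real k - 1) * 2 - 0))"
  using ev eventually_neq_at_within[of p0 p0 S]
 proof eventually_elim
  case (elim p)
  then have "\<bar>p - p0\<bar> powr (- 1 - (real k - 1) * 2) = 1 / \<bar>p - p0\<bar> ^ (2 * k - 1)"
   using k by (intro powr_eq) auto
  then show ?case using elim(1) by (simp only: add_0_right diff_0_right times_divide_eq_right mult_1_right)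
 qed
qed

section \<open>Level zero, the operator norm and the critical level\<close>

context perc
begin

lemma no_edges_at_zero: "AE U in PU. opn E 0 U = {}"
proof -
 have "AE U in PU. U e \<in> {0<..}" if e: "e \<in> E" for e
 proof -
  have "\<P>(U in PU. \<forall>f\<in>{e}. U f \<in> {0<..}) = (\<Prod>f\<in>{e}. measure unif {0<..})"
   using e by (intro prob_coords) auto
  then have "\<P>(U in PU. U e \<in> {0<..}) = 1" using measure_unif_gt[of 0] by simp
  moreover have "{U \<in> space PU. U e \<in> {0<..}} \<in> sets PU"
  proof -
   note [measurable] = measurable_coord[OF e]
   show ?thesis by measurable
  qed
  ultimately show ?thesis by (simp only: PU.prob_Collect_eq_1)
 qed
 then have "AE U in PU. \<forall>e\<in>E. U e \<in> {0<..}" by (simp only: AE_ball_countable[OF countable_E]) simp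
 then show ?thesis by eventually_elim (force simp: opn_def)
qed

lemma tau_zero:
 assumes "v \<noteq> u"
 shows "tau 0 v u = 0"
proof -
 have "AE U in PU. \<not> u \<in> clu 0 U v"
  using no_edges_at_zero by eventually_elim (use assms in \<open>simp add: component_empty\<close>)
 then have "\<P>(U in PU. u \<in> clu 0 U v) = 0"
  by (subst PU.prob_Collect_eq_0) auto
 then show ?thesis by (simp add: tau_def)
qed

lemma chi_zero: "v \<in> V \<Longrightarrow> chi 0 v = 1"
proof -
 have "chi 0 v = (\<E> U. 1)"
  unfolding chi_def using no_edges_at_zero
  by (intro nn_integral_cong_AE) (auto elim!: eventually_mono simp: component_empty)
 then show ?thesis by (simp add: PU.emeasure_space_1)
qed

text \<open>At level 0 the matrix is the identity. The set whose supremum is \<open>p_2_to_2\<close>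
  is therefore nonempty, and a level with finite norm can be picked above the critical one.\<close>

lemma l2_op_norm_zero: "l2_op_norm V (two_point E 0) < \<infinity>"
proof -
 let ?T = "two_point E 0"
 let ?g = "\<lambda>f u. \<Sum>\<^sub>\<infinity>v\<in>V. ?T u v * f v"
 have T: "?T u v = (if u = v then 1 else 0)" if "u \<in> V" for u v
  using two_point_eq_tau[OF _ _ that, of 0 v] tau_zero[of u v] by simp
 have s: "(\<lambda>v. ?T u v * f v) summable_on V" and i: "(?g f u) = f u" if u: "u \<in> V" for u f
 proof -
  have "(\<lambda>v. ?T u v * f v) summable_on V \<longleftrightarrow> (\<lambda>v. f v) summable_on {u}"
   by (rule summable_on_cong_neutral) (use u T in auto)
  then show "(\<lambda>v. ?T u v * f v) summable_on V" by simp
  have "(?g f u) = (\<Sum>\<^sub>\<infinity>v\<in>{u}. f v)"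
   by (rule infsum_cong_neutral) (use u T in auto)
  then show "(?g f u) = f u" by simp
 qed
 have n: "l2_norm V (\<lambda>u. \<Sum>\<^sub>\<infinity>v\<in>V. ?T u v * f v) = l2_norm V f" for f
 proof -
  have "((\<lambda>u. (?g f u)\<^sup>2) summable_on V) = ((\<lambda>u. (f u)\<^sup>2) summable_on V)"
   by (rule summable_on_cong) (simp add: i)
  moreover have "(\<Sum>\<^sub>\<infinity>u\<in>V. (?g f u)\<^sup>2) = (\<Sum>\<^sub>\<infinity>u\<in>V. (f u)\<^sup>2)"
   by (rule infsum_cong) (simp add: i)
  ultimately show ?thesis by (simp add: l2_norm_def l2_def)
 qed
 have "l2_op_norm V ?T = (SUP f\<in>{f. l2_norm V f \<le> 1}. l2_norm V f)"
  unfolding l2_op_norm_def n using s by simp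
 also have "... \<le> 1" by (rule SUP_least) simp
 finally show ?thesis by (simp add: order.strict_trans1)
qed

text \<open>Test the operator on the normalised indicator of \<open>A\<close>. The added 1 keeps the
  constant positive.\<close>

lemma operator_norm_square_bound:
 assumes p: "0 \<le> p" "p \<le> 1" and fin: "l2_op_norm V (two_point E p) < \<infinity>"
 shows "\<exists>L>0. \<forall>A\<in>FS. \<forall>B\<in>FS. (\<Sum>w\<in>B. (\<Sum>u\<in>A. tau p w u)\<^sup>2) \<le> L * real (card A)"
proof -
 let ?T = "two_point E p"
 define N where "N = enn2real (l2_op_norm V ?T)"
 have N: "l2_op_norm V ?T = ennreal N" "0 \<le> N" using fin by (auto simp: N_def)
 have op: "l2_op_norm V ?T = (SUP f\<in>{f. l2_norm V f \<le> 1}. l2_norm V (\<lambda>u. \<Sum>\<^sub>\<infinity>v\<in>V. ?T u v * f v))"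
  using fin unfolding l2_op_norm_def by (simp split: if_splits)
 have "(\<Sum>w\<in>B. (\<Sum>u\<in>A. tau p w u)\<^sup>2) \<le> (N\<^sup>2 + 1) * real (card A)" if A: "A \<in> FS" and B: "B \<in> FS" for A B
 proof (cases "A = {}")
  case False
  have fA: "finite A" "A \<subseteq> V" and fB: "finite B" "B \<subseteq> V" using A B by (auto simp: FS_def)
  define n where "n = real (card A)"
  have n: "0 < n" using False fA by (simp add: n_def card_gt_0_iff)
  define f where "f v = (if v \<in> A then 1 / sqrt n else 0)" for v
  have f2: "(\<lambda>v. (f v)\<^sup>2) summable_on V" "(\<Sum>\<^sub>\<infinity>v\<in>V. (f v)\<^sup>2) = 1"
  proof -
   have "(\<lambda>v. (f v)\<^sup>2) summable_on V \<longleftrightarrow> (\<lambda>v. 1 / n) summable_on A"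
    by (rule summable_on_cong_neutral) (use fA n in \<open>auto simp: f_def power_divide\<close>)
   then show "(\<lambda>v. (f v)\<^sup>2) summable_on V" using fA by simp
   have "(\<Sum>\<^sub>\<infinity>v\<in>V. (f v)\<^sup>2) = (\<Sum>\<^sub>\<infinity>v\<in>A. 1 / n)"
    by (rule infsum_cong_neutral) (use fA n in \<open>auto simp: f_def power_divide\<close>)
   then show "(\<Sum>\<^sub>\<infinity>v\<in>V. (f v)\<^sup>2) = 1" using fA n False by (simp add: n_def)
  qed
  define g where "g u = (\<Sum>\<^sub>\<infinity>v\<in>V. ?T u v * f v)" for u
  have g: "g u = (\<Sum>v\<in>A. tau p u v) / sqrt n" if "u \<in> V" for u
  proof -
   have "g u = (\<Sum>\<^sub>\<infinity>v\<in>A. tau p u v / sqrt n)"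
    unfolding g_def by (rule infsum_cong_neutral) (use fA two_point_eq_tau[OF p that] in \<open>auto simp: f_def\<close>)
   then show ?thesis using fA by (simp add: sum_divide_distrib)
  qed
  have "l2_norm V f \<le> 1" using f2 by (simp add: l2_norm_def l2_def)
  then have "l2_norm V g \<le> ennreal N"
   unfolding N(1)[symmetric] op g_def[abs_def] by (intro SUP_upper) simp
  then have "g \<in> l2 V" and sq: "ennreal (sqrt (\<Sum>\<^sub>\<infinity>u\<in>V. (g u)\<^sup>2)) \<le> ennreal N"
   by (auto simp: l2_norm_def top_unique split: if_splits)
  then have gs: "(\<lambda>u. (g u)\<^sup>2) summable_on V" by (simp add: l2_def)
  have gi: "0 \<le> (\<Sum>\<^sub>\<infinity>u\<in>V. (g u)\<^sup>2)" by (rule infsum_nonneg) simp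
  have "sqrt (\<Sum>\<^sub>\<infinity>u\<in>V. (g u)\<^sup>2) \<le> N" using sq N(2) by (simp add: ennreal_le_iff)
  then have "(\<Sum>\<^sub>\<infinity>u\<in>V. (g u)\<^sup>2) \<le> N\<^sup>2" by (rule sqrt_le_D)
  moreover have "(\<Sum>w\<in>B. (g w)\<^sup>2) \<le> (\<Sum>\<^sub>\<infinity>u\<in>V. (g u)\<^sup>2)"
   using gs fB by (intro finite_sum_le_infsum) auto
  ultimately have gB: "(\<Sum>w\<in>B. (g w)\<^sup>2) \<le> N\<^sup>2 + 1" by simp
  have "(\<Sum>w\<in>B. (\<Sum>u\<in>A. tau p w u)\<^sup>2) = n * (\<Sum>w\<in>B. (g w)\<^sup>2)"
   unfolding sum_distrib_left using fB n by (intro sum.cong) (auto simp: g power_divide)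
  also have "... \<le> n * (N\<^sup>2 + 1)" using gB n by (intro mult_left_mono) auto
  finally show ?thesis by (simp add: n_def mult.commute)
 qed simp
 moreover have "0 < N\<^sup>2 + 1" by (simp add: add_nonneg_pos)
 ultimately show ?thesis by blast
qed

lemma critical_prob_eq: "critical_prob V E = Sup {p \<in> {0..1}. \<forall>v\<in>V. M p 1 {} v = 0}"
 unfolding critical_prob_def using AE_finite_iff by (intro arg_cong[where f=Sup] Collect_cong) auto

lemma M_above_critical:
 assumes "critical_prob V E < p" "p \<le> 1" "0 \<le> p"
 shows "\<exists>v\<in>V. 0 < M p 1 {} v"
proof (rule ccontr)
 assume "\<not> (\<exists>v\<in>V. 0 < M p 1 {} v)"
 then have "p \<in> {p \<in> {0..1}. \<forall>v\<in>V. M p 1 {} v = 0}"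
  using assms M_bounds(1)[of _ 1 p "{}"] by (auto simp: not_less intro!: antisym)
 then have "p \<le> critical_prob V E"
  unfolding critical_prob_eq by (intro cSup_upper) (auto intro: bdd_aboveI[of _ 1])
 then show False using assms by simp
qed

text \<open>Bounded sums would make the susceptibility finite, and then the cluster would be finite
  almost surely.\<close>

lemma tau_sum_unbounded:
 assumes v: "v \<in> V" and th: "0 < M p 1 {} v"
 shows "\<exists>B. finite B \<and> B \<subseteq> V \<and> Q \<le> (\<Sum>u\<in>B. tau p v u)"
proof (rule ccontr)
 assume neg: "\<not> (\<exists>B. finite B \<and> B \<subseteq> V \<and> Q \<le> (\<Sum>u\<in>B. tau p v u))"
 have "chi p v \<le> ennreal Q"
  unfolding chi_eq_sum[OF v]
 proof (rule nn_integral_count_le)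
  show "(\<Sum>u\<in>B. tau p v u) \<le> Q" if "B \<in> FS" for B
   using neg that by (auto simp: FS_def not_le intro: less_imp_le)
 qed (rule tau_bounds)
 then have fin: "AE U in PU. finite (clu p U v)" by (rule chi_finite_AE[OF v])
 have "ennreal (M p 1 {} v) = (\<E> U. ennreal (phi 1 (K p U {} v)))" by (rule nn_M[OF v, symmetric]) auto
 also have "... = (\<E> U. 0)"
  using fin by (intro nn_integral_cong_AE) (auto elim!: eventually_mono simp: phi_def xp_def)
 finally show False using th by simp
qed

end

context bperc
begin

text \<open>Sprinkle from the empty graph, where \<open>M\<close> is at most \<open>h\<close> and
  \<open>X\<close> at most 1. At level \<open>1 / (2 * d)\<close> the sprinkling coefficient is one
  half, so \<open>M \<le> 2 * h\<close> for every \<open>h\<close>. This is what makes the critical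
  level positive.\<close>

lemma theta_zero_small: "v \<in> V \<Longrightarrow> M (1 / (2 * real d)) 1 {} v = 0"
proof -
 assume v: "v \<in> V"
 have d: "0 < real d" "1 \<le> real d" using d_pos by auto
 have "M (1 / (2 * real d)) 1 {} v \<le> 2 * h" if h: "0 < h" for h
 proof -
  have "M (1 / (2 * real d)) 1 {} v \<le> M (1 / (2 * real d)) (exp (- h)) {} v" using h v by (intro M_mono_gen) auto
  also have "... \<le> 2 * h"
  proof (rule sprinkle_upper_sup[where p=0 and b=1])
   show "M 0 (exp (- h)) {} y \<le> h" if "y \<in> V" for y
    using M_le_chi[OF that, of 0 1 h] chi_zero[OF that] h by simp
   show "X 0 (exp (- h)) y \<le> ennreal 1" if "y \<in> V" for y
    using order_trans[OF X_le_chi[of "exp (- h)" 0 y], of 1] chi_zero[OF that] h by simp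
  qed (use d h v in \<open>auto simp: field_simps\<close>)
  finally show ?thesis .
 qed
 from this[of "M (1 / (2 * real d)) 1 {} v / 4"] show ?thesis
  using M_bounds(1)[OF v, of 1 "1 / (2 * real d)" "{}"] by (cases "M (1 / (2 * real d)) 1 {} v = 0") auto
qed

lemma critical_set_mem: "1 / (2 * real d) \<in> {p \<in> {0..1}. \<forall>v\<in>V. M p 1 {} v = 0}"
 using theta_zero_small d_pos by (auto simp: field_simps)

lemma critical_prob_pos: "0 < critical_prob V E"
proof -
 have "1 / (2 * real d) \<le> critical_prob V E"
  unfolding critical_prob_eq by (rule cSup_upper[OF critical_set_mem]) (auto intro: bdd_aboveI[of _ 1])
 moreover have "0 < 1 / (2 * real d)" using d_pos by simp
 ultimately show ?thesis by linarith
qed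

lemma M_below_critical:
 assumes p: "p < critical_prob V E" and v: "v \<in> V"
 shows "M p 1 {} v = 0"
proof -
 obtain p' where p': "p' \<in> {p \<in> {0..1}. \<forall>v\<in>V. M p 1 {} v = 0}" "p < p'"
  using less_cSupD[OF _ p[unfolded critical_prob_eq]] critical_set_mem by blast
 then have "M p 1 {} v \<le> M p' 1 {} v" using v by (intro M_mono_gen) auto
 then show ?thesis using p' v M_bounds(1)[OF v, of 1 p "{}"] by simp
qed

end

theorem corollary1p4:
 fixes V :: "'a set" and E :: "'a set set"
 assumes "simple_graph V E"
  and "connected_graph V E"
  and "locally_finite V E"
  and "quasi_transitive V E"
  and "critical_prob V E < p_2_to_2 V E"
 shows "(\<exists>\<delta>>0. \<exists>c>0. \<exists>C>0. \<forall>k\<ge>1.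
   \<forall>p \<in> {critical_prob V E - \<delta><..<critical_prob V E} \<union>
      {critical_prob V E<..<critical_prob V E + \<delta>}. \<forall>v\<in>V.
    ennreal (c ^ k * \<bar>p - critical_prob V E\<bar> powi (- 2 * int k + 1) * fact k)
     \<le> truncated_moment E p k v \<and>
    truncated_moment E p k v
     \<le> ennreal (C ^ k * \<bar>p - critical_prob V E\<bar> powi (- 2 * int k + 1) * fact k)) \<and>
  (\<forall>\<gamma> \<Delta>. subcritical_exponents V E \<gamma> \<Delta> \<longleftrightarrow> \<gamma> = 1 \<and> \<Delta> = 2) \<and>
  (\<forall>\<gamma>' \<Delta>'. supercritical_exponents V E \<gamma>' \<Delta>' \<longleftrightarrow> \<gamma>' = 1 \<and> \<Delta>' = 2)"
proof -
 define pc where "pc = critical_prob V E"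
 interpret perc V E using assms by unfold_locales
 obtain d where d: "1 \<le> d" "\<And>v. v \<in> V \<Longrightarrow> card (tch {v}) \<le> d" using bounded_degree[OF assms(4)] by blast
 interpret bperc V E d using d by unfold_locales
 have pc0: "0 < pc" unfolding pc_def by (rule critical_prob_pos)
 have "0 \<in> {p \<in> {0..1}. l2_op_norm V (two_point E p) < \<infinity>}" using l2_op_norm_zero by simp
 then have "{p \<in> {0..1}. l2_op_norm V (two_point E p) < \<infinity>} \<noteq> {}" by blast
 from less_cSupD[OF this assms(5)[unfolded p_2_to_2_def]]
 obtain p2 where p2: "p2 \<in> {p \<in> {0..1}. l2_op_norm V (two_point E p) < \<infinity>}" "pc < p2"
  unfolding pc_def by blast
 \<comment> \<open>Halfway, so that \<open>p3\<close> is supercritical and below 1, while the square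
   bound at \<open>p2\<close> passes down to it.\<close>
 define p3 where "p3 = (pc + p2) / 2"
 have p3: "pc < p3" "p3 < p2" "p3 < 1" "0 \<le> p3" using p2 pc0 by (auto simp: p3_def)
 \<comment> \<open>A positive lower end of the range of levels keeps the finite energy constants
   away from 0.\<close>
 define plo where "plo = pc / 2"
 have plo: "0 < plo" "plo < pc" "plo \<le> 1" using pc0 p3 by (auto simp: plo_def)
 obtain L where L: "0 < L" "\<forall>A\<in>FS. \<forall>B\<in>FS. (\<Sum>w\<in>B. (\<Sum>u\<in>A. tau p2 w u)\<^sup>2) \<le> L * real (card A)"
  using operator_norm_square_bound[of p2] p2 by auto
 have L3: "(\<Sum>w\<in>B. (\<Sum>u\<in>A. tau p3 w u)\<^sup>2) \<le> L * real (card A)" if "A \<in> FS" "B \<in> FS" for A B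
 proof -
  have "(\<Sum>w\<in>B. (\<Sum>u\<in>A. tau p3 w u)\<^sup>2) \<le> (\<Sum>w\<in>B. (\<Sum>u\<in>A. tau p2 w u)\<^sup>2)"
   using p3 by (intro sum_mono power_mono tau_mono sum_nonneg tau_bounds) auto
  then show ?thesis using L(2) that by fastforce
 qed
 obtain c1 where c1: "0 < c1" "\<forall>p\<in>{plo..1}. \<forall>x\<in>{0..1}. \<forall>u\<in>V. \<forall>v\<in>V. c1 * M p x {} v \<le> M p x {} u"
  using integral_comparable[OF assms(4) plo(1,3)] by blast
 have sup: "0 < M p 1 {} v" if p: "pc < p" "p \<le> 1" "v \<in> V" for p v
 proof -
  obtain u where u: "u \<in> V" "0 < M p 1 {} u" using M_above_critical[of p] p pc0 by (auto simp: pc_def)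
  have "0 < c1 * M p 1 {} u" using c1 u by simp
  also have "... \<le> M p 1 {} v" using c1(2) p u plo by simp
  finally show ?thesis .
 qed
 obtain c where c: "0 < c" "\<forall>p\<in>{plo..p3}. \<forall>x\<in>{0..1}. \<forall>S\<in>FS. \<forall>v\<in>V. c * real (card S) * M p x {} v \<le> (\<Sum>(a, y)\<in>bd E S. M p x S y)"
 proof -
  \<comment> \<open>The infinite susceptibility needed here comes from \<open>p3 > pc\<close>: at
    \<open>p3\<close> every vertex has an infinite cluster with positive probability.\<close>
  have "\<exists>c>0::real. \<forall>p\<in>{plo..p3}. \<forall>x\<in>{0..1}. \<forall>S\<in>FS. \<forall>v\<in>V. c * real (card S) * M p x {} v \<le> (\<Sum>(a, y)\<in>bd E S. M p x S y)"
   using p3 plo L by (intro boundary_influence[OF assms(4), where Lam=L] tau_sum_unbounded sup L3) auto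
  then show ?thesis using that by blast
 qed
 interpret sperc V E d plo p3 c pc c1 L
 proof unfold_locales
  show "c * real (card S) * M p x {} v \<le> (\<Sum>e\<in>bd E S. M p x S (snd e))"
   if "p \<in> {plo..p3}" "x \<in> {0..1}" "S \<in> FS" "v \<in> V" for p x S v
   using c(2) that by (simp add: case_prod_beta')
  show "M p 1 {} v = 0" if "p < pc" "v \<in> V" for p v using that by (intro M_below_critical) (auto simp: pc_def)
  show "0 < M p 1 {} v" if "pc < p" "p \<le> p3" "v \<in> V" for p v using sup that p3 by simp
  show "c1 * M p x {} v \<le> M p x {} u" if "p \<in> {plo..p3}" "x \<in> {0..1}" "u \<in> V" "v \<in> V" for p x u v
   using c1(2) that p3 by simp
 qed (use plo p3 c c1 L L3 in auto)
 obtain c' C' \<delta>0 where C: "0 < c'" "0 < C'" "0 < \<delta>0" "\<delta>0 \<le> pc"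
  and mb: "\<And>k \<epsilon> v p. 1 \<le> k \<Longrightarrow> \<epsilon> \<in> {0<..<\<delta>0} \<Longrightarrow> v \<in> V \<Longrightarrow> p \<in> {pc - \<epsilon>, pc + \<epsilon>} \<Longrightarrow>
   ennreal (c' ^ k * fact k / \<epsilon> ^ (2 * k - 1)) \<le> mom p k v \<and> mom p k v \<le> ennreal (C' ^ k * fact k / \<epsilon> ^ (2 * k - 1))"
  using moment_bounds by (elim exE conjE) metis
 define \<delta> where "\<delta> = min \<delta>0 (p3 - pc)"
 have d: "0 < \<delta>" "\<delta> \<le> \<delta>0" "\<delta> \<le> p3 - pc" using C p3 by (auto simp: \<delta>_def)
 have mbp: "ennreal (c' ^ k * fact k / \<bar>p - pc\<bar> ^ (2 * k - 1)) \<le> truncated_moment E p k v \<and>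
   truncated_moment E p k v \<le> ennreal (C' ^ k * fact k / \<bar>p - pc\<bar> ^ (2 * k - 1))"
  if k: "1 \<le> k" and p: "p \<in> {pc - \<delta><..<pc} \<union> {pc<..<pc + \<delta>}" and v: "v \<in> V" for k p v
 proof -
  have p01: "0 \<le> p" "p \<le> 1" using p d C p3 by auto
  have "\<bar>p - pc\<bar> \<in> {0<..<\<delta>0}" "p \<in> {pc - \<bar>p - pc\<bar>, pc + \<bar>p - pc\<bar>}" using p d by auto
  from mb[OF k this(1) v this(2)] show ?thesis unfolding truncated_moment_eq_mom[OF p01 v] .
 qed
 have part1: "\<exists>\<delta>>0. \<exists>c>0. \<exists>C>0. \<forall>k\<ge>1. \<forall>p\<in>{pc - \<delta><..<pc} \<union> {pc<..<pc + \<delta>}. \<forall>v\<in>V.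
    ennreal (c ^ k * \<bar>p - pc\<bar> powi (- 2 * int k + 1) * fact k) \<le> truncated_moment E p k v \<and>
    truncated_moment E p k v \<le> ennreal (C ^ k * \<bar>p - pc\<bar> powi (- 2 * int k + 1) * fact k)"
 proof (rule exI[of _ \<delta>], rule conjI[OF d(1)], rule exI[of _ c'], rule conjI[OF C(1)], rule exI[of _ C'], rule conjI[OF C(2)], intro allI impI ballI)
  fix k :: nat and p v
  assume k: "1 \<le> k" and p: "p \<in> {pc - \<delta><..<pc} \<union> {pc<..<pc + \<delta>}" and v: "v \<in> V"
  have "D ^ k * \<bar>p - pc\<bar> powi (- 2 * int k + 1) * fact k = D ^ k * fact k / \<bar>p - pc\<bar> ^ (2 * k - 1)" for D :: real
   unfolding powi_eq[OF k] by simp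
  then show "ennreal (c' ^ k * \<bar>p - pc\<bar> powi (- 2 * int k + 1) * fact k) \<le> truncated_moment E p k v \<and>
    truncated_moment E p k v \<le> ennreal (C' ^ k * \<bar>p - pc\<bar> powi (- 2 * int k + 1) * fact k)"
   using mbp[OF k p v] by simp
 qed
 have below: "\<forall>\<^sub>F p in at_left pc. p \<in> {pc - \<delta><..<pc}" using d by (intro eventually_at_left_real) auto
 have above: "\<forall>\<^sub>F p in at_right pc. p \<in> {pc<..<pc + \<delta>}" using d by (intro eventually_at_right_real) auto
 have sub: "has_power_law (at_left pc) pc (\<lambda>p. moment E p k v) (- 1 - (real k - 1) * 2)" if v: "v \<in> V" and k: "1 \<le> k" for v k
 proof (rule power_lawI[OF k C(1,2)])
  show "\<forall>\<^sub>F p in at_left pc. ennreal (c' ^ k * fact k / \<bar>p - pc\<bar> ^ (2 * k - 1)) \<le> moment E p k v \<and>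
    moment E p k v \<le> ennreal (C' ^ k * fact k / \<bar>p - pc\<bar> ^ (2 * k - 1))"
   using below
  proof eventually_elim
   case (elim p)
   have p01: "0 \<le> p" "p \<le> 1" using elim d C p3 by auto
   have "M p 1 {} v = 0" using elim by (intro theta_sub v) auto
   \<comment> \<open>Below \<open>pc\<close> clusters are almost surely finite, so truncation does
     not change the moment.\<close>
   then have "moment E p k v = truncated_moment E p k v"
    using moment_eq_mom[OF p01 v] truncated_moment_eq_mom[OF p01 v] by simp
   then show ?case using mbp[OF k _ v, of p] elim by simp
  qed
 qed
 have super: "has_power_law (at_right pc) pc (\<lambda>p. truncated_moment E p k v) (- 1 - (real k - 1) * 2)" if v: "v \<in> V" and k: "1 \<le> k" for v k
 proof (rule power_lawI[OF k C(1,2)])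
  show "\<forall>\<^sub>F p in at_right pc. ennreal (c' ^ k * fact k / \<bar>p - pc\<bar> ^ (2 * k - 1)) \<le> truncated_moment E p k v \<and>
    truncated_moment E p k v \<le> ennreal (C' ^ k * fact k / \<bar>p - pc\<bar> ^ (2 * k - 1))"
   using above by eventually_elim (rule mbp[OF k _ v], simp)
 qed
 have V: "V \<noteq> {}" using assms(2) by (simp add: connected_graph_def)
 have "subcritical_exponents V E \<gamma> \<Delta> \<longleftrightarrow> \<gamma> = 1 \<and> \<Delta> = 2" for \<gamma> \<Delta>
  unfolding subcritical_exponents_def pc_def[symmetric]
  by (rule exponents_iff[OF _ abs_diff_at_right V sub]) simp
 moreover have "supercritical_exponents V E \<gamma> \<Delta> \<longleftrightarrow> \<gamma> = 1 \<and> \<Delta> = 2" for \<gamma> \<Delta>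
  unfolding supercritical_exponents_def pc_def[symmetric]
  by (rule exponents_iff[OF _ abs_diff_at_right V super]) simp
 ultimately show ?thesis using part1 unfolding pc_def by blast
qed

end
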